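(* Let $P$, $F$, $\Phi$ and the toric K\"ahler data be as in the context, let $t>0$ be rational, and let $P_t=P\cap\{\Phi\geq t\}$, with $k$ running through positive integers for which $kP_t$ is an integral polytope. Then there exists a sequence $\xi_j$ ($j\ge 0$) of distributions on $P$ such that for each $N>0$ we have, for all $f\in C^\infty(P)$, $$\langle \hat{\rho}_{tk},f\rangle = k^n\left\{ \sum_{j=0}^N\langle \xi_j, f\rangle k^{-j} + k^{-N-1}\langle R_{N+1,k},f\rangle\right\},$$ where $R_{N+1,k}$ is a distribution on $P$ satisfying $$\langle R_{N+1,k},f\rangle \leq C\|f\|_{C^{N'}}$$ for some $N'$ depending upon $N$, with $C$ independent of $k$ and $f$.
   Context: Toric set-up. $\mathfrak t^*$, the dual of the Lie algebra of a compact torus $T^n$, is identified with $\mathbb R^n$ so that the lattice $\Lambda^*$ dual to $\Lambda=\ker(\exp)$ is $\mathbb Z^n$; $\Lambda^*_k=k^{-1}\Lambda^*$. $X$ is a smooth connected projective toric variety of complex dimension $n$, $L\to X$ an ample equivariant line bundle, $h$ a $T^n$-invariant Hermitian metric on $L$ with curvature $-i\omega$, $\omega$ a K\"ahler form, $\mu:X\to\mathfrak t^*$ the moment map, normalized so that $P=\mu(X)$ is the integral Delzant polytope of $(X,L)$. $P=\bigcap_a\{\ell_a\ge 0\}$ with one $\ell_a(x)=\langle x,\nu_a\rangle-\lambda_a$ per facet, $\nu_a\in\Lambda$ primitive. The K\"ahler structure is given by a symplectic potential $u$: a strictly convex function on $P$ (also strictly convex on the interior of each face), smooth in the interior, with $u-\frac12\sum_a\ell_a\log\ell_a\in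 C^\infty(P)$. $F=\{\ell_{a_1}=\dots=\ell_{a_q}=0\}\cap P$ is a face of codimension $q$ and $\Phi=\ell_{a_1}+\dots+\ell_{a_q}$. For $\alpha\in P\cap\Lambda^*_k$, $e_{\alpha,k}$ is the unit-$L^2$-norm equivariant holomorphic section of $L^k$ corresponding to the lattice point $\alpha$; its pointwise squared norm is, as a function of $y\in P$, $$|e_{\alpha,k}(y)|^2=\frac{e^{-k\phi(\alpha,y)}}{(2\pi)^n\int_Pe^{-k\phi(\alpha,z)}\,dz},\qquad \phi(x,y)=2\big(u(x)-u(y)-\langle du(y),x-y\rangle\big).$$ The partial density function is $\hat\rho_{tk}=\sum_{\alpha\in P_t\cap\Lambda^*_k}|e_{\alpha,k}|^2$ and, for $f\in C^\infty(P)$, $\langle\hat\rho_{tk},f\rangle=\int_X\hat\rho_{tk}\,\mu^*f\,\omega^n/n!=\sum_{\alpha\in P_t\cap\Lambda_k^*}\frac{\int_Pe^{-k\phi(\alpha,y)}f(y)dy}{\int_Pe^{-k\phi(\alpha,y)}dy}$. *)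

theory Defs
  imports "HOL-Analysis.Analysis"
begin

section \<open>Smooth functions on a polytope and distributions\<close>

text \<open>Iterated directional derivatives: \<open>dder [v\<^sub>1, \<dots>, v\<^sub>m] f x\<close> is the derivative of \<open>f\<close> at \<open>x\<close>
  along \<open>v\<^sub>m\<close>, then \<dots>, then \<open>v\<^sub>1\<close>.\<close>

fun dder :: "'v::euclidean_space list \<Rightarrow> ('v \<Rightarrow> real) \<Rightarrow> 'v \<Rightarrow> real" where
  "dder [] f = f"
| "dder (v # vs) f = (\<lambda>x. frechet_derivative (dder vs f) (at x) v)"

text \<open>Used only for open \<open>U\<close>.\<close>

definition smooth_on :: "'v::euclidean_space set \<Rightarrow> ('v \<Rightarrow> real) \<Rightarrow> bool" where
  "smooth_on U f \<longleftrightarrow> (\<forall>vs. dder vs f differentiable_on U)"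

text \<open>\<open>C\<^sup>\<infinity>(P)\<close> for closed \<open>P\<close>: functions whose restriction to \<open>P\<close> extends smoothly to a
  neighbourhood of \<open>P\<close>. Values off \<open>P\<close> are irrelevant.\<close>

definition smooth_upto :: "'v::euclidean_space set \<Rightarrow> ('v \<Rightarrow> real) set" where
  "smooth_upto P = {f. \<exists>U g. open U \<and> P \<subseteq> U \<and> smooth_on U g \<and> (\<forall>x\<in>P. f x = g x)}"

text \<open>The \<open>C\<^sup>m\<close> norm on \<open>P\<close>. For \<open>f \<in> C\<^sup>\<infinity>(P)\<close> with \<open>P\<close> the closure of its interior, the partial
  derivatives extend continuously to \<open>P\<close>, so the supremum over the interior is the supremum
  over \<open>P\<close>; taken over the interior it visibly depends only on \<open>f\<close> restricted to \<open>P\<close>.\<close>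

definition Cnorm :: "'v::euclidean_space set \<Rightarrow> nat \<Rightarrow> ('v \<Rightarrow> real) \<Rightarrow> real" where
  "Cnorm P m f =
     Sup {\<bar>dder vs f x\<bar> | vs x. length vs \<le> m \<and> set vs \<subseteq> Basis \<and> x \<in> interior P}"

text \<open>Distributions on \<open>P\<close>: continuous linear functionals on the Frechet space \<open>C\<^sup>\<infinity>(P)\<close>. The bound
  makes \<open>\<xi> f\<close> depend only on \<open>f\<close> restricted to \<open>P\<close>.\<close>

definition distribution_on ::
    "'v::euclidean_space set \<Rightarrow> (('v \<Rightarrow> real) \<Rightarrow> real) \<Rightarrow> bool" where
  "distribution_on P \<xi> \<longleftrightarrow>
     (\<forall>f\<in>smooth_upto P. \<forall>g\<in>smooth_upto P. \<xi> (\<lambda>x. f x + g x) = \<xi> f + \<xi> g) \<and>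
     (\<forall>f\<in>smooth_upto P. \<forall>c. \<xi> (\<lambda>x. c * f x) = c * \<xi> f) \<and>
     (\<exists>m C. \<forall>f\<in>smooth_upto P. \<bar>\<xi> f\<bar> \<le> C * Cnorm P m f)"

section \<open>Integral Delzant polytopes\<close>

text \<open>Both \<open>\<Lambda>\<close> and its dual are the standard lattice; the pairing is the inner product.\<close>

definition int_lattice :: "(real ^ 'n) set" where
  "int_lattice = {x. \<forall>i. x $ i \<in> \<int>}"

definition scaled_lattice :: "nat \<Rightarrow> (real ^ 'n) set" where
  "scaled_lattice k = {x. real k *\<^sub>R x \<in> int_lattice}"

definition primitive_vec :: "real ^ 'n \<Rightarrow> bool" where
  "primitive_vec v \<longleftrightarrow> v \<in> int_lattice \<and>
     (\<forall>m::nat. m > 0 \<and> (1 / real m) *\<^sub>R v \<in> int_lattice \<longrightarrow> m = 1)"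

definition integral_polytope :: "(real ^ 'n) set \<Rightarrow> bool" where
  "integral_polytope Q \<longleftrightarrow> (\<exists>V. finite V \<and> V \<subseteq> int_lattice \<and> Q = convex hull V)"

definition ell :: "('a \<Rightarrow> real ^ 'n) \<Rightarrow> ('a \<Rightarrow> real) \<Rightarrow> 'a \<Rightarrow> real ^ 'n \<Rightarrow> real" where
  "ell \<nu> lam a x = x \<bullet> \<nu> a - lam a"

text \<open>\<open>A\<close> indexes the facets, one index per facet. The last clause is the Delzant condition: at each
  vertex the normals of the facets through it are a \<open>\<int>\<close>-basis of \<open>\<Lambda>\<close> (there are \<open>n\<close> of them
  and they generate \<open>\<Lambda>\<close>).\<close>

definition integral_delzant ::
    "'a set \<Rightarrow> ('a \<Rightarrow> real ^ 'n) \<Rightarrow> ('a \<Rightarrow> real) \<Rightarrow> (real ^ 'n) set \<Rightarrow> bool" where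
  "integral_delzant A \<nu> lam P \<longleftrightarrow>
     finite A \<and>
     P = {x. \<forall>a\<in>A. ell \<nu> lam a x \<ge> 0} \<and>
     integral_polytope P \<and> interior P \<noteq> {} \<and>
     (\<forall>a\<in>A. primitive_vec (\<nu> a)) \<and>
     (\<forall>a\<in>A. {x\<in>P. ell \<nu> lam a x = 0} facet_of P) \<and>
     inj_on (\<lambda>a. {x\<in>P. ell \<nu> lam a x = 0}) A \<and>
     (\<forall>p. p extreme_point_of P \<longrightarrow>
        card {a\<in>A. ell \<nu> lam a p = 0} = CARD('n) \<and>
        (\<forall>w\<in>int_lattice. \<exists>c :: 'a \<Rightarrow> int.
           w = (\<Sum>a\<in>{a\<in>A. ell \<nu> lam a p = 0}. of_int (c a) *\<^sub>R \<nu> a)))"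

section \<open>Symplectic potentials\<close>

definition strictly_convex_on :: "'v::real_vector set \<Rightarrow> ('v \<Rightarrow> real) \<Rightarrow> bool" where
  "strictly_convex_on S u \<longleftrightarrow> (\<forall>x\<in>S. \<forall>y\<in>S. \<forall>s. x \<noteq> y \<and> 0 < s \<and> s < 1 \<longrightarrow>
     u ((1 - s) *\<^sub>R x + s *\<^sub>R y) < (1 - s) * u x + s * u y)"

text \<open>Positive definite Hessian of the restriction of \<open>u\<close> to the relative interior of \<open>G\<close>. The
  function differentiated is that restriction along a line, as \<open>x + s v \<in> G\<close> for small \<open>s\<close>.\<close>

definition hessian_pos_on :: "'v::euclidean_space set \<Rightarrow> ('v \<Rightarrow> real) \<Rightarrow> bool" where
  "hessian_pos_on G u \<longleftrightarrow>
     (\<forall>x\<in>rel_interior G. \<forall>v\<in>span {y - x | y. y \<in> G}. v \<noteq> 0 \<longrightarrow>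
        (deriv ^^ 2) (\<lambda>s. u (x + s *\<^sub>R v)) 0 > 0)"

text \<open>Strict convexity of a symplectic potential on the interior of a face (\<open>P\<close> itself included)
  is meant in the sense of a positive definite Hessian: this is the nondegeneracy of the Kaehler
  metric on the open dense orbit and on the orbits in its closure. Pointwise strict convexity
  on \<open>P\<close> is a consequence. Note \<open>0 * ln 0 = 0\<close>.\<close>

definition symplectic_potential ::
    "'a set \<Rightarrow> ('a \<Rightarrow> real ^ 'n) \<Rightarrow> ('a \<Rightarrow> real) \<Rightarrow> (real ^ 'n) set \<Rightarrow> (real ^ 'n \<Rightarrow> real) \<Rightarrow> bool" where
  "symplectic_potential A \<nu> lam P u \<longleftrightarrow>
     strictly_convex_on P u \<and>
     (\<forall>G. G face_of P \<longrightarrow> hessian_pos_on G u) \<and>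
     smooth_on (interior P) u \<and>
     (\<lambda>x. u x - 1/2 * (\<Sum>a\<in>A. ell \<nu> lam a x * ln (ell \<nu> lam a x))) \<in> smooth_upto P"

section \<open>Partial density functions\<close>

text \<open>Meaningful for \<open>y\<close> in the interior of \<open>P\<close>, where \<open>du(y)\<close> exists; the boundary is a null set
  for the integrals below.\<close>

definition phi :: "(real ^ 'n \<Rightarrow> real) \<Rightarrow> real ^ 'n \<Rightarrow> real ^ 'n \<Rightarrow> real" where
  "phi u x y = 2 * (u x - u y - frechet_derivative u (at y) (x - y))"

text \<open>Pointwise squared norm of the \<open>L\<^sup>2\<close>-normalised section of \<open>L\<^sup>k\<close> with weight \<open>\<alpha>\<close>, as a
  function of \<open>y = \<mu>(p)\<close>.\<close>

definition sqnorm_e ::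
    "(real ^ 'n) set \<Rightarrow> (real ^ 'n \<Rightarrow> real) \<Rightarrow> nat \<Rightarrow> real ^ 'n \<Rightarrow> real ^ 'n \<Rightarrow> real" where
  "sqnorm_e P u k \<alpha> y =
     exp (- real k * phi u \<alpha> y) /
     ((2 * pi) ^ CARD('n) * integral P (\<lambda>z. exp (- real k * phi u \<alpha> z)))"

definition partial_density ::
    "(real ^ 'n) set \<Rightarrow> (real ^ 'n \<Rightarrow> real) \<Rightarrow> (real ^ 'n) set \<Rightarrow> nat \<Rightarrow> real ^ 'n \<Rightarrow> real" where
  "partial_density P u Pt k y = (\<Sum>\<alpha>\<in>Pt \<inter> scaled_lattice k. sqnorm_e P u k \<alpha> y)"

text \<open>The integral of \<open>\<mu>\<^sup>*g\<close> over \<open>X\<close> against the Liouville measure \<open>\<omega>\<^sup>n/n!\<close>. The moment map pushes that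
  measure forward to \<open>(2\<pi>)\<^sup>n\<close> times Lebesgue measure on \<open>P\<close> (action-angle coordinates on the
  open dense orbit, with angles of period \<open>2\<pi>\<close>).\<close>

definition liouville_integral :: "(real ^ 'n) set \<Rightarrow> (real ^ 'n \<Rightarrow> real) \<Rightarrow> real" where
  "liouville_integral P g = (2 * pi) ^ CARD('n) * integral P g"

definition density_pairing ::
    "(real ^ 'n) set \<Rightarrow> (real ^ 'n \<Rightarrow> real) \<Rightarrow> (real ^ 'n) set \<Rightarrow> nat \<Rightarrow> (real ^ 'n \<Rightarrow> real) \<Rightarrow> real" where
  "density_pairing P u Pt k f = liouville_integral P (\<lambda>y. partial_density P u Pt k y * f y)"

end

theory Submission
  imports Defs
begin

text \<open>The pairing is \<open>\<Sum>\<^sub>\<alpha> E\<^sub>k\<^sub>,\<^sub>\<alpha> f\<close>, summed over the lattice points \<open>\<alpha>\<close> of \<open>P\<^sub>t\<close>, where \<open>E\<^sub>k\<^sub>,\<^sub>x\<close> is the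
  expectation for the probability density proportional to \<open>exp (- k \<phi>(x, y)) dy\<close> on \<open>P\<close>. The
  expansion comes in two independent steps, each of which rests on an exact identity that can be
  iterated.

  Step 1 expands \<open>E\<^sub>k\<^sub>,\<^sub>x f\<close> in powers of \<open>1/k\<close>, uniformly in \<open>x \<in> P\<close>. The gradient of \<open>\<phi>(x, \<cdot>)\<close> is
  \<open>2 Hess(u) (y - x)\<close>, and the inverse Hessian \<open>G\<close> of a symplectic potential extends smoothly to \<open>P\<close>,
  with normal components that vanish on the facets (\<open>inverse_hessian\<close>). Hence integration by parts
  against \<open>G\<close> has no boundary terms, and it gives (\<open>expect_ibp\<close>)
  \<open>E\<^sub>k\<^sub>,\<^sub>x [(y - x)\<^sub>m w] = 1/(2k) E\<^sub>k\<^sub>,\<^sub>x [div (G e\<^sub>m w)]\<close>.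
  This removes a factor \<open>y - x\<close> and gains \<open>1/k\<close> at the cost of a derivative; when the derivative hits a
  second factor \<open>y - x\<close>, two of them are spent. So a moment of degree \<open>2 r\<close> is \<open>O(k\<^sup>-\<^sup>r)\<close>. Taylor
  expansion of \<open>f\<close> at \<open>x\<close> then yields \<open>E\<^sub>k\<^sub>,\<^sub>x f \<sim> \<Sum> k\<^sup>-\<^sup>j (T\<^sub>j f)(x)\<close> with operators \<open>T\<^sub>j\<close> that are bounded between
  the \<open>C\<^sup>m\<close> norms on \<open>P\<close> (\<open>expect_expansion\<close>).

  Step 2 expands \<open>\<Sum>\<^sub>\<alpha> g(\<alpha>)\<close> for smooth \<open>g\<close>. All admissible \<open>k\<close> are multiples \<open>k\<^sub>0 M\<close> of one of them. Let \<open>C\<close> be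
  the cone over the lattice polytope \<open>k\<^sub>0 P\<^sub>t\<close> and \<open>v\<close> run through its vertices, put at height one.
  Applying all the difference operators \<open>1 - \<tau>\<^sub>v\<close> to the indicator function of the lattice points of
  \<open>C\<close> leaves a finitely supported function: a point far up in \<open>C\<close> contains some \<open>v\<close> with a large
  coefficient, so it is far from every facet that does not contain \<open>v\<close>, and there \<open>1 - \<tau>\<^sub>v\<close> sees no
  difference (\<open>differs_finite\<close>). Inverting the operators, the sum over lattice points is a finite
  combination of sums over compositions \<open>\<Sum> g((b + \<Sum> c\<^sub>i v\<^sub>i) / M)\<close>, \<open>\<Sum> c\<^sub>i = M - h\<close>
  (\<open>lattice_sum_decomposition\<close>). A uniformly distributed composition evolves as a Polya urn: adding
  \<open>v\<^sub>i\<close> with a probability proportional to \<open>c\<^sub>i + 1\<close> leads from \<open>M\<close> to \<open>M + 1\<close>. The mean drift of such a step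
  is \<open>O(M\<^sup>-\<^sup>2)\<close> and is again given by averages of this kind, so expansions of the averages are obtained by
  summing the increments, one order at a time (\<open>av_expansion\<close>).

  Together this gives an expansion of \<open>k\<^sup>-\<^sup>n\<close> times the pairing in powers of \<open>1/k\<close>: higher powers of \<open>k\<close>
  are excluded by counting lattice points. Coefficients of an expansion are unique, so they depend
  linearly on \<open>f\<close>, and the uniform error bounds make them continuous in \<open>f\<close>.\<close>

section \<open>Calculus of smooth functions on a convex body\<close>

lemma dder_append: "dder (vs @ ws) f = dder vs (dder ws f)"
  by (induction vs) auto

lemma frechet_derivative_local:
  assumes "open S" "x \<in> S" "\<And>y. y \<in> S \<Longrightarrow> f y = g y"
  shows "frechet_derivative f (at x) = frechet_derivative g (at x)"
proof -
  have "(f has_derivative D) (at x) \<longleftrightarrow> (g has_derivative D) (at x)" for D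
    using has_derivative_transform_within_open[OF _ assms(1,2), of f D UNIV g]
      has_derivative_transform_within_open[OF _ assms(1,2), of g D UNIV f] assms(3)
    by auto
  then show ?thesis by (simp add: frechet_derivative_def)
qed

lemma smooth_on_dder: "smooth_on U f \<Longrightarrow> smooth_on U (dder vs f)"
  unfolding smooth_on_def by (metis dder_append)

lemma smooth_on_subset: "smooth_on U f \<Longrightarrow> V \<subseteq> U \<Longrightarrow> smooth_on V f"
  unfolding smooth_on_def by (meson differentiable_on_subset)

lemma smooth_on_differentiable: "smooth_on U f \<Longrightarrow> f differentiable_on U"
  unfolding smooth_on_def by (metis dder.simps(1))

text \<open>Smoothness quantifies over iterated derivatives. It therefore holds for every member of a class of
  differentiable functions that is stable under directional derivatives.\<close>

lemma smooth_on_coinduct: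
  assumes U: "open U" and f: "f \<in> C"
    and diff: "\<And>f. f \<in> C \<Longrightarrow> f differentiable_on U"
    and step: "\<And>f v. f \<in> C \<Longrightarrow> \<exists>g\<in>C. \<forall>x\<in>U. frechet_derivative f (at x) v = g x"
  shows "smooth_on U f"
proof -
  have ex: "\<exists>g\<in>C. \<forall>x\<in>U. dder vs f x = g x" for vs
  proof (induction vs)
    case Nil
    then show ?case using f by auto
  next
    case (Cons v vs)
    then obtain g where g: "g \<in> C" "\<forall>x\<in>U. dder vs f x = g x" by auto
    obtain h where h: "h \<in> C" "\<forall>x\<in>U. frechet_derivative g (at x) v = h x"
      using step[OF g(1)] by blast
    have "dder (v # vs) f x = h x" if "x \<in> U" for x
      using frechet_derivative_local[OF U that, of "dder vs f" g] g(2) h(2) that by simp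
    then show ?case using h(1) by blast
  qed
  show ?thesis unfolding smooth_on_def
  proof
    fix vs
    obtain g where g: "g \<in> C" "\<forall>x\<in>U. dder vs f x = g x" using ex by blast
    show "dder vs f differentiable_on U"
      using diff[OF g(1)] g(2) differentiable_transform_within[where d=1]
      unfolding differentiable_on_def by (metis zero_less_one)
  qed
qed

lemma smooth_on_const: "open U \<Longrightarrow> smooth_on U (\<lambda>x. c)"
  by (rule smooth_on_coinduct[where C = "range (\<lambda>c x. c)"]) auto

lemma smooth_on_inner: "open U \<Longrightarrow> smooth_on U (\<lambda>x. x \<bullet> w)"
proof (rule smooth_on_coinduct[where C = "range (\<lambda>c x. c) \<union> range (\<lambda>w x. x \<bullet> w)"])
  fix f :: "'a \<Rightarrow> real" and v :: 'a assume f: "f \<in> range (\<lambda>c x. c) \<union> range (\<lambda>w x. x \<bullet> w)"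
  have *: "((\<lambda>x. x \<bullet> w) has_derivative (\<lambda>h. h \<bullet> w)) (at x within S)" for x w :: 'a and S
    by (auto intro!: derivative_eq_intros)
  from f show "f differentiable_on U"
    by (auto simp: differentiable_on_def intro: differentiableI[OF *])
  have "frechet_derivative (\<lambda>x. x \<bullet> w) (at x) v = v \<bullet> w" for x w :: 'a
    using frechet_derivative_at[OF *[of w x UNIV]] by metis
  then show "\<exists>g\<in>range (\<lambda>c x. c) \<union> range (\<lambda>w x. x \<bullet> w). \<forall>x\<in>U. frechet_derivative f (at x) v = g x"
    using f by auto
qed auto

text \<open>The functions obtained from smooth ones by ring operations and by inverting functions
  without zeros are closed under differentiation; hence they are all smooth.\<close>

inductive_set smooth_alg :: "'v::euclidean_space set \<Rightarrow> ('v \<Rightarrow> real) set" for U where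
  base: "smooth_on U f \<Longrightarrow> f \<in> smooth_alg U"
| add: "f \<in> smooth_alg U \<Longrightarrow> g \<in> smooth_alg U \<Longrightarrow> (\<lambda>x. f x + g x) \<in> smooth_alg U"
| mult: "f \<in> smooth_alg U \<Longrightarrow> g \<in> smooth_alg U \<Longrightarrow> (\<lambda>x. f x * g x) \<in> smooth_alg U"
| inv: "f \<in> smooth_alg U \<Longrightarrow> \<forall>x\<in>U. f x \<noteq> 0 \<Longrightarrow> (\<lambda>x. inverse (f x)) \<in> smooth_alg U"

lemma differentiable_on_open_has_derivative:
  "f differentiable_on U \<Longrightarrow> open U \<Longrightarrow> x \<in> U \<Longrightarrow> (f has_derivative frechet_derivative f (at x)) (at x)"
  by (metis at_within_open differentiable_on_def frechet_derivative_works)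

lemma smooth_alg_deriv:
  assumes U: "open U" and "f \<in> smooth_alg U"
  shows "f differentiable_on U \<and>
    (\<forall>v. \<exists>g\<in>smooth_alg U. \<forall>x\<in>U. frechet_derivative f (at x) v = g x)"
  using assms(2)
proof induction
  case (base f)
  then show ?case
    using smooth_alg.base[OF smooth_on_dder[OF base, of "[_]"]]
    by (auto simp: smooth_on_differentiable)
next
  case (add f g)
  have D: "(f has_derivative frechet_derivative f (at x)) (at x)"
    "(g has_derivative frechet_derivative g (at x)) (at x)" if "x \<in> U" for x
    by (rule differentiable_on_open_has_derivative[OF conjunct1 U that]; rule add.IH)+
  have "\<exists>h\<in>smooth_alg U. \<forall>x\<in>U. frechet_derivative (\<lambda>x. f x + g x) (at x) v = h x" for v
  proof -
    obtain f' g' where *: "f' \<in> smooth_alg U" "\<forall>x\<in>U. frechet_derivative f (at x) v = f' x"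
       "g' \<in> smooth_alg U" "\<forall>x\<in>U. frechet_derivative g (at x) v = g' x"
      using spec[OF conjunct2[OF add.IH(1)], of v] spec[OF conjunct2[OF add.IH(2)], of v] by blast
    have "frechet_derivative (\<lambda>x. f x + g x) (at x) v = f' x + g' x" if x: "x \<in> U" for x
    proof -
      have "((\<lambda>x. f x + g x) has_derivative
          (\<lambda>h. frechet_derivative f (at x) h + frechet_derivative g (at x) h)) (at x)"
        by (rule has_derivative_add[OF D[OF x]])
      from fun_cong[OF frechet_derivative_at[OF this, symmetric], of v]
      show ?thesis by (simp only: bspec[OF *(2) x] bspec[OF *(4) x])
    qed
    then show ?thesis by (intro bexI[OF _ smooth_alg.add[OF *(1,3)]] ballI)
  qed
  then show ?case by (intro conjI allI differentiable_on_add conjunct1[OF add.IH(1)] conjunct1[OF add.IH(2)])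
next
  case (mult f g)
  have D: "(f has_derivative frechet_derivative f (at x)) (at x)"
    "(g has_derivative frechet_derivative g (at x)) (at x)" if "x \<in> U" for x
    by (rule differentiable_on_open_has_derivative[OF conjunct1 U that]; rule mult.IH)+
  have "\<exists>h\<in>smooth_alg U. \<forall>x\<in>U. frechet_derivative (\<lambda>x. f x * g x) (at x) v = h x" for v
  proof -
    obtain f' g' where *: "f' \<in> smooth_alg U" "\<forall>x\<in>U. frechet_derivative f (at x) v = f' x"
       "g' \<in> smooth_alg U" "\<forall>x\<in>U. frechet_derivative g (at x) v = g' x"
      using spec[OF conjunct2[OF mult.IH(1)], of v] spec[OF conjunct2[OF mult.IH(2)], of v] by blast
    have "frechet_derivative (\<lambda>x. f x * g x) (at x) v = f x * g' x + f' x * g x" if x: "x \<in> U" for x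
    proof -
      have "((\<lambda>x. f x * g x) has_derivative
          (\<lambda>h. f x * frechet_derivative g (at x) h + frechet_derivative f (at x) h * g x)) (at x)"
        by (rule has_derivative_mult[OF D[OF x]])
      from fun_cong[OF frechet_derivative_at[OF this, symmetric], of v]
      show ?thesis by (simp only: bspec[OF *(2) x] bspec[OF *(4) x])
    qed
    moreover have "(\<lambda>x. f x * g' x + f' x * g x) \<in> smooth_alg U"
      using mult.hyps * by (intro smooth_alg.add smooth_alg.mult)
    ultimately show ?thesis by (intro bexI[rotated] ballI)
  qed
  then show ?case by (intro conjI allI differentiable_on_mult conjunct1[OF mult.IH(1)] conjunct1[OF mult.IH(2)])
next
  case (inv f)
  have D: "(f has_derivative frechet_derivative f (at x)) (at x)" if "x \<in> U" for x
    by (rule differentiable_on_open_has_derivative[OF conjunct1 U that]; rule inv.IH)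
  have "\<exists>h\<in>smooth_alg U. \<forall>x\<in>U. frechet_derivative (\<lambda>x. inverse (f x)) (at x) v = h x" for v
  proof -
    obtain f' where *: "f' \<in> smooth_alg U" "\<forall>x\<in>U. frechet_derivative f (at x) v = f' x"
      using spec[OF conjunct2[OF inv.IH], of v] by blast
    have "frechet_derivative (\<lambda>x. inverse (f x)) (at x) v
        = (-1) * (inverse (f x) * (f' x * inverse (f x)))" if "x \<in> U" for x
    proof -
      have "((\<lambda>x. inverse (f x)) has_derivative
         (\<lambda>h. - (inverse (f x) * frechet_derivative f (at x) h * inverse (f x)))) (at x)"
        using Deriv.has_derivative_inverse[OF _ D[OF that]] inv.hyps that by blast
      from fun_cong[OF frechet_derivative_at[OF this, symmetric], of v] show ?thesis
        by (simp only: bspec[OF *(2) that] mult.assoc mult_minus1)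
    qed
    moreover have "(\<lambda>x. (-1) * (inverse (f x) * (f' x * inverse (f x)))) \<in> smooth_alg U"
      by (intro smooth_alg.mult smooth_alg.inv smooth_alg.base[OF smooth_on_const[OF U]] inv.hyps *(1))
    ultimately show ?thesis by (intro bexI[rotated] ballI)
  qed
  moreover have "(\<lambda>x. inverse (f x)) differentiable_on U"
    unfolding differentiable_on_def using inv.hyps(2)
    by (intro ballI differentiableI[OF has_derivative_at_withinI[OF Deriv.has_derivative_inverse[OF _ D]]]) auto
  ultimately show ?case by (intro conjI allI)
qed

lemma smooth_alg_smooth: "open U \<Longrightarrow> f \<in> smooth_alg U \<Longrightarrow> smooth_on U f"
  by (rule smooth_on_coinduct[where C = "smooth_alg U"]) (use smooth_alg_deriv in blast)+

lemma smooth_uptoD: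
  "f \<in> smooth_upto P \<Longrightarrow> \<exists>U g. open U \<and> P \<subseteq> U \<and> smooth_on U g \<and> (\<forall>x\<in>P. f x = g x)"
  by (simp add: smooth_upto_def)

lemma smooth_uptoI:
  "open U \<Longrightarrow> P \<subseteq> U \<Longrightarrow> smooth_on U g \<Longrightarrow> (\<And>x. x \<in> P \<Longrightarrow> f x = g x) \<Longrightarrow> f \<in> smooth_upto P"
  unfolding smooth_upto_def by blast

lemma smooth_upto_const: "(\<lambda>x. c) \<in> smooth_upto P"
  by (rule smooth_uptoI[of UNIV _ "\<lambda>x. c"]) (auto intro: smooth_on_const)

lemma smooth_upto_inner: "(\<lambda>x. x \<bullet> w) \<in> smooth_upto P"
  by (rule smooth_uptoI[of UNIV _ "\<lambda>x. x \<bullet> w"]) (auto intro: smooth_on_inner)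

lemma smooth_upto_coord: "(\<lambda>x. x $ i) \<in> smooth_upto P"
  using smooth_upto_inner[of "axis i (1::real)"] by (simp add: inner_axis)

lemma smooth_upto_add:
  assumes "f \<in> smooth_upto P" "g \<in> smooth_upto P"
  shows "(\<lambda>x. f x + g x) \<in> smooth_upto P"
proof -
  obtain U f' where U: "open U" "P \<subseteq> U" "smooth_on U f'" "\<forall>x\<in>P. f x = f' x"
    using smooth_uptoD[OF assms(1)] by (elim exE conjE) (rule that; assumption)
  obtain V g' where V: "open V" "P \<subseteq> V" "smooth_on V g'" "\<forall>x\<in>P. g x = g' x"
    using smooth_uptoD[OF assms(2)] by (elim exE conjE) (rule that; assumption)
  have "smooth_on (U \<inter> V) (\<lambda>x. f' x + g' x)"
    using U(1) V(1) by (intro smooth_alg_smooth[OF _ smooth_alg.add[OF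
          smooth_alg.base[OF smooth_on_subset[OF U(3)]] smooth_alg.base[OF smooth_on_subset[OF V(3)]]]]) auto
  then show ?thesis using U V by (intro smooth_uptoI[of "U \<inter> V"]) auto
qed

lemma smooth_upto_mult:
  assumes "f \<in> smooth_upto P" "g \<in> smooth_upto P"
  shows "(\<lambda>x. f x * g x) \<in> smooth_upto P"
proof -
  obtain U f' where U: "open U" "P \<subseteq> U" "smooth_on U f'" "\<forall>x\<in>P. f x = f' x"
    using smooth_uptoD[OF assms(1)] by (elim exE conjE) (rule that; assumption)
  obtain V g' where V: "open V" "P \<subseteq> V" "smooth_on V g'" "\<forall>x\<in>P. g x = g' x"
    using smooth_uptoD[OF assms(2)] by (elim exE conjE) (rule that; assumption)
  have "smooth_on (U \<inter> V) (\<lambda>x. f' x * g' x)"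
    using U(1) V(1) by (intro smooth_alg_smooth[OF _ smooth_alg.mult[OF
          smooth_alg.base[OF smooth_on_subset[OF U(3)]] smooth_alg.base[OF smooth_on_subset[OF V(3)]]]]) auto
  then show ?thesis using U V by (intro smooth_uptoI[of "U \<inter> V"]) auto
qed

text \<open>The extension of \<open>f\<close> may vanish away from \<open>P\<close>; the neighbourhood has to be shrunk.\<close>

lemma smooth_upto_inverse:
  assumes "f \<in> smooth_upto P" "\<And>x. x \<in> P \<Longrightarrow> f x \<noteq> 0"
  shows "(\<lambda>x. inverse (f x)) \<in> smooth_upto P"
proof -
  obtain U f' where U: "open U" "P \<subseteq> U" "smooth_on U f'" "\<forall>x\<in>P. f x = f' x"
    using smooth_uptoD[OF assms(1)] by (elim exE conjE) (rule that; assumption)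
  define V where "V = U \<inter> f' -` (- {0})"
  have "continuous_on U f'" using U smooth_on_differentiable differentiable_imp_continuous_on by blast
  then have V: "open V" unfolding V_def using U by (intro continuous_open_preimage) auto
  have "smooth_on V (\<lambda>x. inverse (f' x))"
    by (rule smooth_alg_smooth[OF V smooth_alg.inv[OF smooth_alg.base[OF smooth_on_subset[OF U(3)]]]])
      (auto simp: V_def)
  moreover have "P \<subseteq> V" using U assms(2) by (auto simp: V_def)
  ultimately show ?thesis using U V by (intro smooth_uptoI[of V]) auto
qed

lemma smooth_upto_cong: "f \<in> smooth_upto P \<Longrightarrow> (\<And>x. x \<in> P \<Longrightarrow> f x = g x) \<Longrightarrow> g \<in> smooth_upto P"
  unfolding smooth_upto_def by fastforce

lemma smooth_upto_cmult: "f \<in> smooth_upto P \<Longrightarrow> (\<lambda>x. c * f x) \<in> smooth_upto P"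
  by (intro smooth_upto_mult smooth_upto_const)

lemma smooth_upto_minus: "f \<in> smooth_upto P \<Longrightarrow> (\<lambda>x. - f x) \<in> smooth_upto P"
  using smooth_upto_cmult[of f P "-1"] by simp

lemma smooth_upto_diff:
  "f \<in> smooth_upto P \<Longrightarrow> g \<in> smooth_upto P \<Longrightarrow> (\<lambda>x. f x - g x) \<in> smooth_upto P"
  using smooth_upto_add[OF _ smooth_upto_minus, of f P g] by simp

lemma smooth_upto_sum:
  "(\<And>i. i \<in> I \<Longrightarrow> f i \<in> smooth_upto P) \<Longrightarrow> (\<lambda>x. \<Sum>i\<in>I. f i x) \<in> smooth_upto P"
  by (induction I rule: infinite_finite_induct) (auto intro: smooth_upto_const smooth_upto_add)

definition smooth_ext :: "(real^'n) set \<Rightarrow> (real^'n \<Rightarrow> real) \<Rightarrow> real^'n \<Rightarrow> real" where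
  "smooth_ext P f = (SOME g. \<exists>U. open U \<and> P \<subseteq> U \<and> smooth_on U g \<and> (\<forall>x\<in>P. f x = g x))"

text \<open>A function on \<open>P\<close> has many smooth extensions, but they all have the same derivatives on \<open>P\<close>
  if \<open>P\<close> is the closure of its interior.\<close>

definition pd :: "(real^'n) set \<Rightarrow> 'n \<Rightarrow> (real^'n \<Rightarrow> real) \<Rightarrow> real^'n \<Rightarrow> real" where
  "pd P i f = dder [axis i 1] (smooth_ext P f)"

fun pds :: "(real^'n) set \<Rightarrow> 'n list \<Rightarrow> (real^'n \<Rightarrow> real) \<Rightarrow> real^'n \<Rightarrow> real" where
  "pds P [] f = f"
| "pds P (i # is) f = pd P i (pds P is f)"

lemma smooth_ext:
  assumes "f \<in> smooth_upto P"
  obtains U where "open U" "P \<subseteq> U" "smooth_on U (smooth_ext P f)" "\<And>x. x \<in> P \<Longrightarrow> f x = smooth_ext P f x"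
proof -
  have "\<exists>g U. open U \<and> P \<subseteq> U \<and> smooth_on U g \<and> (\<forall>x\<in>P. f x = g x)"
    using assms unfolding smooth_upto_def by blast
  from someI_ex[OF this] show ?thesis using that unfolding smooth_ext_def by blast
qed

lemma pd_smooth: "f \<in> smooth_upto P \<Longrightarrow> pd P i f \<in> smooth_upto P"
  by (metis pd_def smooth_ext smooth_on_dder smooth_uptoI)

lemma pds_smooth: "f \<in> smooth_upto P \<Longrightarrow> pds P is f \<in> smooth_upto P"
  by (induction "is") (auto intro: pd_smooth)

lemma pds_append: "pds P (is @ js) f = pds P is (pds P js f)"
  by (induction "is") auto

lemma smooth_upto_continuous: 
  assumes "f \<in> smooth_upto P" shows "continuous_on P f"
proof -
  obtain U g where "open U" "P \<subseteq> U" "smooth_on U g" "\<forall>x\<in>P. f x = g x"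
    using smooth_uptoD[OF assms] by (elim exE conjE) (rule that; assumption)
  then show ?thesis
    by (metis continuous_on_cong continuous_on_subset differentiable_imp_continuous_on smooth_on_differentiable)
qed

lemma linear_axis_sum:
  fixes D :: "real^'n \<Rightarrow> real"
  assumes "linear D" shows "D v = (\<Sum>i\<in>UNIV. v $ i * D (axis i 1))"
proof -
  have "D v = D (\<Sum>i\<in>UNIV. (v $ i) *\<^sub>R axis i 1)"
    using basis_expansion[of v] by (simp add: scalar_mult_eq_scaleR)
  also have "\<dots> = (\<Sum>i\<in>UNIV. v $ i * D (axis i 1))"
    using assms by (simp add: linear_sum linear_cmul)
  finally show ?thesis .
qed

lemma pd_has_derivative:
  assumes f: "f \<in> smooth_upto P" and x: "x \<in> P"
  shows "(f has_derivative (\<lambda>v. \<Sum>i\<in>UNIV. v $ i * pd P i f x)) (at x within P)"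
proof -
  obtain U where U: "open U" "P \<subseteq> U" "smooth_on U (smooth_ext P f)" "\<And>x. x \<in> P \<Longrightarrow> f x = smooth_ext P f x"
    using smooth_ext[OF f] by blast
  let ?g = "smooth_ext P f"
  have *: "(?g has_derivative frechet_derivative ?g (at x)) (at x)"
    by (rule differentiable_on_open_has_derivative[OF smooth_on_differentiable[OF U(3)] U(1) subsetD[OF U(2) x]])
  then have lin: "linear (frechet_derivative ?g (at x))" by (rule has_derivative_linear)
  have eq: "frechet_derivative ?g (at x) = (\<lambda>v. \<Sum>i\<in>UNIV. v $ i * pd P i f x)"
    unfolding pd_def dder.simps by (rule ext) (rule linear_axis_sum[OF lin])
  have "(?g has_derivative (\<lambda>v. \<Sum>i\<in>UNIV. v $ i * pd P i f x)) (at x within P)"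
    using * unfolding eq by (rule has_derivative_at_withinI)
  then show ?thesis
    by (rule has_derivative_transform[OF x, rotated]) (use U(4) in auto)
qed

lemma pd_has_derivative_at:
  assumes f: "f \<in> smooth_upto P" and x: "x \<in> interior P"
  shows "(f has_derivative (\<lambda>v. \<Sum>i\<in>UNIV. v $ i * pd P i f x)) (at x)"
proof -
  have "(f has_derivative (\<lambda>v. \<Sum>i\<in>UNIV. v $ i * pd P i f x)) (at x within interior P)"
    by (rule has_derivative_subset[OF pd_has_derivative[OF f subsetD[OF interior_subset x]] interior_subset])
  then show ?thesis unfolding at_within_open[OF x open_interior] .
qed

lemma Basis_vec_axis: "(Basis :: (real^'n) set) = range (\<lambda>i. axis i 1)"
  by (auto simp: Basis_vec_def)

locale convex_body =
  fixes P :: "(real^'n) set"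
  assumes convex_P: "convex P" and compact_P: "compact P" and interior_P: "interior P \<noteq> {}"
begin

lemma closure_interior_P: "closure (interior P) = P"
  using convex_closure_interior[OF convex_P interior_P] closure_closed[OF compact_imp_closed[OF compact_P]] by simp

lemma interior_sub: "x \<in> interior P \<Longrightarrow> x \<in> P"
  using interior_subset by blast

lemma le_by_continuity:
  fixes f :: "real^'n \<Rightarrow> real"
  assumes "continuous_on P f" "\<And>x. x \<in> interior P \<Longrightarrow> f x \<le> B" "x \<in> P"
  shows "f x \<le> B"
  using continuous_le_on_closure[of "interior P" f x B] assms closure_interior_P by auto

lemma eq_by_continuity:
  fixes f :: "real^'n \<Rightarrow> real"
  assumes "continuous_on P f" "continuous_on P g" "\<And>x. x \<in> interior P \<Longrightarrow> f x = g x" "x \<in> P"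
  shows "f x = g x"
proof -
  have "f x - g x \<le> 0" "g x - f x \<le> 0"
    by (rule le_by_continuity[where x=x]; use assms in \<open>auto intro!: continuous_intros\<close>)+
  then show ?thesis by simp
qed

abbreviation "CP \<equiv> smooth_upto P"
abbreviation "D i f \<equiv> pd P i f"
abbreviation "Ds is f \<equiv> pds P is f"
abbreviation "nrm m f \<equiv> Cnorm P m f"

text \<open>This makes the \<open>C\<^sup>m\<close> norms, which are defined by derivatives in the interior, accessible through the
  derivatives of the extensions.\<close>

lemma dder_eq_pds:
  assumes f: "f \<in> CP" and x: "x \<in> interior P"
  shows "dder (map (\<lambda>i. axis i 1) is) f x = Ds is f x"
  using x
proof (induction "is" arbitrary: x)
  case (Cons i "is")
  have "frechet_derivative (dder (map (\<lambda>i. axis i 1) is) f) (at x) = frechet_derivative (Ds is f) (at x)"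
    by (rule frechet_derivative_local[of "interior P"]) (use Cons in auto)
  also have "\<dots> = (\<lambda>v. \<Sum>i\<in>UNIV. v $ i * D i (Ds is f) x)"
    using frechet_derivative_at[OF pd_has_derivative_at[OF pds_smooth[OF f] Cons.prems]] by metis
  finally show ?case by (simp add: axis_def if_distrib[of "\<lambda>z. z * _"] cong: if_cong)
qed simp

text \<open>On the interior the partial derivative is determined by \<open>f\<close>, and both sides are continuous on \<open>P\<close>,
  the closure of its interior. All rules of differentiation up to the boundary follow from this.\<close>

lemma pd_unique:
  assumes f: "f \<in> CP" and h: "continuous_on P h"
    and D: "\<And>x. x \<in> interior P \<Longrightarrow> (f has_derivative f' x) (at x)"
      "\<And>x. x \<in> interior P \<Longrightarrow> f' x (axis i 1) = h x" and x: "x \<in> P"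
  shows "D i f x = h x"
proof (rule eq_by_continuity[OF _ h _ x])
  show "continuous_on P (D i f)" using f pd_smooth smooth_upto_continuous by blast
  fix x assume x: "x \<in> interior P"
  have "f' x = (\<lambda>v. \<Sum>i\<in>UNIV. v $ i * D i f x)"
    using has_derivative_unique[OF D(1)[OF x] pd_has_derivative_at[OF f x]] .
  then have "f' x (axis i 1) = D i f x"
    by (simp add: axis_def if_distrib[of "\<lambda>z. z * _"] cong: if_cong)
  then show "D i f x = h x" using D(2)[OF x] by simp
qed

lemma axis_sum: "(\<Sum>j\<in>UNIV. axis i (1::real) $ j * c j) = c i"
  by (simp add: axis_def if_distrib[of "\<lambda>z. z * _"] cong: if_cong)

lemma CP_cont: "f \<in> CP \<Longrightarrow> continuous_on P f"
  by (rule smooth_upto_continuous)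

lemma pd_cong:
  assumes "f \<in> CP" "\<And>x. x \<in> P \<Longrightarrow> f x = g x" "x \<in> P" shows "D i f x = D i g x"
proof -
  have g: "g \<in> CP" using assms(1,2) by (rule smooth_upto_cong)
  show ?thesis
  proof (rule pd_unique[OF assms(1) CP_cont[OF pd_smooth[OF g]] _ _ assms(3)])
    fix x assume x: "x \<in> interior P"
    show "(f has_derivative (\<lambda>v. \<Sum>i\<in>UNIV. v $ i * D i g x)) (at x)"
      by (rule has_derivative_transform_within_open[OF pd_has_derivative_at[OF g x] open_interior x])
        (use assms(2) interior_sub in auto)
  qed (simp add: axis_sum)
qed

lemma pds_cong:
  assumes "f \<in> CP" "\<And>x. x \<in> P \<Longrightarrow> f x = g x" "x \<in> P" shows "Ds is f x = Ds is g x"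
  using assms(3) by (induction "is" arbitrary: x) (use assms in \<open>auto intro!: pd_cong pds_smooth\<close>)

lemma pd_add:
  assumes f: "f \<in> CP" and g: "g \<in> CP" and x: "x \<in> P"
  shows "D i (\<lambda>x. f x + g x) x = D i f x + D i g x"
  by (rule pd_unique[OF smooth_upto_add[OF f g] _ has_derivative_add[OF pd_has_derivative_at[OF f] pd_has_derivative_at[OF g]] _ x])
    (auto simp: axis_sum intro!: continuous_intros CP_cont[OF f] CP_cont[OF g] CP_cont[OF pd_smooth[OF f]] CP_cont[OF pd_smooth[OF g]])

lemma pd_mult:
  assumes f: "f \<in> CP" and g: "g \<in> CP" and x: "x \<in> P"
  shows "D i (\<lambda>x. f x * g x) x = D i f x * g x + f x * D i g x"
  by (rule pd_unique[OF smooth_upto_mult[OF f g] _ has_derivative_mult[OF pd_has_derivative_at[OF f] pd_has_derivative_at[OF g]] _ x])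
    (auto simp: axis_sum intro!: continuous_intros CP_cont[OF f] CP_cont[OF g] CP_cont[OF pd_smooth[OF f]] CP_cont[OF pd_smooth[OF g]])

lemma pd_const: "x \<in> P \<Longrightarrow> D i (\<lambda>x. c) x = 0"
  by (rule pd_unique[OF smooth_upto_const _ has_derivative_const]) auto

lemma pd_coord: "x \<in> P \<Longrightarrow> D i (\<lambda>x. x $ j) x = (if i = j then 1 else 0)"
  by (rule pd_unique[OF smooth_upto_coord, where f' = "\<lambda>_ v. v $ j"])
     (auto intro!: bounded_linear_imp_has_derivative bounded_linear_vec_nth simp: axis_def)

lemma pds_add:
  assumes f: "f \<in> CP" and g: "g \<in> CP" and x: "x \<in> P"
  shows "Ds is (\<lambda>x. f x + g x) x = Ds is f x + Ds is g x"
  using x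
proof (induction "is" arbitrary: x)
  case (Cons i "is")
  have "D i (Ds is (\<lambda>x. f x + g x)) x = D i (\<lambda>x. Ds is f x + Ds is g x) x"
    using Cons f g by (intro pd_cong pds_smooth smooth_upto_add) auto
  then show ?case using pd_add[OF pds_smooth[OF f] pds_smooth[OF g] Cons.prems] by simp
qed simp

subsection \<open>The \<open>C\<^sup>m\<close> norms\<close>

lemma nrm_set:
  assumes f: "f \<in> CP"
  shows "{\<bar>dder vs f x\<bar> | vs x. length vs \<le> m \<and> set vs \<subseteq> Basis \<and> x \<in> interior P}
    = {\<bar>Ds is f x\<bar> | is x. length is \<le> m \<and> x \<in> interior P}" (is "?L = ?R")
proof
  show "?L \<subseteq> ?R"
  proof
    fix y assume "y \<in> ?L"
    then obtain vs x where *: "y = \<bar>dder vs f x\<bar>" "length vs \<le> m" "set vs \<subseteq> Basis" "x \<in> interior P" by blast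
    then have "\<forall>v\<in>set vs. \<exists>i. v = axis i 1" by (auto simp: Basis_vec_axis)
    then obtain "is" where "vs = map (\<lambda>i. axis i 1) is"
      unfolding ex_map_conv[symmetric] by blast
    with * show "y \<in> ?R" using dder_eq_pds[OF f] by auto
  qed
  show "?R \<subseteq> ?L"
  proof
    fix y assume "y \<in> ?R"
    then obtain "is" x where *: "y = \<bar>Ds is f x\<bar>" "length is \<le> m" "x \<in> interior P" by blast
    then have "y = \<bar>dder (map (\<lambda>i. axis i 1) is) f x\<bar>" using dder_eq_pds[OF f] by simp
    with * show "y \<in> ?L" by (force simp: Basis_vec_axis)
  qed
qed

lemma nrm_bdd:
  assumes f: "f \<in> CP"
  shows "bdd_above {\<bar>Ds is f x\<bar> | is x. length is \<le> m \<and> x \<in> interior P}"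
proof -
  have "\<exists>B. \<forall>x\<in>P. \<bar>Ds is f x\<bar> \<le> B" for "is"
    using compact_imp_bounded[OF compact_continuous_image[OF CP_cont[OF pds_smooth[OF f]] compact_P, of "is"]]
    by (auto simp: bounded_iff)
  then obtain B where B: "\<And>is x. x \<in> P \<Longrightarrow> \<bar>Ds is f x\<bar> \<le> B is" by metis
  have fin: "finite {is :: 'n list. length is \<le> m}"
    using finite_lists_length_le[of "UNIV :: 'n set" m] by simp
  have "\<bar>Ds is f x\<bar> \<le> (\<Sum>is\<in>{is. length is \<le> m}. \<bar>B is\<bar>)" if "length is \<le> m" "x \<in> interior P" for "is" x
  proof -
    have "\<bar>Ds is f x\<bar> \<le> \<bar>B is\<bar>" using B[OF interior_sub[OF that(2)], of "is"] by linarith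
    also have "\<dots> \<le> (\<Sum>is\<in>{is. length is \<le> m}. \<bar>B is\<bar>)" using that(1) fin
      by (intro member_le_sum) auto
    finally show ?thesis .
  qed
  then show ?thesis by (intro bdd_aboveI) auto
qed

lemma nrm_ge:
  assumes f: "f \<in> CP" and "length is \<le> m" "x \<in> P"
  shows "\<bar>Ds is f x\<bar> \<le> nrm m f"
proof (rule le_by_continuity[OF _ _ assms(3)])
  show "continuous_on P (\<lambda>x. \<bar>Ds is f x\<bar>)"
    by (intro continuous_intros CP_cont pds_smooth f)
  fix x assume "x \<in> interior P"
  then show "\<bar>Ds is f x\<bar> \<le> nrm m f"
    unfolding Cnorm_def nrm_set[OF f] using assms(2) by (intro cSup_upper nrm_bdd f) auto
qed

lemma nrm_le:
  assumes f: "f \<in> CP" and "\<And>is x. length is \<le> m \<Longrightarrow> x \<in> P \<Longrightarrow> \<bar>Ds is f x\<bar> \<le> B"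
  shows "nrm m f \<le> B"
  unfolding Cnorm_def nrm_set[OF f]
proof (rule cSup_least)
  obtain x where "x \<in> interior P" using interior_P by blast
  then show "{\<bar>Ds is f x\<bar> |is x. length is \<le> m \<and> x \<in> interior P} \<noteq> {}"
    by (auto intro!: exI[of _ "[]"])
qed (use assms(2) interior_sub in auto)

lemma nrm_nonneg: assumes "f \<in> CP" shows "0 \<le> nrm m f"
proof -
  obtain x where "x \<in> P" using interior_P interior_sub by blast
  then show ?thesis using nrm_ge[OF assms, of "[]" m] by force
qed

lemma nrm_val: "f \<in> CP \<Longrightarrow> x \<in> P \<Longrightarrow> \<bar>f x\<bar> \<le> nrm m f"
  using nrm_ge[of f "[]" m x] by simp

lemma nrm_mono: "f \<in> CP \<Longrightarrow> m \<le> m' \<Longrightarrow> nrm m f \<le> nrm m' f"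
  by (rule nrm_le) (auto intro: nrm_ge)

lemma nrm_add: "f \<in> CP \<Longrightarrow> g \<in> CP \<Longrightarrow> nrm m (\<lambda>x. f x + g x) \<le> nrm m f + nrm m g"
  by (rule nrm_le) (auto simp: pds_add intro!: smooth_upto_add order_trans[OF abs_triangle_ineq] add_mono nrm_ge)

lemma nrm_pd: "f \<in> CP \<Longrightarrow> nrm m (D i f) \<le> nrm (Suc m) f"
  using nrm_ge[of f "_ @ [i]" "Suc m"] by (intro nrm_le) (auto simp: pds_append intro: pd_smooth)

lemma nrm_cong: "f \<in> CP \<Longrightarrow> (\<And>x. x \<in> P \<Longrightarrow> f x = g x) \<Longrightarrow> nrm m f = nrm m g"
proof -
  assume *: "f \<in> CP" "\<And>x. x \<in> P \<Longrightarrow> f x = g x"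
  then have g: "g \<in> CP" by (rule smooth_upto_cong)
  have "nrm m f \<le> nrm m g" by (rule nrm_le) (use * pds_cong nrm_ge[OF g] in auto)
  moreover have "nrm m g \<le> nrm m f" by (rule nrm_le) (use * g pds_cong[of f g] nrm_ge[OF *(1)] in \<open>auto\<close>)
  ultimately show ?thesis by simp
qed

lemma nrm_Suc:
  assumes f: "f \<in> CP" shows "nrm (Suc m) f \<le> nrm 0 f + (\<Sum>i\<in>UNIV. nrm m (D i f))"
proof (rule nrm_le[OF f])
  fix "is" :: "'n list" and x assume *: "length is \<le> Suc m" "x \<in> P"
  have nn: "0 \<le> nrm m (D i f)" for i using nrm_nonneg pd_smooth f by blast
  show "\<bar>Ds is f x\<bar> \<le> nrm 0 f + (\<Sum>i\<in>UNIV. nrm m (D i f))"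
  proof (cases "is" rule: rev_cases)
    case Nil
    then show ?thesis using nrm_val[OF f *(2), of 0] sum_nonneg[of UNIV "\<lambda>i. nrm m (D i f)"] nn by force
  next
    case (snoc js i)
    have "\<bar>Ds is f x\<bar> = \<bar>Ds js (D i f) x\<bar>" by (simp add: snoc pds_append)
    also have "\<dots> \<le> nrm m (D i f)" using snoc * by (intro nrm_ge pd_smooth f) auto
    also have "\<dots> \<le> (\<Sum>i\<in>UNIV. nrm m (D i f))" using nn by (intro member_le_sum) auto
    finally show ?thesis using nrm_nonneg[OF f, of 0] by linarith
  qed
qed

text \<open>By the Leibniz rule, applied to one derivative at a time.\<close>

lemma nrm_mult:
  assumes "w \<in> CP" shows "\<exists>C\<ge>0. \<forall>f\<in>CP. nrm m (\<lambda>x. w x * f x) \<le> C * nrm m f"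
  using assms
proof (induction m arbitrary: w)
  case 0
  have "nrm 0 (\<lambda>x. w x * f x) \<le> nrm 0 w * nrm 0 f" if f: "f \<in> CP" for f
    by (rule nrm_le) (use 0 f nrm_val[of _ _ 0] in \<open>auto simp: abs_mult intro!: smooth_upto_mult mult_mono nrm_nonneg\<close>)
  then show ?case using nrm_nonneg[OF 0] by blast
next
  case (Suc m)
  obtain C where C: "C \<ge> 0" "\<And>f. f \<in> CP \<Longrightarrow> nrm m (\<lambda>x. w x * f x) \<le> C * nrm m f"
    using Suc.IH[OF Suc.prems] by blast
  have "\<exists>C\<ge>0. \<forall>f\<in>CP. nrm m (\<lambda>x. D i w x * f x) \<le> C * nrm m f" for i
    using Suc.IH[OF pd_smooth[OF Suc.prems]] by blast
  then obtain E where E: "\<And>i. E i \<ge> 0" "\<And>i f. f \<in> CP \<Longrightarrow> nrm m (\<lambda>x. D i w x * f x) \<le> E i * nrm m f"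
    by metis
  have "nrm (Suc m) (\<lambda>x. w x * f x) \<le> (C + (\<Sum>i\<in>UNIV. E i + C)) * nrm (Suc m) f" if f: "f \<in> CP" for f
  proof -
    have wf: "(\<lambda>x. w x * f x) \<in> CP" using Suc.prems f by (rule smooth_upto_mult)
    have 1: "nrm m (D i (\<lambda>x. w x * f x)) \<le> (E i + C) * nrm (Suc m) f" for i
    proof -
      have "nrm m (D i (\<lambda>x. w x * f x)) = nrm m (\<lambda>x. D i w x * f x + w x * D i f x)"
        by (rule nrm_cong) (use Suc.prems f wf in \<open>auto intro: pd_smooth simp: pd_mult\<close>)
      also have "\<dots> \<le> nrm m (\<lambda>x. D i w x * f x) + nrm m (\<lambda>x. w x * D i f x)"
        using Suc.prems f by (intro nrm_add smooth_upto_mult pd_smooth)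
      also have "\<dots> \<le> E i * nrm m f + C * nrm m (D i f)"
        by (intro add_mono E(2) C(2) f pd_smooth)
      also have "\<dots> \<le> E i * nrm (Suc m) f + C * nrm (Suc m) f"
        using E C f nrm_pd nrm_mono by (intro add_mono mult_left_mono) auto
      finally show ?thesis by (simp add: distrib_right)
    qed
    have "nrm 0 (\<lambda>x. w x * f x) \<le> nrm m (\<lambda>x. w x * f x)" using wf by (intro nrm_mono) auto
    also have "\<dots> \<le> C * nrm m f" using C f by auto
    also have "\<dots> \<le> C * nrm (Suc m) f" using C f nrm_mono[of f m "Suc m"] by (intro mult_left_mono) auto
    finally have "nrm (Suc m) (\<lambda>x. w x * f x) \<le> C * nrm (Suc m) f + (\<Sum>i\<in>UNIV. (E i + C) * nrm (Suc m) f)"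
      using nrm_Suc[OF wf, of m] sum_mono[of UNIV "\<lambda>i. nrm m (D i (\<lambda>x. w x * f x))", OF 1] by linarith
    then show ?thesis by (simp only: sum_distrib_right distrib_right)
  qed
  moreover have "0 \<le> C + (\<Sum>i\<in>UNIV. E i + C)" using E C by (intro add_nonneg_nonneg sum_nonneg) auto
  ultimately show ?case by blast
qed

text \<open>The coefficients of the expansions will be such operators applied to \<open>f\<close>. The class is closed under
  sums, compositions, derivatives and multiplication by smooth functions, and it keeps track of
  uniformity in \<open>f\<close>.\<close>

definition bop :: "((real^'n \<Rightarrow> real) \<Rightarrow> real^'n \<Rightarrow> real) \<Rightarrow> bool" where
  "bop T \<longleftrightarrow> (\<forall>f\<in>CP. T f \<in> CP) \<and> (\<forall>m. \<exists>m' C. 0 \<le> C \<and> (\<forall>f\<in>CP. nrm m (T f) \<le> C * nrm m' f))"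

lemma bop_CP: "bop T \<Longrightarrow> f \<in> CP \<Longrightarrow> T f \<in> CP"
  by (simp add: bop_def)

lemma bop_bound:
  "bop T \<Longrightarrow> \<exists>m' C. 0 \<le> C \<and> (\<forall>f\<in>CP. nrm m (T f) \<le> C * nrm m' f)"
  by (simp add: bop_def)

lemma bopI:
  assumes "\<And>f. f \<in> CP \<Longrightarrow> T f \<in> CP" "\<And>m. \<exists>m' C. 0 \<le> C \<and> (\<forall>f\<in>CP. nrm m (T f) \<le> C * nrm m' f)"
  shows "bop T"
  using assms unfolding bop_def by blast

lemma bop_id: "bop (\<lambda>f. f)"
proof (rule bopI)
  show "\<exists>m' C. 0 \<le> C \<and> (\<forall>f\<in>CP. nrm m f \<le> C * nrm m' f)" for m
    by (rule exI[of _ m], rule exI[of _ 1]) simp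
qed

lemma bop_pd: "bop (D i)"
proof (rule bopI)
  show "\<exists>m' C. 0 \<le> C \<and> (\<forall>f\<in>CP. nrm m (D i f) \<le> C * nrm m' f)" for m
    by (rule exI[of _ "Suc m"], rule exI[of _ 1]) (simp add: nrm_pd)
qed (rule pd_smooth)

lemma bop_mult: "w \<in> CP \<Longrightarrow> bop (\<lambda>f x. w x * f x)"
proof (rule bopI)
  show "w \<in> CP \<Longrightarrow> \<exists>m' C. 0 \<le> C \<and> (\<forall>f\<in>CP. nrm m (\<lambda>x. w x * f x) \<le> C * nrm m' f)" for m
    using nrm_mult by blast
qed (rule smooth_upto_mult)

lemma bop_comp:
  assumes S: "bop S" and T: "bop T" shows "bop (\<lambda>f. S (T f))"
proof (rule bopI)
  show "S (T f) \<in> CP" if "f \<in> CP" for f using that S T bop_CP by blast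
  fix m
  obtain m' C where C: "0 \<le> C" "\<forall>f\<in>CP. nrm m (S f) \<le> C * nrm m' f"
    using bop_bound[OF S] by blast
  obtain m'' C' where C': "0 \<le> C'" "\<forall>f\<in>CP. nrm m' (T f) \<le> C' * nrm m'' f"
    using bop_bound[OF T] by blast
  have "nrm m (S (T f)) \<le> (C * C') * nrm m'' f" if f: "f \<in> CP" for f
  proof -
    have "nrm m (S (T f)) \<le> C * nrm m' (T f)" using C f T bop_CP by blast
    also have "\<dots> \<le> C * (C' * nrm m'' f)" using C C' f by (intro mult_left_mono) auto
    finally show ?thesis by (simp add: mult.assoc)
  qed
  then show "\<exists>m' C. 0 \<le> C \<and> (\<forall>f\<in>CP. nrm m (S (T f)) \<le> C * nrm m' f)" using C C' by (meson mult_nonneg_nonneg)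
qed

lemma bop_add:
  assumes S: "bop S" and T: "bop T" shows "bop (\<lambda>f x. S f x + T f x)"
proof (rule bopI)
  show "(\<lambda>x. S f x + T f x) \<in> CP" if "f \<in> CP" for f using that S T bop_CP smooth_upto_add by blast
  fix m
  obtain m' C where C: "0 \<le> C" "\<forall>f\<in>CP. nrm m (S f) \<le> C * nrm m' f"
    using bop_bound[OF S] by blast
  obtain m'' C' where C': "0 \<le> C'" "\<forall>f\<in>CP. nrm m (T f) \<le> C' * nrm m'' f"
    using bop_bound[OF T] by blast
  have "nrm m (\<lambda>x. S f x + T f x) \<le> (C + C') * nrm (max m' m'') f" if f: "f \<in> CP" for f
  proof -
    have "nrm m (\<lambda>x. S f x + T f x) \<le> nrm m (S f) + nrm m (T f)"
      using f S T bop_CP nrm_add by blast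
    also have "\<dots> \<le> C * nrm m' f + C' * nrm m'' f" using C C' f by (intro add_mono) auto
    also have "\<dots> \<le> C * nrm (max m' m'') f + C' * nrm (max m' m'') f"
      using C C' f by (intro add_mono mult_left_mono nrm_mono) auto
    finally show ?thesis by (simp add: distrib_right)
  qed
  then show "\<exists>m' C. 0 \<le> C \<and> (\<forall>f\<in>CP. nrm m (\<lambda>x. S f x + T f x) \<le> C * nrm m' f)"
    using C C' by (meson add_nonneg_nonneg)
qed

lemma bop_cmult: "bop T \<Longrightarrow> bop (\<lambda>f x. c * T f x)"
  using bop_comp[OF bop_mult[OF smooth_upto_const]] .

lemma bop_zero: "bop (\<lambda>f x. 0)"
  using bop_cmult[OF bop_id, of 0] by simp

lemma bop_sum: "(\<And>i. i \<in> I \<Longrightarrow> bop (T i)) \<Longrightarrow> bop (\<lambda>f x. \<Sum>i\<in>I. T i f x)"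
  by (induction I rule: infinite_finite_induct) (auto intro: bop_zero bop_add)

lemma bop_pds: "bop (Ds is)"
  by (induction "is") (use bop_id bop_comp[OF bop_pd] in auto)

end

section \<open>Taylor's formula on a convex body\<close>

text \<open>Words in the coordinate directions replace multi-indices: with a sum over all words of length \<open>l\<close>
  in place of the multi-indices of degree \<open>l\<close>, the multinomial coefficients in Taylor's formula become
  \<open>1 / l!\<close>. The words in \<open>del_each j is\<close> index the terms of the \<open>j\<close>-th derivative of \<open>mon is\<close>.\<close>

fun mon :: "'n list \<Rightarrow> real^'n \<Rightarrow> real^'n \<Rightarrow> real" where
  "mon [] x y = 1"
| "mon (i # is) x y = (y $ i - x $ i) * mon is x y"

fun del_each :: "'n \<Rightarrow> 'n list \<Rightarrow> 'n list list" where
  "del_each j [] = []"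
| "del_each j (i # is) = (if i = j then [is] else []) @ map ((#) i) (del_each j is)"

lemma length_del_each: "js \<in> set (del_each j is) \<Longrightarrow> Suc (length js) = length is"
  by (induction "is" arbitrary: js) (auto split: if_splits)

definition words :: "nat \<Rightarrow> 'n list set" where
  "words l = {is. length is = l}"

lemma words_0: "words 0 = {[]}"
  by (auto simp: words_def)

lemma sum_words_Suc:
  "(\<Sum>is\<in>words (Suc l). f is) = (\<Sum>i\<in>(UNIV::'n::finite set). \<Sum>is\<in>words l. f (i # is))"
proof -
  have eq: "words (Suc l) = (\<lambda>(i, is). i # is) ` ((UNIV::'n set) \<times> words l)"
    by (auto simp: words_def length_Suc_conv image_iff)
  have "(\<Sum>is\<in>words (Suc l). f is) = (\<Sum>(i, is)\<in>UNIV \<times> words l. f (i # is))"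
    unfolding eq by (subst sum.reindex) (auto simp: inj_on_def intro!: sum.cong)
  then show ?thesis by (simp add: sum.cartesian_product)
qed

lemma mon_bound:
  assumes "\<And>i. \<bar>y $ i - x $ i\<bar> \<le> M" shows "\<bar>mon is x y\<bar> \<le> M ^ length is"
proof (induction "is")
  case (Cons i "is")
  have "0 \<le> M" using assms[of i] by linarith
  then show ?case using Cons assms[of i] by (simp add: abs_mult mult_mono)
qed simp

text \<open>Remainders are bounded by even powers, whose expectations are again moments.\<close>

lemma mon_even_bound:
  assumes "length is = 2 * r"
  shows "\<bar>mon is x y\<bar> \<le> (\<Sum>i\<in>UNIV. mon (replicate (2 * r) i) x (y::real^'n))"
proof -
  have rep: "mon (replicate l i) x y = (y $ i - x $ i) ^ l" for l i
    by (induction l) auto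
  define M where "M = Max (range (\<lambda>i. \<bar>y $ i - x $ i\<bar>))"
  have le: "\<bar>y $ i - x $ i\<bar> \<le> M" for i unfolding M_def by (intro Max_ge) auto
  have "M \<in> range (\<lambda>i. \<bar>y $ i - x $ i\<bar>)" unfolding M_def by (intro Max_in) auto
  then obtain i where i: "M = \<bar>y $ i - x $ i\<bar>" by blast
  have "\<bar>mon is x y\<bar> \<le> M ^ (2 * r)" using mon_bound[OF le, of "is"] assms by simp
  also have "\<dots> = mon (replicate (2 * r) i) x y" by (simp add: rep i power_mult)
  also have "\<dots> \<le> (\<Sum>i\<in>UNIV. mon (replicate (2 * r) i) x y)"
    by (intro member_le_sum) (auto simp: rep power_mult)
  finally show ?thesis .
qed

context convex_body
begin

lemma mon_smooth: "mon is x \<in> CP"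
proof (induction "is")
  case Nil
  show ?case by (rule smooth_upto_cong[OF smooth_upto_const[of 1]]) simp
next
  case (Cons i "is")
  have "(\<lambda>y. (y $ i - x $ i) * mon is x y) \<in> CP"
    by (intro smooth_upto_mult smooth_upto_diff smooth_upto_coord smooth_upto_const Cons)
  then show ?case by (rule smooth_upto_cong) simp
qed

lemma pd_mon: "y \<in> P \<Longrightarrow> D j (mon is x) y = (\<Sum>js\<leftarrow>del_each j is. mon js x y)"
proof (induction "is")
  case Nil
  have "D j (mon [] x) y = D j (\<lambda>y. 1) y"
    by (rule pd_cong[OF mon_smooth _ Nil]) simp
  then show ?case using pd_const[OF Nil] by simp
next
  case (Cons i "is")
  have c: "(\<lambda>y. y $ i - x $ i) \<in> CP"
    by (intro smooth_upto_diff smooth_upto_coord smooth_upto_const)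
  have dc: "D j (\<lambda>y. y $ i - x $ i) y = (if i = j then 1 else 0)"
    using pd_add[OF smooth_upto_coord smooth_upto_const, of y j i "- (x $ i)"] pd_coord[of y j i] pd_const[of y j]
      Cons.prems by auto
  have "D j (mon (i # is) x) y = D j (\<lambda>y. (y $ i - x $ i) * mon is x y) y"
    by (rule pd_cong[OF mon_smooth _ Cons.prems]) simp
  also have "\<dots> = (if i = j then 1 else 0) * mon is x y + (y $ i - x $ i) * D j (mon is x) y"
    using pd_mult[OF c mon_smooth Cons.prems] dc by simp
  also have "\<dots> = (\<Sum>js\<leftarrow>del_each j (i # is). mon js x y)"
    using Cons by (simp add: sum_list_const_mult o_def)
  finally show ?case .
qed

lemma segment_in_P: "x \<in> P \<Longrightarrow> y \<in> P \<Longrightarrow> s \<in> {0..1} \<Longrightarrow> x + s *\<^sub>R (y - x) \<in> P"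
proof -
  assume *: "x \<in> P" "y \<in> P" "s \<in> {0..1}"
  then have "(1 - s) *\<^sub>R x + s *\<^sub>R y \<in> P"
    using convex_P by (auto simp: convex_alt)
  moreover have "(1 - s) *\<^sub>R x + s *\<^sub>R y = x + s *\<^sub>R (y - x)" by (simp add: algebra_simps)
  ultimately show ?thesis by simp
qed

lemma has_vector_derivative_along_segment:
  assumes f: "f \<in> CP" and xy: "x \<in> P" "y \<in> P" and s: "s \<in> {0..1}"
  shows "((\<lambda>s. f (x + s *\<^sub>R (y - x))) has_vector_derivative
     (\<Sum>i\<in>UNIV. (y $ i - x $ i) * D i f (x + s *\<^sub>R (y - x)))) (at s within {0..1})"
proof -
  have 1: "((\<lambda>s. x + s *\<^sub>R (y - x)) has_derivative (\<lambda>h. h *\<^sub>R (y - x))) (at s within {0..1})"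
    by (auto intro!: derivative_eq_intros)
  have "((\<lambda>s. f (x + s *\<^sub>R (y - x))) has_derivative
     (\<lambda>h. \<Sum>i\<in>UNIV. (h *\<^sub>R (y - x)) $ i * D i f (x + s *\<^sub>R (y - x)))) (at s within {0..1})"
    by (rule has_derivative_in_compose2[OF pd_has_derivative[OF f] _ s 1])
      (use segment_in_P[OF xy] in auto)
  then show ?thesis
    by (simp add: has_vector_derivative_def sum_distrib_left mult.assoc)
qed

definition taylor_poly :: "nat \<Rightarrow> (real^'n \<Rightarrow> real) \<Rightarrow> real^'n \<Rightarrow> real^'n \<Rightarrow> real" where
  "taylor_poly m f x y = (\<Sum>l<m. (\<Sum>is\<in>words l. Ds is f x * mon is x y) / fact l)"

text \<open>One-dimensional Taylor formula with integral remainder along the segment from \<open>x\<close> to \<open>y\<close>, which stays in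
  \<open>P\<close> by convexity; derivatives at its end points are one-sided.\<close>

lemma taylor:
  assumes f: "f \<in> CP" and xy: "x \<in> P" "y \<in> P" and m: "m > 0"
  shows "\<bar>f y - taylor_poly m f x y\<bar> \<le> nrm m f * (\<Sum>is\<in>words m. \<bar>mon is x y\<bar>)"
proof -
  define z where "z s = x + s *\<^sub>R (y - x)" for s
  define Df where "Df l s = (\<Sum>is\<in>words l. Ds is f (z s) * mon is x y)" for l s
  have zP: "z s \<in> P" if "s \<in> {0..1}" for s using segment_in_P[OF xy that] by (simp add: z_def)
  have 0: "Df 0 = (\<lambda>s. f (z s))" by (simp add: Df_def words_0 fun_eq_iff)
  have step: "(Df l has_vector_derivative Df (Suc l) s) (at s within {0..1})" if "0 \<le> s" "s \<le> 1" for l s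
  proof -
    have s: "s \<in> {0..1}" using that by simp
    have "(Df l has_vector_derivative (\<Sum>is\<in>words l.
        (\<Sum>i\<in>UNIV. (y $ i - x $ i) * D i (Ds is f) (z s)) * mon is x y)) (at s within {0..1})"
      unfolding Df_def z_def
      by (intro has_vector_derivative_sum has_vector_derivative_mult_left
            has_vector_derivative_along_segment pds_smooth f xy s)
    also have "(\<Sum>is\<in>words l. (\<Sum>i\<in>UNIV. (y $ i - x $ i) * D i (Ds is f) (z s)) * mon is x y) = Df (Suc l) s"
      unfolding Df_def sum_words_Suc sum_distrib_right
      by (subst sum.swap) (simp add: mult_ac)
    finally show ?thesis .
  qed
  let ?i = "\<lambda>s. ((1 - s) ^ (m - 1) / fact (m - 1)) *\<^sub>R Df m s"
  have int: "(?i has_integral f (z 1) - (\<Sum>l<m. ((1 - 0) ^ l / fact l) *\<^sub>R Df l 0)) {0..1}"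
    by (rule Taylor_has_integral[OF m 0 step]) auto
  let ?B = "nrm m f * (\<Sum>is\<in>words m. \<bar>mon is x y\<bar>)"
  have B0: "0 \<le> ?B" using nrm_nonneg[OF f] by (intro mult_nonneg_nonneg sum_nonneg) auto
  have bd: "norm (?i s) \<le> ?B" if s: "s \<in> {0..1}" for s
  proof -
    have "\<bar>Df m s\<bar> \<le> (\<Sum>is\<in>words m. \<bar>Ds is f (z s) * mon is x y\<bar>)"
      unfolding Df_def by (rule sum_abs)
    also have "\<dots> \<le> (\<Sum>is\<in>words m. nrm m f * \<bar>mon is x y\<bar>)"
      unfolding abs_mult using nrm_ge[OF f _ zP[OF s]]
      by (intro sum_mono mult_right_mono) (auto simp: words_def)
    also have "\<dots> = ?B" by (simp add: sum_distrib_left)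
    finally have 1: "\<bar>Df m s\<bar> \<le> ?B" .
    have "(1 - s) ^ (m - 1) \<le> 1" using s by (intro power_le_one) auto
    then have "\<bar>(1 - s) ^ (m - 1) / fact (m - 1)\<bar> \<le> 1"
      using s fact_ge_1[of "m - 1", where 'a=real] by (simp add: divide_le_eq_1 order_trans)
    then have "\<bar>(1 - s) ^ (m - 1) / fact (m - 1)\<bar> * \<bar>Df m s\<bar> \<le> 1 * ?B"
      using 1 B0 by (intro mult_mono) auto
    then show ?thesis by (simp add: abs_mult)
  qed
  have "norm (f (z 1) - (\<Sum>l<m. ((1 - 0) ^ l / fact l) *\<^sub>R Df l 0)) \<le> ?B * measure lborel {0..1::real}"
    by (rule has_integral_bound_real[OF B0 finite.emptyI int]) (rule bd, simp)
  moreover have "z 1 = y" "z 0 = x" by (auto simp: z_def)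
  ultimately show ?thesis
    by (simp add: taylor_poly_def Df_def)
qed

end

section \<open>Linear systems with smooth coefficients\<close>

text \<open>Gaussian elimination: for positive definite matrices every pivot is a positive function on \<open>P\<close>, so
  dividing by it preserves smoothness, and the Schur complement is positive definite again.\<close>

lemma smooth_solve_posdef:
  fixes A :: "'b \<Rightarrow> 'b \<Rightarrow> real^'n \<Rightarrow> real"
  assumes "finite I"
    and "\<And>i j. i \<in> I \<Longrightarrow> j \<in> I \<Longrightarrow> A i j \<in> smooth_upto P"
    and "\<And>i j x. i \<in> I \<Longrightarrow> j \<in> I \<Longrightarrow> x \<in> P \<Longrightarrow> A i j x = A j i x"
    and "\<And>x z. x \<in> P \<Longrightarrow> \<exists>i\<in>I. z i \<noteq> (0::real) \<Longrightarrow> 0 < (\<Sum>i\<in>I. \<Sum>j\<in>I. z i * A i j x * z j)"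
    and "\<And>i. i \<in> I \<Longrightarrow> b i \<in> smooth_upto P"
  shows "\<exists>z. (\<forall>i\<in>I. z i \<in> smooth_upto P) \<and> (\<forall>i\<in>I. \<forall>x\<in>P. (\<Sum>j\<in>I. A i j x * z j x) = b i x)"
  using assms
proof (induction I arbitrary: A b)
  case empty
  then show ?case by auto
next
  case (insert p J)
  let ?a = "\<lambda>x. inverse (A p p x)"
  have ap: "A p p x > 0" if "x \<in> P" for x
    using insert.prems(3)[OF that, of "\<lambda>i. if i = p then 1 else 0"] insert.hyps
    by (simp add: if_distrib[of "\<lambda>z. z * _"] if_distrib[of "\<lambda>z. _ * z"] sum.delta' cong: if_cong)
  have a_smooth: "?a \<in> smooth_upto P"
    by (rule smooth_upto_inverse[OF insert.prems(1)]) (use ap in force)+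
  define A' where "A' i j x = A i j x - A i p x * ?a x * A p j x" for i j x
  define b' where "b' i x = b i x - A i p x * ?a x * b p x" for i x
  have "\<exists>z. (\<forall>i\<in>J. z i \<in> smooth_upto P) \<and> (\<forall>i\<in>J. \<forall>x\<in>P. (\<Sum>j\<in>J. A' i j x * z j x) = b' i x)"
  proof (rule insert.IH)
    show "A' i j \<in> smooth_upto P" if "i \<in> J" "j \<in> J" for i j
      unfolding A'_def using that
      by (intro smooth_upto_diff smooth_upto_mult a_smooth insert.prems(1)) auto
    show "b' i \<in> smooth_upto P" if "i \<in> J" for i
      unfolding b'_def using that
      by (intro smooth_upto_diff smooth_upto_mult a_smooth insert.prems(1,4)) auto
    show "A' i j x = A' j i x" if "i \<in> J" "j \<in> J" "x \<in> P" for i j x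
      using insert.prems(2)[of i j x] insert.prems(2)[of i p x] insert.prems(2)[of j p x] that
      by (simp add: A'_def)
    show "0 < (\<Sum>i\<in>J. \<Sum>j\<in>J. z i * A' i j x * z j)" if x: "x \<in> P" and z: "\<exists>i\<in>J. z i \<noteq> (0::real)" for x z
    proof -
      define s where "s = (\<Sum>j\<in>J. A p j x * z j)"
      define y where "y i = (if i = p then - (?a x * s) else z i)" for i
      have yJ: "y i = z i" if "i \<in> J" for i using that insert.hyps by (auto simp: y_def)
      have s': "(\<Sum>j\<in>J. z j * A j p x) = s"
        unfolding s_def using insert.prems(2) x by (intro sum.cong) (auto simp: mult.commute)
      have sy: "(\<Sum>j\<in>J. A p j x * y j) = s" "(\<Sum>j\<in>J. y j * A j p x) = s"
        unfolding s'[symmetric] s_def using yJ s' s_def by (auto intro!: sum.cong)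
      have "\<exists>i\<in>insert p J. y i \<noteq> 0" using z yJ by force
      from insert.prems(3)[OF x this]
      have "0 < (\<Sum>j\<in>insert p J. y p * A p j x * y j) + (\<Sum>i\<in>J. \<Sum>j\<in>insert p J. y i * A i j x * y j)"
        using insert.hyps by simp
      also have "\<dots> = y p * A p p x * y p + y p * s + (s * y p + (\<Sum>i\<in>J. \<Sum>j\<in>J. z i * A i j x * z j))"
      proof -
        have "(\<Sum>j\<in>J. y p * A p j x * y j) = y p * s"
          unfolding sy(1)[symmetric] sum_distrib_left by (simp add: mult_ac)
        moreover have "(\<Sum>i\<in>J. y i * A i p x * y p) = s * y p"
          unfolding sy(2)[symmetric] sum_distrib_right by (simp add: mult_ac)
        moreover have "(\<Sum>i\<in>J. \<Sum>j\<in>J. y i * A i j x * y j) = (\<Sum>i\<in>J. \<Sum>j\<in>J. z i * A i j x * z j)"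
          using yJ by simp
        ultimately show ?thesis using insert.hyps by (simp add: sum.distrib)
      qed
      also have "\<dots> = (\<Sum>i\<in>J. \<Sum>j\<in>J. z i * A i j x * z j) - s * ?a x * s"
        using ap[OF x] by (simp add: y_def field_simps)
      also have "s * ?a x * s = (\<Sum>i\<in>J. \<Sum>j\<in>J. z i * (A i p x * ?a x * A p j x) * z j)"
      proof -
        have "s * ?a x * s = (\<Sum>i\<in>J. z i * A i p x) * ?a x * (\<Sum>j\<in>J. A p j x * z j)"
          unfolding s' s_def[symmetric] ..
        also have "\<dots> = (\<Sum>i\<in>J. \<Sum>j\<in>J. z i * (A i p x * ?a x * A p j x) * z j)"
          by (simp add: sum_distrib_left sum_distrib_right mult_ac)
        finally show ?thesis .
      qed
      also have "(\<Sum>i\<in>J. \<Sum>j\<in>J. z i * A i j x * z j) - \<dots> = (\<Sum>i\<in>J. \<Sum>j\<in>J. z i * A' i j x * z j)"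
        by (simp add: A'_def sum_subtractf algebra_simps)
      finally show ?thesis .
    qed
  qed
  then obtain z where z: "\<And>i. i \<in> J \<Longrightarrow> z i \<in> smooth_upto P"
    "\<And>i x. i \<in> J \<Longrightarrow> x \<in> P \<Longrightarrow> (\<Sum>j\<in>J. A' i j x * z j x) = b' i x" by blast
  define y where "y i = (if i = p then (\<lambda>x. ?a x * (b p x - (\<Sum>j\<in>J. A p j x * z j x))) else z i)" for i
  have yJ: "y i = z i" if "i \<in> J" for i using that insert.hyps by (auto simp: y_def)
  have "y i \<in> smooth_upto P" if "i \<in> insert p J" for i
  proof (cases "i = p")
    case True
    have "(\<lambda>x. ?a x * (b p x - (\<Sum>j\<in>J. A p j x * z j x))) \<in> smooth_upto P"
      by (intro smooth_upto_mult a_smooth smooth_upto_diff smooth_upto_sum insert.prems(1,4) z) auto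
    with True show ?thesis by (simp add: y_def)
  qed (use that z yJ in auto)
  moreover have "(\<Sum>j\<in>insert p J. A i j x * y j x) = b i x" if i: "i \<in> insert p J" and x: "x \<in> P" for i x
  proof -
    let ?s = "\<Sum>j\<in>J. A p j x * z j x"
    have yp: "y p x = ?a x * (b p x - ?s)" by (simp add: y_def)
    have 1: "(\<Sum>j\<in>insert p J. A i j x * y j x) = A i p x * y p x + (\<Sum>j\<in>J. A i j x * z j x)"
      using insert.hyps yJ by simp
    show ?thesis
    proof (cases "i = p")
      case True
      have "A p p x * y p x = b p x - ?s" using yp ap[OF x] by simp
      with 1 True show ?thesis by simp
    next
      case False
      then have iJ: "i \<in> J" using i by simp
      have "(\<Sum>j\<in>J. A' i j x * z j x) = (\<Sum>j\<in>J. A i j x * z j x) - A i p x * ?a x * ?s"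
        by (simp add: A'_def left_diff_distrib sum_subtractf sum_distrib_left mult.assoc)
      with z(2)[OF iJ x] 1 yp show ?thesis by (simp add: b'_def algebra_simps)
    qed
  qed
  ultimately show ?case by blast
qed

text \<open>With the ansatz \<open>z = M\<^sup>T y\<close> the system becomes \<open>M M\<^sup>T y = b\<close>, which is positive definite when \<open>M\<^sup>T\<close> is
  injective at each point.\<close>

lemma smooth_solve:
  fixes M :: "'b \<Rightarrow> 'b \<Rightarrow> real^'n \<Rightarrow> real"
  assumes I: "finite I"
    and M: "\<And>i j. i \<in> I \<Longrightarrow> j \<in> I \<Longrightarrow> M i j \<in> smooth_upto P"
    and inj: "\<And>x y. x \<in> P \<Longrightarrow> (\<And>j. j \<in> I \<Longrightarrow> (\<Sum>i\<in>I. y i * M i j x) = 0) \<Longrightarrow> \<forall>i\<in>I. y i = (0::real)"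
    and b: "\<And>i. i \<in> I \<Longrightarrow> b i \<in> smooth_upto P"
  shows "\<exists>z. (\<forall>i\<in>I. z i \<in> smooth_upto P) \<and> (\<forall>i\<in>I. \<forall>x\<in>P. (\<Sum>j\<in>I. M i j x * z j x) = b i x)"
proof -
  define A where "A i j x = (\<Sum>c\<in>I. M i c x * M j c x)" for i j x
  have "\<exists>y. (\<forall>i\<in>I. y i \<in> smooth_upto P) \<and> (\<forall>i\<in>I. \<forall>x\<in>P. (\<Sum>j\<in>I. A i j x * y j x) = b i x)"
  proof (rule smooth_solve_posdef[OF I _ _ _ b])
    show "A i j \<in> smooth_upto P" if "i \<in> I" "j \<in> I" for i j
      unfolding A_def using that by (intro smooth_upto_sum smooth_upto_mult M)
    show "A i j x = A j i x" for i j x by (simp add: A_def mult.commute)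
    show "0 < (\<Sum>i\<in>I. \<Sum>j\<in>I. y i * A i j x * y j)" if x: "x \<in> P" and y: "\<exists>i\<in>I. y i \<noteq> 0" for x y
    proof -
      have "\<exists>c\<in>I. (\<Sum>i\<in>I. y i * M i c x) \<noteq> 0" using inj[OF x, of y] y by blast
      then have "0 < (\<Sum>c\<in>I. (\<Sum>i\<in>I. y i * M i c x)\<^sup>2)"
        using I by (auto intro!: sum_pos2)
      also have "\<dots> = (\<Sum>c\<in>I. \<Sum>i\<in>I. \<Sum>j\<in>I. y i * M i c x * (y j * M j c x))"
        by (simp add: power2_eq_square sum_product)
      also have "\<dots> = (\<Sum>i\<in>I. \<Sum>c\<in>I. \<Sum>j\<in>I. y i * M i c x * (y j * M j c x))"
        by (rule sum.swap)
      also have "\<dots> = (\<Sum>i\<in>I. \<Sum>j\<in>I. \<Sum>c\<in>I. y i * M i c x * (y j * M j c x))"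
        by (intro sum.cong refl sum.swap)
      also have "\<dots> = (\<Sum>i\<in>I. \<Sum>j\<in>I. y i * A i j x * y j)"
        by (simp add: A_def sum_distrib_left sum_distrib_right mult_ac)
      finally show ?thesis .
    qed
  qed
  then obtain y where y: "\<And>i. i \<in> I \<Longrightarrow> y i \<in> smooth_upto P"
    "\<And>i x. i \<in> I \<Longrightarrow> x \<in> P \<Longrightarrow> (\<Sum>j\<in>I. A i j x * y j x) = b i x" by blast
  define z where "z c x = (\<Sum>j\<in>I. M j c x * y j x)" for c x
  have "z c \<in> smooth_upto P" if "c \<in> I" for c
    unfolding z_def using that by (intro smooth_upto_sum smooth_upto_mult M y)
  moreover have "(\<Sum>c\<in>I. M i c x * z c x) = b i x" if "i \<in> I" "x \<in> P" for i x
  proof -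
    have "(\<Sum>c\<in>I. M i c x * z c x) = (\<Sum>c\<in>I. \<Sum>j\<in>I. M i c x * M j c x * y j x)"
      by (simp add: z_def sum_distrib_left mult.assoc)
    also have "\<dots> = (\<Sum>j\<in>I. A i j x * y j x)"
      by (subst sum.swap) (simp add: A_def sum_distrib_right)
    finally show ?thesis using y(2)[OF that] by simp
  qed
  ultimately show ?thesis by blast
qed

section \<open>The inverse Hessian of a symplectic potential\<close>

locale toric_potential =
  fixes A :: "'a set" and \<nu> :: "'a \<Rightarrow> real^'n" and lam :: "'a \<Rightarrow> real"
    and P :: "(real^'n) set" and u :: "real^'n \<Rightarrow> real"
  assumes delzant: "integral_delzant A \<nu> lam P"
    and potential: "symplectic_potential A \<nu> lam P u"
begin

abbreviation "l \<equiv> ell \<nu> lam"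

lemma finite_A: "finite A" and P_def: "P = {x. \<forall>a\<in>A. l a x \<ge> 0}" 
  using delzant by (auto simp: integral_delzant_def)

sublocale convex_body P
proof
  obtain V where V: "finite V" "P = convex hull V"
    using delzant by (auto simp: integral_delzant_def integral_polytope_def)
  show "convex P" using V by (simp add: convex_convex_hull)
  show "compact P" using V by (simp add: finite_imp_compact_convex_hull)
  show "interior P \<noteq> {}" using delzant unfolding integral_delzant_def by blast
qed

definition "v x = u x - 1/2 * (\<Sum>a\<in>A. l a x * ln (l a x))"

lemma v_smooth: "v \<in> CP"
  using potential by (simp add: symplectic_potential_def v_def[abs_def])

lemma l_nonneg: "x \<in> P \<Longrightarrow> a \<in> A \<Longrightarrow> 0 \<le> l a x"
  using P_def by blast

lemma l_smooth: "l a \<in> CP"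
  unfolding ell_def by (intro smooth_upto_diff smooth_upto_inner smooth_upto_const)

lemma l_add: "l a (x + w) = l a x + w \<bullet> \<nu> a"
  by (simp add: ell_def inner_add_left)

lemma l_line: "l a (x + s *\<^sub>R w) = l a x + s * (w \<bullet> \<nu> a)"
  by (simp add: ell_def inner_add_left)

lemma continuous_l: "continuous_on S (l a)"
  unfolding ell_def by (intro continuous_intros)

lemma normal_nonzero: "a \<in> A \<Longrightarrow> \<nu> a \<noteq> 0"
proof
  assume a: "a \<in> A" "\<nu> a = 0"
  then have "primitive_vec (\<nu> a)" using delzant unfolding integral_delzant_def by blast
  then have "\<forall>m::nat. m > 0 \<and> (1 / real m) *\<^sub>R \<nu> a \<in> int_lattice \<longrightarrow> m = 1"
    by (simp add: primitive_vec_def)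
  \<comment> \<open>the zero vector is divisible by \<open>2\<close>, hence not primitive\<close>
  from this[rule_format, of 2] a show False by (simp add: int_lattice_def)
qed

lemma l_pos_interior: "x \<in> interior P \<Longrightarrow> a \<in> A \<Longrightarrow> 0 < l a x"
proof (rule ccontr)
  assume x: "x \<in> interior P" and a: "a \<in> A" and "\<not> 0 < l a x"
  then have 0: "l a x \<le> 0" by simp
  obtain e where e: "e > 0" "ball x e \<subseteq> P" using x by (meson mem_interior)
  define y where "y = x - (e / (2 * norm (\<nu> a))) *\<^sub>R \<nu> a"
  have n: "norm (\<nu> a) > 0" using normal_nonzero[OF a] by simp
  have "dist x y = e / 2" using e n by (simp add: y_def dist_norm)
  then have "y \<in> P" using e by auto
  moreover have "l a y = l a x - e / (2 * norm (\<nu> a)) * (\<nu> a \<bullet> \<nu> a)"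
    by (simp add: y_def ell_def inner_diff_left)
  moreover have "e / (2 * norm (\<nu> a)) * (\<nu> a \<bullet> \<nu> a) > 0" using e n by (simp add: inner_gt_zero_iff)
  ultimately show False using 0 l_nonneg[OF _ a, of y] by linarith
qed

lemma interior_P_eq: "interior P = {x. \<forall>a\<in>A. 0 < l a x}"
proof
  show "interior P \<subseteq> {x. \<forall>a\<in>A. 0 < l a x}" using l_pos_interior by blast
  have "open (\<Inter>a\<in>A. {x. 0 < l a x})"
    using finite_A by (intro open_INT ballI open_Collect_less continuous_l continuous_intros) auto
  moreover have "(\<Inter>a\<in>A. {x. 0 < l a x}) = {x. \<forall>a\<in>A. 0 < l a x}" by auto
  moreover have "{x. \<forall>a\<in>A. 0 < l a x} \<subseteq> P" unfolding P_def by (auto intro: less_imp_le)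
  ultimately show "{x. \<forall>a\<in>A. 0 < l a x} \<subseteq> interior P" by (metis interior_maximal)
qed

definition "active x = {a\<in>A. l a x = 0}"

definition "face_at x = {y\<in>P. \<forall>a\<in>active x. l a y = 0}"

lemma face_at_face: "face_at x face_of P"
proof (cases "active x = {}")
  case True
  then show ?thesis using face_of_refl[OF convex_P] by (simp add: face_at_def)
next
  case False
  have "(\<Inter>a\<in>active x. {y\<in>P. l a y = 0}) face_of P"
  proof (rule face_of_Inter)
    fix T assume "T \<in> (\<lambda>a. {y\<in>P. l a y = 0}) ` active x"
    then show "T face_of P" using delzant facet_of_imp_face_of
      by (fastforce simp: integral_delzant_def active_def)
  qed (use False in auto)
  also have "(\<Inter>a\<in>active x. {y\<in>P. l a y = 0}) = face_at x" using False by (auto simp: face_at_def)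
  finally show ?thesis .
qed

text \<open>The face through \<open>x\<close> contains a vertex \<open>p\<close> of \<open>P\<close>, at which the facets through \<open>x\<close> are active as well. By
  the Delzant condition the \<open>n\<close> normals at \<open>p\<close> span the space, so they are linearly independent.\<close>

lemma active_independent:
  assumes x: "x \<in> P" and z: "(\<Sum>a\<in>active x. z a *\<^sub>R \<nu> a) = 0" and a: "a \<in> active x"
  shows "z a = (0::real)"
proof -
  have F: "face_at x face_of P" by (rule face_at_face)
  have "face_at x \<noteq> {}" using x by (auto simp: face_at_def active_def)
  moreover have "compact (face_at x)" "convex (face_at x)"
    using face_of_imp_compact[OF convex_P compact_P F] face_of_imp_convex[OF F] by auto
  ultimately obtain p where p: "p extreme_point_of face_at x"
    using extreme_point_exists_convex by blast
  then have p': "p extreme_point_of P" "p \<in> face_at x"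
    using extreme_point_of_face[OF F] by auto
  have fin: "finite (active p)" using finite_A by (simp add: active_def)
  have card: "card (active p) = CARD('n)"
    using delzant p' by (simp add: integral_delzant_def active_def)
  have "axis i 1 \<in> span (\<nu> ` active p)" for i
  proof -
    have "axis i (1::real) \<in> int_lattice" by (auto simp: int_lattice_def axis_def)
    then obtain c :: "'a \<Rightarrow> int" where "axis i 1 = (\<Sum>a\<in>active p. of_int (c a) *\<^sub>R \<nu> a)"
      using delzant p' unfolding integral_delzant_def active_def by meson
    moreover have "(\<Sum>a\<in>active p. of_int (c a) *\<^sub>R \<nu> a) \<in> span (\<nu> ` active p)"
      by (intro span_sum span_scale span_base imageI)
    ultimately show ?thesis by simp
  qed
  then have "(Basis :: (real^'n) set) \<subseteq> span (\<nu> ` active p)" by (auto simp: Basis_vec_axis)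
  then have sp: "UNIV \<subseteq> span (\<nu> ` active p)"
    by (metis span_Basis span_minimal subspace_span)
  have "dim (UNIV :: (real^'n) set) \<le> card (\<nu> ` active p)"
    using sp fin by (intro span_card_ge_dim) auto
  then have ge: "CARD('n) \<le> card (\<nu> ` active p)" by simp
  then have ceq: "card (\<nu> ` active p) = card (active p)" using card card_image_le[OF fin, of \<nu>] by simp
  then have inj: "inj_on \<nu> (active p)" using fin by (simp add: eq_card_imp_inj_on)
  have indep: "independent (\<nu> ` active p)"
    by (rule card_le_dim_spanning[of _ UNIV]) (use sp fin ceq card in auto)
  have sub: "active x \<subseteq> active p" using p'(2) by (auto simp: active_def face_at_def)
  define w where "w y = (let a = the_inv_into (active p) \<nu> y in if a \<in> active x then z a else 0)" for y
  have w: "w (\<nu> a) = (if a \<in> active x then z a else 0)" if "a \<in> active p" for a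
    using the_inv_into_f_f[OF inj that] by (simp add: w_def)
  have "(\<Sum>y\<in>\<nu> ` active p. w y *\<^sub>R y) = (\<Sum>a\<in>active p. w (\<nu> a) *\<^sub>R \<nu> a)"
    by (simp add: sum.reindex[OF inj])
  also have "\<dots> = (\<Sum>a\<in>active x. z a *\<^sub>R \<nu> a)"
    using sub fin w by (intro sum.mono_neutral_cong_right) auto
  finally have "w (\<nu> a) = 0"
    using independentD[OF indep, of "\<nu> ` active p" w "\<nu> a"] z fin a sub by auto
  then show ?thesis using w[of a] a sub by auto
qed

lemma line_has_derivative:
  assumes f: "f \<in> CP" and P: "\<And>s. s \<in> {a<..<b} \<Longrightarrow> x + s *\<^sub>R w \<in> P" and s: "s \<in> {a<..<b}"
  shows "((\<lambda>s. f (x + s *\<^sub>R w)) has_real_derivative (\<Sum>i\<in>UNIV. w $ i * D i f (x + s *\<^sub>R w))) (at s)"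
proof -
  have 1: "((\<lambda>s. x + s *\<^sub>R w) has_derivative (\<lambda>h. h *\<^sub>R w)) (at s within {a<..<b})"
    by (auto intro!: derivative_eq_intros)
  have "((\<lambda>s. f (x + s *\<^sub>R w)) has_derivative
     (\<lambda>h. \<Sum>i\<in>UNIV. (h *\<^sub>R w) $ i * D i f (x + s *\<^sub>R w))) (at s within {a<..<b})"
    by (rule has_derivative_in_compose2[OF pd_has_derivative[OF f] _ s 1]) (use P in auto)
  then have "((\<lambda>s. f (x + s *\<^sub>R w)) has_derivative
     (\<lambda>h. \<Sum>i\<in>UNIV. (h *\<^sub>R w) $ i * D i f (x + s *\<^sub>R w))) (at s)"
    unfolding at_within_open[OF s open_greaterThanLessThan] .
  moreover have "(\<lambda>h. \<Sum>i\<in>UNIV. (h *\<^sub>R w) $ i * D i f (x + s *\<^sub>R w)) =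
      (*) (\<Sum>i\<in>UNIV. w $ i * D i f (x + s *\<^sub>R w))"
    by (auto simp: sum_distrib_left mult_ac fun_eq_iff)
  ultimately show ?thesis by (simp add: has_field_derivative_def)
qed

text \<open>On the face through \<open>x\<close> the singular terms of the active facets vanish identically, since
  \<open>0 * ln 0 = 0\<close>; what remains is the Hessian of the restriction of \<open>u\<close>, which is positive.\<close>

lemma hessian_on_face:
  assumes x: "x \<in> P" and w: "w \<noteq> 0" and tang: "\<And>a. a \<in> active x \<Longrightarrow> w \<bullet> \<nu> a = 0"
  shows "0 < (\<Sum>i\<in>UNIV. \<Sum>j\<in>UNIV. w $ i * w $ j * D j (D i v) x)
      + 1/2 * (\<Sum>a\<in>A - active x. (w \<bullet> \<nu> a)\<^sup>2 / l a x)"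
proof -
  let ?N = "A - active x"
  have N: "0 < l a x" if "a \<in> ?N" for a
    using that l_nonneg[OF x, of a] by (auto simp: active_def less_le)
  define Om where "Om = (\<Inter>a\<in>?N. {y. 0 < l a y})"
  have "open Om" unfolding Om_def
    using finite_A by (intro open_INT ballI open_Collect_less continuous_l continuous_intros) auto
  moreover have "x \<in> Om" using N by (auto simp: Om_def)
  ultimately obtain e where e: "e > 0" "ball x e \<subseteq> Om" by (meson open_contains_ball)
  have face: "y \<in> face_at x" if "y \<in> ball x e" "\<And>a. a \<in> active x \<Longrightarrow> l a y = 0" for y
  proof -
    have "y \<in> Om" using that(1) e by blast
    then have "0 \<le> l a y" if "a \<in> A" for a
      using that \<open>\<And>a. a \<in> active x \<Longrightarrow> l a y = 0\<close>
      by (cases "a \<in> active x") (auto simp: Om_def intro: less_imp_le)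
    then have "y \<in> P" using P_def by blast
    then show ?thesis using that by (simp add: face_at_def)
  qed
  \<comment> \<open>so that \<open>x + s w\<close> stays in the ball for \<open>|s| < d\<close>\<close>
  define d where "d = e / norm w"
  have d: "d > 0" using e w by (simp add: d_def)
  have line: "x + s *\<^sub>R w \<in> ball x e" if "s \<in> {-d<..<d}" for s
    using that w by (auto simp: dist_norm d_def field_simps abs_less_iff)
  have lineF: "x + s *\<^sub>R w \<in> face_at x" if "s \<in> {-d<..<d}" for s
    using face[OF line[OF that]] tang by (auto simp: l_line active_def)
  have lineP: "x + s *\<^sub>R w \<in> P" if "s \<in> {-d<..<d}" for s
    using lineF[OF that] by (simp add: face_at_def)
  have line0: "l a (x + s *\<^sub>R w) = 0" if "a \<in> active x" for a s
    using tang[OF that] that by (auto simp: l_line active_def)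
  have linepos: "0 < l a (x + s *\<^sub>R w)" if "a \<in> ?N" "s \<in> {-d<..<d}" for a s
    using line[OF that(2)] e that(1) by (auto simp: Om_def)
  have xF: "x \<in> face_at x" using x by (auto simp: face_at_def active_def)
  have rel: "x \<in> rel_interior (face_at x)"
  proof -
    have "affine {y. \<forall>a\<in>active x. l a y = 0}"
    proof -
      have "affine (\<Inter>a\<in>active x. {y. \<nu> a \<bullet> y = lam a})" by (intro affine_Inter) (auto simp: affine_hyperplane)
      moreover have "(\<Inter>a\<in>active x. {y. \<nu> a \<bullet> y = lam a}) = {y. \<forall>a\<in>active x. l a y = 0}"
        by (auto simp: ell_def inner_commute)
      ultimately show ?thesis by simp
    qed
    then have "affine hull face_at x \<subseteq> {y. \<forall>a\<in>active x. l a y = 0}"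
      by (intro hull_minimal) (auto simp: face_at_def)
    then have "ball x e \<inter> affine hull face_at x \<subseteq> face_at x" using face by blast
    then show ?thesis using xF e by (auto simp: mem_rel_interior_ball)
  qed
  have span: "w \<in> span {y - x | y. y \<in> face_at x}"
  proof -
    have "(x + (d/2) *\<^sub>R w) - x \<in> {y - x | y. y \<in> face_at x}" using lineF[of "d/2"] d by force
    then have "(2/d) *\<^sub>R ((x + (d/2) *\<^sub>R w) - x) \<in> span {y - x | y. y \<in> face_at x}"
      by (intro span_scale span_base)
    then show ?thesis using d by simp
  qed
  have "hessian_pos_on (face_at x) u"
    using potential face_at_face by (simp add: symplectic_potential_def)
  then have pos: "(deriv ^^ 2) (\<lambda>s. u (x + s *\<^sub>R w)) 0 > 0"
    using rel span w by (simp add: hessian_pos_on_def)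
  define h where "h s = u (x + s *\<^sub>R w)" for s
  define h1 where "h1 s = (\<Sum>i\<in>UNIV. w $ i * D i v (x + s *\<^sub>R w))
     + 1/2 * (\<Sum>a\<in>?N. (w \<bullet> \<nu> a) * ln (l a (x + s *\<^sub>R w)) + (w \<bullet> \<nu> a))" for s
  have h_eq: "h s = v (x + s *\<^sub>R w) + 1/2 * (\<Sum>a\<in>?N. l a (x + s *\<^sub>R w) * ln (l a (x + s *\<^sub>R w)))" for s
  proof -
    have "(\<Sum>a\<in>A. l a (x + s *\<^sub>R w) * ln (l a (x + s *\<^sub>R w)))
       = (\<Sum>a\<in>?N. l a (x + s *\<^sub>R w) * ln (l a (x + s *\<^sub>R w)))"
      using finite_A line0 by (intro sum.mono_neutral_right) auto
    then show ?thesis by (simp add: h_def v_def)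
  qed
  have dl: "((\<lambda>s. l a (x + s *\<^sub>R w)) has_real_derivative w \<bullet> \<nu> a) (at s)" for a s
    unfolding l_line by (auto intro!: derivative_eq_intros)
  have dh: "(h has_real_derivative h1 s) (at s)" if s: "s \<in> {-d<..<d}" for s
    unfolding h_eq[abs_def] h1_def
  proof (intro DERIV_add DERIV_cmult DERIV_sum line_has_derivative[OF v_smooth lineP s])
    fix a assume a: "a \<in> ?N"
    have p: "0 < l a (x + s *\<^sub>R w)" using linepos[OF a s] .
    show "((\<lambda>s. l a (x + s *\<^sub>R w) * ln (l a (x + s *\<^sub>R w))) has_real_derivative
         w \<bullet> \<nu> a * ln (l a (x + s *\<^sub>R w)) + w \<bullet> \<nu> a) (at s)"
      using p by (auto intro!: derivative_eq_intros dl)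
  qed
  have z: "0 \<in> {-d<..<d}" using d by simp
  have ev: "\<forall>\<^sub>F s in nhds 0. deriv h s = h1 s"
    using eventually_nhds_in_open[OF open_greaterThanLessThan z]
    by eventually_elim (use dh DERIV_imp_deriv in blast)
  have dh1: "(h1 has_real_derivative (\<Sum>i\<in>UNIV. w $ i * (\<Sum>j\<in>UNIV. w $ j * D j (D i v) (x + 0 *\<^sub>R w)))
      + 1/2 * (\<Sum>a\<in>?N. (w \<bullet> \<nu> a)\<^sup>2 / l a (x + 0 *\<^sub>R w))) (at 0)"
    unfolding h1_def[abs_def]
  proof (intro DERIV_add DERIV_cmult DERIV_sum line_has_derivative[OF pd_smooth[OF v_smooth] lineP z])
    fix a assume a: "a \<in> ?N"
    have p: "0 < l a (x + 0 *\<^sub>R w)" using linepos[OF a z] .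
    show "((\<lambda>s. w \<bullet> \<nu> a * ln (l a (x + s *\<^sub>R w)) + w \<bullet> \<nu> a) has_real_derivative
         (w \<bullet> \<nu> a)\<^sup>2 / l a (x + 0 *\<^sub>R w)) (at 0)"
      using p by (auto intro!: derivative_eq_intros dl simp: power2_eq_square)
  qed
  have "(deriv ^^ 2) h 0 = deriv h1 0"
    using deriv_cong_ev[OF ev refl] by (simp add: numeral_2_eq_2)
  also have "\<dots> = (\<Sum>i\<in>UNIV. w $ i * (\<Sum>j\<in>UNIV. w $ j * D j (D i v) x))
      + 1/2 * (\<Sum>a\<in>?N. (w \<bullet> \<nu> a)\<^sup>2 / l a x)"
    using DERIV_imp_deriv[OF dh1] by simp
  finally show ?thesis using pos unfolding h_def by (simp add: sum_distrib_left mult.assoc)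
qed

text \<open>The Hessian of \<open>u\<close> is \<open>V + 1/2 \<Sum> \<nu>\<^sub>a \<nu>\<^sub>a\<^sup>T / l\<^sub>a\<close> with \<open>V\<close> smooth on \<open>P\<close>. Its inverse \<open>G\<close> is found by
  solving the bordered system \<open>V G + N Z = 1\<close>, \<open>N\<^sup>T G = 2 l Z\<close>, whose coefficients are smooth up to
  the boundary and which is nonsingular everywhere on \<open>P\<close>: at a boundary point this is the
  positivity of the Hessian on the face together with the Delzant condition. The second equation
  also says that the normal components of \<open>G\<close> vanish on the facets.\<close>

lemma inverse_hessian:
  "\<exists>G Z. (\<forall>j m. G j m \<in> CP) \<and> (\<forall>a\<in>A. \<forall>m. Z a m \<in> CP) \<and>
    (\<forall>x\<in>P. \<forall>i m. (\<Sum>j\<in>UNIV. D j (D i v) x * G j m x) + (\<Sum>a\<in>A. \<nu> a $ i * Z a m x) = (if i = m then 1 else 0)) \<and>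
    (\<forall>x\<in>P. \<forall>a\<in>A. \<forall>m. (\<Sum>j\<in>UNIV. \<nu> a $ j * G j m x) = 2 * l a x * Z a m x)"
proof -
  define I where "I = (UNIV :: 'n set) <+> A"
  define M where "M r c x = (case r of
      Inl i \<Rightarrow> (case c of Inl j \<Rightarrow> D j (D i v) x | Inr a \<Rightarrow> \<nu> a $ i)
    | Inr a \<Rightarrow> (case c of Inl j \<Rightarrow> - \<nu> a $ j | Inr b \<Rightarrow> if a = b then 2 * l a x else 0))" for r c x
  have sumI: "(\<Sum>c\<in>I. f c) = (\<Sum>j\<in>UNIV. f (Inl j)) + (\<Sum>a\<in>A. f (Inr a))" for f :: "'n + 'a \<Rightarrow> real"
    unfolding I_def by (simp add: sum.Plus finite_A)
  have mI: "Inl j \<in> I" "Inr a \<in> I \<longleftrightarrow> a \<in> A" for j a by (auto simp: I_def)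
  have finI: "finite I" unfolding I_def using finite_A by simp
  have M_smooth: "M r c \<in> CP" for r c
  proof (cases r; cases c)
    fix a b assume "r = Inr a" "c = Inr b"
    then show ?thesis
      by (cases "a = b") (auto simp: M_def[abs_def] intro!: smooth_upto_const smooth_upto_cmult l_smooth)
  qed (auto simp: M_def[abs_def] intro!: pd_smooth v_smooth smooth_upto_const)
  \<comment> \<open>pairing the first block with \<open>w\<close> gives \<open>0\<close> for the Hessian on the face, evaluated at \<open>w\<close>\<close>
  have inj: "\<forall>r\<in>I. y r = 0" if x: "x \<in> P" and y: "\<And>c. c \<in> I \<Longrightarrow> (\<Sum>r\<in>I. y r * M r c x) = (0::real)" for x y
  proof -
    define w where "w = (\<chi> i. y (Inl i))"
    define z where "z a = y (Inr a)" for a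
    have row: "(\<Sum>i\<in>UNIV. w $ i * D j (D i v) x) = (\<Sum>a\<in>A. z a * \<nu> a $ j)" for j
      using y[of "Inl j"] by (simp add: sumI M_def w_def z_def mI sum_negf)
    have col: "w \<bullet> \<nu> a = - 2 * l a x * z a" if "a \<in> A" for a
      using y[of "Inr a"] that finite_A
      by (simp add: sumI M_def w_def z_def mI inner_vec_def if_distrib[of "\<lambda>z. _ * z"]
          eq_neg_iff_add_eq_0 mult.commute mult.left_commute cong: if_cong)
    have "(\<Sum>i\<in>UNIV. \<Sum>j\<in>UNIV. w $ i * w $ j * D j (D i v) x)
        = (\<Sum>j\<in>UNIV. w $ j * (\<Sum>i\<in>UNIV. w $ i * D j (D i v) x))"
      by (subst sum.swap) (simp add: sum_distrib_left mult_ac)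
    also have "\<dots> = (\<Sum>a\<in>A. z a * (w \<bullet> \<nu> a))"
      unfolding row by (simp add: sum_distrib_left inner_vec_def) (subst sum.swap, simp add: mult_ac)
    also have "\<dots> = (\<Sum>a\<in>A. - 2 * l a x * (z a)\<^sup>2)"
      by (intro sum.cong refl) (simp add: col power2_eq_square)
    also have "\<dots> = (\<Sum>a\<in>A - active x. - 2 * l a x * (z a)\<^sup>2)"
      using finite_A by (intro sum.mono_neutral_right) (auto simp: active_def)
    finally have 1: "(\<Sum>i\<in>UNIV. \<Sum>j\<in>UNIV. w $ i * w $ j * D j (D i v) x)
       = (\<Sum>a\<in>A - active x. - 2 * l a x * (z a)\<^sup>2)" .
    have 2: "1/2 * (\<Sum>a\<in>A - active x. (w \<bullet> \<nu> a)\<^sup>2 / l a x) = (\<Sum>a\<in>A - active x. 2 * l a x * (z a)\<^sup>2)"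
      unfolding sum_distrib_left
    proof (intro sum.cong refl)
      fix a assume a: "a \<in> A - active x"
      then have "l a x \<noteq> 0" by (simp add: active_def)
      then show "1/2 * ((w \<bullet> \<nu> a)\<^sup>2 / l a x) = 2 * l a x * (z a)\<^sup>2"
        using a by (simp add: col power2_eq_square)
    qed
    have w0: "w = 0"
    proof (rule ccontr)
      assume "w \<noteq> 0"
      have "w \<bullet> \<nu> a = 0" if "a \<in> active x" for a
        using col[of a] that by (simp add: active_def)
      from hessian_on_face[OF x \<open>w \<noteq> 0\<close> this] show False
        unfolding 1 2 by (simp add: sum_negf)
    qed
    have zN: "z a = 0" if "a \<in> A - active x" for a
      using col[of a] that w0 by (simp add: active_def)
    have "(\<Sum>a\<in>active x. z a *\<^sub>R \<nu> a) = (\<Sum>a\<in>A. z a *\<^sub>R \<nu> a)"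
      using finite_A zN by (intro sum.mono_neutral_left) (auto simp: active_def)
    also have "\<dots> = 0"
      using row w0 by (simp add: vec_eq_iff)
    finally have "z a = 0" if "a \<in> A" for a
      using active_independent[OF x, of z a] zN[of a] that by blast
    then show ?thesis using w0 by (auto simp: I_def z_def w_def vec_eq_iff)
  qed
  have "\<exists>z. (\<forall>r\<in>I. z r \<in> CP) \<and> (\<forall>r\<in>I. \<forall>x\<in>P. (\<Sum>c\<in>I. M r c x * z c x) = (if r = Inl m then 1 else 0))" for m
    by (rule smooth_solve[OF finI M_smooth inj smooth_upto_const])
  then have "\<forall>m. \<exists>z. (\<forall>r\<in>I. z r \<in> CP) \<and> (\<forall>r\<in>I. \<forall>x\<in>P. (\<Sum>c\<in>I. M r c x * z c x) = (if r = Inl m then 1 else 0))"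
    by (rule allI)
  from choice[OF this] obtain z where zz: "\<forall>m. (\<forall>r\<in>I. z m r \<in> CP) \<and>
      (\<forall>r\<in>I. \<forall>x\<in>P. (\<Sum>c\<in>I. M r c x * z m c x) = (if r = Inl m then 1 else 0))" ..
  have z: "r \<in> I \<Longrightarrow> z m r \<in> CP"
    "r \<in> I \<Longrightarrow> x \<in> P \<Longrightarrow> (\<Sum>c\<in>I. M r c x * z m c x) = (if r = Inl m then 1 else 0)" for m r x
    using spec[OF zz, of m] by simp_all
  show ?thesis
  proof (intro exI[of _ "\<lambda>j m. z m (Inl j)"] exI[of _ "\<lambda>a m. z m (Inr a)"] conjI allI ballI)
    show "z m (Inl j) \<in> CP" for j m using z(1) by (simp add: mI)
    show "z m (Inr a) \<in> CP" if "a \<in> A" for a m using z(1) that by (simp add: mI)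
    show "(\<Sum>j\<in>UNIV. D j (D i v) x * z m (Inl j) x) + (\<Sum>a\<in>A. \<nu> a $ i * z m (Inr a) x)
        = (if i = m then 1 else 0)" if "x \<in> P" for x i m
      using z(2)[of "Inl i" x m] that by (simp add: sumI M_def mI)
    show "(\<Sum>j\<in>UNIV. \<nu> a $ j * z m (Inl j) x) = 2 * l a x * z m (Inr a) x" if "x \<in> P" "a \<in> A" for x a m
    proof -
      have "(\<Sum>j\<in>UNIV. - \<nu> a $ j * z m (Inl j) x) + 2 * l a x * z m (Inr a) x = 0"
        using z(2)[of "Inr a" x m] that finite_A
        by (simp add: sumI M_def mI if_distrib[of "\<lambda>z. z * _"] cong: if_cong)
      then show ?thesis by (simp add: sum_negf)
    qed
  qed
qed

end

section \<open>Integration by parts\<close>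

text \<open>Used at boundary points, where the cut-off field is extended by zero.\<close>

lemma has_derivative_zero_if_quadratic:
  fixes Y :: "'v::real_normed_vector \<Rightarrow> real"
  assumes "Y z = 0" and "\<And>h. \<bar>Y (z + h)\<bar> \<le> K * (norm h)\<^sup>2"
  shows "(Y has_derivative (\<lambda>h. 0)) (at z)"
proof (rule has_derivativeI_sandwich[where e = 1 and H = "\<lambda>y. K * norm (y - z)"])
  show "norm (Y y - Y z - 0) / norm (y - z) \<le> K * norm (y - z)" if "y \<noteq> z" for y
    using assms(2)[of "y - z"] assms(1) that by (simp add: divide_le_eq power2_eq_square mult.assoc)
  show "((\<lambda>y. K * norm (y - z)) \<longlongrightarrow> 0) (at z)"
    by (auto intro!: tendsto_eq_intros)
qed auto

text \<open>By translation invariance the difference quotients have integral \<open>0\<close>.\<close>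

lemma integral_derivative_zero:
  fixes Y :: "'v::euclidean_space \<Rightarrow> real"
  assumes D: "\<And>z. (Y has_derivative Y' z) (at z)" and B: "\<And>z. \<bar>Y' z e\<bar> \<le> B"
    and S: "bounded S" and Y0: "\<And>z. z \<notin> S \<Longrightarrow> Y z = 0"
  shows "((\<lambda>z. Y' z e) has_integral 0) UNIV"
proof -
  obtain a where "S \<subseteq> cbox (-a) a" using bounded_subset_cbox_symmetric[OF S] by blast
  then have Ya: "Y z = 0" if "z \<notin> cbox (-a) a" for z using that Y0 by blast
  have "continuous_on UNIV Y"
    by (meson D continuous_at_imp_continuous_on has_derivative_continuous)
  then have "Y integrable_on cbox (-a) a" by (meson continuous_on_subset integrable_continuous subset_UNIV)
  then obtain I where I: "(Y has_integral I) (cbox (-a) a)" by blast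
  then have Y1: "(Y has_integral I) UNIV" by (rule has_integral_on_superset) (use Ya in auto)
  have Y2: "((\<lambda>z. Y (z + c)) has_integral I) UNIV" for c
  proof -
    have "((\<lambda>z. Y (1 *\<^sub>R z + c)) has_integral (1 / \<bar>1\<bar> ^ DIM('v)) *\<^sub>R I)
      ((\<lambda>z. (1/1) *\<^sub>R z + - ((1/1) *\<^sub>R c)) ` cbox (-a) a)"
      by (rule has_integral_affinity[OF I]) simp
    then have "((\<lambda>z. Y (z + c)) has_integral I) ((\<lambda>z. z - c) ` cbox (-a) a)" by simp
    then show ?thesis
    proof (rule has_integral_on_superset)
      fix z assume "z \<notin> (\<lambda>z. z - c) ` cbox (-a) a"
      then have "z + c \<notin> cbox (-a) a" by (metis add_diff_cancel_right' image_eqI)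
      then show "Y (z + c) = 0" by (rule Ya)
    qed simp
  qed
  have line: "((\<lambda>s. Y (z + s *\<^sub>R e)) has_real_derivative Y' (z + s *\<^sub>R e) e) (at s)" for z s
  proof -
    have "((\<lambda>s. z + s *\<^sub>R e) has_derivative (\<lambda>h. h *\<^sub>R e)) (at s)" by (auto intro!: derivative_eq_intros)
    from has_derivative_compose[OF this D]
    have "((\<lambda>s. Y (z + s *\<^sub>R e)) has_derivative (\<lambda>h. Y' (z + s *\<^sub>R e) (h *\<^sub>R e))) (at s)" by simp
    moreover have "(\<lambda>h. Y' (z + s *\<^sub>R e) (h *\<^sub>R e)) = (*) (Y' (z + s *\<^sub>R e) e)"
      using linear_cmul[OF has_derivative_linear[OF D]] by (auto simp: fun_eq_iff mult.commute)
    ultimately show ?thesis by (simp add: has_field_derivative_def)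
  qed
  define t where "t k = inverse (real (Suc k))" for k
  have t: "0 < t k" "t k \<le> 1" for k by (auto simp: t_def inverse_le_1_iff)
  have t0: "t \<longlonglongrightarrow> 0" unfolding t_def by (rule LIMSEQ_inverse_real_of_nat)
  define q where "q k z = (Y (z + t k *\<^sub>R e) - Y z) / t k" for k z
  have B0: "0 \<le> B" using B[of undefined] by linarith
  have quot: "\<bar>q k z\<bar> \<le> B" for k z
  proof -
    obtain s where "Y (z + t k *\<^sub>R e) - Y (z + 0 *\<^sub>R e) = (t k - 0) * Y' (z + s *\<^sub>R e) e"
      using MVT2[of 0 "t k" "\<lambda>s. Y (z + s *\<^sub>R e)" "\<lambda>s. Y' (z + s *\<^sub>R e) e"] line t by blast
    then have "q k z = Y' (z + s *\<^sub>R e) e" using t(1)[of k] by (simp add: q_def)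
    then show ?thesis using B by simp
  qed
  obtain r where r: "\<And>z. z \<in> cbox (-a) a \<Longrightarrow> norm z \<le> r"
    using bounded_cbox[of "-a" a] unfolding bounded_iff by blast
  define b where "b = r + norm e"
  have q0: "q k z = 0" if z: "z \<notin> cball 0 b" for k z
  proof -
    have n: "norm (t k *\<^sub>R e) \<le> norm e" using t[of k] by (simp add: mult_left_le_one_le)
    have "norm z > r" using z norm_ge_zero[of e] unfolding b_def mem_cball_0 by linarith
    then have "z \<notin> cbox (-a) a" using r by force
    moreover have "norm (z + t k *\<^sub>R e) > r"
      using z n norm_diff_ineq[of z "t k *\<^sub>R e"] by (simp add: b_def)
    then have "z + t k *\<^sub>R e \<notin> cbox (-a) a" using r by force
    ultimately show ?thesis using Ya by (simp add: q_def)
  qed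
  show ?thesis
  proof (rule has_integral_dominated_convergence)
    show "(q k has_integral 0) UNIV" for k
    proof -
      have "((\<lambda>z. (Y (z + t k *\<^sub>R e) - Y z) * inverse (t k)) has_integral (I - I) * inverse (t k)) UNIV"
        by (intro has_integral_mult_left has_integral_diff Y1 Y2)
      then show ?thesis by (simp add: q_def[abs_def] divide_inverse)
    qed
    show "(\<lambda>z. if z \<in> cball 0 b then B else 0) integrable_on UNIV"
      unfolding integrable_restrict_UNIV by (rule integrable_on_const) (rule lmeasurable_cball)
    show "\<forall>z\<in>UNIV. norm (q k z) \<le> (if z \<in> cball 0 b then B else 0)" for k
      using quot q0 by auto
    show "\<forall>z\<in>UNIV. (\<lambda>k. q k z) \<longlonglongrightarrow> Y' z e"
    proof
      fix z
      have "((\<lambda>h. (Y (z + (0 + h) *\<^sub>R e) - Y (z + 0 *\<^sub>R e)) / h) \<longlongrightarrow> Y' (z + 0 *\<^sub>R e) e) (at 0)"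
        using line[of z 0] unfolding DERIV_def by simp
      moreover have "filterlim t (at 0) sequentially"
        using t0 t(1) by (auto simp: filterlim_at less_imp_neq[symmetric] intro: always_eventually)
      ultimately have "(\<lambda>k. (Y (z + (0 + t k) *\<^sub>R e) - Y (z + 0 *\<^sub>R e)) / t k) \<longlonglongrightarrow> Y' (z + 0 *\<^sub>R e) e"
        by (rule filterlim_compose)
      then show "(\<lambda>k. q k z) \<longlonglongrightarrow> Y' z e" by (simp add: q_def)
    qed
  qed simp
qed

lemma integrable_bounded_continuous:
  fixes h :: "'v::euclidean_space \<Rightarrow> real"
  assumes S: "S \<in> lmeasurable" and "continuous_on S h" "\<And>y. y \<in> S \<Longrightarrow> \<bar>h y\<bar> \<le> B"
  shows "h integrable_on S"
proof (rule measurable_bounded_by_integrable_imp_integrable)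
  show "S \<in> sets lebesgue" using S by blast
  then show "h \<in> borel_measurable (lebesgue_on S)"
    using assms(2) by (rule continuous_imp_measurable_on_sets_lebesgue[rotated])
  show "(\<lambda>y. B) integrable_on S" using S by (rule integrable_on_const)
qed (use assms(3) in auto)

lemma (in convex_body) interior_lmeasurable: "interior P \<in> lmeasurable"
  using compact_P compact_imp_bounded by (meson bounded_subset interior_subset lmeasurable_open open_interior)

lemma (in convex_body) integral_interior:
  fixes h :: "real^'n \<Rightarrow> real"
  shows "integral P h = integral (interior P) h"
proof -
  have neg: "negligible (frontier P)" by (rule negligible_convex_frontier[OF convex_P])
  have "P - interior P \<subseteq> frontier P" using closure_subset by (auto simp: frontier_def)
  then have 1: "negligible {x \<in> P - interior P. h x \<noteq> 0}"
    by (intro negligible_subset[OF neg]) auto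
  have 2: "negligible {x \<in> interior P - P. h x \<noteq> 0}"
    using interior_sub by (auto intro: negligible_subset[OF negligible_empty])
  have "(h has_integral y) P \<longleftrightarrow> (h has_integral y) (interior P)" for y
    by (rule has_integral_spike_set_eq[OF 1 2])
  then show ?thesis unfolding integral_def integrable_on_def by simp
qed

context toric_potential
begin

lemma l_has_derivative: "(l a has_derivative (\<lambda>h. h \<bullet> \<nu> a)) (at y)"
  unfolding ell_def by (auto intro!: derivative_eq_intros)

lemma u_has_derivative:
  assumes y: "y \<in> interior P"
  shows "(u has_derivative (\<lambda>h. (\<Sum>i\<in>UNIV. h $ i * D i v y) + 1/2 * (\<Sum>a\<in>A. (h \<bullet> \<nu> a) * (ln (l a y) + 1)))) (at y)"
proof -
  have "((\<lambda>x. v x + 1/2 * (\<Sum>a\<in>A. l a x * ln (l a x))) has_derivative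
    (\<lambda>h. (\<Sum>i\<in>UNIV. h $ i * D i v y) + 1/2 * (\<Sum>a\<in>A. (h \<bullet> \<nu> a) * (ln (l a y) + 1)))) (at y)"
  proof (intro has_derivative_add pd_has_derivative_at v_smooth y has_derivative_mult_right has_derivative_sum)
    fix a assume "a \<in> A"
    then have "0 < l a y" using l_pos_interior[OF y] by blast
    then show "((\<lambda>x. l a x * ln (l a x)) has_derivative (\<lambda>h. (h \<bullet> \<nu> a) * (ln (l a y) + 1))) (at y)"
      by (auto intro!: derivative_eq_intros l_has_derivative simp: fun_eq_iff algebra_simps)
  qed
  moreover have "(\<lambda>x. v x + 1/2 * (\<Sum>a\<in>A. l a x * ln (l a x))) = u" by (simp add: v_def fun_eq_iff)
  ultimately show ?thesis by simp
qed

text \<open>The terms \<open>l\<^sub>a ln l\<^sub>a\<close> at \<open>y\<close> cancel; \<open>\<phi>\<close> has only logarithmic singularities in \<open>y\<close>.\<close>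

lemma phi_eq:
  assumes y: "y \<in> interior P"
  shows "phi u x y = 2 * (u x - v y - (\<Sum>i\<in>UNIV. (x - y) $ i * D i v y))
     - (\<Sum>a\<in>A. l a x * ln (l a y) + l a x - l a y)"
proof -
  have eq: "(x - y) \<bullet> \<nu> a = l a x - l a y" for a by (simp add: ell_def inner_diff_left)
  have "frechet_derivative u (at y) (x - y)
    = (\<Sum>i\<in>UNIV. (x - y) $ i * D i v y) + 1/2 * (\<Sum>a\<in>A. (l a x - l a y) * (ln (l a y) + 1))"
    using frechet_derivative_at[OF u_has_derivative[OF y], symmetric] by (simp add: eq)
  then have "phi u x y = 2 * (u x - v y - (\<Sum>i\<in>UNIV. (x - y) $ i * D i v y))
    - ((\<Sum>a\<in>A. l a y * ln (l a y)) + (\<Sum>a\<in>A. (l a x - l a y) * (ln (l a y) + 1)))"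
    by (simp add: phi_def v_def)
  also have "(\<Sum>a\<in>A. l a y * ln (l a y)) + (\<Sum>a\<in>A. (l a x - l a y) * (ln (l a y) + 1))
     = (\<Sum>a\<in>A. l a x * ln (l a y) + l a x - l a y)"
    unfolding sum.distrib[symmetric] by (intro sum.cong refl) (simp add: algebra_simps)
  finally show ?thesis .
qed

lemma phi_has_derivative:
  assumes y: "y \<in> interior P"
  shows "((\<lambda>y. phi u x y) has_derivative (\<lambda>h. (\<Sum>a\<in>A. (h \<bullet> \<nu> a) * (l a y - l a x) / l a y)
     + 2 * (\<Sum>i\<in>UNIV. (y - x) $ i * (\<Sum>j\<in>UNIV. h $ j * D j (D i v) y)))) (at y)"
proof -
  have "((\<lambda>y. 2 * (u x - v y - (\<Sum>i\<in>UNIV. (x - y) $ i * D i v y))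
     - (\<Sum>a\<in>A. l a x * ln (l a y) + l a x - l a y)) has_derivative
    (\<lambda>h. 2 * (0 - (\<Sum>i\<in>UNIV. h $ i * D i v y) -
        (\<Sum>i\<in>UNIV. (x - y) $ i * (\<Sum>j\<in>UNIV. h $ j * D j (D i v) y) + (- h $ i) * D i v y))
     - (\<Sum>a\<in>A. l a x * ((h \<bullet> \<nu> a) / l a y) + 0 - (h \<bullet> \<nu> a)))) (at y)"
  proof (intro has_derivative_diff has_derivative_mult_right has_derivative_const has_derivative_sum
      pd_has_derivative_at v_smooth y has_derivative_mult pd_smooth has_derivative_add)
    fix i :: 'n
    show "((\<lambda>y. (x - y) $ i) has_derivative (\<lambda>h. (- h $ i))) (at y)"
      by (auto intro!: derivative_eq_intros bounded_linear_imp_has_derivative bounded_linear_vec_nth)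
  next
    fix a assume "a \<in> A"
    then have p: "0 < l a y" using l_pos_interior[OF y] by blast
    show "((\<lambda>y. ln (l a y)) has_derivative (\<lambda>h. (h \<bullet> \<nu> a) / l a y)) (at y)"
      using p unfolding ell_def by (auto intro!: derivative_eq_intros simp: fun_eq_iff field_simps)
    show "(l a has_derivative (\<lambda>h. h \<bullet> \<nu> a)) (at y)"
      unfolding ell_def by (auto intro!: derivative_eq_intros)
  qed
  moreover have "2 * (0 - (\<Sum>i\<in>UNIV. h $ i * D i v y) -
        (\<Sum>i\<in>UNIV. (x - y) $ i * (\<Sum>j\<in>UNIV. h $ j * D j (D i v) y) + (- h $ i) * D i v y))
     - (\<Sum>a\<in>A. l a x * ((h \<bullet> \<nu> a) / l a y) + 0 - (h \<bullet> \<nu> a))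
     = (\<Sum>a\<in>A. (h \<bullet> \<nu> a) * (l a y - l a x) / l a y)
     + 2 * (\<Sum>i\<in>UNIV. (y - x) $ i * (\<Sum>j\<in>UNIV. h $ j * D j (D i v) y))" for h
  proof -
    have 1: "(\<Sum>a\<in>A. (h \<bullet> \<nu> a) * (l a y - l a x) / l a y) = - (\<Sum>a\<in>A. l a x * ((h \<bullet> \<nu> a) / l a y) + 0 - (h \<bullet> \<nu> a))"
      unfolding sum_negf[symmetric]
    proof (intro sum.cong refl)
      fix a assume "a \<in> A"
      then have "l a y \<noteq> 0" using l_pos_interior[OF y, of a] by simp
      then show "h \<bullet> \<nu> a * (l a y - l a x) / l a y = - (l a x * (h \<bullet> \<nu> a / l a y) + 0 - h \<bullet> \<nu> a)"
        by (simp add: field_simps)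
    qed
    have 2: "(\<Sum>i\<in>UNIV. (y - x) $ i * (\<Sum>j\<in>UNIV. h $ j * D j (D i v) y))
       = - (\<Sum>i\<in>UNIV. (x - y) $ i * (\<Sum>j\<in>UNIV. h $ j * D j (D i v) y))"
      unfolding sum_negf[symmetric] by (intro sum.cong refl) (simp add: left_diff_distrib)
    show ?thesis unfolding 1 2 by (simp add: sum.distrib sum_subtractf sum_negf)
  qed
  ultimately have *: "((\<lambda>y. 2 * (u x - v y - (\<Sum>i\<in>UNIV. (x - y) $ i * D i v y))
     - (\<Sum>a\<in>A. l a x * ln (l a y) + l a x - l a y)) has_derivative (\<lambda>h. (\<Sum>a\<in>A. (h \<bullet> \<nu> a) * (l a y - l a x) / l a y)
     + 2 * (\<Sum>i\<in>UNIV. (y - x) $ i * (\<Sum>j\<in>UNIV. h $ j * D j (D i v) y)))) (at y)"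
    by simp
  show ?thesis
    by (rule has_derivative_transform_within_open[OF * open_interior y]) (simp add: phi_eq)
qed

text \<open>\<open>phi u x y\<close> is the error of the first-order Taylor expansion of the convex function \<open>u\<close>.\<close>

lemma phi_nonneg:
  assumes x: "x \<in> P" and y: "y \<in> interior P" shows "0 \<le> phi u x y"
proof (cases "x = y")
  case True
  have "linear (frechet_derivative u (at y))"
    by (rule linear_frechet_derivative[OF differentiableI[OF u_has_derivative[OF y]]])
  then have "frechet_derivative u (at y) 0 = 0" by (rule linear_0)
  then show ?thesis using True by (simp add: phi_def)
next
  case False
  let ?F = "frechet_derivative u (at y)"
  have F: "(u has_derivative ?F) (at y)"
    using differentiableI[OF u_has_derivative[OF y]] by (simp only: frechet_derivative_works)
  have lim: "((\<lambda>s. (u (y + s *\<^sub>R (x - y)) - u y) / s) \<longlongrightarrow> ?F (x - y)) (at_right 0)"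
  proof -
    have "((\<lambda>s. y + s *\<^sub>R (x - y)) has_derivative (\<lambda>h. h *\<^sub>R (x - y))) (at 0)"
      by (auto intro!: derivative_eq_intros)
    moreover have "(u has_derivative ?F) (at (y + 0 *\<^sub>R (x - y)))" using F by simp
    ultimately have "((\<lambda>s. u (y + s *\<^sub>R (x - y))) has_derivative (\<lambda>h. ?F (h *\<^sub>R (x - y)))) (at 0)"
      by (rule has_derivative_compose)
    moreover have "(\<lambda>h. ?F (h *\<^sub>R (x - y))) = (*) (?F (x - y))"
      using linear_cmul[OF has_derivative_linear[OF F]] by (auto simp: fun_eq_iff mult.commute)
    ultimately have "((\<lambda>s. u (y + s *\<^sub>R (x - y))) has_real_derivative ?F (x - y)) (at 0)"
      by (simp add: has_field_derivative_def)
    then have "((\<lambda>s. (u (y + s *\<^sub>R (x - y)) - u y) / s) \<longlongrightarrow> ?F (x - y)) (at 0)"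
      by (simp add: DERIV_def)
    then show ?thesis by (rule filterlim_mono) (auto simp: at_within_le_at)
  qed
  have sc: "strictly_convex_on P u" using potential by (simp add: symplectic_potential_def)
  have "(u (y + s *\<^sub>R (x - y)) - u y) / s \<le> u x - u y" if s: "0 < s" "s < 1" for s
  proof -
    have "u ((1 - s) *\<^sub>R y + s *\<^sub>R x) < (1 - s) * u y + s * u x"
      by (rule sc[unfolded strictly_convex_on_def, rule_format, OF interior_sub[OF y] x])
        (use False s in auto)
    moreover have "(1 - s) *\<^sub>R y + s *\<^sub>R x = y + s *\<^sub>R (x - y)" by (simp add: algebra_simps)
    ultimately have "u (y + s *\<^sub>R (x - y)) - u y \<le> (u x - u y) * s" by (simp add: algebra_simps)
    then show ?thesis using s by (simp add: pos_divide_le_eq)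
  qed
  then have "\<forall>\<^sub>F s in at_right 0. (u (y + s *\<^sub>R (x - y)) - u y) / s \<le> u x - u y"
    unfolding eventually_at_right_field by (intro exI[of _ 1]) auto
  then have "?F (x - y) \<le> u x - u y"
    by (rule tendsto_upperbound[OF lim]) simp
  then show ?thesis by (simp add: phi_def)
qed

definition "E k x y = exp (- real k * phi u x y)"

lemma E_bounds: "x \<in> P \<Longrightarrow> y \<in> interior P \<Longrightarrow> 0 < E k x y \<and> E k x y \<le> 1"
  using phi_nonneg[of x y] by (auto simp: E_def)

lemma continuous_E: "continuous_on (interior P) (E k x)"
proof -
  have "continuous_on (interior P) (phi u x)"
    by (rule has_derivative_continuous_on[OF has_derivative_at_withinI[OF phi_has_derivative]])
  then show ?thesis unfolding E_def[abs_def] by (intro continuous_intros)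
qed

text \<open>The cutoff \<open>s\<^sup>2 / (\<epsilon>\<^sup>2 + s\<^sup>2)\<close> of each facet function vanishes to second order at the facet, so that
  the cut-off field extends differentiably by \<open>0\<close> although the Hessian of \<open>u\<close> blows up like
  \<open>1 / l\<^sub>a\<close>.\<close>

definition rho :: "real \<Rightarrow> real \<Rightarrow> real" where "rho \<epsilon> s = s\<^sup>2 / (\<epsilon>\<^sup>2 + s\<^sup>2)"
definition drho :: "real \<Rightarrow> real \<Rightarrow> real" where "drho \<epsilon> s = 2 * s * \<epsilon>\<^sup>2 / (\<epsilon>\<^sup>2 + s\<^sup>2)\<^sup>2"
definition rhoq :: "real \<Rightarrow> real \<Rightarrow> real" where "rhoq \<epsilon> s = s / (\<epsilon>\<^sup>2 + s\<^sup>2)"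
definition cut :: "real \<Rightarrow> 'a set \<Rightarrow> real^'n \<Rightarrow> real" where "cut \<epsilon> B y = (\<Prod>a\<in>B. rho \<epsilon> (l a y))"

lemma rho_range: "\<epsilon> > 0 \<Longrightarrow> 0 \<le> rho \<epsilon> s \<and> rho \<epsilon> s \<le> 1"
  by (simp add: rho_def divide_le_eq_1 add_pos_nonneg)

lemma rho_le: "\<epsilon> > 0 \<Longrightarrow> rho \<epsilon> s \<le> s\<^sup>2 / \<epsilon>\<^sup>2"
  by (simp add: rho_def frac_le)

lemma rho_deriv: "\<epsilon> > 0 \<Longrightarrow> (rho \<epsilon> has_real_derivative drho \<epsilon> s) (at s)"
proof -
  assume "\<epsilon> > 0"
  then have "\<epsilon>\<^sup>2 + s\<^sup>2 \<noteq> 0" by (metis add_pos_nonneg less_irrefl zero_le_power2 zero_less_power)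
  moreover have "2 * s * (\<epsilon> * \<epsilon> + s * s) - s * s * (2 * s) = 2 * s * (\<epsilon> * \<epsilon>)" by algebra
  ultimately show ?thesis unfolding rho_def[abs_def] drho_def
    by (auto intro!: derivative_eq_intros simp: power2_eq_square)
qed

lemma cut_range: "\<epsilon> > 0 \<Longrightarrow> 0 \<le> cut \<epsilon> B y \<and> cut \<epsilon> B y \<le> 1"
  unfolding cut_def using rho_range by (auto intro!: prod_nonneg prod_le_1)

lemma cut_remove: "a \<in> A \<Longrightarrow> cut \<epsilon> A y = rho \<epsilon> (l a y) * cut \<epsilon> (A - {a}) y"
  unfolding cut_def using finite_A by (simp add: prod.remove)

lemma cut_deriv:
  assumes "\<epsilon> > 0"
  shows "(cut \<epsilon> A has_derivative (\<lambda>h. \<Sum>a\<in>A. (h \<bullet> \<nu> a) * drho \<epsilon> (l a y) * cut \<epsilon> (A - {a}) y)) (at y)"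
proof -
  have "((\<lambda>y. rho \<epsilon> (l a y)) has_derivative (\<lambda>h. (h \<bullet> \<nu> a) * drho \<epsilon> (l a y))) (at y)" for a
    using has_derivative_compose[OF l_has_derivative rho_deriv[OF assms, unfolded has_field_derivative_def], of a y]
    by (simp add: mult.commute)
  then show ?thesis unfolding cut_def[abs_def] by (rule has_derivative_prod)
qed

lemma continuous_cut: "\<epsilon> > 0 \<Longrightarrow> continuous_on S (cut \<epsilon> B)"
  unfolding cut_def[abs_def] rho_def
  by (intro continuous_intros continuous_l) (metis add_pos_nonneg less_irrefl zero_le_power2 zero_less_power)

lemma continuous_drho: "\<epsilon> > 0 \<Longrightarrow> continuous_on S (\<lambda>y. drho \<epsilon> (l a y))"
  unfolding drho_def
  by (intro continuous_intros continuous_l) (metis add_pos_nonneg less_irrefl zero_le_power2 zero_less_power power_not_zero)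

lemma continuous_rhoq: "\<epsilon> > 0 \<Longrightarrow> continuous_on S (\<lambda>y. rhoq \<epsilon> (l a y))"
  unfolding rhoq_def
  by (intro continuous_intros continuous_l) (metis add_pos_nonneg less_irrefl zero_le_power2 zero_less_power)

text \<open>The \<open>j\<close>-th derivative of the cut-off function \<open>cut * exp (- k \<phi>) * W\<close>, divided by \<open>exp (- k \<phi>)\<close>. The factor
  \<open>1 / l\<^sub>a\<close> in the gradient of \<open>\<phi>\<close> is absorbed by \<open>rho (l\<^sub>a)\<close>, which leaves \<open>rhoq (l\<^sub>a)\<close>: the result is
  continuous up to the boundary.\<close>

definition cutdiv :: "real \<Rightarrow> nat \<Rightarrow> real^'n \<Rightarrow> 'n \<Rightarrow> (real^'n \<Rightarrow> real) \<Rightarrow> real^'n \<Rightarrow> real" where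
  "cutdiv \<epsilon> k x j W y =
     W y * (\<Sum>a\<in>A. \<nu> a $ j * drho \<epsilon> (l a y) * cut \<epsilon> (A - {a}) y) + cut \<epsilon> A y * D j W y
     - real k * W y * ((\<Sum>a\<in>A. \<nu> a $ j * (l a y - l a x) * rhoq \<epsilon> (l a y) * cut \<epsilon> (A - {a}) y)
        + cut \<epsilon> A y * (2 * (\<Sum>i\<in>UNIV. (y - x) $ i * D j (D i v) y)))"

lemma integral_cutdiv:
  assumes W: "W \<in> CP" and x: "x \<in> P" and \<epsilon>: "\<epsilon> > 0"
  shows "((\<lambda>y. E k x y * cutdiv \<epsilon> k x j W y) has_integral 0) (interior P)"
proof -
  define Y where "Y y = (if y \<in> interior P then cut \<epsilon> A y * E k x y * W y else 0)" for y
  define phi' where "phi' y h = (\<Sum>a\<in>A. (h \<bullet> \<nu> a) * (l a y - l a x) / l a y)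
     + 2 * (\<Sum>i\<in>UNIV. (y - x) $ i * (\<Sum>j\<in>UNIV. h $ j * D j (D i v) y))" for y h
  define cut' where "cut' y h = (\<Sum>a\<in>A. (h \<bullet> \<nu> a) * drho \<epsilon> (l a y) * cut \<epsilon> (A - {a}) y)" for y h
  define Y' where "Y' y h = (if y \<in> interior P then
      cut \<epsilon> A y * E k x y * (\<Sum>i\<in>UNIV. h $ i * D i W y)
      + (cut \<epsilon> A y * (E k x y * (- real k * phi' y h)) + cut' y h * E k x y) * W y else 0)" for y h
  obtain BW where BW: "\<And>y. y \<in> P \<Longrightarrow> \<bar>W y\<bar> \<le> BW" using nrm_val[OF W, of _ 0] by blast
  have D: "(Y has_derivative Y' z) (at z)" for z
  proof (cases "z \<in> interior P")
    case True
    have dE: "(E k x has_derivative (\<lambda>h. E k x z * (- real k * phi' z h))) (at z)"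
      unfolding E_def[abs_def] phi'_def
      by (rule has_derivative_eq_rhs[OF has_derivative_exp[OF has_derivative_mult_right[OF phi_has_derivative[OF True]]]])
        (simp add: fun_eq_iff)
    have "((\<lambda>y. cut \<epsilon> A y * E k x y * W y) has_derivative Y' z) (at z)"
      using has_derivative_mult[OF has_derivative_mult[OF cut_deriv[OF \<epsilon>] dE] pd_has_derivative_at[OF W True]] True
      by (simp add: Y'_def[abs_def] cut'_def)
    then show ?thesis
      by (rule has_derivative_transform_within_open[OF _ open_interior True]) (simp add: Y_def)
  next
    case False
    \<comment> \<open>here \<open>rho (l\<^sub>a)\<close> alone makes the function quadratically small\<close>
    then obtain a where a: "a \<in> A" "l a z \<le> 0" by (auto simp: interior_P_eq not_less)
    have "(Y has_derivative (\<lambda>h. 0)) (at z)"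
    proof (rule has_derivative_zero_if_quadratic)
      show "Y z = 0" using False by (simp add: Y_def)
      fix h
      show "\<bar>Y (z + h)\<bar> \<le> ((norm (\<nu> a))\<^sup>2 / \<epsilon>\<^sup>2 * \<bar>BW\<bar>) * (norm h)\<^sup>2"
      proof (cases "z + h \<in> interior P")
        case zh: True
        have "0 < l a (z + h)" using l_pos_interior[OF zh a(1)] .
        moreover have "l a (z + h) \<le> h \<bullet> \<nu> a" using a(2) by (simp add: l_add)
        moreover have "h \<bullet> \<nu> a \<le> norm h * norm (\<nu> a)" by (rule norm_cauchy_schwarz)
        ultimately have "(l a (z + h))\<^sup>2 \<le> (norm h * norm (\<nu> a))\<^sup>2" by (intro power_mono) auto
        have "cut \<epsilon> A (z + h) \<le> rho \<epsilon> (l a (z + h)) * 1"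
          unfolding cut_remove[OF a(1)] using rho_range[OF \<epsilon>] cut_range[OF \<epsilon>] by (intro mult_left_mono) auto
        also have "\<dots> \<le> (norm h * norm (\<nu> a))\<^sup>2 / \<epsilon>\<^sup>2"
          using rho_le[OF \<epsilon>, of "l a (z + h)"] \<open>(l a (z + h))\<^sup>2 \<le> _\<close> divide_right_mono[of _ _ "\<epsilon>\<^sup>2"] by fastforce
        finally have c: "cut \<epsilon> A (z + h) \<le> (norm h * norm (\<nu> a))\<^sup>2 / \<epsilon>\<^sup>2" .
        have "\<bar>Y (z + h)\<bar> = cut \<epsilon> A (z + h) * (E k x (z + h) * \<bar>W (z + h)\<bar>)"
          using zh cut_range[OF \<epsilon>] E_bounds[OF x zh, of k] by (simp add: Y_def abs_mult mult.assoc)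
        also have "\<dots> \<le> (norm h * norm (\<nu> a))\<^sup>2 / \<epsilon>\<^sup>2 * (1 * \<bar>BW\<bar>)"
          using c cut_range[OF \<epsilon>] E_bounds[OF x zh, of k] BW[OF interior_sub[OF zh]]
          by (intro mult_mono) auto
        finally show ?thesis by (simp add: power_mult_distrib mult_ac)
      qed (simp add: Y_def)
    qed
    then show ?thesis using False by (simp add: Y'_def[abs_def])
  qed
  have Y'_eq: "Y' y (axis j 1) = E k x y * cutdiv \<epsilon> k x j W y" if y: "y \<in> interior P" for y
  proof -
    have ax: "axis j 1 \<bullet> \<nu> a = \<nu> a $ j" for a by (simp add: inner_axis')
    have "cut \<epsilon> A y * (\<Sum>a\<in>A. \<nu> a $ j * (l a y - l a x) / l a y)
       = (\<Sum>a\<in>A. \<nu> a $ j * (l a y - l a x) * rhoq \<epsilon> (l a y) * cut \<epsilon> (A - {a}) y)"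
      unfolding sum_distrib_left
    proof (intro sum.cong refl)
      fix a assume a: "a \<in> A"
      then have "l a y \<noteq> 0" using l_pos_interior[OF y, of a] by simp
      then show "cut \<epsilon> A y * (\<nu> a $ j * (l a y - l a x) / l a y)
        = \<nu> a $ j * (l a y - l a x) * rhoq \<epsilon> (l a y) * cut \<epsilon> (A - {a}) y"
        unfolding cut_remove[OF a] rho_def rhoq_def by (simp add: power2_eq_square)
    qed
    then have "cut \<epsilon> A y * phi' y (axis j 1) = (\<Sum>a\<in>A. \<nu> a $ j * (l a y - l a x) * rhoq \<epsilon> (l a y) * cut \<epsilon> (A - {a}) y)
        + cut \<epsilon> A y * (2 * (\<Sum>i\<in>UNIV. (y - x) $ i * D j (D i v) y))"
      unfolding phi'_def ax axis_sum distrib_left by simp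
    then show ?thesis using y unfolding Y'_def cutdiv_def cut'_def ax axis_sum
      by (simp add: algebra_simps)
  qed
  have "continuous_on P (cutdiv \<epsilon> k x j W)"
    unfolding cutdiv_def[abs_def]
    by (intro continuous_intros continuous_cut[OF \<epsilon>] continuous_drho[OF \<epsilon>] continuous_rhoq[OF \<epsilon>] continuous_l
        CP_cont[OF W] CP_cont[OF pd_smooth[OF W]] CP_cont[OF pd_smooth[OF pd_smooth[OF v_smooth]]])
  then obtain B where B: "\<And>y. y \<in> P \<Longrightarrow> \<bar>cutdiv \<epsilon> k x j W y\<bar> \<le> B"
    using compact_imp_bounded[OF compact_continuous_image[OF _ compact_P]] by (fastforce simp: bounded_iff)
  have "\<bar>Y' z (axis j 1)\<bar> \<le> \<bar>B\<bar>" for z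
  proof (cases "z \<in> interior P")
    case True
    have "\<bar>Y' z (axis j 1)\<bar> = E k x z * \<bar>cutdiv \<epsilon> k x j W z\<bar>"
      using E_bounds[OF x True, of k] by (simp add: Y'_eq[OF True] abs_mult)
    also have "\<dots> \<le> 1 * \<bar>B\<bar>"
      using E_bounds[OF x True, of k] B[OF interior_sub[OF True]] by (intro mult_mono) auto
    finally show ?thesis by simp
  qed (simp add: Y'_def)
  then have "((\<lambda>z. Y' z (axis j 1)) has_integral 0) UNIV"
    by (rule integral_derivative_zero[OF D _ bounded_subset[OF compact_imp_bounded[OF compact_P] interior_subset]])
      (simp add: Y_def)
  also have "(\<lambda>z. Y' z (axis j 1)) = (\<lambda>z. if z \<in> interior P then E k x z * cutdiv \<epsilon> k x j W z else 0)"
    using Y'_eq by (auto simp: fun_eq_iff Y'_def)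
  finally show ?thesis by (simp only: has_integral_restrict_UNIV)
qed

end

locale toric_inverse_hessian = toric_potential A \<nu> lam P u
  for A :: "'a set" and \<nu> :: "'a \<Rightarrow> real^'n" and lam P u +
  fixes G :: "'n \<Rightarrow> 'n \<Rightarrow> real^'n \<Rightarrow> real" and Z :: "'a \<Rightarrow> 'n \<Rightarrow> real^'n \<Rightarrow> real"
  assumes G_smooth: "\<And>j m. G j m \<in> CP" and Z_smooth: "\<And>a m. a \<in> A \<Longrightarrow> Z a m \<in> CP"
    and GZ1: "\<And>x i m. x \<in> P \<Longrightarrow>
      (\<Sum>j\<in>UNIV. D j (D i v) x * G j m x) + (\<Sum>a\<in>A. \<nu> a $ i * Z a m x) = (if i = m then 1 else 0)"
    and GZ2: "\<And>x a m. x \<in> P \<Longrightarrow> a \<in> A \<Longrightarrow> (\<Sum>j\<in>UNIV. \<nu> a $ j * G j m x) = 2 * l a x * Z a m x"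
begin

definition "divG m w y = (\<Sum>j\<in>UNIV. D j (\<lambda>y. G j m y * w y) y)"

lemma divG_smooth: "w \<in> CP \<Longrightarrow> divG m w \<in> CP"
  unfolding divG_def[abs_def] by (intro smooth_upto_sum pd_smooth smooth_upto_mult G_smooth)

text \<open>Summation over \<open>j\<close> turns the gradient of \<open>\<phi>\<close> into \<open>2 (y - x)\<^sub>m\<close> by \<open>V G + N Z = 1\<close>, and every normal
  component of \<open>G\<close> into a multiple of \<open>l\<^sub>a\<close> by \<open>N\<^sup>T G = 2 l Z\<close>. So the derivative of the cutoff occurs
  only in the combination \<open>s rho'(s)\<close>, which is bounded uniformly in \<open>\<epsilon>\<close>.\<close>

lemma sum_cutdiv:
  assumes y: "y \<in> P"
  shows "(\<Sum>j\<in>UNIV. cutdiv \<epsilon> k x j (\<lambda>y. G j m y * w y) y) =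
     w y * (\<Sum>a\<in>A. 2 * (l a y * drho \<epsilon> (l a y)) * cut \<epsilon> (A - {a}) y * Z a m y)
     + cut \<epsilon> A y * (divG m w y - 2 * real k * ((y $ m - x $ m) * w y))"
proof -
  define d where "d a = drho \<epsilon> (l a y) * cut \<epsilon> (A - {a}) y" for a
  define e where "e a = (l a y - l a x) * rhoq \<epsilon> (l a y) * cut \<epsilon> (A - {a}) y" for a
  define H where "H j = (\<Sum>i\<in>UNIV. (y - x) $ i * D j (D i v) y)" for j
  let ?c = "cut \<epsilon> A y"
  have contract: "(\<Sum>j\<in>UNIV. (G j m y * w y) * (\<Sum>a\<in>A. \<nu> a $ j * f a)) = w y * (\<Sum>a\<in>A. 2 * l a y * Z a m y * f a)" for f
  proof -
    have "(\<Sum>j\<in>UNIV. (G j m y * w y) * (\<Sum>a\<in>A. \<nu> a $ j * f a)) = (\<Sum>j\<in>UNIV. \<Sum>a\<in>A. w y * (f a * (\<nu> a $ j * G j m y)))"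
      by (simp add: sum_distrib_left mult_ac)
    also have "\<dots> = (\<Sum>a\<in>A. w y * (f a * (\<Sum>j\<in>UNIV. \<nu> a $ j * G j m y)))"
      by (subst sum.swap) (simp add: sum_distrib_left)
    also have "\<dots> = w y * (\<Sum>a\<in>A. 2 * l a y * Z a m y * f a)"
      using GZ2[OF y] by (simp add: sum_distrib_left mult_ac)
    finally show ?thesis .
  qed
  have H: "(\<Sum>j\<in>UNIV. (G j m y * w y) * H j) = w y * ((y - x) $ m - (\<Sum>a\<in>A. (l a y - l a x) * Z a m y))"
  proof -
    have "(\<Sum>j\<in>UNIV. (G j m y * w y) * H j) = (\<Sum>j\<in>UNIV. \<Sum>i\<in>UNIV. w y * ((y - x) $ i * (D j (D i v) y * G j m y)))"
      unfolding H_def by (simp only: sum_distrib_left mult_ac)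
    also have "\<dots> = (\<Sum>i\<in>UNIV. w y * ((y - x) $ i * (\<Sum>j\<in>UNIV. D j (D i v) y * G j m y)))"
      by (subst sum.swap) (simp only: sum_distrib_left)
    also have "\<dots> = (\<Sum>i\<in>UNIV. w y * ((y - x) $ i * ((if i = m then 1 else 0) - (\<Sum>a\<in>A. \<nu> a $ i * Z a m y))))"
    proof -
      have "(\<Sum>j\<in>UNIV. D j (D i v) y * G j m y) = (if i = m then 1 else 0) - (\<Sum>a\<in>A. \<nu> a $ i * Z a m y)" for i
        using GZ1[OF y, of i m] by linarith
      then show ?thesis by (simp only:)
    qed
    also have "\<dots> = w y * ((\<Sum>i\<in>UNIV. (y - x) $ i * (if i = m then 1 else 0)) - (\<Sum>i\<in>UNIV. \<Sum>a\<in>A. (y - x) $ i * (\<nu> a $ i * Z a m y)))"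
      by (simp only: right_diff_distrib sum_subtractf sum_distrib_left)
    also have "(\<Sum>i\<in>UNIV. (y - x) $ i * (if i = m then 1 else 0)) = (y - x) $ m"
      by (simp add: if_distrib[of "\<lambda>z. _ * z"] cong: if_cong)
    also have "(\<Sum>i\<in>UNIV. \<Sum>a\<in>A. (y - x) $ i * (\<nu> a $ i * Z a m y)) = (\<Sum>a\<in>A. (\<Sum>i\<in>UNIV. (y - x) $ i * \<nu> a $ i) * Z a m y)"
      by (subst sum.swap) (simp only: sum_distrib_right mult.assoc)
    also have "(\<lambda>a. (\<Sum>i\<in>UNIV. (y - x) $ i * \<nu> a $ i)) = (\<lambda>a. l a y - l a x)"
      by (simp add: ell_def inner_vec_def left_diff_distrib sum_subtractf)
    finally show ?thesis .
  qed
  have el: "l a y * e a = (l a y - l a x) * ?c" if "a \<in> A" for a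
    unfolding e_def cut_remove[OF that] rho_def rhoq_def by (simp add: power2_eq_square)
  have "(\<Sum>j\<in>UNIV. cutdiv \<epsilon> k x j (\<lambda>y. G j m y * w y) y)
    = (\<Sum>j\<in>UNIV. (G j m y * w y) * (\<Sum>a\<in>A. \<nu> a $ j * d a)) + ?c * divG m w y
     - real k * ((\<Sum>j\<in>UNIV. (G j m y * w y) * (\<Sum>a\<in>A. \<nu> a $ j * e a)) + 2 * ?c * (\<Sum>j\<in>UNIV. (G j m y * w y) * H j))"
    unfolding cutdiv_def divG_def d_def e_def H_def[symmetric]
    by (simp add: sum.distrib sum_subtractf sum_distrib_left distrib_left mult_ac)
  also have "\<dots> = w y * (\<Sum>a\<in>A. 2 * l a y * Z a m y * d a) + ?c * divG m w y
     - real k * (w y * (\<Sum>a\<in>A. 2 * l a y * Z a m y * e a) + 2 * ?c * (w y * ((y - x) $ m - (\<Sum>a\<in>A. (l a y - l a x) * Z a m y))))"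
    unfolding contract H ..
  also have "(\<Sum>a\<in>A. 2 * l a y * Z a m y * e a) = 2 * ?c * (\<Sum>a\<in>A. (l a y - l a x) * Z a m y)"
    unfolding sum_distrib_left using el by (intro sum.cong refl) (simp add: mult_ac)
  also have "(\<Sum>a\<in>A. 2 * l a y * Z a m y * d a) = (\<Sum>a\<in>A. 2 * (l a y * drho \<epsilon> (l a y)) * cut \<epsilon> (A - {a}) y * Z a m y)"
    unfolding d_def by (intro sum.cong refl) (simp add: mult_ac)
  finally show ?thesis by (simp add: algebra_simps)
qed

lemma s_drho_bound: "\<epsilon> > 0 \<Longrightarrow> \<bar>s * drho \<epsilon> s\<bar> \<le> 1"
proof -
  assume "\<epsilon> > 0"
  then have p: "0 < (\<epsilon>\<^sup>2 + s\<^sup>2)\<^sup>2" by (simp add: add_pos_nonneg)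
  have "s * drho \<epsilon> s = 2 * s\<^sup>2 * \<epsilon>\<^sup>2 / (\<epsilon>\<^sup>2 + s\<^sup>2)\<^sup>2" by (simp add: drho_def power2_eq_square)
  moreover have "2 * s\<^sup>2 * \<epsilon>\<^sup>2 \<le> (\<epsilon>\<^sup>2 + s\<^sup>2)\<^sup>2" by (simp add: power2_sum)
  ultimately show ?thesis using p by (simp add: abs_mult divide_le_eq)
qed

text \<open>Integration by parts without boundary terms: in the limit \<open>\<epsilon> \<rightarrow> 0\<close> of the cut-off identities,
  \<open>s rho'(s)\<close> tends to \<open>0\<close> boundedly.\<close>

lemma ibp:
  assumes x: "x \<in> P" and w: "w \<in> CP"
  shows "((\<lambda>y. E k x y * (divG m w y - 2 * real k * ((y $ m - x $ m) * w y))) has_integral 0) (interior P)"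
proof -
  define \<epsilon> where "\<epsilon> n = inverse (real (Suc n))" for n
  have \<epsilon>: "\<epsilon> n > 0" for n by (simp add: \<epsilon>_def)
  have \<epsilon>0: "\<epsilon> \<longlonglongrightarrow> 0" unfolding \<epsilon>_def by (rule LIMSEQ_inverse_real_of_nat)
  define g where "g y = divG m w y - 2 * real k * ((y $ m - x $ m) * w y)" for y
  define b where "b n y = (\<Sum>a\<in>A. 2 * (l a y * drho (\<epsilon> n) (l a y)) * cut (\<epsilon> n) (A - {a}) y * Z a m y)" for n y
  have g: "g \<in> CP" unfolding g_def[abs_def]
    by (intro smooth_upto_diff divG_smooth w smooth_upto_cmult smooth_upto_mult smooth_upto_coord smooth_upto_const)
  show ?thesis unfolding g_def[symmetric]
  proof (rule has_integral_dominated_convergence[where y = "\<lambda>n. 0"])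
    show "((\<lambda>y. E k x y * (w y * b n y + cut (\<epsilon> n) A y * g y)) has_integral 0) (interior P)" for n
    proof -
      have "((\<lambda>y. \<Sum>j\<in>UNIV. E k x y * cutdiv (\<epsilon> n) k x j (\<lambda>y. G j m y * w y) y) has_integral (\<Sum>j\<in>(UNIV::'n set). 0)) (interior P)"
        by (intro has_integral_sum integral_cutdiv x \<epsilon> smooth_upto_mult G_smooth w) auto
      then have "((\<lambda>y. E k x y * (\<Sum>j\<in>UNIV. cutdiv (\<epsilon> n) k x j (\<lambda>y. G j m y * w y) y)) has_integral 0) (interior P)"
        by (simp add: sum_distrib_left)
      then show ?thesis
        by (rule has_integral_eq[rotated]) (simp add: sum_cutdiv interior_sub b_def g_def)
    qed
    define B where "B = nrm 0 w * (\<Sum>a\<in>A. 2 * nrm 0 (Z a m)) + nrm 0 g"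
    show "(\<lambda>y. B) integrable_on interior P" by (rule integrable_on_const[OF interior_lmeasurable])
    show "\<forall>y\<in>interior P. norm (E k x y * (w y * b n y + cut (\<epsilon> n) A y * g y)) \<le> B" for n
    proof
      fix y assume y: "y \<in> interior P"
      note yP = interior_sub[OF y]
      have "\<bar>b n y\<bar> \<le> (\<Sum>a\<in>A. \<bar>2 * (l a y * drho (\<epsilon> n) (l a y)) * cut (\<epsilon> n) (A - {a}) y * Z a m y\<bar>)"
        unfolding b_def by (rule sum_abs)
      also have "\<dots> \<le> (\<Sum>a\<in>A. 2 * 1 * 1 * nrm 0 (Z a m))"
        unfolding abs_mult[of "_ * _"] abs_mult[of 2]
        using s_drho_bound[OF \<epsilon>] cut_range[OF \<epsilon>] nrm_val[OF Z_smooth yP]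
        by (intro sum_mono mult_mono) (auto intro!: mult_nonneg_nonneg)
      finally have bb: "\<bar>b n y\<bar> \<le> (\<Sum>a\<in>A. 2 * nrm 0 (Z a m))" by simp
      have "\<bar>w y * b n y + cut (\<epsilon> n) A y * g y\<bar> \<le> \<bar>w y\<bar> * \<bar>b n y\<bar> + \<bar>cut (\<epsilon> n) A y\<bar> * \<bar>g y\<bar>"
        by (metis abs_mult abs_triangle_ineq)
      also have "\<dots> \<le> nrm 0 w * (\<Sum>a\<in>A. 2 * nrm 0 (Z a m)) + 1 * nrm 0 g"
        using bb cut_range[OF \<epsilon>, of n A y] nrm_val[OF w yP, of 0] nrm_val[OF g yP, of 0]
        by (intro add_mono mult_mono) auto
      finally have "\<bar>w y * b n y + cut (\<epsilon> n) A y * g y\<bar> \<le> B" by (simp add: B_def)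
      then have "E k x y * \<bar>w y * b n y + cut (\<epsilon> n) A y * g y\<bar> \<le> 1 * B"
        using E_bounds[OF x y, of k] by (intro mult_mono) auto
      then show "norm (E k x y * (w y * b n y + cut (\<epsilon> n) A y * g y)) \<le> B"
        using E_bounds[OF x y, of k] by (simp add: abs_mult)
    qed
    show "\<forall>y\<in>interior P. (\<lambda>n. E k x y * (w y * b n y + cut (\<epsilon> n) A y * g y)) \<longlonglongrightarrow> E k x y * g y"
    proof
      fix y assume y: "y \<in> interior P"
      have lp: "l a y \<noteq> 0" if "a \<in> A" for a using l_pos_interior[OF y that] by simp
      have r: "(\<lambda>n. rho (\<epsilon> n) (l a y)) \<longlonglongrightarrow> 1" if "a \<in> A" for a
        unfolding rho_def using lp[OF that] by (auto intro!: tendsto_eq_intros \<epsilon>0)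
      have c: "(\<lambda>n. cut (\<epsilon> n) B y) \<longlonglongrightarrow> 1" if "B \<subseteq> A" for B
      proof -
        have "(\<lambda>n. \<Prod>a\<in>B. rho (\<epsilon> n) (l a y)) \<longlonglongrightarrow> (\<Prod>a\<in>B. 1)"
          using that by (intro tendsto_prod r) auto
        then show ?thesis by (simp add: cut_def)
      qed
      have d: "(\<lambda>n. drho (\<epsilon> n) (l a y)) \<longlonglongrightarrow> 0" if "a \<in> A" for a
        unfolding drho_def using lp[OF that] by (auto intro!: tendsto_eq_intros \<epsilon>0)
      have "(\<lambda>n. b n y) \<longlonglongrightarrow> (\<Sum>a\<in>A. 2 * (l a y * 0) * 1 * Z a m y)"
        unfolding b_def by (intro tendsto_intros d c) auto
      then have b0: "(\<lambda>n. b n y) \<longlonglongrightarrow> 0" by simp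
      have "(\<lambda>n. E k x y * (w y * b n y + cut (\<epsilon> n) A y * g y)) \<longlonglongrightarrow> E k x y * (w y * 0 + 1 * g y)"
        by (intro tendsto_intros b0 c) auto
      then show "(\<lambda>n. E k x y * (w y * b n y + cut (\<epsilon> n) A y * g y)) \<longlonglongrightarrow> E k x y * g y" by simp
    qed
  qed simp
qed

text \<open>\<open>expect k \<alpha> f\<close> is the pairing of \<open>f\<close> with the squared norm of the section of weight \<open>\<alpha>\<close>.\<close>

definition "mass k x = integral (interior P) (E k x)"
definition "expect k x g = integral (interior P) (\<lambda>y. E k x y * g y) / mass k x"

lemma E_integrable:
  assumes x: "x \<in> P" and g: "g \<in> CP"
  shows "(\<lambda>y. E k x y * g y) integrable_on interior P"
proof (rule integrable_bounded_continuous[OF interior_lmeasurable, where B = "nrm 0 g"])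
  show "continuous_on (interior P) (\<lambda>y. E k x y * g y)"
    by (intro continuous_intros continuous_E continuous_on_subset[OF CP_cont[OF g] interior_subset])
  fix y assume y: "y \<in> interior P"
  have "E k x y * \<bar>g y\<bar> \<le> 1 * nrm 0 g"
    using E_bounds[OF x y, of k] nrm_val[OF g interior_sub[OF y], of 0] by (intro mult_mono) auto
  then show "\<bar>E k x y * g y\<bar> \<le> nrm 0 g" using E_bounds[OF x y, of k] by (simp add: abs_mult)
qed

lemma mass_pos: assumes x: "x \<in> P" shows "0 < mass k x"
proof -
  obtain z where "z \<in> interior P" using interior_P by blast
  then obtain r where r: "r > 0" "cball z r \<subseteq> interior P" using open_contains_cball open_interior by blast
  have "\<exists>y0\<in>cball z r. \<forall>y\<in>cball z r. E k x y0 \<le> E k x y"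
    using r by (intro continuous_attains_inf continuous_on_subset[OF continuous_E]) auto
  then obtain y0 where y0: "y0 \<in> cball z r" "\<And>y. y \<in> cball z r \<Longrightarrow> E k x y0 \<le> E k x y" by blast
  have c: "E k x y0 > 0" using E_bounds[OF x, of y0 k] y0 r by blast
  have int: "E k x integrable_on interior P" using E_integrable[OF x smooth_upto_const[of 1]] by simp
  have int': "E k x integrable_on cball z r"
    using E_bounds[OF x, of _ k] r(2)
    by (intro integrable_bounded_continuous[where B = 1] continuous_on_subset[OF continuous_E]) (auto simp: subset_iff abs_le_iff less_imp_le intro: order_trans[of _ 0])
  have "0 < E k x y0 * measure lebesgue (cball z r)"
    using c r(1) content_cball_pos[of r z] by simp
  also have "\<dots> = integral (cball z r) (\<lambda>y. E k x y0)"
    using integral_mult_right[of "cball z r" "E k x y0" "\<lambda>_. 1"] lmeasure_integral[OF lmeasurable_cball[of z r]]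
    by simp
  also have "\<dots> \<le> integral (cball z r) (E k x)"
    using y0(2) int' by (intro integral_le integrable_on_const) auto
  also have "\<dots> \<le> integral (interior P) (E k x)"
    using int int' r(2) E_bounds[OF x] by (intro integral_subset_le) (auto intro: less_imp_le)
  finally show ?thesis by (simp add: mass_def)
qed

lemma expect_abs_le:
  assumes x: "x \<in> P" and g: "g \<in> CP" and h: "h \<in> CP" and le: "\<And>y. y \<in> P \<Longrightarrow> \<bar>g y\<bar> \<le> h y"
  shows "\<bar>expect k x g\<bar> \<le> expect k x h"
proof -
  have "norm (integral (interior P) (\<lambda>y. E k x y * g y)) \<le> integral (interior P) (\<lambda>y. E k x y * h y)"
    using E_bounds[OF x, of _ k] le interior_sub
    by (intro integral_norm_bound_integral E_integrable x g h) (auto simp: abs_mult abs_of_pos intro!: mult_left_mono less_imp_le)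
  then show ?thesis using mass_pos[OF x, of k] by (simp add: expect_def abs_mult divide_right_mono)
qed

lemma expect_add: "x \<in> P \<Longrightarrow> f \<in> CP \<Longrightarrow> g \<in> CP \<Longrightarrow> expect k x (\<lambda>y. f y + g y) = expect k x f + expect k x g"
  by (simp add: expect_def distrib_left integral_add E_integrable add_divide_distrib)

lemma expect_cmult: "expect k x (\<lambda>y. c * g y) = c * expect k x g"
  by (simp add: expect_def mult.left_commute)

lemma expect_const: "x \<in> P \<Longrightarrow> expect k x (\<lambda>y. c) = c"
  using mass_pos[of x k] by (simp add: expect_def mass_def mult.commute)

lemma expect_cong: "(\<And>y. y \<in> P \<Longrightarrow> f y = g y) \<Longrightarrow> expect k x f = expect k x g"
  unfolding expect_def by (intro arg_cong2[where f = "(/)"] integral_cong refl) (simp add: interior_sub)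

lemma expect_sum:
  "x \<in> P \<Longrightarrow> (\<And>i. i \<in> I \<Longrightarrow> f i \<in> CP) \<Longrightarrow> expect k x (\<lambda>y. \<Sum>i\<in>I. f i y) = (\<Sum>i\<in>I. expect k x (f i))"
proof (induction I rule: infinite_finite_induct)
  case (insert i I)
  then show ?case by (simp add: expect_add smooth_upto_sum)
qed (auto simp: expect_const)

text \<open>The identity behind the expansion: a factor \<open>y - x\<close> is worth a factor \<open>1/k\<close> at the cost of one
  derivative.\<close>

lemma expect_ibp:
  assumes x: "x \<in> P" and w: "w \<in> CP" and k: "k > 0"
  shows "expect k x (\<lambda>y. (y $ m - x $ m) * w y) = expect k x (divG m w) / (2 * real k)"
proof -
  have s: "(\<lambda>y. (y $ m - x $ m) * w y) \<in> CP"
    by (intro smooth_upto_diff w smooth_upto_mult smooth_upto_coord smooth_upto_const)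
  have "0 = expect k x (\<lambda>y. divG m w y + (- 2 * real k) * ((y $ m - x $ m) * w y))"
    using ibp[OF x w, of k m] by (simp add: expect_def integral_unique)
  also have "\<dots> = expect k x (divG m w) + (- 2 * real k) * expect k x (\<lambda>y. (y $ m - x $ m) * w y)"
    unfolding expect_add[OF x divG_smooth[OF w] smooth_upto_cmult[OF s]] expect_cmult ..
  finally show ?thesis using k by (simp add: field_simps)
qed

end

section \<open>Expansion of the expectations\<close>

context toric_inverse_hessian
begin

text \<open>Both notions are uniform in \<open>x \<in> P\<close> and allow a loss of derivatives of \<open>g\<close>. The coefficients of an
  expansion are bounded operators, so that they are smooth functions of \<open>x\<close> and can be summed over
  lattice points afterwards.\<close>

definition vanishes :: "nat \<Rightarrow> ((real^'n \<Rightarrow> real) \<Rightarrow> nat \<Rightarrow> real^'n \<Rightarrow> real) \<Rightarrow> bool" where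
  "vanishes r Q \<longleftrightarrow> (\<exists>C m. 0 \<le> C \<and> (\<forall>g\<in>CP. \<forall>x\<in>P. \<forall>k>0. \<bar>Q g k x\<bar> \<le> C * nrm m g / real k ^ r))"

definition expandable :: "nat \<Rightarrow> ((real^'n \<Rightarrow> real) \<Rightarrow> nat \<Rightarrow> real^'n \<Rightarrow> real) \<Rightarrow> bool" where
  "expandable N Q \<longleftrightarrow> (\<exists>T. (\<forall>j. bop (T j)) \<and> vanishes N (\<lambda>g k x. Q g k x - (\<Sum>j<N. T j g x / real k ^ j)))"

lemma vanishesI:
  "0 \<le> C \<Longrightarrow> (\<And>g x k. g \<in> CP \<Longrightarrow> x \<in> P \<Longrightarrow> 0 < k \<Longrightarrow> \<bar>Q g k x\<bar> \<le> C * nrm m g / real k ^ r) \<Longrightarrow> vanishes r Q"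
  unfolding vanishes_def by (intro exI[of _ C] exI[of _ m]) simp

lemma vanishesD:
  "vanishes r Q \<Longrightarrow> \<exists>C m. 0 \<le> C \<and> (\<forall>g\<in>CP. \<forall>x\<in>P. \<forall>k>0. \<bar>Q g k x\<bar> \<le> C * nrm m g / real k ^ r)"
  by (simp add: vanishes_def)

lemma vanishes_cong:
  assumes "vanishes r Q" "\<And>g x k. g \<in> CP \<Longrightarrow> x \<in> P \<Longrightarrow> 0 < k \<Longrightarrow> Q g k x = R g k x"
  shows "vanishes r R"
  using assms(1) unfolding vanishes_def by (simp add: assms(2))

lemma vanishes_add:
  assumes "vanishes r Q" "vanishes r R" shows "vanishes r (\<lambda>g k x. Q g k x + R g k x)"
proof -
  obtain C m where C: "0 \<le> C" "\<forall>g\<in>CP. \<forall>x\<in>P. \<forall>k>0. \<bar>Q g k x\<bar> \<le> C * nrm m g / real k ^ r"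
    using vanishesD[OF assms(1)] by (elim exE conjE)
  obtain C' m' where C': "0 \<le> C'" "\<forall>g\<in>CP. \<forall>x\<in>P. \<forall>k>0. \<bar>R g k x\<bar> \<le> C' * nrm m' g / real k ^ r"
    using vanishesD[OF assms(2)] by (elim exE conjE)
  show ?thesis
  proof (rule vanishesI[of "C + C'" _ "max m m'"])
    fix g x and k :: nat assume g: "g \<in> CP" and x: "x \<in> P" and k: "0 < k"
    have "C * nrm m g / real k ^ r \<le> C * nrm (max m m') g / real k ^ r"
      using C g by (intro divide_right_mono mult_left_mono nrm_mono) auto
    moreover have "C' * nrm m' g / real k ^ r \<le> C' * nrm (max m m') g / real k ^ r"
      using C' g by (intro divide_right_mono mult_left_mono nrm_mono) auto
    moreover have "\<bar>Q g k x\<bar> \<le> C * nrm m g / real k ^ r" using C(2) g x k by blast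
    moreover have "\<bar>R g k x\<bar> \<le> C' * nrm m' g / real k ^ r" using C'(2) g x k by blast
    ultimately show "\<bar>Q g k x + R g k x\<bar> \<le> (C + C') * nrm (max m m') g / real k ^ r"
      by (simp add: distrib_right add_divide_distrib)
  qed (use C C' in simp)
qed

lemma vanishes_zero: "vanishes r (\<lambda>g k x. 0)"
  by (rule vanishesI[of 0]) auto

lemma vanishes_cmult:
  assumes "vanishes r Q" shows "vanishes r (\<lambda>g k x. c * Q g k x)"
proof -
  obtain C m where C: "0 \<le> C" "\<forall>g\<in>CP. \<forall>x\<in>P. \<forall>k>0. \<bar>Q g k x\<bar> \<le> C * nrm m g / real k ^ r"
    using vanishesD[OF assms(1)] by (elim exE conjE)
  show ?thesis
  proof (rule vanishesI[of "\<bar>c\<bar> * C" _ m])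
    fix g x and k :: nat assume g: "g \<in> CP" and x: "x \<in> P" and k: "0 < k"
    have "\<bar>Q g k x\<bar> \<le> C * nrm m g / real k ^ r" using C(2) g x k by blast
    from mult_left_mono[OF this abs_ge_zero[of c]]
    show "\<bar>c * Q g k x\<bar> \<le> \<bar>c\<bar> * C * nrm m g / real k ^ r" by (simp add: abs_mult mult.assoc)
  qed (use C in simp)
qed

lemma vanishes_sum: "(\<And>i. i \<in> I \<Longrightarrow> vanishes r (Q i)) \<Longrightarrow> vanishes r (\<lambda>g k x. \<Sum>i\<in>I. Q i g k x)"
  by (induction I rule: infinite_finite_induct) (auto intro: vanishes_zero vanishes_add)

lemma vanishes_sum_list: "(\<And>i. i \<in> set is \<Longrightarrow> vanishes r (Q i)) \<Longrightarrow> vanishes r (\<lambda>g k x. \<Sum>i\<leftarrow>is. Q i g k x)"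
  by (induction "is") (auto intro: vanishes_zero vanishes_add)

lemma vanishes_mono:
  assumes "vanishes r Q" "r' \<le> r" shows "vanishes r' Q"
proof -
  obtain C m where C: "0 \<le> C" "\<forall>g\<in>CP. \<forall>x\<in>P. \<forall>k>0. \<bar>Q g k x\<bar> \<le> C * nrm m g / real k ^ r"
    using vanishesD[OF assms(1)] by (elim exE conjE)
  show ?thesis
  proof (rule vanishesI[OF C(1)])
    fix g x and k :: nat assume g: "g \<in> CP" and x: "x \<in> P" and k: "0 < k"
    have "real k ^ r' \<le> real k ^ r" using k assms(2) by (intro power_increasing) auto
    then have "C * nrm m g / real k ^ r \<le> C * nrm m g / real k ^ r'"
      using k C(1) nrm_nonneg[OF g] by (intro divide_left_mono) auto
    moreover have "\<bar>Q g k x\<bar> \<le> C * nrm m g / real k ^ r" using C(2) g x k by blast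
    ultimately show "\<bar>Q g k x\<bar> \<le> C * nrm m g / real k ^ r'" by linarith
  qed
qed

lemma vanishes_comp:
  assumes "vanishes r Q" "bop S" shows "vanishes r (\<lambda>g. Q (S g))"
proof -
  obtain C m where C: "0 \<le> C" "\<forall>g\<in>CP. \<forall>x\<in>P. \<forall>k>0. \<bar>Q g k x\<bar> \<le> C * nrm m g / real k ^ r"
    using vanishesD[OF assms(1)] by (elim exE conjE)
  obtain m' C' where C': "0 \<le> C'" "\<forall>g\<in>CP. nrm m (S g) \<le> C' * nrm m' g"
    using bop_bound[OF assms(2)] by blast
  show ?thesis
  proof (rule vanishesI[of "C * C'" _ m'])
    fix g x and k :: nat assume g: "g \<in> CP" and x: "x \<in> P" and k: "0 < k"
    have "\<bar>Q (S g) k x\<bar> \<le> C * nrm m (S g) / real k ^ r" using C(2) bop_CP[OF assms(2) g] x k by blast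
    also have "\<dots> \<le> C * (C' * nrm m' g) / real k ^ r"
      using C C' g by (intro divide_right_mono mult_left_mono) auto
    finally show "\<bar>Q (S g) k x\<bar> \<le> C * C' * nrm m' g / real k ^ r" by (simp add: mult.assoc)
  qed (use C C' in simp)
qed

lemma vanishes_shift:
  assumes "vanishes r Q" shows "vanishes (Suc r) (\<lambda>g k x. Q g k x / real k)"
proof -
  obtain C m where C: "0 \<le> C" "\<forall>g\<in>CP. \<forall>x\<in>P. \<forall>k>0. \<bar>Q g k x\<bar> \<le> C * nrm m g / real k ^ r"
    using vanishesD[OF assms(1)] by (elim exE conjE)
  show ?thesis
  proof (rule vanishesI[OF C(1)])
    fix g x and k :: nat assume g: "g \<in> CP" and x: "x \<in> P" and k: "0 < k"
    have "\<bar>Q g k x\<bar> \<le> C * nrm m g / real k ^ r" using C(2) g x k by blast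
    from divide_right_mono[OF this, of "real k"]
    show "\<bar>Q g k x / real k\<bar> \<le> C * nrm m g / real k ^ Suc r" using k by (simp add: mult.commute)
  qed
qed

text \<open>Needed for Taylor polynomials, where moments of the constant function \<open>1\<close> are multiplied by
  derivatives of \<open>g\<close> at \<open>x\<close>.\<close>

lemma vanishes_fixed_mult:
  assumes "vanishes r Q" "bop S" "f \<in> CP" shows "vanishes r (\<lambda>g k x. S g x * Q f k x)"
proof -
  obtain C m where C: "0 \<le> C" "\<forall>g\<in>CP. \<forall>x\<in>P. \<forall>k>0. \<bar>Q g k x\<bar> \<le> C * nrm m g / real k ^ r"
    using vanishesD[OF assms(1)] by (elim exE conjE)
  obtain m' C' where C': "0 \<le> C'" "\<forall>g\<in>CP. nrm 0 (S g) \<le> C' * nrm m' g"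
    using bop_bound[OF assms(2)] by blast
  show ?thesis
  proof (rule vanishesI[of "C' * (C * nrm m f)" _ m'])
    fix g x and k :: nat assume g: "g \<in> CP" and x: "x \<in> P" and k: "0 < k"
    have "\<bar>S g x\<bar> \<le> C' * nrm m' g" using nrm_val[OF bop_CP[OF assms(2) g] x, of 0] C' g by force
    moreover have "\<bar>Q f k x\<bar> \<le> C * nrm m f / real k ^ r" using C(2) assms(3) x k by blast
    ultimately have "\<bar>S g x\<bar> * \<bar>Q f k x\<bar> \<le> (C' * nrm m' g) * (C * nrm m f / real k ^ r)"
      using C' nrm_nonneg[OF g] by (intro mult_mono) auto
    then show "\<bar>S g x * Q f k x\<bar> \<le> C' * (C * nrm m f) * nrm m' g / real k ^ r" by (simp add: abs_mult mult_ac)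
  qed (use C C' nrm_nonneg[OF assms(3)] in simp)
qed

lemma expandableI: "(\<And>j. bop (T j)) \<Longrightarrow> vanishes N (\<lambda>g k x. Q g k x - (\<Sum>j<N. T j g x / real k ^ j)) \<Longrightarrow> expandable N Q"
  unfolding expandable_def by (intro exI[of _ T]) simp

lemma expandableD: "expandable N Q \<Longrightarrow> \<exists>T. (\<forall>j. bop (T j)) \<and> vanishes N (\<lambda>g k x. Q g k x - (\<Sum>j<N. T j g x / real k ^ j))"
  by (simp add: expandable_def)

lemma expandable_cong:
  assumes "expandable N Q" "\<And>g x k. g \<in> CP \<Longrightarrow> x \<in> P \<Longrightarrow> 0 < k \<Longrightarrow> Q g k x = R g k x"
  shows "expandable N R"
proof -
  obtain T where T: "\<forall>j. bop (T j)" "vanishes N (\<lambda>g k x. Q g k x - (\<Sum>j<N. T j g x / real k ^ j))"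
    using expandableD[OF assms(1)] by (elim exE conjE)
  show ?thesis by (rule expandableI[of T, OF spec[OF T(1)] vanishes_cong[OF T(2)]]) (simp add: assms(2))
qed

lemma expandable_vanishes: "vanishes N Q \<Longrightarrow> expandable N Q"
  by (rule expandableI[of "\<lambda>j f x. 0"]) (simp_all add: bop_zero)

lemma expandable_add:
  assumes "expandable N Q" "expandable N R" shows "expandable N (\<lambda>g k x. Q g k x + R g k x)"
proof -
  obtain T where T: "\<forall>j. bop (T j)" "vanishes N (\<lambda>g k x. Q g k x - (\<Sum>j<N. T j g x / real k ^ j))"
    using expandableD[OF assms(1)] by (elim exE conjE)
  obtain S where S: "\<forall>j. bop (S j)" "vanishes N (\<lambda>g k x. R g k x - (\<Sum>j<N. S j g x / real k ^ j))"
    using expandableD[OF assms(2)] by (elim exE conjE)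
  show ?thesis
  proof (rule expandableI[of "\<lambda>j g x. T j g x + S j g x"])
    show "bop (\<lambda>g x. T j g x + S j g x)" for j by (rule bop_add[OF spec[OF T(1)] spec[OF S(1)]])
    show "vanishes N (\<lambda>g k x. Q g k x + R g k x - (\<Sum>j<N. (T j g x + S j g x) / real k ^ j))"
      by (rule vanishes_cong[OF vanishes_add[OF T(2) S(2)]]) (simp add: add_divide_distrib sum.distrib)
  qed
qed

lemma expandable_cmult:
  assumes "expandable N Q" shows "expandable N (\<lambda>g k x. c * Q g k x)"
proof -
  obtain T where T: "\<forall>j. bop (T j)" "vanishes N (\<lambda>g k x. Q g k x - (\<Sum>j<N. T j g x / real k ^ j))"
    using expandableD[OF assms(1)] by (elim exE conjE)
  show ?thesis
  proof (rule expandableI[of "\<lambda>j g x. c * T j g x"])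
    show "bop (\<lambda>g x. c * T j g x)" for j by (rule bop_cmult[OF spec[OF T(1)]])
    show "vanishes N (\<lambda>g k x. c * Q g k x - (\<Sum>j<N. c * T j g x / real k ^ j))"
      by (rule vanishes_cong[OF vanishes_cmult[OF T(2), of c]]) (simp add: right_diff_distrib sum_distrib_left)
  qed
qed

lemma expandable_sum: "(\<And>i. i \<in> I \<Longrightarrow> expandable N (Q i)) \<Longrightarrow> expandable N (\<lambda>g k x. \<Sum>i\<in>I. Q i g k x)"
  by (induction I rule: infinite_finite_induct) (auto intro: expandable_vanishes vanishes_zero expandable_add)

lemma expandable_sum_list: "(\<And>i. i \<in> set is \<Longrightarrow> expandable N (Q i)) \<Longrightarrow> expandable N (\<lambda>g k x. \<Sum>i\<leftarrow>is. Q i g k x)"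
  by (induction "is") (auto intro: expandable_vanishes vanishes_zero expandable_add)

lemma expandable_comp:
  assumes "expandable N Q" "bop S" shows "expandable N (\<lambda>g. Q (S g))"
proof -
  obtain T where T: "\<forall>j. bop (T j)" "vanishes N (\<lambda>g k x. Q g k x - (\<Sum>j<N. T j g x / real k ^ j))"
    using expandableD[OF assms(1)] by (elim exE conjE)
  show ?thesis
  proof (rule expandableI[of "\<lambda>j g. T j (S g)"])
    show "bop (\<lambda>g. T j (S g))" for j by (rule bop_comp[OF spec[OF T(1)] assms(2)])
    show "vanishes N (\<lambda>g k x. Q (S g) k x - (\<Sum>j<N. T j (S g) x / real k ^ j))"
      by (rule vanishes_comp[OF T(2) assms(2)])
  qed
qed

lemma expandable_shift:
  assumes "expandable N Q" shows "expandable (Suc N) (\<lambda>g k x. Q g k x / real k)"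
proof -
  obtain T where T: "\<forall>j. bop (T j)" "vanishes N (\<lambda>g k x. Q g k x - (\<Sum>j<N. T j g x / real k ^ j))"
    using expandableD[OF assms(1)] by (elim exE conjE)
  show ?thesis
  proof (rule expandableI[of "\<lambda>j. case j of 0 \<Rightarrow> (\<lambda>g x. 0) | Suc i \<Rightarrow> T i"])
    show "bop (case j of 0 \<Rightarrow> (\<lambda>g x. 0) | Suc i \<Rightarrow> T i)" for j using T(1) bop_zero by (cases j) auto
    show "vanishes (Suc N) (\<lambda>g k x. Q g k x / real k - (\<Sum>j<Suc N. (case j of 0 \<Rightarrow> (\<lambda>g x. 0) | Suc i \<Rightarrow> T i) g x / real k ^ j))"
      by (rule vanishes_cong[OF vanishes_shift[OF T(2)]])
        (simp only: sum.lessThan_Suc_shift, simp add: diff_divide_distrib sum_divide_distrib mult.commute)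
  qed
qed

lemma expandable_fixed_mult:
  assumes "expandable N Q" "bop S" "f \<in> CP" shows "expandable N (\<lambda>g k x. S g x * Q f k x)"
proof -
  obtain T where T: "\<forall>j. bop (T j)" "vanishes N (\<lambda>g k x. Q g k x - (\<Sum>j<N. T j g x / real k ^ j))"
    using expandableD[OF assms(1)] by (elim exE conjE)
  show ?thesis
  proof (rule expandableI[of "\<lambda>j g x. T j f x * S g x"])
    show "bop (\<lambda>g x. T j f x * S g x)" for j
      by (rule bop_comp[OF bop_mult[OF bop_CP[OF spec[OF T(1)] assms(3)]] assms(2)])
    show "vanishes N (\<lambda>g k x. S g x * Q f k x - (\<Sum>j<N. T j f x * S g x / real k ^ j))"
      by (rule vanishes_cong[OF vanishes_fixed_mult[OF T(2) assms(2,3)]])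
        (simp add: right_diff_distrib sum_distrib_left mult_ac)
  qed
qed

lemma expandable_id: "expandable N (\<lambda>g k x. g x)"
proof (rule expandableI[of "\<lambda>j. if j = 0 then (\<lambda>g. g) else (\<lambda>g x. 0)"])
  show "bop (if j = 0 then (\<lambda>g. g) else (\<lambda>g x. 0))" for j :: nat using bop_id bop_zero by auto
  show "vanishes N (\<lambda>g k x. g x - (\<Sum>j<N. (if j = 0 then (\<lambda>g. g) else (\<lambda>g x. 0)) g x / real k ^ j))"
  proof (cases N)
    case 0
    then show ?thesis using nrm_val by (intro vanishesI[of 1]) auto
  next
    case (Suc n)
    show ?thesis unfolding Suc sum.lessThan_Suc_shift by (rule vanishes_cong[OF vanishes_zero]) simp
  qed
qed

definition "mom is g k x = expect k x (\<lambda>y. mon is x y * g y)"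

text \<open>The derivative in the divergence falls either on \<open>G g\<close> or on the monomial, which then loses one factor
  more.\<close>

lemma mom_step:
  assumes g: "g \<in> CP" and x: "x \<in> P" and k: "0 < k"
  shows "mom (i # is) g k x = (1/2) * ((mom is (divG i g) k x
     + (\<Sum>j\<in>UNIV. \<Sum>js\<leftarrow>del_each j is. mom js (\<lambda>y. G j i y * g y) k x)) / real k)"
proof -
  let ?w = "\<lambda>y. mon is x y * g y"
  have w: "?w \<in> CP" by (intro smooth_upto_mult mon_smooth g)
  have Gg: "(\<lambda>y. G j i y * g y) \<in> CP" for j by (intro smooth_upto_mult G_smooth g)
  have s: "(\<lambda>y. mon js x y * (G j i y * g y)) \<in> CP" for j js by (intro smooth_upto_mult mon_smooth Gg[unfolded smooth_upto_mult])
  have "divG i ?w y = mon is x y * divG i g y + (\<Sum>j\<in>UNIV. \<Sum>js\<leftarrow>del_each j is. mon js x y * (G j i y * g y))" if y: "y \<in> P" for y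
  proof -
    have "D j (\<lambda>y. G j i y * ?w y) y = mon is x y * D j (\<lambda>y. G j i y * g y) y + (\<Sum>js\<leftarrow>del_each j is. mon js x y * (G j i y * g y))" for j
    proof -
      have "D j (\<lambda>y. G j i y * ?w y) y = D j (\<lambda>y. mon is x y * (G j i y * g y)) y"
        by (rule pd_cong[OF _ _ y]) (auto simp: mult_ac intro!: smooth_upto_mult G_smooth mon_smooth g)
      also have "\<dots> = (\<Sum>js\<leftarrow>del_each j is. mon js x y) * (G j i y * g y) + mon is x y * D j (\<lambda>y. G j i y * g y) y"
        by (simp add: pd_mult[OF mon_smooth Gg y] pd_mon[OF y])
      finally show ?thesis by (simp add: sum_list_mult_const)
    qed
    then show ?thesis unfolding divG_def by (simp add: sum.distrib sum_distrib_left)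
  qed
  then have "expect k x (divG i ?w) = expect k x (\<lambda>y. mon is x y * divG i g y + (\<Sum>j\<in>UNIV. \<Sum>js\<leftarrow>del_each j is. mon js x y * (G j i y * g y)))"
    by (rule expect_cong)
  also have "\<dots> = mom is (divG i g) k x + (\<Sum>j\<in>UNIV. \<Sum>js\<leftarrow>del_each j is. mom js (\<lambda>y. G j i y * g y) k x)"
  proof -
    have sl: "(\<lambda>y. \<Sum>js\<leftarrow>L. mon js x y * (G j i y * g y)) \<in> CP \<and>
       expect k x (\<lambda>y. \<Sum>js\<leftarrow>L. mon js x y * (G j i y * g y)) = (\<Sum>js\<leftarrow>L. mom js (\<lambda>y. G j i y * g y) k x)" for L j
    proof (induction L)
      case Nil
      then show ?case by (simp add: smooth_upto_const expect_const[OF x])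
    next
      case (Cons js L)
      then show ?case by (simp add: smooth_upto_add[OF s] expect_add[OF x s] mom_def)
    qed
    have "(\<lambda>y. \<Sum>j\<in>UNIV. \<Sum>js\<leftarrow>del_each j is. mon js x y * (G j i y * g y)) \<in> CP"
      using sl by (intro smooth_upto_sum) blast
    moreover have "(\<lambda>y. mon is x y * divG i g y) \<in> CP" by (intro smooth_upto_mult mon_smooth divG_smooth g)
    ultimately show ?thesis
      by (subst expect_add[OF x]) (auto simp: mom_def[symmetric] expect_sum[OF x] sl)
  qed
  finally have "expect k x (divG i ?w) = \<dots>" .
  moreover have "mom (i # is) g k x = expect k x (\<lambda>y. (y $ i - x $ i) * ?w y)"
    by (simp add: mom_def mult.assoc)
  ultimately show ?thesis using expect_ibp[OF x w k, of i] by simp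
qed

lemma bop_divG: "bop (divG i)"
  unfolding divG_def[abs_def] by (intro bop_sum bop_comp[OF bop_pd bop_mult] G_smooth)

text \<open>In \<open>mom_step\<close> one power of \<open>1/k\<close> is gained for at most two letters.\<close>

lemma mom_vanishes: "vanishes ((length is + 1) div 2) (mom is)"
proof (induction "length is" arbitrary: "is" rule: less_induct)
  case less
  show ?case
  proof (cases "is")
    case Nil
    have "\<bar>mom [] g k x\<bar> \<le> nrm 0 g" if g: "g \<in> CP" and x: "x \<in> P" for g k x
    proof -
      have "\<bar>expect k x g\<bar> \<le> expect k x (\<lambda>y. nrm 0 g)"
        using nrm_val[OF g] by (intro expect_abs_le x g smooth_upto_const)
      then show ?thesis by (simp add: mom_def expect_const[OF x])
    qed
    then show ?thesis unfolding Nil by (intro vanishesI[of 1 _ 0]) auto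
  next
    case (Cons i js)
    have "vanishes ((length js + 1) div 2) (mom js)" by (rule less) (simp add: Cons)
    then have 1: "vanishes (length js div 2) (mom js)" by (rule vanishes_mono) simp
    have 2: "vanishes (length js div 2) (mom ls)" if "ls \<in> set (del_each j js)" for ls j
    proof -
      have l: "Suc (length ls) = length js" using length_del_each[OF that] .
      then have "vanishes ((length ls + 1) div 2) (mom ls)" by (intro less) (simp add: Cons)
      then show ?thesis by (simp add: l[symmetric])
    qed
    have "vanishes (Suc (length js div 2)) (\<lambda>g k x. (1/2) * ((mom js (divG i g) k x
     + (\<Sum>j\<in>UNIV. \<Sum>ls\<leftarrow>del_each j js. mom ls (\<lambda>y. G j i y * g y) k x)) / real k))"
      by (intro vanishes_cmult vanishes_shift vanishes_add vanishes_sum vanishes_sum_list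
         vanishes_comp[OF 1 bop_divG] vanishes_comp[OF 2 bop_mult[OF G_smooth]])
    then have "vanishes (Suc (length js div 2)) (mom is)"
      unfolding Cons by (rule vanishes_cong) (simp only: mom_step)
    then show ?thesis using Cons by simp
  qed
qed

lemma expect_taylor:
  assumes g: "g \<in> CP" and x: "x \<in> P"
  shows "expect k x (taylor_poly m g x) = (\<Sum>l<m. \<Sum>is\<in>words l. (1 / fact l) * (Ds is g x * mom is (\<lambda>_. 1) k x))"
proof -
  have s: "(\<lambda>y. (Ds is g x / fact l) * mon is x y) \<in> CP" for l "is" by (intro smooth_upto_cmult mon_smooth)
  have "expect k x (taylor_poly m g x) = expect k x (\<lambda>y. \<Sum>l<m. \<Sum>is\<in>words l. (Ds is g x / fact l) * mon is x y)"
    by (rule expect_cong) (simp add: taylor_poly_def sum_divide_distrib)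
  also have "\<dots> = (\<Sum>l<m. expect k x (\<lambda>y. \<Sum>is\<in>words l. (Ds is g x / fact l) * mon is x y))"
    by (rule expect_sum[OF x]) (intro smooth_upto_sum s)
  also have "\<dots> = (\<Sum>l<m. \<Sum>is\<in>words l. expect k x (\<lambda>y. (Ds is g x / fact l) * mon is x y))"
    by (intro sum.cong refl expect_sum[OF x] s)
  also have "\<dots> = (\<Sum>l<m. \<Sum>is\<in>words l. (Ds is g x / fact l) * expect k x (mon is x))"
    by (simp only: expect_cmult)
  finally show ?thesis by (simp add: mom_def)
qed

lemma taylor_poly_smooth: "taylor_poly m g x \<in> CP"
proof -
  have "(\<lambda>y. \<Sum>l<m. \<Sum>is\<in>words l. (Ds is g x / fact l) * mon is x y) \<in> CP"
    by (intro smooth_upto_sum smooth_upto_cmult mon_smooth)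
  then show ?thesis by (rule smooth_upto_cong) (simp add: taylor_poly_def sum_divide_distrib)
qed

text \<open>The Taylor polynomial has degree below \<open>2 r\<close>, and moments of order \<open>2 r\<close> are \<open>O(k\<^sup>-\<^sup>r)\<close>.\<close>

lemma taylor_remainder_vanishes:
  assumes "0 < r"
  shows "vanishes r (\<lambda>g k x. expect k x g - expect k x (taylor_poly (2 * r) g x))"
proof -
  let ?R = "\<lambda>i. replicate (2 * r) (i::'n)"
  have "vanishes r (mom (?R i))" for i using mom_vanishes[of "?R i"] by simp
  then have "\<exists>C. 0 \<le> C \<and> (\<forall>x\<in>P. \<forall>k>0. \<bar>mom (?R i) (\<lambda>_. 1) k x\<bar> \<le> C / real k ^ r)" for i
  proof -
    obtain C m where C: "0 \<le> C" "\<forall>g\<in>CP. \<forall>x\<in>P. \<forall>k>0. \<bar>mom (?R i) g k x\<bar> \<le> C * nrm m g / real k ^ r"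
      using vanishesD[OF \<open>vanishes r (mom (?R i))\<close>] by (elim exE conjE)
    then show ?thesis using smooth_upto_const[of 1 P] nrm_nonneg[OF smooth_upto_const[of 1 P], of m]
      by (intro exI[of _ "C * nrm m (\<lambda>_. 1)"]) auto
  qed
  then obtain C where C: "\<And>i. 0 \<le> C i" "\<And>i x k. x \<in> P \<Longrightarrow> 0 < k \<Longrightarrow> \<bar>mom (?R i) (\<lambda>_. 1) k x\<bar> \<le> C i / real k ^ r"
    by metis
  let ?W = "real (card (words (2 * r) :: 'n list set))"
  show ?thesis
  proof (rule vanishesI[of "?W * (\<Sum>i\<in>UNIV. C i)" _ "2 * r"])
    fix g x and k :: nat assume g: "g \<in> CP" and x: "x \<in> P" and k: "0 < k"
    let ?h = "\<lambda>y. (nrm (2 * r) g * ?W) * (\<Sum>i\<in>UNIV. mon (?R i) x y)"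
    have h: "?h \<in> CP" by (intro smooth_upto_cmult smooth_upto_sum mon_smooth)
    have le: "\<bar>g y + (-1) * taylor_poly (2 * r) g x y\<bar> \<le> ?h y" if y: "y \<in> P" for y
    proof -
      have "\<bar>g y - taylor_poly (2 * r) g x y\<bar> \<le> nrm (2 * r) g * (\<Sum>is\<in>words (2 * r). \<bar>mon is x y\<bar>)"
        using taylor[OF g x y, of "2 * r"] assms by simp
      also have "\<dots> \<le> nrm (2 * r) g * (\<Sum>is\<in>(words (2 * r) :: 'n list set). \<Sum>i\<in>UNIV. mon (?R i) x y)"
        by (intro mult_left_mono sum_mono mon_even_bound nrm_nonneg g) (simp add: words_def)
      finally show ?thesis by simp
    qed
    have "expect k x g - expect k x (taylor_poly (2 * r) g x) = expect k x (\<lambda>y. g y + (-1) * taylor_poly (2 * r) g x y)"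
      unfolding expect_add[OF x g smooth_upto_cmult[OF taylor_poly_smooth]] expect_cmult by simp
    also have "\<bar>\<dots>\<bar> \<le> expect k x ?h"
      by (intro expect_abs_le x h le smooth_upto_add smooth_upto_cmult taylor_poly_smooth g)
    also have "\<dots> = (nrm (2 * r) g * ?W) * (\<Sum>i\<in>UNIV. mom (?R i) (\<lambda>_. 1) k x)"
      unfolding expect_cmult by (simp add: expect_sum[OF x mon_smooth] mom_def)
    also have "\<dots> \<le> (nrm (2 * r) g * ?W) * (\<Sum>i\<in>UNIV. C i / real k ^ r)"
      using C(2)[OF x k] nrm_nonneg[OF g] by (intro mult_left_mono sum_mono) (auto simp: abs_le_iff)
    finally show "\<bar>expect k x g - expect k x (taylor_poly (2 * r) g x)\<bar> \<le> ?W * (\<Sum>i\<in>UNIV. C i) * nrm (2 * r) g / real k ^ r"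
      by (simp add: sum_divide_distrib[symmetric] mult_ac)
  qed (use C in \<open>auto intro!: sum_nonneg mult_nonneg_nonneg\<close>)
qed

text \<open>Induction on the order. For a nonempty word \<open>mom_step\<close> gains one order; for the empty word, the Taylor
  polynomial at \<open>x\<close> reduces the expectation to moments of nonempty words and the value at \<open>x\<close>.\<close>

lemma mom_expandable: "expandable N (mom is)"
proof (induction N arbitrary: "is")
  case 0
  show ?case by (rule expandable_vanishes[OF vanishes_mono[OF mom_vanishes]]) simp
next
  case (Suc N)
  have step: "expandable (Suc N) (mom (i # js))" for i js
  proof -
    have "expandable (Suc N) (\<lambda>g k x. (1/2) * ((mom js (divG i g) k x
     + (\<Sum>j\<in>UNIV. \<Sum>ls\<leftarrow>del_each j js. mom ls (\<lambda>y. G j i y * g y) k x)) / real k))"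
      by (intro expandable_cmult expandable_shift expandable_add expandable_sum expandable_sum_list
         expandable_comp[OF Suc bop_divG] expandable_comp[OF Suc bop_mult[OF G_smooth]])
    then show ?thesis by (rule expandable_cong) (simp only: mom_step)
  qed
  show ?case
  proof (cases "is")
    case Nil
    let ?m = "2 * Suc N"
    have "expandable (Suc N) (\<lambda>g k x. Ds js g x * mom js (\<lambda>_. 1) k x)" for js
    proof (cases js)
      case Nil
      show ?thesis unfolding Nil by (rule expandable_cong[OF expandable_id]) (simp add: mom_def expect_const)
    next
      case (Cons i ls)
      show ?thesis unfolding Cons
        by (rule expandable_fixed_mult[OF step bop_pds smooth_upto_const])
    qed
    then have "expandable (Suc N) (\<lambda>g k x. (\<Sum>l<?m. \<Sum>js\<in>words l. (1 / fact l) * (Ds js g x * mom js (\<lambda>_. 1) k x))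
        + (expect k x g - expect k x (taylor_poly ?m g x)))"
      by (intro expandable_add[OF expandable_sum[OF expandable_sum[OF expandable_cmult]]
          expandable_vanishes[OF taylor_remainder_vanishes]]) simp_all
    then show ?thesis unfolding Nil
      by (rule expandable_cong) (simp add: expect_taylor mom_def del: mult_Suc_right)
  qed (simp add: step)
qed

lemma expect_expansion: "expandable N (\<lambda>g k x. expect k x g)"
  by (rule expandable_cong[OF mom_expandable[of N "[]"]]) (simp add: mom_def)

end

section \<open>Asymptotic expansions in inverse powers\<close>

text \<open>One constant \<open>B\<close> controls the coefficients and the error. It will be a multiple of a norm of a test
  function, and every operation below changes it by a factor independent of the sequence.\<close>

definition expands :: "nat \<Rightarrow> nat \<Rightarrow> real \<Rightarrow> (nat \<Rightarrow> real) \<Rightarrow> bool" where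
  "expands m0 N B s \<longleftrightarrow> (\<exists>a. (\<forall>j<N. \<bar>a j\<bar> \<le> B) \<and>
     (\<forall>M\<ge>m0. \<bar>s M - (\<Sum>j<N. a j / real M ^ j)\<bar> \<le> B / real M ^ N))"

lemma expandsI:
  "(\<And>j. j < N \<Longrightarrow> \<bar>a j\<bar> \<le> B) \<Longrightarrow> (\<And>M. M \<ge> m0 \<Longrightarrow> \<bar>s M - (\<Sum>j<N. a j / real M ^ j)\<bar> \<le> B / real M ^ N)
   \<Longrightarrow> expands m0 N B s"
  unfolding expands_def by (rule exI[of _ a]) blast

lemma expands_cong: "expands m0 N B s \<Longrightarrow> (\<And>M. M \<ge> m0 \<Longrightarrow> s M = s' M) \<Longrightarrow> expands m0 N B s'"
  by (simp add: expands_def)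

lemma expands_mono:
  assumes "expands m0 N B s" "B \<le> B'" shows "expands m0 N B' s"
proof -
  obtain a where ha0: "\<forall>j<N. \<bar>a j\<bar> \<le> B"
      "\<forall>M\<ge>m0. \<bar>s M - (\<Sum>j<N. a j / real M ^ j)\<bar> \<le> B / real M ^ N"
    using assms(1) unfolding expands_def by (elim exE conjE)
  note a = ha0(1)[rule_format] ha0(2)[rule_format]
  have "B / real M ^ N \<le> B' / real M ^ N" for M using assms(2) by (intro divide_right_mono) auto
  with a assms(2) show ?thesis by (intro expandsI[where a = a]) (meson order_trans)+
qed

lemma expands_add:
  assumes "expands m0 N B s" "expands m0 N B' s'"
  shows "expands m0 N (B + B') (\<lambda>M. s M + s' M)"
proof -
  obtain a where ha0: "\<forall>j<N. \<bar>a j\<bar> \<le> B"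
      "\<forall>M\<ge>m0. \<bar>s M - (\<Sum>j<N. a j / real M ^ j)\<bar> \<le> B / real M ^ N"
    using assms(1) unfolding expands_def by (elim exE conjE)
  note a = ha0(1)[rule_format] ha0(2)[rule_format]
  obtain a' where ha'0: "\<forall>j<N. \<bar>a' j\<bar> \<le> B'"
      "\<forall>M\<ge>m0. \<bar>s' M - (\<Sum>j<N. a' j / real M ^ j)\<bar> \<le> B' / real M ^ N"
    using assms(2) unfolding expands_def by (elim exE conjE)
  note a' = ha'0(1)[rule_format] ha'0(2)[rule_format]
  show ?thesis
  proof (rule expandsI[where a = "\<lambda>j. a j + a' j"])
    show "\<bar>a j + a' j\<bar> \<le> B + B'" if "j < N" for j using a(1)[OF that] a'(1)[OF that] by linarith
    show "\<bar>s M + s' M - (\<Sum>j<N. (a j + a' j) / real M ^ j)\<bar> \<le> (B + B') / real M ^ N" if "M \<ge> m0" for M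
      using a(2)[OF that] a'(2)[OF that] by (simp add: add_divide_distrib sum.distrib)
  qed
qed

lemma expands_cmult:
  assumes "expands m0 N B s" shows "expands m0 N (\<bar>c\<bar> * B) (\<lambda>M. c * s M)"
proof -
  obtain a where ha0: "\<forall>j<N. \<bar>a j\<bar> \<le> B"
      "\<forall>M\<ge>m0. \<bar>s M - (\<Sum>j<N. a j / real M ^ j)\<bar> \<le> B / real M ^ N"
    using assms(1) unfolding expands_def by (elim exE conjE)
  note a = ha0(1)[rule_format] ha0(2)[rule_format]
  show ?thesis
  proof (rule expandsI[where a = "\<lambda>j. c * a j"])
    show "\<bar>c * a j\<bar> \<le> \<bar>c\<bar> * B" if "j < N" for j using a(1)[OF that] by (simp add: abs_mult mult_left_mono)
    fix M assume M: "M \<ge> m0"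
    have "c * s M - (\<Sum>j<N. c * a j / real M ^ j) = c * (s M - (\<Sum>j<N. a j / real M ^ j))"
      by (simp add: right_diff_distrib sum_distrib_left)
    then have "\<bar>c * s M - (\<Sum>j<N. c * a j / real M ^ j)\<bar> = \<bar>c\<bar> * \<bar>s M - (\<Sum>j<N. a j / real M ^ j)\<bar>"
      by (simp add: abs_mult)
    also have "\<dots> \<le> \<bar>c\<bar> * (B / real M ^ N)" using a(2)[OF M] by (intro mult_left_mono) auto
    finally show "\<bar>c * s M - (\<Sum>j<N. c * a j / real M ^ j)\<bar> \<le> \<bar>c\<bar> * B / real M ^ N" by simp
  qed
qed

lemma expands_zero: "0 \<le> B \<Longrightarrow> expands m0 N B (\<lambda>M. 0)"
  by (rule expandsI[where a = "\<lambda>_. 0"]) auto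

lemma expands_bounded: "(\<And>M. M \<ge> m0 \<Longrightarrow> \<bar>s M\<bar> \<le> B / real M ^ N) \<Longrightarrow> 0 \<le> B \<Longrightarrow> expands m0 N B s"
  by (rule expandsI[where a = "\<lambda>_. 0"]) auto

lemma expands_sum:
  "(\<And>i. i \<in> I \<Longrightarrow> expands m0 N (B i) (s i)) \<Longrightarrow> expands m0 N (\<Sum>i\<in>I. B i) (\<lambda>M. \<Sum>i\<in>I. s i M)"
  by (induction I rule: infinite_finite_induct) (auto intro: expands_zero expands_add)

lemma expands_sum_list:
  "(\<And>i. i \<in> set is \<Longrightarrow> expands m0 N (B i) (s i)) \<Longrightarrow> expands m0 N (\<Sum>i\<leftarrow>is. B i) (\<lambda>M. \<Sum>i\<leftarrow>is. s i M)"
  by (induction "is") (auto intro: expands_zero expands_add)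

lemma expands_const: "expands m0 N \<bar>c\<bar> (\<lambda>M. c)"
proof (rule expandsI[where a = "\<lambda>j. if j = 0 then c else 0"])
  show "\<bar>c - (\<Sum>j<N. (if j = 0 then c else 0) / real M ^ j)\<bar> \<le> \<bar>c\<bar> / real M ^ N" for M
  proof (cases N)
    case (Suc n)
    have "(\<Sum>j<N. (if j = 0 then c else 0) / real M ^ j) = c"
      unfolding Suc sum.lessThan_Suc_shift by simp
    then show ?thesis by simp
  qed simp
qed auto

lemma expands_divide:
  assumes "expands m0 N B s" "0 \<le> B"
  shows "expands m0 (Suc N) B (\<lambda>M. s M / real M)"
proof -
  obtain a where ha0: "\<forall>j<N. \<bar>a j\<bar> \<le> B"
      "\<forall>M\<ge>m0. \<bar>s M - (\<Sum>j<N. a j / real M ^ j)\<bar> \<le> B / real M ^ N"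
    using assms(1) unfolding expands_def by (elim exE conjE)
  note a = ha0(1)[rule_format] ha0(2)[rule_format]
  show ?thesis
  proof (rule expandsI[where a = "\<lambda>j. case j of 0 \<Rightarrow> 0 | Suc i \<Rightarrow> a i"])
    show "\<bar>case j of 0 \<Rightarrow> 0 | Suc i \<Rightarrow> a i\<bar> \<le> B" if "j < Suc N" for j
      using a(1) that assms(2) by (cases j) auto
    fix M assume M: "M \<ge> m0"
    have "(\<Sum>j<Suc N. (case j of 0 \<Rightarrow> 0 | Suc i \<Rightarrow> a i) / real M ^ j) = (\<Sum>j<N. a j / real M ^ j) / real M"
      unfolding sum.lessThan_Suc_shift by (simp add: sum_divide_distrib mult.commute)
    then have "\<bar>s M / real M - (\<Sum>j<Suc N. (case j of 0 \<Rightarrow> 0 | Suc i \<Rightarrow> a i) / real M ^ j)\<bar>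
       = \<bar>s M - (\<Sum>j<N. a j / real M ^ j)\<bar> / real M"
      by (simp add: diff_divide_distrib[symmetric])
    also have "\<dots> \<le> B / real M ^ N / real M" using a(2)[OF M] by (intro divide_right_mono) auto
    finally show "\<bar>s M / real M - (\<Sum>j<Suc N. (case j of 0 \<Rightarrow> 0 | Suc i \<Rightarrow> a i) / real M ^ j)\<bar> \<le> B / real M ^ Suc N"
      by (simp add: mult.commute)
  qed
qed

lemma expands_divide_power:
  "expands m0 N B s \<Longrightarrow> 0 \<le> B \<Longrightarrow> expands m0 (N + i) B (\<lambda>M. s M / real M ^ i)"
proof (induction i)
  case (Suc i)
  then show ?case using expands_divide[of m0 "N + i" B "\<lambda>M. s M / real M ^ i"] by (simp add: mult.commute)
qed simp

lemma sum_lessThan_add: "(\<Sum>j<N + m. f j) = (\<Sum>j<N. f j) + (\<Sum>l<m. f (N + l))" for f :: "nat \<Rightarrow> real"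
  by (induction m) simp_all

lemma expands_drop:
  assumes "expands m0 (N + i) B s" "0 < m0" "0 \<le> B" shows "expands m0 N (real (Suc i) * B) s"
  using assms(1)
proof (induction i arbitrary: B)
  case (Suc i)
  obtain a where ha: "\<forall>j<Suc (N + i). \<bar>a j\<bar> \<le> B"
      "\<forall>M\<ge>m0. \<bar>s M - (\<Sum>j<Suc (N + i). a j / real M ^ j)\<bar> \<le> B / real M ^ Suc (N + i)"
    using Suc.prems unfolding expands_def add_Suc_right by (elim exE conjE)
  note a = ha(1)[rule_format] ha(2)[rule_format]
  have "expands m0 N (B + real (Suc i) * B) s"
  proof (rule expandsI[where a = a])
    have B: "0 \<le> B" using a(1)[of 0] by linarith
    show "\<bar>a j\<bar> \<le> B + real (Suc i) * B" if "j < N" for j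
    proof -
      have "\<bar>a j\<bar> \<le> B" using a(1)[of j] that by simp
      moreover have "0 \<le> real (Suc i) * B" using B by simp
      ultimately show ?thesis by linarith
    qed
    fix M assume M: "M \<ge> m0"
    then have M1: "1 \<le> real M" using assms(2) by simp
    have pw: "B / real M ^ (N + l) \<le> B / real M ^ N" for l
      using M1 B by (intro divide_left_mono power_increasing mult_pos_pos) auto
    have eq: "(\<Sum>j<Suc (N + i). a j / real M ^ j) = (\<Sum>j<N. a j / real M ^ j) + (\<Sum>l<Suc i. a (N + l) / real M ^ (N + l))"
      using sum_lessThan_add[of "\<lambda>j. a j / real M ^ j" N "Suc i"] by simp
    have "\<bar>\<Sum>l<Suc i. a (N + l) / real M ^ (N + l)\<bar> \<le> (\<Sum>l<Suc i. B / real M ^ N)"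
    proof (rule order_trans[OF sum_abs sum_mono])
      fix l assume "l \<in> {..<Suc i}"
      then have "\<bar>a (N + l)\<bar> / real M ^ (N + l) \<le> B / real M ^ (N + l)"
        using a(1)[of "N + l"] by (intro divide_right_mono) auto
      then show "\<bar>a (N + l) / real M ^ (N + l)\<bar> \<le> B / real M ^ N" using pw[of l] by simp
    qed
    then have "\<bar>s M - (\<Sum>j<N. a j / real M ^ j)\<bar> \<le> B / real M ^ N + real (Suc i) * (B / real M ^ N)"
      using a(2)[OF M] pw[of "Suc i"] unfolding eq by simp
    then show "\<bar>s M - (\<Sum>j<N. a j / real M ^ j)\<bar> \<le> (B + real (Suc i) * B) / real M ^ N"
      by (simp add: add_divide_distrib)
  qed
  then show ?case by (simp add: algebra_simps)
qed simp

text \<open>Fixed sequences with complete expansions, as opposed to those that depend on a test function.\<close>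

definition nice :: "nat \<Rightarrow> (nat \<Rightarrow> real) \<Rightarrow> bool" where
  "nice m0 r \<longleftrightarrow> (\<forall>N. \<exists>B\<ge>0. expands m0 N B r)"

text \<open>The coefficients of \<open>s\<close> enter linearly, so it suffices to expand \<open>r M / M\<^sup>j\<close> for each \<open>j\<close>.\<close>

lemma expands_mult_nice:
  assumes r: "nice m0 r" and m0: "0 < m0"
  shows "\<exists>C\<ge>0. \<forall>s B. 0 \<le> B \<longrightarrow> expands m0 N B s \<longrightarrow> expands m0 N (C * B) (\<lambda>M. r M * s M)"
proof -
  have "\<exists>B\<ge>0. expands m0 N B (\<lambda>M. r M / real M ^ j)" for j
  proof -
    obtain B where B: "B \<ge> 0" "expands m0 N B r" using r unfolding nice_def by blast
    from expands_drop[OF expands_divide_power[OF B(2,1), of j] m0 B(1)] B(1) show ?thesis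
      by (intro exI[of _ "real (Suc j) * B"]) simp
  qed
  then obtain E where E: "\<And>j. E j \<ge> 0" "\<And>j. expands m0 N (E j) (\<lambda>M. r M / real M ^ j)" by metis
  obtain B0 where B0: "B0 \<ge> 0" "expands m0 0 B0 r" using r unfolding nice_def by blast
  then have rb: "\<bar>r M\<bar> \<le> B0" if "M \<ge> m0" for M using that by (auto simp: expands_def)
  define C where "C = (\<Sum>j<N. E j) + B0"
  have "expands m0 N (C * B) (\<lambda>M. r M * s M)" if B: "0 \<le> B" and s: "expands m0 N B s" for s B
  proof -
    obtain a where ha: "\<forall>j<N. \<bar>a j\<bar> \<le> B"
      "\<forall>M\<ge>m0. \<bar>s M - (\<Sum>j<N. a j / real M ^ j)\<bar> \<le> B / real M ^ N"
      using s unfolding expands_def by (elim exE conjE)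
    note a = ha(1)[rule_format] ha(2)[rule_format]
    have 1: "expands m0 N (\<Sum>j<N. E j * B) (\<lambda>M. \<Sum>j<N. a j * (r M / real M ^ j))"
    proof (rule expands_sum)
      fix j assume "j \<in> {..<N}"
      then have "\<bar>a j\<bar> * E j \<le> E j * B" using mult_right_mono[OF a(1)[of j] E(1)[of j]] by (simp add: mult.commute)
      then show "expands m0 N (E j * B) (\<lambda>M. a j * (r M / real M ^ j))"
        by (rule expands_mono[OF expands_cmult[OF E(2)]])
    qed
    have 2: "expands m0 N (B0 * B) (\<lambda>M. r M * (s M - (\<Sum>j<N. a j / real M ^ j)))"
    proof (rule expands_bounded)
      fix M assume M: "M \<ge> m0"
      have "\<bar>r M\<bar> * \<bar>s M - (\<Sum>j<N. a j / real M ^ j)\<bar> \<le> B0 * (B / real M ^ N)"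
        using rb[OF M] a(2)[OF M] B0 by (intro mult_mono) auto
      then show "\<bar>r M * (s M - (\<Sum>j<N. a j / real M ^ j))\<bar> \<le> B0 * B / real M ^ N" by (simp add: abs_mult)
    qed (use B B0 in simp)
    have "expands m0 N ((\<Sum>j<N. E j * B) + B0 * B) (\<lambda>M. r M * s M)"
      by (rule expands_cong[OF expands_add[OF 1 2]]) (simp add: algebra_simps sum_distrib_left)
    then show ?thesis by (simp add: C_def distrib_right sum_distrib_right)
  qed
  moreover have "C \<ge> 0" unfolding C_def using E B0 by (intro add_nonneg_nonneg sum_nonneg) auto
  ultimately show ?thesis by blast
qed

lemma nice_const: "nice m0 (\<lambda>M. c)"
  unfolding nice_def using expands_const abs_ge_zero by blast

lemma nice_mult: "0 < m0 \<Longrightarrow> nice m0 r \<Longrightarrow> nice m0 s \<Longrightarrow> nice m0 (\<lambda>M. r M * s M)"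
  unfolding nice_def[of m0 s] nice_def[of m0 "\<lambda>M. r M * s M"]
  by (metis expands_mult_nice mult_nonneg_nonneg)

lemma nice_add: "nice m0 r \<Longrightarrow> nice m0 s \<Longrightarrow> nice m0 (\<lambda>M. r M + s M)"
  unfolding nice_def by (metis expands_add add_nonneg_nonneg)

lemma nice_cmult: "nice m0 r \<Longrightarrow> nice m0 (\<lambda>M. c * r M)"
  unfolding nice_def by (metis expands_cmult abs_ge_zero mult_nonneg_nonneg)

lemma nice_cong: "nice m0 r \<Longrightarrow> (\<And>M. M \<ge> m0 \<Longrightarrow> r M = s M) \<Longrightarrow> nice m0 s"
  unfolding nice_def by (meson expands_cong)

lemma nice_sum: "(\<And>i. i \<in> I \<Longrightarrow> nice m0 (r i)) \<Longrightarrow> nice m0 (\<lambda>M. \<Sum>i\<in>I. r i M)"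
  by (induction I rule: infinite_finite_induct) (auto intro: nice_const nice_add)

lemma nice_power: "0 < m0 \<Longrightarrow> nice m0 r \<Longrightarrow> nice m0 (\<lambda>M. r M ^ i)"
  by (induction i) (auto intro: nice_const nice_mult)

lemma nice_inverse_M: "0 < m0 \<Longrightarrow> nice m0 (\<lambda>M. 1 / real M)"
  unfolding nice_def
proof
  fix N assume m0: "0 < m0"
  show "\<exists>B\<ge>0. expands m0 N B (\<lambda>M. 1 / real M)"
    using expands_drop[of m0 N 1 1, OF _ m0] expands_divide[OF expands_const[of m0 N 1]] by (intro exI[of _ 2]) simp
qed

lemma nice_ratio:
  assumes m0: "0 < m0" and c: "\<And>M. M \<ge> m0 \<Longrightarrow> 1 \<le> real M + c"
  shows "nice m0 (\<lambda>M. real M / (real M + c))"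
  unfolding nice_def
proof
  fix N
  show "\<exists>B\<ge>0. expands m0 N B (\<lambda>M. real M / (real M + c))"
  proof (induction N)
    case 0
    have "\<bar>real M / (real M + c)\<bar> \<le> 1 + \<bar>c\<bar>" if M: "M \<ge> m0" for M
    proof -
      have p: "1 \<le> real M + c" using c[OF M] .
      have "real M \<le> (real M + c) + \<bar>c\<bar> * 1" by simp
      also have "\<dots> \<le> (real M + c) + \<bar>c\<bar> * (real M + c)" using p by (intro add_left_mono mult_left_mono) auto
      finally show ?thesis using p by (simp add: divide_le_eq algebra_simps)
    qed
    then show ?case by (intro exI[of _ "1 + \<bar>c\<bar>"] conjI expands_bounded) auto
  next
    case (Suc N)
    then obtain B where B: "B \<ge> 0" "expands m0 N B (\<lambda>M. real M / (real M + c))" by blast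
    \<comment> \<open>since \<open>r = 1 - (c / M) r\<close> for \<open>r = M / (M + c)\<close>\<close>
    have "expands m0 (Suc N) (\<bar>1\<bar> + \<bar>-c\<bar> * B) (\<lambda>M. 1 + (-c) * (real M / (real M + c) / real M))"
      by (intro expands_add expands_const expands_cmult expands_divide B)
    then have "expands m0 (Suc N) (\<bar>1\<bar> + \<bar>-c\<bar> * B) (\<lambda>M. real M / (real M + c))"
    proof (rule expands_cong)
      fix M assume M: "M \<ge> m0"
      have "real M + c \<noteq> 0" "real M \<noteq> 0" using c[OF M] M m0 by auto
      then have e: "real M / (real M + c) / real M = 1 / (real M + c)" "real M + c \<noteq> 0" by auto
      then show "1 + (-c) * (real M / (real M + c) / real M) = real M / (real M + c)"
        unfolding e(1) by (simp add: field_simps)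
    qed
    then show ?case using B by (intro exI[of _ "\<bar>1\<bar> + \<bar>-c\<bar> * B"]) auto
  qed
qed

subsection \<open>Summation\<close>

text \<open>The increments are dominated by those of the monotone sequence \<open>2 B M\<^sup>-\<^sup>i\<^sup>-\<^sup>1\<close>; adding it to \<open>s\<close>, respectively
  subtracting it, gives monotone sequences with the same limit.\<close>

lemma expands_of_small_increments:
  assumes m0: "0 < m0" and B: "\<And>M. M \<ge> m0 \<Longrightarrow> \<bar>s M\<bar> \<le> B"
    and d: "\<And>M. M \<ge> m0 \<Longrightarrow> \<bar>s (Suc M) - s M\<bar> \<le> B / real M ^ (i + 2)"
  shows "expands m0 (Suc i) (2 * B) s"
proof -
  have B0: "0 \<le> B" using B[of m0] by linarith
  define f where "f M = 1 / real M ^ Suc i" for M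
  have f: "1 / real M ^ (i + 2) \<le> 2 * (f M - f (Suc M))" if M: "M \<ge> m0" for M
  proof -
    have M1: "1 \<le> real M" using M m0 by simp
    define r where "r = real M / real (Suc M)"
    have r: "0 \<le> r" "r \<le> 1" by (auto simp: r_def)
    have "r ^ Suc i \<le> r ^ 1" using r by (intro power_decreasing) auto
    then have "1 - r \<le> 1 - r ^ Suc i" by simp
    moreover have "1 / real M \<le> 2 * (1 - r)" using M1 by (simp add: r_def field_simps)
    ultimately have "1 / real M \<le> 2 * (1 - r ^ Suc i)" by simp
    then have "1 / real M * (1 / real M ^ Suc i) \<le> 2 * (1 - r ^ Suc i) * (1 / real M ^ Suc i)"
      by (intro mult_right_mono) auto
    moreover have "(1 - r ^ Suc i) * (1 / real M ^ Suc i) = f M - f (Suc M)"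
      using M1 unfolding f_def r_def power_divide left_diff_distrib by (simp del: power_Suc)
    ultimately have "1 / real M * (1 / real M ^ Suc i) \<le> 2 * (f M - f (Suc M))" by (simp only: mult.assoc)
    then show ?thesis by simp
  qed
  have step: "\<bar>s (Suc M) - s M\<bar> \<le> 2 * B * (f M - f (Suc M))" if M: "M \<ge> m0" for M
  proof -
    have "B / real M ^ (i + 2) \<le> 2 * B * (f M - f (Suc M))"
      using mult_left_mono[OF f[OF M] B0] by (simp add: algebra_simps)
    with d[OF M] show ?thesis by linarith
  qed
  define g where "g l = s (m0 + l) + 2 * B * f (m0 + l)" for l
  define g' where "g' l = s (m0 + l) - 2 * B * f (m0 + l)" for l
  have step': "\<bar>s (m0 + Suc n) - s (m0 + n)\<bar> \<le> 2 * B * f (m0 + n) - 2 * B * f (m0 + Suc n)" for n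
    using step[of "m0 + n"] by (simp add: right_diff_distrib)
  have dec: "decseq g"
    unfolding decseq_Suc_iff g_def
  proof
    fix n show "s (m0 + Suc n) + 2 * B * f (m0 + Suc n) \<le> s (m0 + n) + 2 * B * f (m0 + n)"
      using step'[of n] unfolding abs_le_iff by linarith
  qed
  have inc: "incseq g'"
    unfolding incseq_Suc_iff g'_def
  proof
    fix n show "s (m0 + n) - 2 * B * f (m0 + n) \<le> s (m0 + Suc n) - 2 * B * f (m0 + Suc n)"
      using step'[of n] unfolding abs_le_iff by linarith
  qed
  have f0: "(\<lambda>l. f (m0 + l)) \<longlonglongrightarrow> 0"
  proof -
    have "(\<lambda>n. 1 / real n) \<longlonglongrightarrow> 0" by (rule lim_1_over_n)
    then have "(\<lambda>n. (1 / real n) ^ Suc i) \<longlonglongrightarrow> 0 ^ Suc i" by (rule tendsto_power)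
    then have "f \<longlonglongrightarrow> 0" unfolding f_def[abs_def] by (simp add: power_divide)
    from LIMSEQ_ignore_initial_segment[OF this, of m0] show ?thesis by (simp add: add.commute)
  qed
  have fpos: "0 \<le> f M" for M by (simp add: f_def)
  have "- B \<le> g l" for l
  proof -
    have "0 \<le> 2 * B * f (m0 + l)" using B0 fpos by simp
    then show ?thesis using B[of "m0 + l"] by (simp add: g_def)
  qed
  then obtain s0 where g0: "g \<longlonglongrightarrow> s0" using decseq_convergent[OF dec] by blast
  have "(\<lambda>l. g l - 2 * (2 * B) * f (m0 + l)) \<longlonglongrightarrow> s0 - 2 * (2 * B) * 0"
    by (intro tendsto_intros g0 f0)
  then have g'0: "g' \<longlonglongrightarrow> s0" by (simp add: g_def g'_def[abs_def] mult.assoc)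
  have "(\<lambda>l. g l - (2 * B) * f (m0 + l)) \<longlonglongrightarrow> s0 - (2 * B) * 0"
    by (intro tendsto_intros g0 f0)
  then have s0: "(\<lambda>l. s (m0 + l)) \<longlonglongrightarrow> s0" by (simp add: g_def mult.assoc)
  have "s0 \<le> B" by (rule LIMSEQ_le_const2[OF s0]) (use B in \<open>auto simp: abs_le_iff\<close>)
  moreover have "- B \<le> s0"
  proof (rule LIMSEQ_le_const[OF s0], intro exI allI impI)
    show "- B \<le> s (m0 + l)" for l using B[of "m0 + l"] by (simp add: abs_le_iff)
  qed
  ultimately have s0B: "\<bar>s0\<bar> \<le> 2 * B" using B0 by simp
  have close: "\<bar>s M - s0\<bar> \<le> 2 * B / real M ^ Suc i" if M: "M \<ge> m0" for M
  proof -
    have "s0 \<le> g (M - m0)" by (rule decseq_ge[OF dec g0])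
    moreover have "g' (M - m0) \<le> s0" by (rule incseq_le[OF inc g'0])
    ultimately show ?thesis using M by (simp add: g_def g'_def f_def abs_le_iff)
  qed
  show ?thesis
  proof (rule expandsI[where a = "\<lambda>j. if j = 0 then s0 else 0"])
    show "\<bar>if j = 0 then s0 else 0\<bar> \<le> 2 * B" for j using s0B B0 by simp
    show "\<bar>s M - (\<Sum>j<Suc i. (if j = 0 then s0 else 0) / real M ^ j)\<bar> \<le> 2 * B / real M ^ Suc i" if "M \<ge> m0" for M
      using close[OF that] unfolding sum.lessThan_Suc_shift by simp
  qed
qed

text \<open>The increments \<open>M\<^sup>-\<^sup>i\<^sup>-\<^sup>2\<close> are summed one order at a time with the help of the discrete derivative of
  \<open>M\<^sup>-\<^sup>i\<^sup>-\<^sup>1\<close>; a term \<open>1/M\<close>, which would lead to logarithms, does not occur.\<close>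

lemma expands_summation:
  assumes m0: "0 < m0"
  shows "\<exists>C\<ge>0. \<forall>s d B. (\<forall>M\<ge>m0. \<bar>s M\<bar> \<le> B) \<longrightarrow> expands m0 N B d \<longrightarrow>
      (\<forall>M\<ge>m0. s (Suc M) - s M = d M / real M ^ (i + 2)) \<longrightarrow> expands m0 (N + i + 1) (C * B) s"
proof (induction N arbitrary: i)
  case 0
  have "expands m0 (0 + i + 1) (2 * B) s"
    if B: "\<forall>M\<ge>m0. \<bar>s M\<bar> \<le> B" and d: "expands m0 0 B d" and sd: "\<forall>M\<ge>m0. s (Suc M) - s M = d M / real M ^ (i + 2)" for s d B
  proof -
    have dB: "\<bar>d M\<bar> \<le> B" if "M \<ge> m0" for M using d that by (auto simp: expands_def)
    have "expands m0 (Suc i) (2 * B) s"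
    proof (rule expands_of_small_increments[OF m0])
      show "\<bar>s M\<bar> \<le> B" if "M \<ge> m0" for M using B that by blast
      show "\<bar>s (Suc M) - s M\<bar> \<le> B / real M ^ (i + 2)" if "M \<ge> m0" for M
        using dB[OF that] sd that by (simp add: divide_right_mono)
    qed
    then show ?thesis by simp
  qed
  then show ?case by (intro exI[of _ 2]) auto
next
  case (Suc N)
  define r where "r M = real M / (real M + 1)" for M
  have r: "nice m0 r" unfolding r_def[abs_def] by (rule nice_ratio[OF m0]) simp
  \<comment> \<open>\<open>e M / M\<^sup>i\<^sup>+\<^sup>3\<close> is the error made when \<open>M\<^sup>-\<^sup>i\<^sup>-\<^sup>2\<close> is replaced by a difference of \<open>M\<^sup>-\<^sup>i\<^sup>-\<^sup>1 / (i + 1)\<close>\<close>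
  define e where "e M = 1 / real (Suc i) * (\<Sum>t<Suc i. r M * (\<Sum>u<Suc t. r M ^ u))" for M
  have "nice m0 e" unfolding e_def[abs_def]
    by (intro nice_cmult nice_sum nice_mult nice_power m0 r)
  then obtain Ce where Ce: "Ce \<ge> 0" "expands m0 N Ce e" unfolding nice_def by blast
  obtain Cp where Cp: "Cp \<ge> 0" "expands m0 (N + Suc i + 1) Cp (\<lambda>M. (1 / real M) ^ Suc i)"
    using nice_power[OF m0 nice_inverse_M[OF m0]] unfolding nice_def by blast
  obtain C where C: "C \<ge> 0" "\<And>s d B. \<forall>M\<ge>m0. \<bar>s M\<bar> \<le> B \<Longrightarrow> expands m0 N B d \<Longrightarrow>
      \<forall>M\<ge>m0. s (Suc M) - s M = d M / real M ^ (Suc i + 2) \<Longrightarrow> expands m0 (N + Suc i + 1) (C * B) s"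
    using Suc.IH[of "Suc i"] by blast
  have "expands m0 (Suc N + i + 1) ((C * (Ce + 2) + Cp) * B) s"
    if B: "\<forall>M\<ge>m0. \<bar>s M\<bar> \<le> B" and d: "expands m0 (Suc N) B d"
      and sd: "\<forall>M\<ge>m0. s (Suc M) - s M = d M / real M ^ (i + 2)" for s d B
  proof -
    obtain a where ha0: "\<forall>j<Suc N. \<bar>a j\<bar> \<le> B"
      "\<forall>M\<ge>m0. \<bar>d M - (\<Sum>j<Suc N. a j / real M ^ j)\<bar> \<le> B / real M ^ Suc N"
    using d unfolding expands_def by (elim exE conjE)
  note a = ha0(1)[rule_format] ha0(2)[rule_format]
    have B0: "0 \<le> B" using a(1)[of 0] by force
    have a0: "\<bar>a 0\<bar> \<le> B" using a(1) by simp
    define d' where "d' M = real M * (d M - a 0)" for M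
    have d': "expands m0 N B d'"
    proof (rule expandsI[where a = "\<lambda>j. a (Suc j)"])
      fix M assume M: "M \<ge> m0"
      then have Mp: "real M > 0" using m0 by simp
      have "d' M - (\<Sum>j<N. a (Suc j) / real M ^ j) = real M * (d M - (\<Sum>j<Suc N. a j / real M ^ j))"
        using Mp unfolding sum.lessThan_Suc_shift d'_def by (simp add: algebra_simps sum_distrib_left)
      then have "\<bar>d' M - (\<Sum>j<N. a (Suc j) / real M ^ j)\<bar> = real M * \<bar>d M - (\<Sum>j<Suc N. a j / real M ^ j)\<bar>"
        by (simp add: abs_mult)
      also have "\<dots> \<le> real M * (B / real M ^ Suc N)" using a(2)[OF M] by (intro mult_left_mono) auto
      also have "\<dots> = B / real M ^ N" using Mp by simp
      finally show "\<bar>d' M - (\<Sum>j<N. a (Suc j) / real M ^ j)\<bar> \<le> B / real M ^ N" .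
    qed (use a(1) in auto)
    define s' where "s' M = s M + a 0 / real (Suc i) * (1 / real M) ^ Suc i" for M
    have "expands m0 (N + Suc i + 1) (C * ((Ce + 2) * B)) s'"
    proof (rule C(2))
      show "expands m0 N ((Ce + 2) * B) (\<lambda>M. a 0 * e M + d' M)"
      proof (rule expands_mono[OF expands_add[OF expands_cmult[OF Ce(2)] d']])
        show "\<bar>a 0\<bar> * Ce + B \<le> (Ce + 2) * B"
          using mult_right_mono[OF a0 Ce(1)] B0 by (simp add: algebra_simps)
      qed
      show "\<forall>M\<ge>m0. \<bar>s' M\<bar> \<le> (Ce + 2) * B"
      proof (intro allI impI)
        fix M assume M: "M \<ge> m0"
        then have M1: "1 \<le> real M" using m0 by simp
        have "1 / real (Suc i) * (1 / real M) ^ Suc i \<le> 1 * 1"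
          using M1 by (intro mult_mono power_le_one) auto
        then have "\<bar>a 0\<bar> * (1 / real (Suc i) * (1 / real M) ^ Suc i) \<le> B * 1"
          using a0 B0 M1 by (intro mult_mono) auto
        then have "\<bar>a 0 / real (Suc i) * (1 / real M) ^ Suc i\<bar> \<le> B" by (simp add: abs_mult)
        moreover have "\<bar>s M\<bar> \<le> B" using B M by blast
        ultimately have "\<bar>s' M\<bar> \<le> 2 * B" unfolding s'_def by linarith
        moreover have "0 \<le> Ce * B" using Ce B0 by simp
        ultimately show "\<bar>s' M\<bar> \<le> (Ce + 2) * B" by (simp add: distrib_right)
      qed
      show "\<forall>M\<ge>m0. s' (Suc M) - s' M = (a 0 * e M + d' M) / real M ^ (Suc i + 2)"
      proof (intro allI impI)
        fix M assume M: "M \<ge> m0"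
        then have Mp: "real M > 0" using m0 by simp
        have "1 - r M = 1 / (real M + 1)" by (simp add: r_def field_simps)
        moreover have "r M / real M = 1 / (real M + 1)" using Mp by (simp add: r_def)
        ultimately have q: "1 - r M = r M / real M" by simp
        have geo: "real M * (1 - r M ^ Suc t) = r M * (\<Sum>u<Suc t. r M ^ u)" for t
        proof -
          have "1 - r M ^ Suc t = (1 - r M) * (\<Sum>u<Suc t. r M ^ u)" by (rule one_diff_power_eq)
          then show ?thesis using Mp by (simp add: q)
        qed
        have tel: "(\<Sum>t<Suc i. 1 - r M ^ Suc t) = real (Suc i) - real M * (1 - r M ^ Suc i)"
        proof -
          have "(\<Sum>t<Suc i. r M ^ Suc t) = r M * (\<Sum>t<Suc i. r M ^ t)" by (simp only: sum_distrib_left power_Suc)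
          then show ?thesis using geo[of i] by (simp add: sum_subtractf)
        qed
        have "real (Suc i) * e M = (\<Sum>t<Suc i. real M * (1 - r M ^ Suc t))"
          unfolding e_def geo by simp
        also have "\<dots> = real M * (real (Suc i) - real M * (1 - r M ^ Suc i))"
          unfolding sum_distrib_left[symmetric] tel ..
        finally have eM: "real (Suc i) * e M = real M * (real (Suc i) - real M * (1 - r M ^ Suc i))" .
        have "1 / real (Suc M) = r M / real M" using Mp by (simp add: r_def add.commute)
        then have pw: "(1 / real (Suc M)) ^ Suc i = r M ^ Suc i / real M ^ Suc i" by (simp only: power_divide)
        have "s' (Suc M) - s' M = d M / real M ^ (i + 2) + a 0 / real (Suc i) * ((1 / real (Suc M)) ^ Suc i - (1 / real M) ^ Suc i)"
          using sd M by (simp add: s'_def right_diff_distrib del: power_Suc of_nat_Suc)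
        also have "(1 / real (Suc M)) ^ Suc i - (1 / real M) ^ Suc i = - (1 - r M ^ Suc i) / real M ^ Suc i"
          unfolding pw by (simp add: power_divide diff_divide_distrib del: power_Suc)
        also have "d M / real M ^ (i + 2) = (a 0 + d' M / real M) / real M ^ (i + 2)"
          using Mp by (simp add: d'_def)
        also have "(a 0 + d' M / real M) / real M ^ (i + 2) + a 0 / real (Suc i) * (- (1 - r M ^ Suc i) / real M ^ Suc i)
            = (a 0 / real (Suc i) * (real M * (real (Suc i) - real M * (1 - r M ^ Suc i))) + d' M) / real M ^ (Suc i + 2)"
          using Mp by (simp add: field_simps del: of_nat_Suc)
        also have "\<dots> = (a 0 * e M + d' M) / real M ^ (Suc i + 2)"
          unfolding eM[symmetric] by simp
        finally show "s' (Suc M) - s' M = (a 0 * e M + d' M) / real M ^ (Suc i + 2)" .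
      qed
    qed
    from expands_add[OF this expands_cmult[OF Cp(2), of "- a 0 / real (Suc i)"]]
    have "expands m0 (N + Suc i + 1) (C * ((Ce + 2) * B) + \<bar>- a 0 / real (Suc i)\<bar> * Cp) s"
      by (rule expands_cong) (simp add: s'_def)
    moreover have "\<bar>- a 0 / real (Suc i)\<bar> * Cp \<le> Cp * B"
    proof -
      have "\<bar>- a 0 / real (Suc i)\<bar> \<le> \<bar>a 0\<bar> / 1" unfolding abs_divide abs_minus_cancel
        by (intro divide_left_mono) auto
      then have "\<bar>- a 0 / real (Suc i)\<bar> \<le> B" using a0 by simp
      from mult_right_mono[OF this Cp(1)] show ?thesis by (simp add: mult.commute)
    qed
    ultimately have "expands m0 (N + Suc i + 1) (C * ((Ce + 2) * B) + Cp * B) s"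
      by (elim expands_mono) simp
    then show ?thesis by (simp add: algebra_simps)
  qed
  moreover have "0 \<le> C * (Ce + 2) + Cp" using C Ce Cp by simp
  ultimately show ?case by blast
qed

section \<open>Averages over compositions\<close>

text \<open>\<open>csum [v\<^sub>1, \<dots>, v\<^sub>p] L b F\<close> is the sum of \<open>F (b + c\<^sub>1 v\<^sub>1 + \<dots> + c\<^sub>p v\<^sub>p)\<close> over all natural numbers with
  \<open>c\<^sub>1 + \<dots> + c\<^sub>p = L\<close>, and \<open>ccnt p L\<close> is the number of terms.\<close>

fun csum :: "'v::real_vector list \<Rightarrow> nat \<Rightarrow> 'v \<Rightarrow> ('v \<Rightarrow> real) \<Rightarrow> real" where
  "csum [] L b F = (if L = 0 then F b else 0)"
| "csum (v # vs) L b F = (\<Sum>j\<le>L. csum vs (L - j) (b + real j *\<^sub>R v) F)"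

fun ccnt :: "nat \<Rightarrow> nat \<Rightarrow> real" where
  "ccnt 0 L = (if L = 0 then 1 else 0)"
| "ccnt (Suc p) L = (\<Sum>j\<le>L. ccnt p (L - j))"

lemma csum_const: "csum vs L b (\<lambda>x. c) = c * ccnt (length vs) L"
  by (induction vs arbitrary: L b) (simp_all add: sum_distrib_left)

lemma csum_add: "csum vs L b (\<lambda>x. F x + G x) = csum vs L b F + csum vs L b G"
  by (induction vs arbitrary: L b) (simp_all add: sum.distrib)

lemma csum_cmult: "csum vs L b (\<lambda>x. c * F x) = c * csum vs L b F"
  by (induction vs arbitrary: L b) (simp_all add: sum_distrib_left)

lemma csum_diff: "csum vs L b (\<lambda>x. F x - G x) = csum vs L b F - csum vs L b G"
  using csum_add[of vs L b F "\<lambda>x. (-1) * G x"] csum_cmult[of vs L b "-1" G] by simp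

lemma csum_sum: "csum vs L b (\<lambda>x. \<Sum>i\<in>I. F i x) = (\<Sum>i\<in>I. csum vs L b (F i))"
  by (induction I rule: infinite_finite_induct) (simp_all add: csum_add csum_const)

lemma csum_translate: "csum vs L (b + w) F = csum vs L b (\<lambda>x. F (x + w))"
proof (induction vs arbitrary: b L)
  case (Cons v vs)
  have "csum vs (L - j) (b + w + real j *\<^sub>R v) F = csum vs (L - j) (b + real j *\<^sub>R v) (\<lambda>x. F (x + w))" for j
    using Cons[of "L - j" "b + real j *\<^sub>R v"] by (simp add: add_ac)
  then show ?case by simp
qed simp

lemma sum_atMost_triangle:
  fixes f :: "nat \<Rightarrow> nat \<Rightarrow> real"
  shows "(\<Sum>i\<le>L. \<Sum>j\<le>L - i. f i j) = (\<Sum>j\<le>L. \<Sum>i\<le>L - j. f i j)"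
proof -
  have "(\<Sum>i\<le>L. \<Sum>j\<le>L - i. f i j) = (\<Sum>i\<le>L. \<Sum>j\<le>L. if i + j \<le> L then f i j else 0)"
    by (intro sum.cong refl sum.mono_neutral_cong_left) auto
  also have "\<dots> = (\<Sum>j\<le>L. \<Sum>i\<le>L. if i + j \<le> L then f i j else 0)" by (rule sum.swap)
  also have "\<dots> = (\<Sum>j\<le>L. \<Sum>i\<le>L - j. f i j)"
    by (intro sum.cong refl sum.mono_neutral_cong_right) auto
  finally show ?thesis .
qed

lemma sum_atMost_diagonal:
  fixes g :: "nat \<Rightarrow> real"
  shows "(\<Sum>i\<le>L. \<Sum>j\<le>L - i. g (i + j)) = (\<Sum>s\<le>L. real (Suc s) * g s)"
proof (induction L)
  case (Suc L)
  have "(\<Sum>i\<le>Suc L. \<Sum>j\<le>Suc L - i. g (i + j)) = (\<Sum>i\<le>L. (\<Sum>j\<le>L - i. g (i + j)) + g (Suc L)) + g (Suc L)"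
    by (simp add: Suc_diff_le)
  then show ?case using Suc by (simp add: sum.distrib algebra_simps)
qed simp

lemma sum_list_sum_swap:
  fixes f :: "'b \<Rightarrow> 'c \<Rightarrow> real"
  shows "(\<Sum>w\<leftarrow>ws. \<Sum>j\<in>J. f w j) = (\<Sum>j\<in>J. \<Sum>w\<leftarrow>ws. f w j)"
  by (induction ws) (simp_all add: sum.distrib)

lemma csum_swap: "csum (v # w # vs) L b F = csum (w # v # vs) L b F"
proof -
  have "csum (v # w # vs) L b F = (\<Sum>i\<le>L. \<Sum>j\<le>L - i. csum vs (L - i - j) (b + real i *\<^sub>R v + real j *\<^sub>R w) F)"
    by simp
  also have "\<dots> = (\<Sum>j\<le>L. \<Sum>i\<le>L - j. csum vs (L - i - j) (b + real i *\<^sub>R v + real j *\<^sub>R w) F)"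
    by (rule sum_atMost_triangle)
  also have "\<dots> = csum (w # v # vs) L b F"
    by (simp add: add_ac diff_right_commute)
  finally show ?thesis .
qed

lemma csum_dup: "csum (v # v # vs) L b F = (\<Sum>j\<le>L. real (Suc j) * csum vs (L - j) (b + real j *\<^sub>R v) F)"
proof -
  have "csum (v # v # vs) L b F = (\<Sum>i\<le>L. \<Sum>j\<le>L - i. csum vs (L - (i + j)) (b + real (i + j) *\<^sub>R v) F)"
    by (simp add: scaleR_add_left add_ac)
  also have "\<dots> = (\<Sum>j\<le>L. real (Suc j) * csum vs (L - j) (b + real j *\<^sub>R v) F)"
    by (rule sum_atMost_diagonal)
  finally show ?thesis .
qed

text \<open>Adding a ball to an urn: with \<open>c\<^sub>i + 1\<close> as weights, summing over the compositions of \<open>L\<close> amounts to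
  duplicating the \<open>i\<close>-th vector.\<close>

lemma csum_weight: "(\<Sum>v\<leftarrow>vs. csum (v # vs) L b F) = real (L + length vs) * csum vs L b F"
proof (induction vs arbitrary: L b)
  case (Cons v vs)
  have IH: "(\<Sum>w\<leftarrow>vs. csum (w # v # vs) L b F) = (\<Sum>j\<le>L. real (L - j + length vs) * csum vs (L - j) (b + real j *\<^sub>R v) F)"
  proof -
    have "(\<Sum>w\<leftarrow>vs. csum (w # v # vs) L b F) = (\<Sum>w\<leftarrow>vs. \<Sum>j\<le>L. csum (w # vs) (L - j) (b + real j *\<^sub>R v) F)"
      by (simp only: csum_swap[of _ v vs]) (simp only: csum.simps(2)[of v])
    also have "\<dots> = (\<Sum>j\<le>L. \<Sum>w\<leftarrow>vs. csum (w # vs) (L - j) (b + real j *\<^sub>R v) F)"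
      by (rule sum_list_sum_swap)
    finally show ?thesis by (simp only: Cons)
  qed
  have "(\<Sum>w\<leftarrow>v # vs. csum (w # v # vs) L b F)
    = (\<Sum>j\<le>L. (real (Suc j) + real (L - j + length vs)) * csum vs (L - j) (b + real j *\<^sub>R v) F)"
    unfolding list.map sum_list.Cons csum_dup IH by (simp only: sum.distrib distrib_right)
  also have "\<dots> = (\<Sum>j\<le>L. real (L + length (v # vs)) * csum vs (L - j) (b + real j *\<^sub>R v) F)"
    by (intro sum.cong refl) (simp add: of_nat_diff)
  finally show ?case by (simp only: csum.simps sum_distrib_left)
qed simp

text \<open>Counted with the weights \<open>c\<^sub>i + 1\<close>, enlarging the \<open>i\<close>-th part of the compositions \<open>c\<close> of \<open>L\<close> reaches each composition
  of \<open>L + 1\<close> exactly \<open>L + 1\<close> times.\<close>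

lemma csum_step: "(\<Sum>v\<leftarrow>vs. csum (v # vs) L (b + v) F) = real (Suc L) * csum vs (Suc L) b F"
proof (induction vs arbitrary: L b)
  case (Cons v vs)
  have IH: "(\<Sum>w\<leftarrow>vs. csum (w # v # vs) L (b + w) F) = (\<Sum>j\<le>Suc L. real (Suc L - j) * csum vs (Suc L - j) (b + real j *\<^sub>R v) F)"
  proof -
    have "(\<Sum>w\<leftarrow>vs. csum (w # v # vs) L (b + w) F) = (\<Sum>w\<leftarrow>vs. \<Sum>j\<le>L. csum (w # vs) (L - j) ((b + real j *\<^sub>R v) + w) F)"
      by (simp only: csum_swap[of _ v vs]) (simp only: csum.simps(2)[of v] add_ac)
    also have "\<dots> = (\<Sum>j\<le>L. \<Sum>w\<leftarrow>vs. csum (w # vs) (L - j) ((b + real j *\<^sub>R v) + w) F)"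
      by (rule sum_list_sum_swap)
    also have "\<dots> = (\<Sum>j\<le>L. real (Suc L - j) * csum vs (Suc L - j) (b + real j *\<^sub>R v) F)"
      unfolding Cons by (intro sum.cong refl) (simp add: Suc_diff_le)
    finally show ?thesis by simp
  qed
  have "csum (v # v # vs) L (b + v) F = (\<Sum>j\<le>L. real (Suc j) * csum vs (Suc L - Suc j) (b + real (Suc j) *\<^sub>R v) F)"
    unfolding csum_dup by (simp add: scaleR_add_left add_ac)
  also have "\<dots> = (\<Sum>j\<le>Suc L. real j * csum vs (Suc L - j) (b + real j *\<^sub>R v) F)"
    unfolding sum.atMost_Suc_shift by simp
  finally have 1: "csum (v # v # vs) L (b + v) F = (\<Sum>j\<le>Suc L. real j * csum vs (Suc L - j) (b + real j *\<^sub>R v) F)" .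
  have "(\<Sum>w\<leftarrow>v # vs. csum (w # v # vs) L (b + w) F)
    = (\<Sum>j\<le>Suc L. (real j + real (Suc L - j)) * csum vs (Suc L - j) (b + real j *\<^sub>R v) F)"
    unfolding list.map sum_list.Cons 1 IH by (simp only: sum.distrib distrib_right)
  also have "\<dots> = (\<Sum>j\<le>Suc L. real (Suc L) * csum vs (Suc L - j) (b + real j *\<^sub>R v) F)"
    by (intro sum.cong refl) (simp add: of_nat_diff)
  finally show ?case by (simp only: csum.simps sum_distrib_left)
qed simp

text \<open>The mean of the added vector, computed from the position \<open>x = b + \<Sum> c\<^sub>i v\<^sub>i\<close>.\<close>

lemma csum_position:
  fixes vs :: "(real^'n) list"
  shows "(\<Sum>v\<leftarrow>vs. v $ i * csum (v # vs) L b F)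
    = csum vs L b (\<lambda>x. (x $ i - b $ i + sum_list vs $ i) * F x)"
proof (induction vs arbitrary: L b)
  case (Cons v vs)
  let ?c = "\<lambda>j. csum vs (L - j) (b + real j *\<^sub>R v)"
  have IH: "(\<Sum>w\<leftarrow>vs. w $ i * csum (w # v # vs) L b F)
     = (\<Sum>j\<le>L. ?c j (\<lambda>x. (x $ i - (b + real j *\<^sub>R v) $ i + sum_list vs $ i) * F x))"
  proof -
    have "(\<Sum>w\<leftarrow>vs. w $ i * csum (w # v # vs) L b F) = (\<Sum>w\<leftarrow>vs. \<Sum>j\<le>L. w $ i * csum (w # vs) (L - j) (b + real j *\<^sub>R v) F)"
      by (simp only: csum_swap[of _ v vs]) (simp only: csum.simps(2)[of v] sum_distrib_left)
    also have "\<dots> = (\<Sum>j\<le>L. \<Sum>w\<leftarrow>vs. w $ i * csum (w # vs) (L - j) (b + real j *\<^sub>R v) F)"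
      by (rule sum_list_sum_swap)
    finally show ?thesis by (simp only: Cons)
  qed
  have "v $ i * csum (v # v # vs) L b F = (\<Sum>j\<le>L. ?c j (\<lambda>x. (real (Suc j) * v $ i) * F x))"
    unfolding csum_dup csum_cmult by (simp add: sum_distrib_left mult_ac)
  with IH have "(\<Sum>w\<leftarrow>v # vs. w $ i * csum (w # v # vs) L b F)
    = (\<Sum>j\<le>L. ?c j (\<lambda>x. (real (Suc j) * v $ i) * F x + (x $ i - (b + real j *\<^sub>R v) $ i + sum_list vs $ i) * F x))"
    by (simp only: list.map sum_list.Cons sum.distrib csum_add)
  also have "\<dots> = (\<Sum>j\<le>L. ?c j (\<lambda>x. (x $ i - b $ i + sum_list (v # vs) $ i) * F x))"
    by (intro sum.cong refl arg_cong[where f = "csum _ _ _"]) (simp add: algebra_simps fun_eq_iff)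
  finally show ?case by (simp only: csum.simps)
qed simp

lemma ccnt_weight: "real p * ccnt (Suc p) L = real (L + p) * ccnt p L"
  using csum_weight[where vs = "replicate p (0::real)" and F = "\<lambda>_. 1" and b = 0 and L = L]
  by (simp only: csum_const) (simp add: sum_list_replicate del: ccnt.simps)

lemma ccnt_step: "real p * ccnt (Suc p) L = real (Suc L) * ccnt p (Suc L)"
  using csum_step[where vs = "replicate p (0::real)" and F = "\<lambda>_. 1" and b = 0 and L = L]
  by (simp only: csum_const) (simp add: sum_list_replicate del: ccnt.simps)

lemma ccnt_pos: "0 < p \<Longrightarrow> 0 < ccnt p L"
proof (induction p arbitrary: L)
  case (Suc p)
  show ?case
  proof (cases p)
    case 0
    have "ccnt (Suc 0) L = (\<Sum>j\<le>L. if j = L then 1 else 0)"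
      unfolding ccnt.simps by (intro sum.cong refl) auto
    then show ?thesis using 0 by simp
  next
    case (Suc q)
    then have "0 < ccnt p (L - j)" for j using Suc.IH by (simp del: ccnt.simps)
    then show ?thesis unfolding ccnt.simps by (intro sum_pos) auto
  qed
qed simp

lemma power2_div_power: "real M > 0 \<Longrightarrow> (real M)\<^sup>2 * (1 / (real M + 1) ^ (l + 2)) = (real M / (real M + 1)) ^ (l + 2) / real M ^ l"
  by (simp add: power_divide power_add power2_eq_square)

text \<open>\<open>ccnt (q + 1) L\<close> is a polynomial in \<open>L\<close> of degree \<open>q\<close>.\<close>

lemma nice_ccnt:
  assumes m0: "0 < m0" and h: "h \<le> m0"
  shows "nice m0 (\<lambda>M. ccnt (Suc q) (M - h) / real M ^ q)"
proof (induction q)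
  case 0
  have "ccnt (Suc 0) L = 1" for L
  proof -
    have "ccnt (Suc 0) L = (\<Sum>j\<le>L. if j = L then 1 else 0)"
      unfolding ccnt.simps by (intro sum.cong refl) auto
    then show ?thesis by simp
  qed
  then show ?case using nice_const[of m0 1] by (simp del: ccnt.simps)
next
  case (Suc q)
  have "nice m0 (\<lambda>M. 1 / real (Suc q) * (1 + (real (Suc q) - real h) * (1 / real M)) * (ccnt (Suc q) (M - h) / real M ^ q))"
    by (intro nice_mult[OF m0] nice_add nice_const nice_cmult nice_inverse_M[OF m0] Suc)
  then show ?case
  proof (rule nice_cong)
    fix M assume M: "M \<ge> m0"
    then have Mp: "real M > 0" and L: "real (M - h) = real M - real h" using m0 h by (auto simp: of_nat_diff)
    have "ccnt (Suc (Suc q)) (M - h) = (real M - real h + real (Suc q)) / real (Suc q) * ccnt (Suc q) (M - h)"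
      using ccnt_weight[of "Suc q" "M - h"] L by (simp del: ccnt.simps add: field_simps)
    moreover have "(1 + (real (Suc q) - real h) * (1 / real M)) = (real M - real h + real (Suc q)) / real M"
      using Mp by (simp add: field_simps)
    ultimately have "1 / real (Suc q) * (1 + (real (Suc q) - real h) * (1 / real M)) * (ccnt (Suc q) (M - h) / real M ^ q)
        = 1 / real (Suc q) * ((real M - real h + real (Suc q)) / real M) * (ccnt (Suc q) (M - h) / real M ^ q)"
      "ccnt (Suc (Suc q)) (M - h) / real M ^ Suc q = (real M - real h + real (Suc q)) / real (Suc q) * ccnt (Suc q) (M - h) / real M ^ Suc q"
      by (simp_all only:)
    then show "1 / real (Suc q) * (1 + (real (Suc q) - real h) * (1 / real M)) * (ccnt (Suc q) (M - h) / real M ^ q)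
      = ccnt (Suc (Suc q)) (M - h) / real M ^ Suc q"
      by (simp add: mult_ac del: ccnt.simps of_nat_Suc)
  qed
qed

context convex_body
begin

text \<open>At height \<open>0\<close> this is \<open>{0}\<close>, which a division by \<open>h\<close> could not express.\<close>

definition "scal h = {real h *\<^sub>R y | y. y \<in> P}"

lemma scal_add:
  assumes "b \<in> scal h" "w \<in> P" shows "b + real j *\<^sub>R w \<in> scal (h + j)"
proof (cases "h + j = 0")
  case False
  obtain y where y: "b = real h *\<^sub>R y" "y \<in> P" using assms(1) by (auto simp: scal_def)
  have p: "real (h + j) > 0" using False by linarith
  let ?z = "(real h / real (h + j)) *\<^sub>R y + (real j / real (h + j)) *\<^sub>R w"
  have "?z \<in> P"
    using p by (intro convexD[OF convex_P y(2) assms(2)]) (auto simp: add_divide_distrib[symmetric])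
  moreover have "b + real j *\<^sub>R w = real (h + j) *\<^sub>R ?z"
    using p unfolding y(1) by (simp add: scaleR_add_right del: of_nat_add)
  ultimately show ?thesis unfolding scal_def by blast
qed (use assms in simp)

lemma scal_point: "x \<in> scal M \<Longrightarrow> M > 0 \<Longrightarrow> (1 / real M) *\<^sub>R x \<in> P"
  by (auto simp: scal_def)

lemma csum_bound:
  assumes "b \<in> scal h" "set vs \<subseteq> P" "\<And>x. x \<in> scal (h + L) \<Longrightarrow> \<bar>F x\<bar> \<le> B"
  shows "\<bar>csum vs L b F\<bar> \<le> B * ccnt (length vs) L"
  using assms
proof (induction vs arbitrary: b h L)
  case (Cons w vs)
  have "\<bar>csum vs (L - j) (b + real j *\<^sub>R w) F\<bar> \<le> B * ccnt (length vs) (L - j)" if "j \<le> L" for j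
    using Cons.prems that by (intro Cons.IH[of _ "h + j"] scal_add) auto
  then have "\<bar>csum (w # vs) L b F\<bar> \<le> (\<Sum>j\<le>L. B * ccnt (length vs) (L - j))"
    unfolding csum.simps by (intro order_trans[OF sum_abs] sum_mono) auto
  then show ?case by (simp add: sum_distrib_left)
qed auto

text \<open>The total weight of \<open>b + \<Sum> c\<^sub>i v\<^sub>i\<close> is \<open>h + (M - h) = M\<close> if \<open>b\<close> lies at height \<open>h\<close>. Division by \<open>M\<close> gives a point of \<open>P\<close>.\<close>

definition av :: "(real^'n) list \<Rightarrow> real^'n \<Rightarrow> nat \<Rightarrow> nat \<Rightarrow> (real^'n \<Rightarrow> real) \<Rightarrow> real" where
  "av vs b h M g = csum vs (M - h) b (\<lambda>x. g ((1 / real M) *\<^sub>R x)) / ccnt (length vs) (M - h)"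

lemma av_add: "av vs b h M (\<lambda>y. f y + g y) = av vs b h M f + av vs b h M g"
  by (simp add: av_def csum_add add_divide_distrib)

lemma av_cmult: "av vs b h M (\<lambda>y. c * g y) = c * av vs b h M g"
  by (simp add: av_def csum_cmult)

lemma av_sum: "av vs b h M (\<lambda>y. \<Sum>i\<in>I. f i y) = (\<Sum>i\<in>I. av vs b h M (f i))"
  by (simp add: av_def csum_sum sum_divide_distrib)

lemma av_bound:
  assumes b: "b \<in> scal h" and vs: "set vs \<subseteq> P" "vs \<noteq> []" and M: "h \<le> M" "0 < M"
    and B: "\<And>y. y \<in> P \<Longrightarrow> \<bar>g y\<bar> \<le> B"
  shows "\<bar>av vs b h M g\<bar> \<le> B"
proof -
  have "\<bar>csum vs (M - h) b (\<lambda>x. g ((1 / real M) *\<^sub>R x))\<bar> \<le> B * ccnt (length vs) (M - h)"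
    by (rule csum_bound[OF b vs(1)]) (use M B scal_point in auto)
  moreover have "0 < ccnt (length vs) (M - h)" using vs(2) by (intro ccnt_pos) auto
  ultimately show ?thesis by (simp add: av_def abs_divide pos_divide_le_eq)
qed

text \<open>One step of the urn: the new point is \<open>y + (w - y) / (M + 1)\<close> if \<open>w\<close> is added at \<open>y\<close>.\<close>

lemma av_step:
  assumes vs: "vs \<noteq> []" and M: "h \<le> M" "0 < M"
  shows "av vs b h (Suc M) g
    = (1 / real (length vs)) * (\<Sum>w\<leftarrow>vs. av (w # vs) b h M (\<lambda>y. g (y + (1 / (real M + 1)) *\<^sub>R (w - y))))"
proof -
  define L where "L = M - h"
  define F where "F x = g ((1 / real (Suc M)) *\<^sub>R x)" for x
  let ?p = "real (length vs)"
  have p: "?p > 0" using vs by simp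
  have SL: "Suc M - h = Suc L" using M by (simp add: L_def)
  have pt: "F (x + w) = g ((1 / real M) *\<^sub>R x + (1 / (real M + 1)) *\<^sub>R (w - (1 / real M) *\<^sub>R x))" for x w
  proof -
    have "(1 / real M) *\<^sub>R x + (1 / (real M + 1)) *\<^sub>R (w - (1 / real M) *\<^sub>R x)
      = (1 / real M - (1 / (real M + 1)) * (1 / real M)) *\<^sub>R x + (1 / (real M + 1)) *\<^sub>R w"
      by (simp add: scaleR_diff_right scaleR_diff_left)
    also have "1 / real M - (1 / (real M + 1)) * (1 / real M) = 1 / (real M + 1)"
    proof -
      have "real M > 0" using M by simp
      then have "real M \<noteq> 0" "real M + 1 \<noteq> 0" by linarith+
      then show ?thesis by (simp add: divide_simps)
    qed
    finally show ?thesis by (simp add: F_def scaleR_add_right add.commute)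
  qed
  have "(\<Sum>w\<leftarrow>vs. av (w # vs) b h M (\<lambda>y. g (y + (1 / (real M + 1)) *\<^sub>R (w - y))))
     = (\<Sum>w\<leftarrow>vs. csum (w # vs) L (b + w) F / ccnt (Suc (length vs)) L)"
    unfolding av_def L_def[symmetric] csum_translate pt by simp
  also have "\<dots> = (\<Sum>w\<leftarrow>vs. csum (w # vs) L (b + w) F) / ccnt (Suc (length vs)) L"
    by (simp only: divide_inverse sum_list_mult_const)
  also have "\<dots> = real (Suc L) * csum vs (Suc L) b F / ccnt (Suc (length vs)) L"
    by (simp only: csum_step)
  also have "ccnt (Suc (length vs)) L = real (Suc L) * ccnt (length vs) (Suc L) / ?p"
    using ccnt_step[of "length vs" L] p by (simp only: eq_divide_eq) (simp add: mult.commute del: ccnt.simps)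
  also have "real (Suc L) * csum vs (Suc L) b F / (real (Suc L) * ccnt (length vs) (Suc L) / ?p)
     = ?p * (csum vs (Suc L) b F / ccnt (length vs) (Suc L))"
    using p by (simp del: csum.simps ccnt.simps of_nat_Suc)
  finally have S: "(\<Sum>w\<leftarrow>vs. av (w # vs) b h M (\<lambda>y. g (y + (1 / (real M + 1)) *\<^sub>R (w - y))))
    = ?p * (csum vs (Suc L) b F / ccnt (length vs) (Suc L))" .
  have "av vs b h (Suc M) g = csum vs (Suc L) b F / ccnt (length vs) (Suc L)"
    unfolding av_def SL F_def ..
  then show ?thesis unfolding S using p by simp
qed

lemma av_same:
  assumes vs: "vs \<noteq> []"
  shows "av vs b h M g = (1 / real (length vs)) * (\<Sum>w\<leftarrow>vs. av (w # vs) b h M g)"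
proof -
  define L where "L = M - h"
  define F where "F x = g ((1 / real M) *\<^sub>R x)" for x
  let ?p = "real (length vs)"
  have p: "?p > 0" using vs by simp
  have q: "real (L + length vs) > 0" using p unfolding of_nat_add by linarith
  have "(\<Sum>w\<leftarrow>vs. av (w # vs) b h M g) = (\<Sum>w\<leftarrow>vs. csum (w # vs) L b F) / ccnt (Suc (length vs)) L"
    unfolding av_def L_def[symmetric] F_def[symmetric] by (simp only: divide_inverse sum_list_mult_const length_Cons)
  also have "\<dots> = real (L + length vs) * csum vs L b F / ccnt (Suc (length vs)) L"
    by (simp only: csum_weight)
  also have "ccnt (Suc (length vs)) L = real (L + length vs) * ccnt (length vs) L / ?p"
    using ccnt_weight[of "length vs" L] p by (simp only: eq_divide_eq) (simp add: mult.commute del: ccnt.simps)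
  also have "real (L + length vs) * csum vs L b F / (real (L + length vs) * ccnt (length vs) L / ?p)
     = ?p * (csum vs L b F / ccnt (length vs) L)"
    using p q by (simp del: csum.simps ccnt.simps of_nat_add)
  finally have S: "(\<Sum>w\<leftarrow>vs. av (w # vs) b h M g) = ?p * (csum vs L b F / ccnt (length vs) L)" .
  have "av vs b h M g = csum vs L b F / ccnt (length vs) L"
    unfolding av_def L_def F_def ..
  then show ?thesis unfolding S using p by simp
qed

text \<open>The term of degree \<open>l\<close> in the Taylor expansion of \<open>g\<close> at \<open>y\<close> in direction \<open>w - y\<close>, as an operator on \<open>g\<close>.\<close>

definition tay :: "nat \<Rightarrow> real^'n \<Rightarrow> (real^'n \<Rightarrow> real) \<Rightarrow> real^'n \<Rightarrow> real" where
  "tay l w g y = (\<Sum>is\<in>words l. (mon is y w / fact l) * Ds is g y)"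

text \<open>The derivative of \<open>g\<close> along the expected displacement of the urn at \<open>y\<close>, up to the factor computed in
  \<open>av_drift\<close>.\<close>

definition drift :: "(real^'n) list \<Rightarrow> real^'n \<Rightarrow> nat \<Rightarrow> (real^'n \<Rightarrow> real) \<Rightarrow> real^'n \<Rightarrow> real" where
  "drift vs b h g y = (\<Sum>i\<in>UNIV. (sum_list vs $ i - b $ i + (real h - real (length vs)) * y $ i) * D i g y)"

lemma tay_0: "tay 0 w g y = g y"
  by (simp add: tay_def words_0)

lemma tay_1: "tay (Suc 0) w g y = (\<Sum>i\<in>UNIV. (w $ i - y $ i) * D i g y)"
  unfolding tay_def sum_words_Suc by (simp add: words_0)

text \<open>The first-order drift of the urn is itself of order \<open>1/M\<close>, because on average the added ball has
  the current composition.\<close>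

lemma av_drift:
  assumes vs: "vs \<noteq> []" and M: "h \<le> M" "0 < M"
  shows "(1 / real (length vs)) * (\<Sum>w\<leftarrow>vs. av (w # vs) b h M (tay (Suc 0) w g))
    = av vs b h M (drift vs b h g) / (real M + (real (length vs) - real h))"
proof -
  define L where "L = M - h"
  define F where "F i x = D i g ((1 / real M) *\<^sub>R x)" for i x
  let ?p = "length vs"
  have p: "real ?p > 0" using vs by simp
  have q: "real (L + ?p) > 0" using p unfolding of_nat_add by linarith
  have Lp: "real (L + ?p) = real M + (real ?p - real h)" using M by (simp add: L_def of_nat_diff)
  define e where "e i w = csum (w # vs) L b (\<lambda>x. (x $ i / real M) * F i x)" for i w
  have "csum (w # vs) L b (\<lambda>x. tay (Suc 0) w g ((1 / real M) *\<^sub>R x)) = (\<Sum>i\<in>UNIV. w $ i * csum (w # vs) L b (F i) - e i w)" for w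
  proof -
    have "csum (w # vs) L b (\<lambda>x. tay (Suc 0) w g ((1 / real M) *\<^sub>R x))
        = csum (w # vs) L b (\<lambda>x. \<Sum>i\<in>UNIV. w $ i * F i x - (x $ i / real M) * F i x)"
      by (simp add: tay_1 F_def left_diff_distrib)
    also have "\<dots> = (\<Sum>i\<in>UNIV. w $ i * csum (w # vs) L b (F i) - e i w)"
      by (simp only: csum_sum csum_diff csum_cmult e_def)
    finally show ?thesis .
  qed
  then have "(\<Sum>w\<leftarrow>vs. csum (w # vs) L b (\<lambda>x. tay (Suc 0) w g ((1 / real M) *\<^sub>R x)))
     = (\<Sum>i\<in>UNIV. \<Sum>w\<leftarrow>vs. w $ i * csum (w # vs) L b (F i) - e i w)"
    by (simp only: sum_list_sum_swap)
  also have "\<dots> = (\<Sum>i\<in>UNIV. (\<Sum>w\<leftarrow>vs. w $ i * csum (w # vs) L b (F i)) - (\<Sum>w\<leftarrow>vs. e i w))"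
    by (simp only: sum_list_subtractf)
  also have "\<dots> = (\<Sum>i\<in>UNIV. csum vs L b (\<lambda>x. (x $ i - b $ i + sum_list vs $ i) * F i x)
        - real (L + ?p) * csum vs L b (\<lambda>x. (x $ i / real M) * F i x))"
    by (simp only: csum_position csum_weight e_def)
  also have "\<dots> = csum vs L b (\<lambda>x. \<Sum>i\<in>UNIV. (x $ i - b $ i + sum_list vs $ i) * F i x - real (L + ?p) * ((x $ i / real M) * F i x))"
    by (simp only: csum_sum csum_diff csum_cmult)
  also have "\<dots> = csum vs L b (\<lambda>x. drift vs b h g ((1 / real M) *\<^sub>R x))"
  proof (rule arg_cong[where f = "csum vs L b"], rule ext)
    fix x
    have "(x $ i - b $ i + sum_list vs $ i) * F i x - real (L + ?p) * ((x $ i / real M) * F i x)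
      = (sum_list vs $ i - b $ i + (real h - real ?p) * ((1 / real M) *\<^sub>R x) $ i) * F i x" for i
    proof -
      have xM: "x $ i = real M * (x $ i / real M)" using M by simp
      have "real M * z - (real M + (real ?p - real h)) * z = (real h - real ?p) * z" for z
        by (simp add: algebra_simps)
      from this[of "x $ i / real M"] have "x $ i - real (L + ?p) * (x $ i / real M) = (real h - real ?p) * (x $ i / real M)"
        unfolding Lp xM[symmetric] .
      then have "(x $ i - b $ i + sum_list vs $ i) - real (L + ?p) * (x $ i / real M)
         = sum_list vs $ i - b $ i + (real h - real ?p) * (x $ i / real M)" by linarith
      then have "((x $ i - b $ i + sum_list vs $ i) - real (L + ?p) * (x $ i / real M)) * F i x
         = (sum_list vs $ i - b $ i + (real h - real ?p) * (x $ i / real M)) * F i x" by (rule arg_cong)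
      then show ?thesis
        by (simp only: left_diff_distrib mult.assoc vector_scaleR_component real_scaleR_def mult_1_left times_divide_eq_left)
    qed
    then show "(\<Sum>i\<in>UNIV. (x $ i - b $ i + sum_list vs $ i) * F i x - real (L + ?p) * ((x $ i / real M) * F i x))
       = drift vs b h g ((1 / real M) *\<^sub>R x)" unfolding drift_def F_def by simp
  qed
  finally have 1: "(\<Sum>w\<leftarrow>vs. csum (w # vs) L b (\<lambda>x. tay (Suc 0) w g ((1 / real M) *\<^sub>R x)))
     = csum vs L b (\<lambda>x. drift vs b h g ((1 / real M) *\<^sub>R x))" .
  have "(\<Sum>w\<leftarrow>vs. av (w # vs) b h M (tay (Suc 0) w g))
     = csum vs L b (\<lambda>x. drift vs b h g ((1 / real M) *\<^sub>R x)) / ccnt (Suc ?p) L"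
    unfolding av_def L_def[symmetric] 1[symmetric] by (simp only: divide_inverse sum_list_mult_const length_Cons)
  also have "ccnt (Suc ?p) L = real (L + ?p) * ccnt ?p L / real ?p"
    using ccnt_weight[of ?p L] p by (simp only: eq_divide_eq) (simp add: mult.commute del: ccnt.simps)
  finally have 2: "(\<Sum>w\<leftarrow>vs. av (w # vs) b h M (tay (Suc 0) w g))
     = csum vs L b (\<lambda>x. drift vs b h g ((1 / real M) *\<^sub>R x)) / (real (L + ?p) * ccnt ?p L / real ?p)" .
  have 3: "av vs b h M (drift vs b h g) = csum vs L b (\<lambda>x. drift vs b h g ((1 / real M) *\<^sub>R x)) / ccnt ?p L"
    unfolding av_def L_def ..
  show ?thesis unfolding 2 3 Lp[symmetric]
    using p q by (simp del: csum.simps ccnt.simps of_nat_add)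
qed

lemma mon_smooth_left: "(\<lambda>y. mon is y w) \<in> CP"
proof (induction "is")
  case Nil
  show ?case by (rule smooth_upto_cong[OF smooth_upto_const[of 1]]) simp
next
  case (Cons i "is")
  have "(\<lambda>y. (w $ i - y $ i) * mon is y w) \<in> CP"
    by (intro smooth_upto_mult smooth_upto_diff smooth_upto_coord smooth_upto_const Cons)
  then show ?case by (rule smooth_upto_cong) simp
qed

lemma bop_tay: "bop (tay l w)"
proof -
  have "(\<lambda>y. mon is y w / fact l) \<in> CP" for "is"
    using smooth_upto_cmult[OF mon_smooth_left, of "1 / fact l" "is" w] by simp
  then show ?thesis unfolding tay_def[abs_def] by (intro bop_sum bop_comp[OF bop_mult bop_pds])
qed

lemma bop_drift: "bop (drift vs b h)"
  unfolding drift_def[abs_def]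
  by (intro bop_sum bop_comp[OF bop_mult bop_pd] smooth_upto_add smooth_upto_const smooth_upto_cmult smooth_upto_coord)

lemma mon_scale: "mon is y (y + c *\<^sub>R (w - y)) = c ^ length is * mon is y w"
  by (induction "is") (simp_all add: algebra_simps)

lemma urn_taylor:
  assumes m: "0 < m"
  shows "\<exists>W\<ge>0. \<forall>g\<in>CP. \<forall>y\<in>P. \<forall>w\<in>P. \<forall>c\<in>{0..1}.
    \<bar>g (y + c *\<^sub>R (w - y)) - (\<Sum>l<m. c ^ l * tay l w g y)\<bar> \<le> W * nrm m g * c ^ m"
proof -
  obtain r where r: "\<And>y. y \<in> P \<Longrightarrow> norm y \<le> r"
    using compact_imp_bounded[OF compact_P] unfolding bounded_iff by blast
  define W where "W = real (card (words m :: 'n list set)) * (2 * \<bar>r\<bar>) ^ m"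
  have "\<bar>g (y + c *\<^sub>R (w - y)) - (\<Sum>l<m. c ^ l * tay l w g y)\<bar> \<le> W * nrm m g * c ^ m"
    if g: "g \<in> CP" and y: "y \<in> P" and w: "w \<in> P" and c: "c \<in> {0..1}" for g y w c
  proof -
    let ?z = "y + c *\<^sub>R (w - y)"
    have z: "?z \<in> P" by (rule segment_in_P[OF y w c])
    have t: "taylor_poly m g y ?z = (\<Sum>l<m. c ^ l * tay l w g y)"
      unfolding taylor_poly_def tay_def mon_scale sum_distrib_left sum_divide_distrib
      by (intro sum.cong refl) (simp add: words_def)
    have mb: "\<bar>mon is y ?z\<bar> \<le> c ^ m * (2 * \<bar>r\<bar>) ^ m" if "is \<in> words m" for "is"
    proof -
      have "\<bar>w $ i - y $ i\<bar> \<le> 2 * \<bar>r\<bar>" for i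
        using component_le_norm_cart[of w i] component_le_norm_cart[of y i] r[OF w] r[OF y] by linarith
      from mon_bound[OF this, of "is"] that have "\<bar>mon is y w\<bar> \<le> (2 * \<bar>r\<bar>) ^ m" by (simp add: words_def)
      then show ?thesis using that c unfolding mon_scale by (simp add: words_def abs_mult mult_left_mono)
    qed
    have "\<bar>g ?z - taylor_poly m g y ?z\<bar> \<le> nrm m g * (\<Sum>is\<in>words m. \<bar>mon is y ?z\<bar>)"
      by (rule taylor[OF g y z m])
    also have "\<dots> \<le> nrm m g * (\<Sum>is\<in>(words m :: 'n list set). c ^ m * (2 * \<bar>r\<bar>) ^ m)"
      using mb nrm_nonneg[OF g] by (intro mult_left_mono sum_mono) auto
    finally show ?thesis unfolding t W_def by (simp add: mult_ac)
  qed
  moreover have "0 \<le> W" by (simp add: W_def)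
  ultimately show ?thesis by blast
qed

text \<open>The averages change only by \<open>O(M\<^sup>-\<^sup>2)\<close> from \<open>M\<close> to \<open>M + 1\<close>, and the change is again expressed by such
  averages; hence an expansion up to order \<open>N\<close> can be summed to one of order \<open>N + 1\<close>.\<close>

lemma av_expansion:
  assumes b: "b \<in> scal h" and m0: "m0 = max 1 h"
  shows "\<forall>vs. vs \<noteq> [] \<longrightarrow> set vs \<subseteq> P \<longrightarrow>
    (\<exists>C m. 0 \<le> C \<and> (\<forall>g\<in>CP. expands m0 N (C * nrm m g) (\<lambda>M. av vs b h M g)))"
proof (induction N)
  case 0
  show ?case
  proof (intro allI impI)
    fix vs assume vs: "vs \<noteq> []" "set vs \<subseteq> P"
    have "expands m0 0 (1 * nrm 0 g) (\<lambda>M. av vs b h M g)" if g: "g \<in> CP" for g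
    proof (rule expands_bounded)
      fix M assume "m0 \<le> M"
      then have M: "h \<le> M" "0 < M" using m0 by auto
      show "\<bar>av vs b h M g\<bar> \<le> 1 * nrm 0 g / real M ^ 0"
        using av_bound[OF b vs(2,1) M, of g "nrm 0 g"] nrm_val[OF g] by simp
    qed (simp add: nrm_nonneg g)
    then show "\<exists>C m. 0 \<le> C \<and> (\<forall>g\<in>CP. expands m0 0 (C * nrm m g) (\<lambda>M. av vs b h M g))"
      by (intro exI[of _ 1] exI[of _ 0]) simp
  qed
next
  case (Suc N)
  have m0p: "0 < m0" using m0 by simp
  have IH: "\<exists>C m. 0 \<le> C \<and> (\<forall>g\<in>CP. expands m0 N (C * nrm m g) (\<lambda>M. av vs b h M (S g)))"
    if vs: "vs \<noteq> []" "set vs \<subseteq> P" and S: "bop S" for vs S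
  proof -
    obtain C m where C: "0 \<le> C" "\<forall>g\<in>CP. expands m0 N (C * nrm m g) (\<lambda>M. av vs b h M g)"
      using Suc vs by blast
    obtain m' C' where C': "0 \<le> C'" "\<forall>g\<in>CP. nrm m (S g) \<le> C' * nrm m' g" using bop_bound[OF S] by blast
    have "expands m0 N ((C * C') * nrm m' g) (\<lambda>M. av vs b h M (S g))" if g: "g \<in> CP" for g
    proof (rule expands_mono)
      show "expands m0 N (C * nrm m (S g)) (\<lambda>M. av vs b h M (S g))" using C(2) bop_CP[OF S g] by blast
      show "C * nrm m (S g) \<le> (C * C') * nrm m' g"
        using mult_left_mono[OF C'(2)[rule_format, OF g] C(1)] by (simp add: mult.assoc)
    qed
    then show ?thesis using C C' by (intro exI[of _ "C * C'"] exI[of _ m']) simp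
  qed
  show ?case
  proof (intro allI impI)
    fix vs assume vs: "vs \<noteq> []" "set vs \<subseteq> P"
    let ?p = "length vs"
    define m where "m = N + 2"
    define r1 where "r1 M = real M / (real M + 1)" for M
    define r2 where "r2 M = real M / (real M + (real ?p - real h))" for M
    have r1: "nice m0 r1" unfolding r1_def[abs_def] by (rule nice_ratio[OF m0p]) simp
    have r2: "nice m0 r2" unfolding r2_def[abs_def]
    proof (rule nice_ratio[OF m0p])
      fix M assume "M \<ge> m0"
      moreover have "1 \<le> real ?p" using vs(1) by (cases vs) auto
      ultimately show "1 \<le> real M + (real ?p - real h)" using m0 by simp
    qed
    obtain Cd md where Cd: "0 \<le> Cd" "\<forall>g\<in>CP. expands m0 N (Cd * nrm md g) (\<lambda>M. av vs b h M (drift vs b h g))"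
      using IH[OF vs bop_drift] by blast
    have "\<forall>w\<in>set vs. \<forall>l. \<exists>C m. 0 \<le> C \<and> (\<forall>g\<in>CP. expands m0 N (C * nrm m g) (\<lambda>M. av (w # vs) b h M (tay l w g)))"
    proof (intro ballI allI)
      fix w l assume "w \<in> set vs"
      then show "\<exists>C m. 0 \<le> C \<and> (\<forall>g\<in>CP. expands m0 N (C * nrm m g) (\<lambda>M. av (w # vs) b h M (tay l w g)))"
        using vs by (intro IH[OF _ _ bop_tay]) auto
    qed
    then obtain Ct mt where Ct: "\<And>w l. w \<in> set vs \<Longrightarrow> 0 \<le> Ct w l"
      "\<And>w l g. w \<in> set vs \<Longrightarrow> g \<in> CP \<Longrightarrow> expands m0 N (Ct w l * nrm (mt w l) g) (\<lambda>M. av (w # vs) b h M (tay l w g))"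
      by metis
    obtain W where W: "0 \<le> W" "\<forall>g\<in>CP. \<forall>y\<in>P. \<forall>w\<in>P. \<forall>c\<in>{0..1}.
        \<bar>g (y + c *\<^sub>R (w - y)) - (\<Sum>l<m. c ^ l * tay l w g y)\<bar> \<le> W * nrm m g * c ^ m"
      using urn_taylor[of m] unfolding m_def by auto
    obtain C12 where C12: "0 \<le> C12" "\<And>s B. 0 \<le> B \<Longrightarrow> expands m0 N B s \<Longrightarrow> expands m0 N (C12 * B) (\<lambda>M. (r1 M * r2 M) * s M)"
      using expands_mult_nice[OF nice_mult[OF m0p r1 r2] m0p, of N] by blast
    have "\<exists>C\<ge>0. \<forall>s B. 0 \<le> B \<longrightarrow> expands m0 N B s \<longrightarrow> expands m0 N (C * B) (\<lambda>M. (r1 M ^ (l + 2) * (1 / real M) ^ l) * s M)" for l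
      by (rule expands_mult_nice[OF nice_mult[OF m0p nice_power[OF m0p r1] nice_power[OF m0p nice_inverse_M[OF m0p]]] m0p])
    then obtain Cl where Cl: "\<And>l. 0 \<le> Cl l" "\<And>l s B. 0 \<le> B \<Longrightarrow> expands m0 N B s \<Longrightarrow>
        expands m0 N (Cl l * B) (\<lambda>M. (r1 M ^ (l + 2) * (1 / real M) ^ l) * s M)" by metis
    obtain Cs where Cs: "0 \<le> Cs" "\<And>s d B. \<forall>M\<ge>m0. \<bar>s M\<bar> \<le> B \<Longrightarrow> expands m0 N B d \<Longrightarrow>
      \<forall>M\<ge>m0. s (Suc M) - s M = d M / real M ^ (0 + 2) \<Longrightarrow> expands m0 (N + 0 + 1) (Cs * B) s"
      using expands_summation[OF m0p, of N 0] by blast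
    \<comment> \<open>the order of the norm that dominates all those that occur\<close>
    define X where "X = insert md (insert m ((\<lambda>(w, l). mt w (l + 2)) ` (set vs \<times> {..<N})))"
    define q where "q = Max X"
    have fX: "finite X" by (simp add: X_def)
    have q: "md \<le> q" "m \<le> q" "\<And>w l. w \<in> set vs \<Longrightarrow> l < N \<Longrightarrow> mt w (l + 2) \<le> q"
      unfolding q_def by (rule Max_ge[OF fX], force simp: X_def)+
    define Ctot where "Ctot = C12 * Cd + (\<Sum>l<N. Cl l * (1 / real ?p * (\<Sum>w\<leftarrow>vs. Ct w (l + 2)))) + W + 1"
    have sl0: "0 \<le> (\<Sum>w\<leftarrow>vs. Ct w l)" for l using Ct(1) by (intro sum_list_nonneg) auto
    have Ctot: "0 \<le> Ctot" "1 \<le> Ctot"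
    proof -
      have "0 \<le> C12 * Cd" using C12 Cd by simp
      moreover have "0 \<le> (\<Sum>l<N. Cl l * (1 / real ?p * (\<Sum>w\<leftarrow>vs. Ct w (l + 2))))"
        using Cl(1) sl0 by (intro sum_nonneg mult_nonneg_nonneg) auto
      ultimately show "0 \<le> Ctot" "1 \<le> Ctot" using W(1) unfolding Ctot_def by linarith+
    qed
    have "expands m0 (Suc N) ((Cs * Ctot) * nrm q g) (\<lambda>M. av vs b h M g)" if g: "g \<in> CP" for g
    proof -
      let ?n = "nrm q g"
      have n0: "0 \<le> ?n" using nrm_nonneg[OF g] .
      define a where "a M = av vs b h M g" for M
      define t where "t l M = (1 / real ?p) * (\<Sum>w\<leftarrow>vs. av (w # vs) b h M (tay l w g))" for l M
      define rem where "rem w M y = g (y + (1 / (real M + 1)) *\<^sub>R (w - y)) - (\<Sum>l<m. (1 / (real M + 1)) ^ l * tay l w g y)" for w M y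
      define R where "R M = (1 / real ?p) * (\<Sum>w\<leftarrow>vs. av (w # vs) b h M (rem w M))" for M
      define d where "d M = (r1 M * r2 M) * av vs b h M (drift vs b h g)
         + (\<Sum>l<N. (r1 M ^ (l + 2) * (1 / real M) ^ l) * t (l + 2) M) + (real M)\<^sup>2 * R M" for M
      have dexp: "expands m0 N (Ctot * ?n) d"
      proof -
        have 1: "expands m0 N (C12 * (Cd * ?n)) (\<lambda>M. (r1 M * r2 M) * av vs b h M (drift vs b h g))"
        proof (rule C12(2))
          show "0 \<le> Cd * ?n" using Cd n0 by simp
          show "expands m0 N (Cd * ?n) (\<lambda>M. av vs b h M (drift vs b h g))"
            by (rule expands_mono[OF Cd(2)[rule_format, OF g] mult_left_mono[OF nrm_mono[OF g q(1)] Cd(1)]])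
        qed
        have 2: "expands m0 N (\<Sum>l<N. Cl l * (1 / real ?p * (\<Sum>w\<leftarrow>vs. Ct w (l + 2) * ?n)))
            (\<lambda>M. \<Sum>l<N. (r1 M ^ (l + 2) * (1 / real M) ^ l) * t (l + 2) M)"
        proof (rule expands_sum, rule Cl(2))
          fix l assume l: "l \<in> {..<N}"
          show "0 \<le> 1 / real ?p * (\<Sum>w\<leftarrow>vs. Ct w (l + 2) * ?n)"
            using Ct(1) n0 by (intro mult_nonneg_nonneg sum_list_nonneg) auto
          have "expands m0 N (\<bar>1 / real ?p\<bar> * (\<Sum>w\<leftarrow>vs. Ct w (l + 2) * ?n)) (t (l + 2))"
            unfolding t_def[abs_def]
          proof (intro expands_cmult expands_sum_list)
            fix w assume w: "w \<in> set vs"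
            show "expands m0 N (Ct w (l + 2) * ?n) (\<lambda>M. av (w # vs) b h M (tay (l + 2) w g))"
              by (rule expands_mono[OF Ct(2)[OF w g] mult_left_mono[OF nrm_mono[OF g q(3)[OF w]] Ct(1)[OF w]]])
                (use l in simp)
          qed
          then show "expands m0 N (1 / real ?p * (\<Sum>w\<leftarrow>vs. Ct w (l + 2) * ?n)) (t (l + 2))" by simp
        qed
        have 3: "expands m0 N (W * ?n) (\<lambda>M. (real M)\<^sup>2 * R M)"
        proof (rule expands_bounded)
          fix M assume "M \<ge> m0"
          then have M: "h \<le> M" "0 < M" using m0 by auto
          let ?c = "1 / (real M + 1)"
          have c: "?c \<in> {0..1}" by simp
          have "\<bar>av (w # vs) b h M (rem w M)\<bar> \<le> W * nrm m g * ?c ^ m" if w: "w \<in> set vs" for w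
          proof (rule av_bound[OF b _ _ M])
            show "\<bar>rem w M y\<bar> \<le> W * nrm m g * ?c ^ m" if "y \<in> P" for y
              unfolding rem_def using W(2) g that w vs(2) c by blast
          qed (use vs w in auto)
          then have "(\<Sum>w\<leftarrow>vs. \<bar>av (w # vs) b h M (rem w M)\<bar>) \<le> (\<Sum>w\<leftarrow>vs. W * nrm m g * ?c ^ m)"
            by (intro sum_list_mono) auto
          moreover have "\<bar>\<Sum>w\<leftarrow>vs. av (w # vs) b h M (rem w M)\<bar> \<le> (\<Sum>w\<leftarrow>vs. \<bar>av (w # vs) b h M (rem w M)\<bar>)"
            using sum_list_abs[of "map (\<lambda>w. av (w # vs) b h M (rem w M)) vs"] by (simp add: o_def)
          ultimately have "\<bar>R M\<bar> \<le> W * nrm m g * ?c ^ m"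
            using vs(1) by (simp add: R_def abs_mult sum_list_triv divide_le_eq mult.commute)
          then have "(real M)\<^sup>2 * \<bar>R M\<bar> \<le> (real M)\<^sup>2 * (W * nrm m g * ?c ^ m)" by (intro mult_left_mono) auto
          also have "\<dots> = W * nrm m g * ((real M)\<^sup>2 * (1 / (real M + 1) ^ (N + 2)))"
            by (simp add: m_def power_divide)
          also have "\<dots> = W * nrm m g * (r1 M ^ (N + 2) / real M ^ N)"
            using M by (subst power2_div_power) (simp_all add: r1_def)
          also have "\<dots> \<le> W * ?n * (1 / real M ^ N)"
          proof -
            have "r1 M ^ (N + 2) \<le> 1" by (intro power_le_one) (auto simp: r1_def)
            then show ?thesis
              using W(1) n0 nrm_mono[OF g q(2)] by (intro mult_mono divide_right_mono) (auto simp: r1_def nrm_nonneg g)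
          qed
          finally show "\<bar>(real M)\<^sup>2 * R M\<bar> \<le> W * ?n / real M ^ N" by (simp add: abs_mult)
        qed (use W n0 in simp)
        have "expands m0 N (C12 * (Cd * ?n) + (\<Sum>l<N. Cl l * (1 / real ?p * (\<Sum>w\<leftarrow>vs. Ct w (l + 2) * ?n))) + W * ?n) d"
          unfolding d_def[abs_def] by (intro expands_add 1 2 3)
        then show ?thesis
        proof (rule expands_mono)
          have "(\<Sum>l<N. Cl l * (1 / real ?p * (\<Sum>w\<leftarrow>vs. Ct w (l + 2) * ?n)))
            = (\<Sum>l<N. Cl l * (1 / real ?p * (\<Sum>w\<leftarrow>vs. Ct w (l + 2)))) * ?n"
            by (simp only: sum_list_mult_const sum_distrib_right mult.assoc)
          then have "C12 * (Cd * ?n) + (\<Sum>l<N. Cl l * (1 / real ?p * (\<Sum>w\<leftarrow>vs. Ct w (l + 2) * ?n))) + W * ?n = (Ctot - 1) * ?n"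
            by (simp add: Ctot_def distrib_right mult.assoc)
          also have "\<dots> \<le> Ctot * ?n" using n0 by (intro mult_right_mono) auto
          finally show "C12 * (Cd * ?n) + (\<Sum>l<N. Cl l * (1 / real ?p * (\<Sum>w\<leftarrow>vs. Ct w (l + 2) * ?n))) + W * ?n \<le> Ctot * ?n" .
        qed
      qed
      have "expands m0 (N + 0 + 1) (Cs * (Ctot * ?n)) a"
      proof (rule Cs(2)[OF _ dexp])
        show "\<forall>M\<ge>m0. \<bar>a M\<bar> \<le> Ctot * ?n"
        proof (intro allI impI)
          fix M assume "m0 \<le> M"
          then have M: "h \<le> M" "0 < M" using m0 by auto
          have "\<bar>a M\<bar> \<le> 1 * ?n" unfolding a_def
            using av_bound[OF b vs(2,1) M, of g ?n] nrm_val[OF g] by simp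
          also have "\<dots> \<le> Ctot * ?n" using Ctot n0 by (intro mult_right_mono) auto
          finally show "\<bar>a M\<bar> \<le> Ctot * ?n" .
        qed
        show "\<forall>M\<ge>m0. a (Suc M) - a M = d M / real M ^ (0 + 2)"
        proof (intro allI impI)
          fix M assume "m0 \<le> M"
          then have M: "h \<le> M" "0 < M" using m0 by auto
          then have Mp: "real M > 0" by simp
          let ?c = "1 / (real M + 1)"
          have split: "(\<lambda>y. g (y + ?c *\<^sub>R (w - y))) = (\<lambda>y. (\<Sum>l<m. ?c ^ l * tay l w g y) + rem w M y)" for w
            by (simp add: rem_def)
          have "a (Suc M) = (1 / real ?p) * (\<Sum>w\<leftarrow>vs. (\<Sum>l<m. ?c ^ l * av (w # vs) b h M (tay l w g)) + av (w # vs) b h M (rem w M))"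
            unfolding a_def av_step[OF vs(1) M] split av_add av_sum av_cmult ..
          also have "\<dots> = (1 / real ?p) * ((\<Sum>w\<leftarrow>vs. \<Sum>l<m. ?c ^ l * av (w # vs) b h M (tay l w g)) + (\<Sum>w\<leftarrow>vs. av (w # vs) b h M (rem w M)))"
            by (simp only: sum_list_addf)
          also have "\<dots> = (\<Sum>l<m. ?c ^ l * t l M) + R M"
            unfolding sum_list_sum_swap R_def t_def
            by (simp only: distrib_left sum_distrib_left sum_list_const_mult mult.left_commute)
          also have "(\<Sum>l<m. ?c ^ l * t l M) = t 0 M + ?c * t (Suc 0) M + (\<Sum>l<N. ?c ^ (l + 2) * t (l + 2) M)"
            by (simp only: m_def add_2_eq_Suc' sum.lessThan_Suc_shift power_0 mult_1_left power_one_right power_Suc0_right add.assoc One_nat_def)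
          also have "t 0 M = a M"
          proof -
            have "tay 0 w g = g" for w by (simp add: tay_0 fun_eq_iff)
            then show ?thesis unfolding a_def t_def av_same[OF vs(1), of b h M g] by simp
          qed
          also have "t (Suc 0) M = av vs b h M (drift vs b h g) / (real M + (real ?p - real h))"
            unfolding t_def by (rule av_drift[OF vs(1) M])
          finally have "a (Suc M) - a M = ?c * (av vs b h M (drift vs b h g) / (real M + (real ?p - real h)))
             + (\<Sum>l<N. ?c ^ (l + 2) * t (l + 2) M) + R M" by simp
          moreover have "d M / real M ^ (0 + 2) = \<dots>"
          proof -
            have e1: "(r1 M * r2 M) * x / (real M)\<^sup>2 = ?c * (x / (real M + (real ?p - real h)))" for x
              using Mp by (simp add: r1_def r2_def power2_eq_square)
            have e2: "(r1 M ^ (l + 2) * (1 / real M) ^ l) * x / (real M)\<^sup>2 = ?c ^ (l + 2) * x" for l x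
            proof -
              have "r1 M ^ (l + 2) * (1 / real M) ^ l = (real M)\<^sup>2 * ?c ^ (l + 2)"
                using power2_div_power[OF Mp, of l] by (simp add: r1_def power_divide)
              then show ?thesis using Mp by simp
            qed
            have e3: "(real M)\<^sup>2 * x / (real M)\<^sup>2 = x" for x using Mp by simp
            show ?thesis unfolding d_def add_divide_distrib sum_divide_distrib add_0 e1 e2 e3 ..
          qed
          ultimately show "a (Suc M) - a M = d M / real M ^ (0 + 2)" by simp
        qed
      qed
      then show ?thesis by (simp add: a_def[abs_def] mult.assoc)
    qed
    then show "\<exists>C m. 0 \<le> C \<and> (\<forall>g\<in>CP. expands m0 (Suc N) (C * nrm m g) (\<lambda>M. av vs b h M g))"
      using Cs(1) Ctot(1) by (intro exI[of _ "Cs * Ctot"] exI[of _ q]) simp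
  qed
qed

text \<open>The same for sums in place of averages; the number of terms is a polynomial in \<open>M\<close>.\<close>

lemma csum_expansion:
  assumes b: "b \<in> scal h" and vs: "vs \<noteq> []" "set vs \<subseteq> P"
  shows "\<exists>C m. 0 \<le> C \<and> (\<forall>g\<in>CP. expands (max 1 h) N (C * nrm m g)
     (\<lambda>M. csum vs (M - h) b (\<lambda>x. g ((1 / real M) *\<^sub>R x)) / real M ^ (length vs - 1)))"
proof -
  let ?m0 = "max 1 h"
  obtain C m where C: "0 \<le> C" "\<forall>g\<in>CP. expands ?m0 N (C * nrm m g) (\<lambda>M. av vs b h M g)"
    using av_expansion[OF b refl, of N] vs by blast
  obtain p where p: "length vs = Suc p" using vs by (cases vs) auto
  have mp: "0 < ?m0" by simp
  have "nice ?m0 (\<lambda>M. ccnt (Suc p) (M - h) / real M ^ p)" by (rule nice_ccnt) auto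
  from expands_mult_nice[OF this mp, of N] obtain E where E: "0 \<le> E" "\<And>s B. 0 \<le> B \<Longrightarrow> expands ?m0 N B s \<Longrightarrow> expands ?m0 N (E * B) (\<lambda>M. (ccnt (Suc p) (M - h) / real M ^ p) * s M)" by blast
  have "expands ?m0 N ((E * C) * nrm m g) (\<lambda>M. csum vs (M - h) b (\<lambda>x. g ((1 / real M) *\<^sub>R x)) / real M ^ (length vs - 1))"
    if g: "g \<in> CP" for g
  proof -
    have "expands ?m0 N (E * (C * nrm m g)) (\<lambda>M. (ccnt (Suc p) (M - h) / real M ^ p) * av vs b h M g)"
      by (rule E(2)) (use C g nrm_nonneg in auto)
    then have "expands ?m0 N (E * (C * nrm m g)) (\<lambda>M. csum vs (M - h) b (\<lambda>x. g ((1 / real M) *\<^sub>R x)) / real M ^ (length vs - 1))"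
    proof (rule expands_cong)
      fix M
      have "ccnt (Suc p) (M - h) \<noteq> 0" using ccnt_pos[of "Suc p" "M - h"] by simp
      then show "(ccnt (Suc p) (M - h) / real M ^ p) * av vs b h M g
        = csum vs (M - h) b (\<lambda>x. g ((1 / real M) *\<^sub>R x)) / real M ^ (length vs - 1)"
        unfolding av_def p by (simp del: ccnt.simps)
    qed
    then show ?thesis by (simp add: mult.assoc)
  qed
  then show ?thesis using E C by (intro exI[of _ "E * C"] exI[of _ m]) simp
qed

end

section \<open>Lattice points in dilated polytopes\<close>

text \<open>A sum over the whole space for functions of finite support, because translations move the support.\<close>

definition fsum :: "('v \<Rightarrow> real) \<Rightarrow> real" where
  "fsum f = (\<Sum>x\<in>{x. f x \<noteq> 0}. f x)"

lemma fsum_eq: "finite B \<Longrightarrow> (\<And>x. x \<notin> B \<Longrightarrow> f x = 0) \<Longrightarrow> fsum f = sum f B"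
  unfolding fsum_def by (rule sum.mono_neutral_left) auto

lemma fsum_translate: "fsum (\<lambda>x. f (x - v)) = fsum (f :: 'v::real_vector \<Rightarrow> real)"
proof -
  have "{x. f (x - v) \<noteq> 0} = (\<lambda>x. x + v) ` {x. f x \<noteq> 0}"
    by (force simp: image_iff intro: exI[of _ "_ - v"])
  then show ?thesis unfolding fsum_def by (simp add: sum.reindex)
qed

text \<open>The second argument is the height. It is an integer, with value zero below height \<open>0\<close>, so that
  differences need no case distinction at the bottom.\<close>

definition fin_supp :: "('v \<Rightarrow> int \<Rightarrow> real) \<Rightarrow> bool" where
  "fin_supp \<eta> \<longleftrightarrow> (\<forall>m. finite {\<beta>. \<eta> \<beta> m \<noteq> 0}) \<and> (\<forall>\<beta> m. m < 0 \<longrightarrow> \<eta> \<beta> m = 0)"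

definition differ :: "'v::real_vector \<Rightarrow> ('v \<Rightarrow> int \<Rightarrow> real) \<Rightarrow> 'v \<Rightarrow> int \<Rightarrow> real" where
  "differ v \<eta> \<beta> m = \<eta> \<beta> m - \<eta> (\<beta> - v) (m - 1)"

fun differs :: "'v::real_vector list \<Rightarrow> ('v \<Rightarrow> int \<Rightarrow> real) \<Rightarrow> 'v \<Rightarrow> int \<Rightarrow> real" where
  "differs [] \<eta> = \<eta>"
| "differs (v # vs) \<eta> = differ v (differs vs \<eta>)"

lemma fin_supp_differ:
  assumes "fin_supp \<eta>" shows "fin_supp (differ v \<eta>)"
proof -
  have "{\<beta>. differ v \<eta> \<beta> m \<noteq> 0} \<subseteq> {\<beta>. \<eta> \<beta> m \<noteq> 0} \<union> (\<lambda>\<beta>. \<beta> + v) ` {\<beta>. \<eta> \<beta> (m - 1) \<noteq> 0}" for m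
  proof
    fix \<beta> assume "\<beta> \<in> {\<beta>. differ v \<eta> \<beta> m \<noteq> 0}"
    then have "\<eta> \<beta> m \<noteq> 0 \<or> \<eta> (\<beta> - v) (m - 1) \<noteq> 0" by (auto simp: differ_def)
    moreover have "\<beta> = (\<beta> - v) + v" by simp
    ultimately show "\<beta> \<in> {\<beta>. \<eta> \<beta> m \<noteq> 0} \<union> (\<lambda>\<beta>. \<beta> + v) ` {\<beta>. \<eta> \<beta> (m - 1) \<noteq> 0}" by blast
  qed
  then have "finite {\<beta>. differ v \<eta> \<beta> m \<noteq> 0}" for m
    using assms unfolding fin_supp_def by (meson finite_UnI finite_imageI finite_subset)
  then show ?thesis using assms by (simp add: fin_supp_def differ_def)
qed

lemma fin_supp_differs: "fin_supp \<eta> \<Longrightarrow> fin_supp (differs vs \<eta>)"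
  by (induction vs) (auto intro: fin_supp_differ)

definition tot :: "('v \<Rightarrow> int \<Rightarrow> real) \<Rightarrow> int \<Rightarrow> ('v \<Rightarrow> real) \<Rightarrow> real" where
  "tot \<eta> m F = fsum (\<lambda>\<beta>. \<eta> \<beta> m * F \<beta>)"

lemma tot_differ:
  assumes "fin_supp \<eta>"
  shows "tot (differ v \<eta>) m F = tot \<eta> m F - tot \<eta> (m - 1) (\<lambda>\<beta>. F (\<beta> + v))"
proof -
  define B where "B = {\<beta>. \<eta> \<beta> m \<noteq> 0} \<union> (\<lambda>\<beta>. \<beta> + v) ` {\<beta>. \<eta> \<beta> (m - 1) \<noteq> 0}"
  have B: "finite B" using assms by (simp add: B_def fin_supp_def)
  have out: "\<eta> \<beta> m = 0" "\<eta> (\<beta> - v) (m - 1) = 0" if "\<beta> \<notin> B" for \<beta>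
  proof -
    show "\<eta> \<beta> m = 0" using that by (auto simp: B_def)
    have "\<beta> = (\<beta> - v) + v" by simp
    then show "\<eta> (\<beta> - v) (m - 1) = 0" using that unfolding B_def by blast
  qed
  have "tot \<eta> (m - 1) (\<lambda>\<beta>. F (\<beta> + v)) = fsum (\<lambda>\<beta>. \<eta> (\<beta> - v) (m - 1) * F \<beta>)"
    unfolding tot_def using fsum_translate[of "\<lambda>\<beta>. \<eta> \<beta> (m - 1) * F (\<beta> + v)" v] by simp
  also have "\<dots> = (\<Sum>\<beta>\<in>B. \<eta> (\<beta> - v) (m - 1) * F \<beta>)" by (rule fsum_eq[OF B]) (simp add: out)
  finally have 1: "tot \<eta> (m - 1) (\<lambda>\<beta>. F (\<beta> + v)) = (\<Sum>\<beta>\<in>B. \<eta> (\<beta> - v) (m - 1) * F \<beta>)" .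
  have 2: "tot \<eta> m F = (\<Sum>\<beta>\<in>B. \<eta> \<beta> m * F \<beta>)" unfolding tot_def by (rule fsum_eq[OF B]) (simp add: out)
  have 3: "tot (differ v \<eta>) m F = (\<Sum>\<beta>\<in>B. differ v \<eta> \<beta> m * F \<beta>)"
    unfolding tot_def by (rule fsum_eq[OF B]) (simp add: out differ_def)
  show ?thesis unfolding 1 2 3 by (simp add: differ_def left_diff_distrib sum_subtractf)
qed

lemma tot_negative: "fin_supp \<eta> \<Longrightarrow> m < 0 \<Longrightarrow> tot \<eta> m F = 0"
  by (simp add: tot_def fin_supp_def fsum_def)

text \<open>The sum over \<open>j\<close> telescopes.\<close>

lemma tot_expand_one:
  assumes "fin_supp \<eta>"
  shows "tot \<eta> (int m) F = (\<Sum>j\<le>m. tot (differ v \<eta>) (int (m - j)) (\<lambda>\<beta>. F (\<beta> + real j *\<^sub>R v)))"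
proof (induction m arbitrary: F)
  case 0
  have "tot \<eta> (-1) G = 0" for G using tot_negative[OF assms, of "-1"] by simp
  then show ?case by (simp add: tot_differ[OF assms])
next
  case (Suc m)
  have "tot \<eta> (int (Suc m)) F = tot (differ v \<eta>) (int (Suc m)) F + tot \<eta> (int m) (\<lambda>\<beta>. F (\<beta> + v))"
    by (simp add: tot_differ[OF assms])
  also have "\<dots> = tot (differ v \<eta>) (int (Suc m)) F + (\<Sum>j\<le>m. tot (differ v \<eta>) (int (m - j)) (\<lambda>\<beta>. F (\<beta> + real j *\<^sub>R v + v)))"
    unfolding Suc ..
  also have "\<dots> = (\<Sum>j\<le>Suc m. tot (differ v \<eta>) (int (Suc m - j)) (\<lambda>\<beta>. F (\<beta> + real j *\<^sub>R v)))"
    unfolding sum.atMost_Suc_shift by (simp add: algebra_simps)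
  finally show ?case .
qed

lemma tot_sum:
  assumes "fin_supp \<eta>" shows "tot \<eta> m (\<lambda>\<beta>. \<Sum>i\<in>I. F i \<beta>) = (\<Sum>i\<in>I. tot \<eta> m (F i))"
proof -
  have B: "finite {\<beta>. \<eta> \<beta> m \<noteq> 0}" using assms by (simp add: fin_supp_def)
  have "tot \<eta> m G = (\<Sum>\<beta>\<in>{\<beta>. \<eta> \<beta> m \<noteq> 0}. \<eta> \<beta> m * G \<beta>)" for G
    unfolding tot_def by (rule fsum_eq[OF B]) auto
  then show ?thesis by (simp add: sum_distrib_left) (rule sum.swap)
qed

text \<open>Convolution with \<open>csum\<close> inverts the iterated difference operator.\<close>

lemma tot_expand:
  assumes "fin_supp \<eta>"
  shows "tot \<eta> (int m) F = (\<Sum>l\<le>m. tot (differs vs \<eta>) (int l) (\<lambda>\<beta>. csum vs (m - l) \<beta> F))"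
proof (induction vs)
  case Nil
  have "(\<Sum>l\<le>m. tot \<eta> (int l) (\<lambda>\<beta>. csum [] (m - l) \<beta> F)) = (\<Sum>l\<le>m. if l = m then tot \<eta> (int m) F else 0)"
    by (intro sum.cong refl) (auto simp: tot_def fsum_def)
  then show ?case by simp
next
  case (Cons v vs)
  have fs: "fin_supp (differs vs \<eta>)" using assms by (rule fin_supp_differs)
  let ?d = "differ v (differs vs \<eta>)"
  have "tot \<eta> (int m) F = (\<Sum>l\<le>m. \<Sum>j\<le>l. tot ?d (int (l - j)) (\<lambda>\<beta>. csum vs (m - l) (\<beta> + real j *\<^sub>R v) F))"
    unfolding Cons by (intro sum.cong refl tot_expand_one[OF fs])
  also have "\<dots> = (\<Sum>i\<le>m. \<Sum>j\<le>m - i. tot ?d (int i) (\<lambda>\<beta>. csum vs (m - i - j) (\<beta> + real j *\<^sub>R v) F))"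
  proof -
    have "(\<Sum>l\<le>m. \<Sum>j\<le>l. f (l - j) j) = (\<Sum>i\<le>m. \<Sum>j\<le>m - i. f i j)" for f :: "nat \<Rightarrow> nat \<Rightarrow> real"
    proof -
      have "(\<Sum>(l, j)\<in>Sigma {..m} (\<lambda>l. {..l}). f (l - j) j) = (\<Sum>(i, j)\<in>Sigma {..m} (\<lambda>i. {..m - i}). f i j)"
        by (rule sum.reindex_bij_witness[of _ "\<lambda>(i, j). (i + j, j)" "\<lambda>(l, j). (l - j, j)"]) auto
      then show ?thesis by (simp add: sum.Sigma)
    qed
    note tri = this[of "\<lambda>i j. tot ?d (int i) (\<lambda>\<beta>. csum vs (m - i - j) (\<beta> + real j *\<^sub>R v) F)"]
    have "(\<Sum>l\<le>m. \<Sum>j\<le>l. tot ?d (int (l - j)) (\<lambda>\<beta>. csum vs (m - l) (\<beta> + real j *\<^sub>R v) F))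
      = (\<Sum>l\<le>m. \<Sum>j\<le>l. tot ?d (int (l - j)) (\<lambda>\<beta>. csum vs (m - (l - j) - j) (\<beta> + real j *\<^sub>R v) F))"
      by (intro sum.cong refl) simp
    then show ?thesis unfolding tri .
  qed
  also have "\<dots> = (\<Sum>i\<le>m. tot (differs (v # vs) \<eta>) (int i) (\<lambda>\<beta>. csum (v # vs) (m - i) \<beta> F))"
    by (simp add: tot_sum[OF fin_supp_differ[OF fs]])
  finally show ?case .
qed

lemma differ_commute: "differ v (differ w \<eta>) = differ w (differ v \<eta>)"
  by (simp add: differ_def fun_eq_iff algebra_simps)

lemma differs_remove1: "v \<in> set vs \<Longrightarrow> differs vs \<eta> = differ v (differs (remove1 v vs) \<eta>)"
  by (induction vs) (auto simp: differ_commute)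

text \<open>A pair \<open>(\<nu>, c)\<close> stands for the inequality \<open>0 \<le> \<beta> \<bullet> \<nu> + c\<close>. Homogenised by the height \<open>m\<close>, such inequalities
  define a cone, whose section at height \<open>m\<close> is the \<open>m\<close>-th dilate of the polytope.\<close>

definition lev :: "(real^'n) \<times> real \<Rightarrow> real^'n \<Rightarrow> int \<Rightarrow> real" where
  "lev p \<beta> m = \<beta> \<bullet> fst p + snd p * of_int m"

definition cone_ind :: "((real^'n) \<times> real) set \<Rightarrow> real^'n \<Rightarrow> int \<Rightarrow> real" where
  "cone_ind H \<beta> m = (if \<beta> \<in> int_lattice \<and> (\<forall>p\<in>H. 0 \<le> lev p \<beta> m) then 1 else 0)"

lemma lev_diff: "lev p (\<beta> - w) (m - 1) = lev p \<beta> m - lev p w 1"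
  by (simp add: lev_def inner_diff_left algebra_simps)

lemma int_lattice_diff: "x \<in> int_lattice \<Longrightarrow> y \<in> int_lattice \<Longrightarrow> x - y \<in> int_lattice"
  by (simp add: int_lattice_def)

lemma int_lattice_add: "x \<in> int_lattice \<Longrightarrow> y \<in> int_lattice \<Longrightarrow> x + y \<in> int_lattice"
  by (simp add: int_lattice_def)

text \<open>All the translates of the cone that enter are contained in the cone.\<close>

lemma differs_cone_zero:
  assumes vs: "\<And>w. w \<in> set ws \<Longrightarrow> w \<in> int_lattice \<and> (\<forall>p\<in>H. 0 \<le> lev p w 1)"
    and "cone_ind H \<beta> m = 0"
  shows "differs ws (cone_ind H) \<beta> m = 0"
  using assms
proof (induction ws arbitrary: \<beta> m)
  case (Cons w ws)
  have "cone_ind H (\<beta> - w) (m - 1) = 0"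
  proof (rule ccontr)
    assume "cone_ind H (\<beta> - w) (m - 1) \<noteq> 0"
    then have *: "\<beta> - w \<in> int_lattice" "\<forall>p\<in>H. 0 \<le> lev p \<beta> m - lev p w 1"
      by (auto simp: cone_ind_def lev_diff split: if_splits)
    have "w \<in> int_lattice" using Cons.prems(1)[of w] by simp
    with *(1) have "\<beta> \<in> int_lattice" using int_lattice_add[of "\<beta> - w" w] by simp
    moreover have "0 \<le> lev p \<beta> m" if "p \<in> H" for p
      using *(2) Cons.prems(1)[of w] that by force
    ultimately show False using Cons.prems(2) by (simp add: cone_ind_def)
  qed
  moreover have IH: "differs ws (cone_ind H) \<beta>' m' = 0" if "cone_ind H \<beta>' m' = 0" for \<beta>' m'
    by (rule Cons.IH[OF _ that]) (use Cons.prems(1) in simp)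
  ultimately show ?case using IH[OF Cons.prems(2)] by (simp add: differ_def)
qed simp

text \<open>Far from all the facets that do not contain \<open>v\<close>, the cone is invariant under translation by \<open>v\<close>.\<close>

lemma differs_cone_invariant:
  assumes ws: "\<And>w. w \<in> set ws \<Longrightarrow> \<forall>p\<in>H. 0 \<le> lev p w 1"
    and v: "v \<in> int_lattice" "\<And>p. p \<in> H \<Longrightarrow> 0 \<le> lev p v 1"
    and far: "\<And>p. p \<in> H \<Longrightarrow> lev p v 1 = 0 \<or> (\<Sum>w\<leftarrow>ws. lev p w 1) + lev p v 1 \<le> lev p \<beta> m"
  shows "differs ws (cone_ind H) (\<beta> - v) (m - 1) = differs ws (cone_ind H) \<beta> m"
  using ws far
proof (induction ws arbitrary: \<beta> m)
  case Nil
  have "\<beta> - v \<in> int_lattice \<longleftrightarrow> \<beta> \<in> int_lattice"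
    using v(1) int_lattice_add[of "\<beta> - v" v] int_lattice_diff[of \<beta> v] by auto
  moreover have "(0 \<le> lev p (\<beta> - v) (m - 1)) \<longleftrightarrow> (0 \<le> lev p \<beta> m)" if "p \<in> H" for p
    using Nil(2)[OF that] v(2)[OF that] by (auto simp: lev_diff)
  ultimately show ?case by (simp add: cone_ind_def)
next
  case (Cons w ws)
  have w0: "0 \<le> lev p w 1" if "p \<in> H" for p using Cons.prems(1)[of w] that by simp
  have "differs ws (cone_ind H) (\<beta> - v) (m - 1) = differs ws (cone_ind H) \<beta> m"
    using Cons.prems w0 by (intro Cons.IH) force+
  moreover have "differs ws (cone_ind H) (\<beta> - w - v) (m - 1 - 1) = differs ws (cone_ind H) (\<beta> - w) (m - 1)"
  proof (rule Cons.IH)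
    show "lev p v 1 = 0 \<or> (\<Sum>w\<leftarrow>ws. lev p w 1) + lev p v 1 \<le> lev p (\<beta> - w) (m - 1)" if "p \<in> H" for p
      using Cons.prems(2)[OF that] by (auto simp: lev_diff)
  qed (use Cons.prems(1) in simp)
  moreover have e: "\<beta> - v - w = \<beta> - w - v" by simp
  ultimately show ?case unfolding differs.simps differ_def e by simp
qed

text \<open>Comparison with the number of integral vectors in a cube.\<close>

lemma finite_bounded_lattice:
  assumes r: "0 \<le> r"
  shows "finite {x \<in> int_lattice :: (real^'n) set. norm x \<le> r} \<and>
     real (card {x \<in> int_lattice :: (real^'n) set. norm x \<le> r}) \<le> (2 * r + 1) ^ CARD('n)"
proof -
  let ?I = "{- \<lfloor>r\<rfloor>..\<lfloor>r\<rfloor>}"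
  let ?f = "\<lambda>f :: 'n \<Rightarrow> int. (\<chi> i. of_int (f i)) :: real^'n"
  have sub: "{x \<in> int_lattice :: (real^'n) set. norm x \<le> r} \<subseteq> ?f ` (Pi\<^sub>E UNIV (\<lambda>_. ?I))"
  proof
    fix x :: "real^'n" assume x: "x \<in> {x \<in> int_lattice. norm x \<le> r}"
    define f where "f i = \<lfloor>x $ i\<rfloor>" for i
    have f: "of_int (f i) = x $ i" for i using x by (simp add: int_lattice_def f_def of_int_floor)
    have "\<bar>x $ i\<bar> \<le> r" for i using component_le_norm_cart[of x i] x by simp
    then have "of_int (f i) \<le> r" "- r \<le> of_int (f i)" for i unfolding f abs_le_iff by (simp_all add: minus_le_iff)
    then have "f i \<le> \<lfloor>r\<rfloor>" "- f i \<le> \<lfloor>r\<rfloor>" for i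
      by (simp_all add: le_floor_iff minus_le_iff)
    then have "f \<in> Pi\<^sub>E UNIV (\<lambda>_. ?I)" by (auto simp: minus_le_iff)
    moreover have "x = ?f f" by (simp add: f vec_eq_iff)
    ultimately show "x \<in> ?f ` (Pi\<^sub>E UNIV (\<lambda>_. ?I))" by blast
  qed
  have fin: "finite (Pi\<^sub>E (UNIV :: 'n set) (\<lambda>_. ?I))" by (intro finite_PiE) auto
  have "card {x \<in> int_lattice :: (real^'n) set. norm x \<le> r} \<le> card (Pi\<^sub>E (UNIV :: 'n set) (\<lambda>_. ?I))"
    by (rule order_trans[OF card_mono[OF finite_imageI[OF fin] sub] card_image_le[OF fin]])
  also have "\<dots> = card ?I ^ CARD('n)" by (subst card_PiE) auto
  finally have "real (card {x \<in> int_lattice :: (real^'n) set. norm x \<le> r}) \<le> real (card ?I) ^ CARD('n)"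
    by (simp only: of_nat_le_iff of_nat_power[symmetric])
  also have "\<dots> \<le> (2 * r + 1) ^ CARD('n)"
  proof (rule power_mono)
    have "0 \<le> \<lfloor>r\<rfloor>" using r by simp
    then show "real (card ?I) \<le> 2 * r + 1" by (simp add: of_nat_nat)
  qed simp
  finally show ?thesis using finite_subset[OF sub finite_imageI[OF fin]] by blast
qed

locale lattice_polytope =
  fixes H :: "((real^'n) \<times> real) set" and vs :: "(real^'n) list"
  assumes finite_H: "finite H" and vs_lattice: "set vs \<subseteq> int_lattice" and vs_ne: "vs \<noteq> []"
    and hull: "{x. \<forall>p\<in>H. 0 \<le> lev p x 1} = convex hull (set vs)"
begin

text \<open>The additional inequality says that the height is nonnegative.\<close>

definition "H' = insert (0, 1) H"

definition "lattice_points m = {\<beta> \<in> int_lattice. \<forall>p\<in>H. 0 \<le> lev p \<beta> (int m)}"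

lemma vs_lev: "w \<in> set vs \<Longrightarrow> p \<in> H' \<Longrightarrow> 0 \<le> lev p w 1"
proof -
  assume w: "w \<in> set vs" and p: "p \<in> H'"
  have "w \<in> convex hull (set vs)" using w by (rule hull_inc)
  then have "\<forall>p\<in>H. 0 \<le> lev p w 1" using hull by blast
  then show ?thesis using p by (auto simp: H'_def lev_def)
qed

lemma lev_scale: "lev p \<beta> (int m) = real m * lev p ((1 / real m) *\<^sub>R \<beta>) 1" if "m > 0"
  using that by (simp add: lev_def algebra_simps)

lemma lattice_points_hull:
  assumes "\<beta> \<in> lattice_points m" "m > 0" shows "(1 / real m) *\<^sub>R \<beta> \<in> convex hull (set vs)"
proof -
  have "0 \<le> real m * lev p ((1 / real m) *\<^sub>R \<beta>) 1" if "p \<in> H" for p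
    using assms that by (simp add: lattice_points_def lev_scale[OF assms(2), symmetric])
  then have "\<forall>p\<in>H. 0 \<le> lev p ((1 / real m) *\<^sub>R \<beta>) 1" using assms(2) by (simp add: zero_le_mult_iff)
  then show ?thesis using hull by blast
qed

lemma hull_bound: "\<exists>r\<ge>0. \<forall>x\<in>convex hull (set vs). norm x \<le> r"
proof -
  have "bounded (convex hull (set vs))"
    by (intro compact_imp_bounded finite_imp_compact_convex_hull) simp
  then obtain r where "\<forall>x\<in>convex hull (set vs). norm x \<le> r" unfolding bounded_iff by blast
  then show ?thesis by (intro exI[of _ "\<bar>r\<bar>"]) force
qed

lemma lattice_points_0: "\<beta> \<in> lattice_points 0 \<Longrightarrow> \<beta> = 0"
proof (rule ccontr)
  assume b: "\<beta> \<in> lattice_points 0" and n: "\<beta> \<noteq> 0"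
  obtain w where w: "w \<in> set vs" using last_in_set[OF vs_ne] by blast
  obtain r where r: "r \<ge> 0" "\<forall>x\<in>convex hull (set vs). norm x \<le> r" using hull_bound by blast
  \<comment> \<open>far enough along the ray \<open>w + t \<beta>\<close> to leave the bounded polytope\<close>
  define t where "t = (r + norm w + 1) / norm \<beta>"
  have t: "t > 0" using n r norm_ge_zero[of w] by (simp add: t_def add_nonneg_pos)
  have "0 \<le> lev p (w + t *\<^sub>R \<beta>) 1" if p: "p \<in> H" for p
  proof -
    have "lev p (w + t *\<^sub>R \<beta>) 1 = lev p w 1 + t * lev p \<beta> 0" by (simp add: lev_def inner_add_left)
    moreover have "0 \<le> lev p \<beta> 0" using b p by (simp add: lattice_points_def)
    moreover have "0 \<le> lev p w 1" using vs_lev[OF w] p by (simp add: H'_def)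
    ultimately show ?thesis using t by simp
  qed
  then have "w + t *\<^sub>R \<beta> \<in> convex hull (set vs)" using hull by blast
  then have "norm (w + t *\<^sub>R \<beta>) \<le> r" using r by blast
  moreover have "norm (t *\<^sub>R \<beta>) = r + norm w + 1" using n r(1) by (simp add: t_def)
  moreover have "norm (t *\<^sub>R \<beta>) \<le> norm (w + t *\<^sub>R \<beta>) + norm w"
    by (metis add.commute add_diff_cancel_left' norm_triangle_ineq4)
  ultimately show False by linarith
qed

lemma lattice_points_count:
  "\<exists>C\<ge>0. \<forall>m. finite (lattice_points m) \<and> (m > 0 \<longrightarrow> real (card (lattice_points m)) \<le> C * real m ^ CARD('n))"
proof -
  obtain r where r: "r \<ge> 0" "\<forall>x\<in>convex hull (set vs). norm x \<le> r" using hull_bound by blast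
  have sub: "lattice_points m \<subseteq> {x \<in> int_lattice. norm x \<le> real m * r}" for m
  proof
    fix \<beta> assume b: "\<beta> \<in> lattice_points m"
    show "\<beta> \<in> {x \<in> int_lattice. norm x \<le> real m * r}"
    proof (cases "m > 0")
      case True
      have "norm ((1 / real m) *\<^sub>R \<beta>) \<le> r" using lattice_points_hull[OF b True] r by blast
      then have "norm \<beta> \<le> real m * r" using True by (simp add: divide_le_eq mult.commute)
      then show ?thesis using b by (simp add: lattice_points_def)
    next
      case False
      then show ?thesis using b lattice_points_0 by (auto simp: lattice_points_def)
    qed
  qed
  have "finite (lattice_points m) \<and> (m > 0 \<longrightarrow> real (card (lattice_points m)) \<le> (2 * r + 1) ^ CARD('n) * real m ^ CARD('n))" for m
  proof -
    have mr: "0 \<le> real m * r" using r by simp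
    note F = finite_bounded_lattice[OF mr, where 'n='n]
    have "real (card (lattice_points m)) \<le> real (card {x \<in> int_lattice :: (real^'n) set. norm x \<le> real m * r})"
      using card_mono[OF conjunct1[OF F] sub] by simp
    also have "\<dots> \<le> (2 * (real m * r) + 1) ^ CARD('n)" using F by blast
    also have "\<dots> \<le> ((2 * r + 1) * real m) ^ CARD('n)" if "m > 0"
      using that r mr by (intro power_mono) (auto simp: algebra_simps)
    finally have "m > 0 \<Longrightarrow> real (card (lattice_points m)) \<le> ((2 * r + 1) * real m) ^ CARD('n)" by blast
    then show ?thesis using finite_subset[OF sub conjunct1[OF F]] by (simp add: power_mult_distrib)
  qed
  then show ?thesis using r by (intro exI[of _ "(2 * r + 1) ^ CARD('n)"]) simp
qed

lemma cone_ind_eq: "cone_ind H' \<beta> (int m) = (if \<beta> \<in> lattice_points m then 1 else 0)"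
  by (auto simp: cone_ind_def lattice_points_def H'_def lev_def)

lemma cone_ind_neg: "m < 0 \<Longrightarrow> cone_ind H' \<beta> m = 0"
  by (auto simp: cone_ind_def H'_def lev_def)

lemma fin_supp_cone: "fin_supp (cone_ind H')"
  unfolding fin_supp_def
proof (intro conjI allI impI)
  show "finite {\<beta>. cone_ind H' \<beta> m \<noteq> 0}" for m
  proof (cases "m < 0")
    case True
    then show ?thesis by (simp add: cone_ind_neg)
  next
    case False
    then obtain k where k: "m = int k" by (metis nonneg_int_cases not_less)
    have "{\<beta>. cone_ind H' \<beta> m \<noteq> 0} = lattice_points k" unfolding k cone_ind_eq by auto
    then show ?thesis using lattice_points_count by auto
  qed
qed (rule cone_ind_neg)

text \<open>A point of the cone at height \<open>m\<close> is a combination of the generators, one of which has a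
  coefficient at least \<open>m / p\<close>. If \<open>m\<close> is large then the point is far from every facet that
  does not contain this generator, and the iterated difference vanishes.\<close>

lemma differs_finite:
  "\<exists>M0. \<forall>m>M0. \<forall>\<beta>. differs vs (cone_ind H') \<beta> (int m) = 0"
proof -
  define p where "p = real (card (set vs))"
  have p: "p > 0" using vs_ne by (simp add: p_def card_gt_0_iff)
  define B where "B h = (\<Sum>w\<leftarrow>vs. lev h w 1)" for h
  define f where "f = (\<lambda>(h, w). p * B h / lev h w 1)"
  have fH: "finite (H' \<times> set vs)" using finite_H by (simp add: H'_def)
  have B0: "0 \<le> B h" if "h \<in> H'" for h unfolding B_def using vs_lev[OF _ that] by (intro sum_list_nonneg) auto
  have f0: "0 \<le> f z" if "z \<in> H' \<times> set vs" for z
    using that B0 vs_lev p by (auto simp: f_def)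
  define R where "R = (\<Sum>z\<in>H' \<times> set vs. f z)"
  have Rf: "f z \<le> R" if "z \<in> H' \<times> set vs" for z
    unfolding R_def using that f0 fH by (intro member_le_sum) auto
  have "differs vs (cone_ind H') \<beta> (int m) = 0" if m: "m > nat \<lceil>R\<rceil>" for m \<beta>
  proof (rule ccontr)
    assume ne: "differs vs (cone_ind H') \<beta> (int m) \<noteq> 0"
    have mR: "real m > R" using m by linarith
    have m0: "m > 0" using m by simp
    have wsH: "w \<in> int_lattice \<and> (\<forall>h\<in>H'. 0 \<le> lev h w 1)" if "w \<in> set vs" for w
      using vs_lattice vs_lev that by blast
    have "cone_ind H' \<beta> (int m) \<noteq> 0" using differs_cone_zero[of vs H' \<beta> "int m"] wsH ne by blast
    then have b: "\<beta> \<in> lattice_points m" by (simp add: cone_ind_eq split: if_splits)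
    obtain c where c: "\<forall>w\<in>set vs. 0 \<le> c w" "sum c (set vs) = 1" "(\<Sum>w\<in>set vs. c w *\<^sub>R w) = (1 / real m) *\<^sub>R \<beta>"
      using lattice_points_hull[OF b m0] by (auto simp: convex_hull_finite)
    have "\<exists>v\<in>set vs. 1 / p \<le> c v"
    proof (rule ccontr)
      assume "\<not> ?thesis"
      then have "sum c (set vs) < (\<Sum>v\<in>set vs. 1 / p)"
        using vs_ne by (intro sum_strict_mono) auto
      then show False using c(2) p vs_ne by (simp add: p_def)
    qed
    then obtain v where v: "v \<in> set vs" "1 / p \<le> c v" by blast
    have levb: "lev h \<beta> (int m) \<ge> real m / p * lev h v 1" if h: "h \<in> H'" for h
    proof -
      have "lev h ((1 / real m) *\<^sub>R \<beta>) 1 = (\<Sum>w\<in>set vs. c w * (w \<bullet> fst h)) + snd h * sum c (set vs)"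
        unfolding c(3)[symmetric] by (simp add: lev_def inner_sum_left c(2))
      also have "\<dots> = (\<Sum>w\<in>set vs. c w * lev h w 1)"
        by (simp add: lev_def distrib_left sum.distrib sum_distrib_left mult.commute)
      also have "\<dots> \<ge> c v * lev h v 1"
        using c(1) vs_lev h v(1) by (intro member_le_sum) auto
      finally have "1 / p * lev h v 1 \<le> lev h ((1 / real m) *\<^sub>R \<beta>) 1"
        using mult_right_mono[OF v(2) vs_lev[OF v(1) h]] by linarith
      then show ?thesis unfolding lev_scale[OF m0] using m0 mult_left_mono[of "1 / p * lev h v 1" _ "real m"] by simp
    qed
    have inv: "differs (remove1 v vs) (cone_ind H') (\<beta> - v) (int m - 1) = differs (remove1 v vs) (cone_ind H') \<beta> (int m)"
    proof (rule differs_cone_invariant)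
      show "\<forall>h\<in>H'. 0 \<le> lev h w 1" if "w \<in> set (remove1 v vs)" for w
        using that wsH notin_set_remove1 by metis
      show "v \<in> int_lattice" "\<And>h. h \<in> H' \<Longrightarrow> 0 \<le> lev h v 1" using wsH[OF v(1)] by auto
      fix h assume h: "h \<in> H'"
      have "(\<Sum>w\<leftarrow>remove1 v vs. lev h w 1) + lev h v 1 = B h"
        unfolding B_def using v(1) by (simp add: sum_list_map_remove1)
      moreover have "B h \<le> lev h \<beta> (int m)" if "lev h v 1 \<noteq> 0"
      proof -
        have l: "0 < lev h v 1" using that vs_lev[OF v(1) h] by simp
        have "p * B h / lev h v 1 \<le> real m" using Rf[of "(h, v)"] h v(1) mR by (auto simp: f_def)
        then have "B h \<le> real m / p * lev h v 1" using l p by (simp add: field_simps)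
        then show ?thesis using levb[OF h] by linarith
      qed
      ultimately show "lev h v 1 = 0 \<or> (\<Sum>w\<leftarrow>remove1 v vs. lev h w 1) + lev h v 1 \<le> lev h \<beta> (int m)" by auto
    qed
    then show False using ne unfolding differs_remove1[OF v(1)] differ_def by simp
  qed
  then show ?thesis by blast
qed

text \<open>\<open>T\<close> is the finite support of the iterated difference of the indicator function, and \<open>\<kappa>\<close> are its values.\<close>

lemma lattice_sum_decomposition:
  "\<exists>T \<kappa>. finite T \<and> (\<forall>(b, l)\<in>T. b \<in> lattice_points l) \<and>
     (\<forall>m F. (\<Sum>\<beta>\<in>lattice_points m. F \<beta>) = (\<Sum>(b, l)\<in>T. if l \<le> m then \<kappa> b l * csum vs (m - l) b F else 0))"
proof -
  obtain M0 where M0: "\<forall>m>M0. \<forall>\<beta>. differs vs (cone_ind H') \<beta> (int m) = 0" using differs_finite by blast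
  have fL: "finite (lattice_points l)" for l using lattice_points_count by blast
  define T where "T = Sigma {..M0} lattice_points"
  define \<kappa> where "\<kappa> l b = differs vs (cone_ind H') b (int l)" for l b
  have \<kappa>0: "\<kappa> l b = 0" if "b \<notin> lattice_points l" for l b
    unfolding \<kappa>_def by (rule differs_cone_zero) (use vs_lattice vs_lev that in \<open>auto simp: cone_ind_eq\<close>)
  have "(\<Sum>\<beta>\<in>lattice_points m. F \<beta>) = (\<Sum>(l, b)\<in>T. if l \<le> m then \<kappa> l b * csum vs (m - l) b F else 0)" for m F
  proof -
    have "(\<Sum>\<beta>\<in>lattice_points m. F \<beta>) = tot (cone_ind H') (int m) F"
      unfolding tot_def cone_ind_eq by (subst fsum_eq[OF fL[of m]]) auto
    also have "\<dots> = (\<Sum>l\<le>m. tot (differs vs (cone_ind H')) (int l) (\<lambda>\<beta>. csum vs (m - l) \<beta> F))"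
      by (rule tot_expand[OF fin_supp_cone])
    also have "\<dots> = (\<Sum>l\<le>m. \<Sum>b\<in>lattice_points l. \<kappa> l b * csum vs (m - l) b F)"
      unfolding tot_def \<kappa>_def[symmetric]
      by (intro sum.cong refl fsum_eq fL) (simp add: \<kappa>0)
    also have "\<dots> = (\<Sum>l\<le>m + M0. if l \<le> m \<and> l \<le> M0 then \<Sum>b\<in>lattice_points l. \<kappa> l b * csum vs (m - l) b F else 0)"
      by (rule sum.mono_neutral_cong_left) (auto simp: \<kappa>_def M0)
    also have "\<dots> = (\<Sum>l\<le>M0. if l \<le> m then \<Sum>b\<in>lattice_points l. \<kappa> l b * csum vs (m - l) b F else 0)"
      by (rule sum.mono_neutral_cong_right) auto
    also have "\<dots> = (\<Sum>l\<le>M0. \<Sum>b\<in>lattice_points l. if l \<le> m then \<kappa> l b * csum vs (m - l) b F else 0)"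
      by (intro sum.cong refl) auto
    also have "\<dots> = (\<Sum>(l, b)\<in>T. if l \<le> m then \<kappa> l b * csum vs (m - l) b F else 0)"
      unfolding T_def using fL by (simp add: sum.Sigma)
    finally show ?thesis .
  qed
  moreover have "(\<Sum>(b, l)\<in>prod.swap ` T. g l b) = (\<Sum>(l, b)\<in>T. g l b)" for g :: "nat \<Rightarrow> real^'n \<Rightarrow> real"
    by (subst sum.reindex) (auto simp: inj_on_def case_prod_unfold)
  moreover have "finite T" unfolding T_def using fL by simp
  ultimately show ?thesis
    by (intro exI[of _ "prod.swap ` T"] exI[of _ "\<lambda>b l. \<kappa> l b"]) (auto simp: T_def)
qed

end

section \<open>Uniqueness of expansions\<close>

lemma tendsto_inverse_powers: "(\<lambda>M. \<Sum>j<n. e j / real M ^ j) \<longlonglongrightarrow> (if n = 0 then 0 else e 0)"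
proof (cases n)
  case (Suc n')
  have "(\<lambda>M. e (Suc j) / real M ^ Suc j) \<longlonglongrightarrow> 0" for j
  proof -
    have "(\<lambda>M. e (Suc j) * (1 / real M) ^ Suc j) \<longlonglongrightarrow> e (Suc j) * 0 ^ Suc j"
      by (intro tendsto_intros lim_1_over_n)
    then show ?thesis by (simp add: power_divide)
  qed
  then have "(\<lambda>M. e 0 + (\<Sum>j<n'. e (Suc j) / real M ^ Suc j)) \<longlonglongrightarrow> e 0 + (\<Sum>j<n'. 0)"
    by (intro tendsto_intros)
  then show ?thesis unfolding Suc sum.lessThan_Suc_shift by simp
qed simp

text \<open>The leading coefficient is the limit of \<open>s\<close>.\<close>

lemma leading_coefficient:
  assumes s: "\<And>M. M \<ge> m0 \<Longrightarrow> \<bar>s M - (\<Sum>j<Suc n. e j / real M ^ j)\<bar> \<le> B / real M ^ Suc n"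
    and s0: "\<And>M. M \<ge> m0 \<Longrightarrow> \<bar>s M\<bar> \<le> B' / real M"
  shows "e 0 = 0"
proof -
  have l: "(\<lambda>M. C / real M ^ Suc i) \<longlonglongrightarrow> 0" for C i
  proof -
    have "(\<lambda>M. C * (1 / real M) ^ Suc i) \<longlonglongrightarrow> C * 0 ^ Suc i" by (intro tendsto_intros lim_1_over_n)
    then show ?thesis by (simp add: power_divide)
  qed
  have 1: "s \<longlonglongrightarrow> 0"
    by (rule Lim_null_comparison[OF _ l[of B' 0]]) (use s0 in \<open>auto simp: eventually_sequentially\<close>)
  have "(\<lambda>M. s M - (\<Sum>j<Suc n. e j / real M ^ j)) \<longlonglongrightarrow> 0"
    by (rule Lim_null_comparison[OF _ l[of B n]]) (use s in \<open>auto simp: eventually_sequentially simp del: sum.lessThan_Suc\<close>)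
  from tendsto_diff[OF 1 this] have "(\<lambda>M. \<Sum>j<Suc n. e j / real M ^ j) \<longlonglongrightarrow> 0" by simp
  with tendsto_inverse_powers[of e "Suc n"] show ?thesis using LIMSEQ_unique by force
qed

lemma expansion_times_M:
  assumes s: "\<And>M. M \<ge> m0 \<Longrightarrow> \<bar>s M - (\<Sum>j<Suc n. e j / real M ^ j)\<bar> \<le> B / real M ^ Suc n"
    and e0: "e 0 = 0" and m0: "0 < m0" and M: "M \<ge> m0"
  shows "\<bar>s M * real M - (\<Sum>j<n. e (Suc j) / real M ^ j)\<bar> \<le> B / real M ^ n"
proof -
  have Mp: "real M > 0" using M m0 by simp
  have "s M * real M - (\<Sum>j<n. e (Suc j) / real M ^ j) = real M * (s M - (\<Sum>j<Suc n. e j / real M ^ j))"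
    unfolding sum.lessThan_Suc_shift using Mp e0 by (simp add: right_diff_distrib sum_distrib_left mult.commute)
  then have "\<bar>s M * real M - (\<Sum>j<n. e (Suc j) / real M ^ j)\<bar> = real M * \<bar>s M - (\<Sum>j<Suc n. e j / real M ^ j)\<bar>"
    by (simp add: abs_mult)
  also have "\<dots> \<le> real M * (B / real M ^ Suc n)" using s[OF M] by (intro mult_left_mono) auto
  also have "\<dots> = B / real M ^ n" using Mp by simp
  finally show ?thesis .
qed

lemma expansion_unique_zero:
  assumes "\<And>M. M \<ge> 1 \<Longrightarrow> \<bar>\<Sum>j<n. e j / real M ^ j\<bar> \<le> B / real M ^ n" "j < n"
  shows "e j = 0"
  using assms
proof (induction n arbitrary: e j)
  case (Suc n)
  let ?s = "\<lambda>M::nat. 0::real"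
  have s: "\<bar>0 - (\<Sum>j<Suc n. e j / real M ^ j)\<bar> \<le> B / real M ^ Suc n" if "M \<ge> 1" for M
    using Suc.prems(1)[OF that] by (simp del: sum.lessThan_Suc)
  have e0: "e 0 = 0" by (rule leading_coefficient[where s = ?s and B' = 0, OF s]) auto
  have "\<bar>\<Sum>j<n. e (Suc j) / real M ^ j\<bar> \<le> B / real M ^ n" if "M \<ge> 1" for M
    using expansion_times_M[where s = ?s, OF s e0 _ that] by simp
  then have "e (Suc i) = 0" if "i < n" for i using Suc.IH[of "\<lambda>j. e (Suc j)"] that by blast
  then show ?case using e0 Suc.prems(2) by (cases j) auto
qed simp

definition has_coeffs :: "nat \<Rightarrow> (nat \<Rightarrow> real) \<Rightarrow> (nat \<Rightarrow> real) \<Rightarrow> bool" where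
  "has_coeffs N s a \<longleftrightarrow> (\<exists>B. \<forall>M\<ge>1. \<bar>s M - (\<Sum>j<N. a j / real M ^ j)\<bar> \<le> B / real M ^ N)"

lemma has_coeffs_Suc:
  assumes "has_coeffs (Suc N) s a" shows "has_coeffs N s a"
proof -
  obtain B where B: "\<forall>M\<ge>1. \<bar>s M - (\<Sum>j<Suc N. a j / real M ^ j)\<bar> \<le> B / real M ^ Suc N"
    using assms unfolding has_coeffs_def by blast
  have "\<bar>s M - (\<Sum>j<N. a j / real M ^ j)\<bar> \<le> (\<bar>B\<bar> + \<bar>a N\<bar>) / real M ^ N" if M: "M \<ge> 1" for M
  proof -
    have "B / real M ^ Suc N \<le> \<bar>B\<bar> / real M ^ N"
    proof -
      have "real M ^ N \<le> real M ^ Suc N" using M by (intro power_increasing) auto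
      then show ?thesis using M by (intro frac_le) auto
    qed
    moreover have "\<bar>a N / real M ^ N\<bar> = \<bar>a N\<bar> / real M ^ N" by simp
    moreover have "\<bar>s M - (\<Sum>j<N. a j / real M ^ j)\<bar> \<le> \<bar>s M - (\<Sum>j<Suc N. a j / real M ^ j)\<bar> + \<bar>a N / real M ^ N\<bar>"
      using abs_triangle_ineq[of "s M - (\<Sum>j<Suc N. a j / real M ^ j)" "a N / real M ^ N"] by simp
    moreover have "\<bar>s M - (\<Sum>j<Suc N. a j / real M ^ j)\<bar> \<le> B / real M ^ Suc N" using B M by blast
    ultimately show ?thesis unfolding add_divide_distrib by linarith
  qed
  then show ?thesis unfolding has_coeffs_def by blast
qed

lemma has_coeffs_mono: "has_coeffs (N + i) s a \<Longrightarrow> has_coeffs N s a"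
  by (induction i) (auto dest: has_coeffs_Suc)

lemma has_coeffs_unique:
  assumes "has_coeffs N s a" "has_coeffs N s b" "j < N" shows "a j = b j"
proof -
  obtain B where B: "\<forall>M\<ge>1. \<bar>s M - (\<Sum>j<N. a j / real M ^ j)\<bar> \<le> B / real M ^ N"
    using assms(1) unfolding has_coeffs_def by blast
  obtain B' where B': "\<forall>M\<ge>1. \<bar>s M - (\<Sum>j<N. b j / real M ^ j)\<bar> \<le> B' / real M ^ N"
    using assms(2) unfolding has_coeffs_def by blast
  have "\<bar>\<Sum>j<N. (a j - b j) / real M ^ j\<bar> \<le> (B + B') / real M ^ N" if "M \<ge> 1" for M
  proof -
    have "\<bar>s M - (\<Sum>j<N. a j / real M ^ j)\<bar> \<le> B / real M ^ N" "\<bar>s M - (\<Sum>j<N. b j / real M ^ j)\<bar> \<le> B' / real M ^ N"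
      using B B' that by blast+
    then show ?thesis unfolding diff_divide_distrib add_divide_distrib sum_subtractf by linarith
  qed
  then have "a j - b j = 0" using expansion_unique_zero[where n = N and e = "\<lambda>j. a j - b j" and B = "B + B'" and j = j] assms(3) by blast
  then show ?thesis by simp
qed

lemma has_coeffs_add:
  assumes "has_coeffs N s a" "has_coeffs N r b" shows "has_coeffs N (\<lambda>M. s M + r M) (\<lambda>j. a j + b j)"
proof -
  obtain B where B: "\<forall>M\<ge>1. \<bar>s M - (\<Sum>j<N. a j / real M ^ j)\<bar> \<le> B / real M ^ N"
    using assms(1) unfolding has_coeffs_def by blast
  obtain B' where B': "\<forall>M\<ge>1. \<bar>r M - (\<Sum>j<N. b j / real M ^ j)\<bar> \<le> B' / real M ^ N"
    using assms(2) unfolding has_coeffs_def by blast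
  have "\<bar>s M + r M - (\<Sum>j<N. (a j + b j) / real M ^ j)\<bar> \<le> (B + B') / real M ^ N" if "M \<ge> 1" for M
  proof -
    have "\<bar>s M - (\<Sum>j<N. a j / real M ^ j)\<bar> \<le> B / real M ^ N" "\<bar>r M - (\<Sum>j<N. b j / real M ^ j)\<bar> \<le> B' / real M ^ N"
      using B B' that by blast+
    then show ?thesis unfolding add_divide_distrib sum.distrib by linarith
  qed
  then show ?thesis unfolding has_coeffs_def by blast
qed

lemma has_coeffs_cmult:
  assumes "has_coeffs N s a" shows "has_coeffs N (\<lambda>M. c * s M) (\<lambda>j. c * a j)"
proof -
  obtain B where B: "\<forall>M\<ge>1. \<bar>s M - (\<Sum>j<N. a j / real M ^ j)\<bar> \<le> B / real M ^ N"
    using assms(1) unfolding has_coeffs_def by blast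
  have "\<bar>c * s M - (\<Sum>j<N. c * a j / real M ^ j)\<bar> \<le> (\<bar>c\<bar> * B) / real M ^ N" if "M \<ge> 1" for M
  proof -
    have "c * s M - (\<Sum>j<N. c * a j / real M ^ j) = c * (s M - (\<Sum>j<N. a j / real M ^ j))"
      by (simp add: right_diff_distrib sum_distrib_left)
    then have "\<bar>c * s M - (\<Sum>j<N. c * a j / real M ^ j)\<bar> = \<bar>c\<bar> * \<bar>s M - (\<Sum>j<N. a j / real M ^ j)\<bar>" by (simp add: abs_mult)
    also have "\<dots> \<le> \<bar>c\<bar> * (B / real M ^ N)" using B that by (intro mult_left_mono) auto
    finally show ?thesis by simp
  qed
  then show ?thesis unfolding has_coeffs_def by blast
qed

text \<open>The choice is unique by \<open>has_coeffs_unique\<close>, whatever the order of the expansion.\<close>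

definition coeff :: "(nat \<Rightarrow> real) \<Rightarrow> nat \<Rightarrow> real" where
  "coeff s j = (SOME a. has_coeffs (Suc j) s a) j"

lemma coeff_eq:
  assumes "has_coeffs N s a" "j < N" shows "coeff s j = a j"
proof -
  have "has_coeffs (Suc j) s a" using has_coeffs_mono[of "Suc j" "N - Suc j" s a] assms by simp
  then have "has_coeffs (Suc j) s (SOME a. has_coeffs (Suc j) s a)" by (rule someI[where P = "has_coeffs (Suc j) s"])
  from has_coeffs_unique[OF this \<open>has_coeffs (Suc j) s a\<close>, of j] show ?thesis by (simp add: coeff_def)
qed

lemma expands_coeff:
  assumes "expands 1 N B s"
  shows "\<And>j. j < N \<Longrightarrow> \<bar>coeff s j\<bar> \<le> B" "\<And>M. M \<ge> 1 \<Longrightarrow> \<bar>s M - (\<Sum>j<N. coeff s j / real M ^ j)\<bar> \<le> B / real M ^ N"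
    "has_coeffs N s (coeff s)"
proof -
  obtain a where a: "\<forall>j<N. \<bar>a j\<bar> \<le> B"
      "\<forall>M\<ge>1. \<bar>s M - (\<Sum>j<N. a j / real M ^ j)\<bar> \<le> B / real M ^ N"
    using assms unfolding expands_def by (elim exE conjE)
  have h: "has_coeffs N s a" using a(2) unfolding has_coeffs_def by blast
  then have eq: "coeff s j = a j" if "j < N" for j using coeff_eq that by blast
  show "\<bar>coeff s j\<bar> \<le> B" if "j < N" for j using a(1) eq that by simp
  have s: "(\<Sum>j<N. coeff s j / real M ^ j) = (\<Sum>j<N. a j / real M ^ j)" for M using eq by simp
  show "\<bar>s M - (\<Sum>j<N. coeff s j / real M ^ j)\<bar> \<le> B / real M ^ N" if "M \<ge> 1" for M
    unfolding s using a(2) that by blast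
  then show "has_coeffs N s (coeff s)" unfolding has_coeffs_def by blast
qed

text \<open>An a priori bound kills the first \<open>i\<close> coefficients.\<close>

lemma expands_lower:
  assumes "expands m0 (N + i) B s" "\<And>M. M \<ge> m0 \<Longrightarrow> \<bar>s M\<bar> \<le> B' / real M ^ i" "0 < m0"
  shows "expands m0 N B (\<lambda>M. s M * real M ^ i)"
  using assms
proof (induction i arbitrary: s)
  case (Suc i)
  obtain a where a: "\<forall>j<Suc (N + i). \<bar>a j\<bar> \<le> B"
      "\<forall>M\<ge>m0. \<bar>s M - (\<Sum>j<Suc (N + i). a j / real M ^ j)\<bar> \<le> B / real M ^ Suc (N + i)"
    using Suc.prems(1) unfolding expands_def add_Suc_right by (elim exE conjE)
  have B'0: "0 \<le> B'"
  proof (rule ccontr)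
    assume "\<not> 0 \<le> B'"
    then have "B' / real m0 ^ Suc i < 0" using Suc.prems(3) by (intro divide_neg_pos) auto
    then show False using Suc.prems(2)[of m0] by simp
  qed
  have "a 0 = 0"
  proof (rule leading_coefficient[where s = s and e = a and n = "N + i" and B' = B'])
    show "\<bar>s M\<bar> \<le> B' / real M" if M: "M \<ge> m0" for M
    proof -
      have "real M \<le> real M ^ Suc i" using M Suc.prems(3) self_le_power[of "real M" "Suc i"] by simp
      then have "B' / real M ^ Suc i \<le> B' / real M" using B'0 M Suc.prems(3) by (intro divide_left_mono) auto
      then show ?thesis using Suc.prems(2)[OF M] by linarith
    qed
  qed (use a(2) in blast)
  then have "expands m0 (N + i) B (\<lambda>M. s M * real M)"
    using a expansion_times_M[of m0 s a "N + i" B] Suc.prems(3) by (intro expandsI[where a = "\<lambda>j. a (Suc j)"]) auto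
  moreover have "\<bar>s M * real M\<bar> \<le> B' / real M ^ i" if M: "M \<ge> m0" for M
  proof -
    have "\<bar>s M\<bar> * real M \<le> B' / real M ^ Suc i * real M" using Suc.prems(2)[OF M] by (intro mult_right_mono) auto
    also have "\<dots> = B' / real M ^ i" using M Suc.prems(3) by simp
    finally show ?thesis by (simp add: abs_mult)
  qed
  ultimately have "expands m0 N B (\<lambda>M. s M * real M * real M ^ i)" using Suc.prems(3) by (rule Suc.IH)
  then show ?case by (simp add: mult.assoc)
qed simp

text \<open>Finitely many terms affect only the error constant.\<close>

lemma expands_extend:
  assumes "expands m0 N B s" "0 \<le> B" "0 < m0"
  shows "expands 1 N ((1 + real N * real m0 ^ N) * B) (\<lambda>M. if m0 \<le> M then s M else 0)"
proof -
  obtain a where ha: "\<forall>j<N. \<bar>a j\<bar> \<le> B"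
      "\<forall>M\<ge>m0. \<bar>s M - (\<Sum>j<N. a j / real M ^ j)\<bar> \<le> B / real M ^ N"
    using assms(1) unfolding expands_def by (elim exE conjE)
  note a = ha(1)[rule_format] ha(2)[rule_format]
  have BB: "B \<le> (1 + real N * real m0 ^ N) * B"
    using mult_right_mono[of 1 "1 + real N * real m0 ^ N" B] assms(2) by simp
  show ?thesis
  proof (rule expandsI[where a = a])
    show "\<bar>a j\<bar> \<le> (1 + real N * real m0 ^ N) * B" if "j < N" for j using a(1)[OF that] BB by linarith
    fix M :: nat assume M: "1 \<le> M"
    show "\<bar>(if m0 \<le> M then s M else 0) - (\<Sum>j<N. a j / real M ^ j)\<bar> \<le> (1 + real N * real m0 ^ N) * B / real M ^ N"
    proof (cases "m0 \<le> M")
      case True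
      have "B / real M ^ N \<le> (1 + real N * real m0 ^ N) * B / real M ^ N" using BB by (intro divide_right_mono) auto
      then show ?thesis using a(2)[OF True] True by simp
    next
      case False
      have "\<bar>\<Sum>j<N. a j / real M ^ j\<bar> \<le> (\<Sum>j<N. B)"
      proof (rule order_trans[OF sum_abs sum_mono])
        fix j assume "j \<in> {..<N}"
        then have "\<bar>a j\<bar> \<le> B" using a(1) by simp
        moreover have "1 \<le> real M ^ j" using M by simp
        ultimately have "\<bar>a j\<bar> / real M ^ j \<le> B / 1" using assms(2) by (intro frac_le) auto
        then show "\<bar>a j / real M ^ j\<bar> \<le> B" by simp
      qed
      then have "\<bar>\<Sum>j<N. a j / real M ^ j\<bar> \<le> real N * B" by simp
      also have "\<dots> \<le> real N * B * (real m0 ^ N / real M ^ N)"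
      proof -
        have "real M ^ N \<le> real m0 ^ N" using False by (intro power_mono) auto
        then have "1 \<le> real m0 ^ N / real M ^ N" using M by simp
        then show ?thesis using mult_left_mono[of 1 "real m0 ^ N / real M ^ N" "real N * B"] assms(2) by simp
      qed
      also have "\<dots> \<le> (1 + real N * real m0 ^ N) * B / real M ^ N"
      proof -
        have "real N * B * real m0 ^ N \<le> (1 + real N * real m0 ^ N) * B" using assms(2) by (simp add: algebra_simps)
        then show ?thesis by (simp add: divide_right_mono)
      qed
      finally show ?thesis using False by simp
    qed
  qed
qed

section \<open>Sums over the lattice points of \<open>P\<^sub>t\<close>\<close>

lemma csum_linear: "linear f \<Longrightarrow> csum (map f vs) L (f b) F = csum vs L b (\<lambda>x. F (f x))"
proof (induction vs arbitrary: L b)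
  case (Cons v vs)
  have "f b + real j *\<^sub>R f v = f (b + real j *\<^sub>R v)" for j
    using Cons.prems by (simp add: linear_add linear_scale)
  then show ?case using Cons by simp
qed simp

text \<open>\<open>Q\<close> is given both by inequalities and as the convex hull of \<open>W\<close>, and \<open>k\<^sub>0\<close> clears the denominators of \<open>W\<close>. It
  may be of smaller dimension than \<open>P\<close>.\<close>

locale rational_polytope = convex_body P for P :: "(real^'n) set" +
  fixes Q :: "(real^'n) set" and H :: "((real^'n) \<times> real) set" and W :: "(real^'n) set" and k0 :: nat
  assumes Q_P: "Q \<subseteq> P" and Q_H: "Q = {x. \<forall>p\<in>H. 0 \<le> lev p x 1}" and fin_H: "finite H"
    and fin_W: "finite W" and W_ne: "W \<noteq> {}" and Q_W: "Q = convex hull W"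
    and k0: "0 < k0" and k0_W: "\<And>w. w \<in> W \<Longrightarrow> real k0 *\<^sub>R w \<in> int_lattice"
begin

definition "gens = map (\<lambda>w. real k0 *\<^sub>R w) (SOME ws. set ws = W)"

lemma set_gens: "set gens = (\<lambda>w. real k0 *\<^sub>R w) ` W"
proof -
  have "set (SOME ws. set ws = W) = W" using finite_list[OF fin_W] by (rule someI_ex)
  then show ?thesis by (simp add: gens_def)
qed

sublocale lattice_polytope "(\<lambda>p. (fst p, real k0 * snd p)) ` H" gens
proof
  show "finite ((\<lambda>p. (fst p, real k0 * snd p)) ` H)" using fin_H by simp
  show "set gens \<subseteq> int_lattice" using k0_W by (auto simp: set_gens)
  show "gens \<noteq> []" using set_gens W_ne by (metis image_is_empty list.set(1))
  have L: "lev (fst p, real k0 * snd p) x 1 = real k0 * lev p ((1 / real k0) *\<^sub>R x) 1" for p x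
    using k0 by (simp add: lev_def algebra_simps)
  have "{x. \<forall>p\<in>(\<lambda>p. (fst p, real k0 * snd p)) ` H. 0 \<le> lev p x 1} = {x. (1 / real k0) *\<^sub>R x \<in> Q}"
    using k0 by (simp add: Q_H L zero_le_mult_iff)
  also have "\<dots> = (\<lambda>x. real k0 *\<^sub>R x) ` Q"
    using k0 by (force simp: image_iff)
  also have "\<dots> = convex hull (set gens)"
    unfolding Q_W set_gens by (rule convex_hull_scaling[symmetric])
  finally show "{x. \<forall>p\<in>(\<lambda>p. (fst p, real k0 * snd p)) ` H. 0 \<le> lev p x 1} = convex hull (set gens)" .
qed

lemma lev_k0: "lev (fst p, real k0 * snd p) \<beta> (int m) = real (k0 * m) * lev p ((1 / real (k0 * m)) *\<^sub>R \<beta>) 1" if "m > 0"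
  using that k0 by (simp add: lev_def algebra_simps)

lemma lattice_points_scaled:
  assumes m: "m > 0"
  shows "Q \<inter> scaled_lattice (k0 * m) = (\<lambda>\<beta>. (1 / real (k0 * m)) *\<^sub>R \<beta>) ` lattice_points m" (is "?L = ?f ` _")
proof
  have k: "real (k0 * m) > 0" using m k0 by simp
  have e: "0 \<le> lev (fst p, real k0 * snd p) \<beta> (int m) \<longleftrightarrow> 0 \<le> lev p (?f \<beta>) 1" for p \<beta>
    using k unfolding lev_k0[OF m] by (simp add: zero_le_mult_iff del: of_nat_mult)
  have QI: "x \<in> Q \<longleftrightarrow> (\<forall>p\<in>H. 0 \<le> lev p x 1)" for x using Q_H by blast
  have iff: "\<beta> \<in> lattice_points m \<longleftrightarrow> \<beta> \<in> int_lattice \<and> ?f \<beta> \<in> Q" for \<beta>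
    unfolding lattice_points_def mem_Collect_eq ball_simps e QI ..
  have inv: "real (k0 * m) *\<^sub>R ?f \<beta> = \<beta>" for \<beta> using k by (simp del: of_nat_mult)
  show "?f ` lattice_points m \<subseteq> ?L" using iff inv by (auto simp: scaled_lattice_def)
  show "?L \<subseteq> ?f ` lattice_points m"
  proof
    fix x assume "x \<in> ?L"
    then have x: "x \<in> Q" "real (k0 * m) *\<^sub>R x \<in> int_lattice" by (auto simp: scaled_lattice_def)
    have "1 / real (k0 * m) * real (k0 * m) = 1" using k by (simp del: of_nat_mult)
    then have fx: "?f (real (k0 * m) *\<^sub>R x) = x" by (simp only: scaleR_scaleR scaleR_one)
    have "real (k0 * m) *\<^sub>R x \<in> lattice_points m" unfolding iff fx using x by blast
    then show "x \<in> ?f ` lattice_points m" by (rule image_eqI[rotated]) (rule fx[symmetric])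
  qed
qed

definition "lsum m g = (\<Sum>\<alpha>\<in>Q \<inter> scaled_lattice (k0 * m). g \<alpha>)"

lemma finite_scaled: "m > 0 \<Longrightarrow> finite (Q \<inter> scaled_lattice (k0 * m))"
  unfolding lattice_points_scaled using lattice_points_count by blast

lemma scaled_count: "\<exists>C\<ge>0. \<forall>m>0. real (card (Q \<inter> scaled_lattice (k0 * m))) \<le> C * real m ^ CARD('n)"
proof -
  obtain C where C: "C \<ge> 0" "\<forall>m. finite (lattice_points m) \<and> (m > 0 \<longrightarrow> real (card (lattice_points m)) \<le> C * real m ^ CARD('n))"
    using lattice_points_count by blast
  have "real (card (Q \<inter> scaled_lattice (k0 * m))) \<le> C * real m ^ CARD('n)" if m: "m > 0" for m
  proof -
    have "card (Q \<inter> scaled_lattice (k0 * m)) \<le> card (lattice_points m)"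
      unfolding lattice_points_scaled[OF m] using C(2) by (intro card_image_le) blast
    then have "real (card (Q \<inter> scaled_lattice (k0 * m))) \<le> real (card (lattice_points m))" by simp
    also have "\<dots> \<le> C * real m ^ CARD('n)" using C(2) m by blast
    finally show ?thesis .
  qed
  then show ?thesis using C by blast
qed

lemma lsum_eq: "m > 0 \<Longrightarrow> lsum m g = (\<Sum>\<beta>\<in>lattice_points m. g ((1 / real (k0 * m)) *\<^sub>R \<beta>))"
  unfolding lsum_def using k0 by (simp add: lattice_points_scaled) (subst sum.reindex, auto simp: inj_on_def)

lemma lattice_point_scal: "b \<in> lattice_points l \<Longrightarrow> (1 / real k0) *\<^sub>R b \<in> scal l"
proof (cases "l = 0")
  case True
  assume "b \<in> lattice_points l"
  then have "b = 0" using True lattice_points_0 by simp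
  moreover obtain y where "y \<in> P" using interior_P interior_sub by blast
  ultimately show ?thesis using True by (auto simp: scal_def)
next
  case False
  assume b: "b \<in> lattice_points l"
  then have "(1 / real (k0 * l)) *\<^sub>R b \<in> Q" using lattice_points_scaled[of l] False by blast
  then have "(1 / real (k0 * l)) *\<^sub>R b \<in> P" using Q_P by blast
  moreover have "(1 / real k0) *\<^sub>R b = real l *\<^sub>R ((1 / real (k0 * l)) *\<^sub>R b)" using False k0 by simp
  ultimately show ?thesis unfolding scal_def by blast
qed

text \<open>The number of generators minus one is the growth rate of each single sum over compositions; it may
  exceed that of the whole sum.\<close>

lemma lsum_expansion_raw:
  "\<exists>C m. 0 \<le> C \<and> (\<forall>g\<in>CP. expands 1 N (C * nrm m g) (\<lambda>M. lsum M g / real M ^ (length gens - 1)))"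
proof -
  obtain T \<kappa> where T: "finite T" "\<forall>(b, l)\<in>T. b \<in> lattice_points l"
    "\<forall>m F. (\<Sum>\<beta>\<in>lattice_points m. F \<beta>) = (\<Sum>(b, l)\<in>T. if l \<le> m then \<kappa> b l * csum gens (m - l) b F else 0)"
    using lattice_sum_decomposition by (elim exE conjE)
  define ws where "ws = map (\<lambda>x. (1 / real k0) *\<^sub>R x) gens"
  have lin: "linear (\<lambda>x::real^'n. (1 / real k0) *\<^sub>R x)" by (simp add: linear_iff scaleR_add_right)
  have ws: "ws \<noteq> []" "set ws \<subseteq> P" "length ws = length gens"
  proof -
    have "w \<in> P" if "w \<in> W" for w using that Q_W Q_P hull_inc[of w W] by auto
    then show "set ws \<subseteq> P" using k0 by (auto simp: ws_def set_gens)
  qed (auto simp: ws_def vs_ne)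
  let ?d = "length gens - 1"
  have X: "\<forall>z\<in>T. \<exists>C m. 0 \<le> C \<and> (\<forall>g\<in>CP. expands (max 1 (snd z)) N (C * nrm m g)
     (\<lambda>M. csum ws (M - snd z) ((1 / real k0) *\<^sub>R fst z) (\<lambda>x. g ((1 / real M) *\<^sub>R x)) / real M ^ ?d))"
  proof
    fix z assume "z \<in> T"
    then have "fst z \<in> lattice_points (snd z)" using T(2) by auto
    from csum_expansion[OF lattice_point_scal[OF this] ws(1,2), of N]
    show "\<exists>C m. 0 \<le> C \<and> (\<forall>g\<in>CP. expands (max 1 (snd z)) N (C * nrm m g)
     (\<lambda>M. csum ws (M - snd z) ((1 / real k0) *\<^sub>R fst z) (\<lambda>x. g ((1 / real M) *\<^sub>R x)) / real M ^ ?d))"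
      by (simp only: ws(3))
  qed
  from bchoice[OF X] obtain C where C1: "\<forall>z\<in>T. \<exists>m. 0 \<le> C z \<and> (\<forall>g\<in>CP. expands (max 1 (snd z)) N (C z * nrm m g)
     (\<lambda>M. csum ws (M - snd z) ((1 / real k0) *\<^sub>R fst z) (\<lambda>x. g ((1 / real M) *\<^sub>R x)) / real M ^ ?d))"
    by (elim exE)
  from bchoice[OF C1] obtain mm where Cm: "\<forall>z\<in>T. 0 \<le> C z \<and> (\<forall>g\<in>CP. expands (max 1 (snd z)) N (C z * nrm (mm z) g)
     (\<lambda>M. csum ws (M - snd z) ((1 / real k0) *\<^sub>R fst z) (\<lambda>x. g ((1 / real M) *\<^sub>R x)) / real M ^ ?d))"
    by (elim exE)
  define q where "q = Max (insert 0 (mm ` T))"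
  have q: "mm z \<le> q" if "z \<in> T" for z unfolding q_def using T(1) that by (intro Max_ge) auto
  define E where "E z = \<bar>\<kappa> (fst z) (snd z)\<bar> * ((1 + real N * real (max 1 (snd z)) ^ N) * C z)" for z
  have E0: "0 \<le> E z" if "z \<in> T" for z using Cm that by (auto simp: E_def)
  have "expands 1 N ((\<Sum>z\<in>T. E z) * nrm q g) (\<lambda>M. lsum M g / real M ^ ?d)" if g: "g \<in> CP" for g
  proof -
    define s where "s z M = csum ws (M - snd z) ((1 / real k0) *\<^sub>R fst z) (\<lambda>x. g ((1 / real M) *\<^sub>R x)) / real M ^ ?d" for z M
    have "expands 1 N (\<Sum>z\<in>T. E z * nrm q g) (\<lambda>M. \<Sum>z\<in>T. \<kappa> (fst z) (snd z) * (if max 1 (snd z) \<le> M then s z M else 0))"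
    proof (rule expands_sum)
      fix z assume z: "z \<in> T"
      have "expands (max 1 (snd z)) N (C z * nrm (mm z) g) (s z)" unfolding s_def[abs_def] using Cm z g by blast
      then have "expands (max 1 (snd z)) N (C z * nrm q g) (s z)"
        by (rule expands_mono) (use Cm z in \<open>auto intro!: mult_left_mono nrm_mono g q\<close>)
      then have "expands 1 N ((1 + real N * real (max 1 (snd z)) ^ N) * (C z * nrm q g)) (\<lambda>M. if max 1 (snd z) \<le> M then s z M else 0)"
        by (rule expands_extend) (use Cm z nrm_nonneg[OF g] in auto)
      from expands_cmult[OF this, of "\<kappa> (fst z) (snd z)"]
      show "expands 1 N (E z * nrm q g) (\<lambda>M. \<kappa> (fst z) (snd z) * (if max 1 (snd z) \<le> M then s z M else 0))"
        by (simp add: E_def mult.assoc)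
    qed
    then have "expands 1 N (\<Sum>z\<in>T. E z * nrm q g) (\<lambda>M. lsum M g / real M ^ ?d)"
    proof (rule expands_cong)
      fix M :: nat assume M: "1 \<le> M"
      have cs: "csum gens (M - snd z) (fst z) (\<lambda>\<beta>. g ((1 / real (k0 * M)) *\<^sub>R \<beta>)) = real M ^ ?d * s z M" for z
      proof -
        have "csum ws (M - snd z) ((1 / real k0) *\<^sub>R fst z) (\<lambda>x. g ((1 / real M) *\<^sub>R x))
          = csum gens (M - snd z) (fst z) (\<lambda>\<beta>. g ((1 / real M) *\<^sub>R (1 / real k0) *\<^sub>R \<beta>))"
          unfolding ws_def by (rule csum_linear[OF lin])
        then show ?thesis using M by (simp add: s_def mult.commute)
      qed
      have "lsum M g = (\<Sum>z\<in>T. if snd z \<le> M then \<kappa> (fst z) (snd z) * csum gens (M - snd z) (fst z) (\<lambda>\<beta>. g ((1 / real (k0 * M)) *\<^sub>R \<beta>)) else 0)"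
        using M by (simp add: lsum_eq T(3) case_prod_unfold del: of_nat_mult)
      then have "lsum M g = (\<Sum>z\<in>T. if snd z \<le> M then \<kappa> (fst z) (snd z) * (real M ^ ?d * s z M) else 0)"
        by (simp only: cs)
      also have "\<dots> = (\<Sum>z\<in>T. real M ^ ?d * (\<kappa> (fst z) (snd z) * (if max 1 (snd z) \<le> M then s z M else 0)))"
        using M by (intro sum.cong refl) auto
      also have "\<dots> = real M ^ ?d * (\<Sum>z\<in>T. \<kappa> (fst z) (snd z) * (if max 1 (snd z) \<le> M then s z M else 0))"
        by (simp only: sum_distrib_left)
      finally show "(\<Sum>z\<in>T. \<kappa> (fst z) (snd z) * (if max 1 (snd z) \<le> M then s z M else 0)) = lsum M g / real M ^ ?d"
        using M by simp
    qed
    then show ?thesis by (simp only: sum_distrib_right)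
  qed
  moreover have "0 \<le> (\<Sum>z\<in>T. E z)" using E0 by (rule sum_nonneg)
  ultimately show ?thesis by (intro exI[of _ "\<Sum>z\<in>T. E z"] exI[of _ q]) simp
qed

text \<open>If there are more generators than \<open>n + 1\<close>, the excessive powers cancel because \<open>Q\<close> has only \<open>O(M\<^sup>n)\<close>
  lattice points.\<close>

lemma lsum_expansion:
  "\<exists>C m. 0 \<le> C \<and> (\<forall>g\<in>CP. expands 1 N (C * nrm m g) (\<lambda>M. lsum M g / real M ^ CARD('n)))"
proof (cases "length gens - 1 \<le> CARD('n)")
  case True
  then obtain i where i: "CARD('n) = length gens - 1 + i" using le_Suc_ex by blast
  obtain C m where C: "0 \<le> C" "\<forall>g\<in>CP. expands 1 N (C * nrm m g) (\<lambda>M. lsum M g / real M ^ (length gens - 1))"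
    using lsum_expansion_raw[of N] by blast
  have "expands 1 N ((real (Suc i) * C) * nrm m g) (\<lambda>M. lsum M g / real M ^ CARD('n))" if g: "g \<in> CP" for g
  proof -
    have n0: "0 \<le> C * nrm m g" using C nrm_nonneg[OF g] by simp
    have "expands 1 (N + i) (C * nrm m g) (\<lambda>M. lsum M g / real M ^ (length gens - 1) / real M ^ i)"
      using C(2) g by (intro expands_divide_power n0) blast
    from expands_drop[OF this _ n0] show ?thesis by (simp add: i power_add mult.assoc)
  qed
  then show ?thesis using C by (intro exI[of _ "real (Suc i) * C"] exI[of _ m]) simp
next
  case False
  then obtain i where i: "length gens - 1 = CARD('n) + i" by (metis le_Suc_ex nat_le_linear)
  obtain C m where C: "0 \<le> C" "\<forall>g\<in>CP. expands 1 (N + i) (C * nrm m g) (\<lambda>M. lsum M g / real M ^ (length gens - 1))"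
    using lsum_expansion_raw[of "N + i"] by blast
  obtain E where E: "E \<ge> 0" "\<forall>m>0. real (card (Q \<inter> scaled_lattice (k0 * m))) \<le> E * real m ^ CARD('n)"
    using scaled_count by blast
  have "expands 1 N (C * nrm m g) (\<lambda>M. lsum M g / real M ^ CARD('n))" if g: "g \<in> CP" for g
  proof -
    have "expands 1 N (C * nrm m g) (\<lambda>M. lsum M g / real M ^ (length gens - 1) * real M ^ i)"
    proof (rule expands_lower[where B' = "E * nrm 0 g"])
      show "expands 1 (N + i) (C * nrm m g) (\<lambda>M. lsum M g / real M ^ (length gens - 1))" using C(2) g by blast
      fix M :: nat assume M: "M \<ge> 1"
      have "\<bar>lsum M g\<bar> \<le> (\<Sum>\<alpha>\<in>Q \<inter> scaled_lattice (k0 * M). nrm 0 g)"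
        unfolding lsum_def using Q_P nrm_val[OF g] by (intro order_trans[OF sum_abs sum_mono]) auto
      also have "\<dots> \<le> E * real M ^ CARD('n) * nrm 0 g"
        using E(2) M nrm_nonneg[OF g] by (simp add: mult_right_mono)
      finally have "\<bar>lsum M g\<bar> / real M ^ (length gens - 1) \<le> E * real M ^ CARD('n) * nrm 0 g / real M ^ (length gens - 1)"
        by (intro divide_right_mono) auto
      also have "\<dots> = E * nrm 0 g / real M ^ i" unfolding i power_add using M by simp
      finally show "\<bar>lsum M g / real M ^ (length gens - 1)\<bar> \<le> E * nrm 0 g / real M ^ i" by simp
    qed simp
    then show ?thesis unfolding i power_add by (rule expands_cong) simp
  qed
  then show ?thesis using C by blast
qed

end

section \<open>Distributions\<close>

lemma (in convex_body) distribution_onI: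
  assumes "\<And>f g. f \<in> CP \<Longrightarrow> g \<in> CP \<Longrightarrow> \<xi> (\<lambda>x. f x + g x) = \<xi> f + \<xi> g"
    and "\<And>f c. f \<in> CP \<Longrightarrow> \<xi> (\<lambda>x. c * f x) = c * \<xi> f"
    and "\<And>f. f \<in> CP \<Longrightarrow> \<bar>\<xi> f\<bar> \<le> C * nrm m f"
  shows "distribution_on P \<xi>"
  unfolding distribution_on_def using assms by blast

lemma distribution_on_zero: "distribution_on P (\<lambda>f. 0)"
  unfolding distribution_on_def by (auto intro!: exI[of _ "0::real"])

lemma distribution_on_cmult:
  assumes "distribution_on P \<xi>" shows "distribution_on P (\<lambda>f. c * \<xi> f)"
proof -
  obtain m C where C: "\<forall>f\<in>smooth_upto P. \<bar>\<xi> f\<bar> \<le> C * Cnorm P m f"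
    using assms unfolding distribution_on_def by blast
  have "\<bar>c * \<xi> f\<bar> \<le> (\<bar>c\<bar> * C) * Cnorm P m f" if "f \<in> smooth_upto P" for f
    using mult_left_mono[OF bspec[OF C that] abs_ge_zero[of c]] by (simp add: abs_mult mult.assoc)
  then have "\<exists>m C. \<forall>f\<in>smooth_upto P. \<bar>c * \<xi> f\<bar> \<le> C * Cnorm P m f" by blast
  then show ?thesis using assms unfolding distribution_on_def by (simp add: algebra_simps)
qed

lemma (in convex_body) distribution_on_add:
  assumes "distribution_on P \<xi>" "distribution_on P \<eta>" shows "distribution_on P (\<lambda>f. \<xi> f + \<eta> f)"
proof -
  obtain m C where C: "\<forall>f\<in>CP. \<bar>\<xi> f\<bar> \<le> C * nrm m f"
    using assms(1) unfolding distribution_on_def by blast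
  obtain m' C' where C': "\<forall>f\<in>CP. \<bar>\<eta> f\<bar> \<le> C' * nrm m' f"
    using assms(2) unfolding distribution_on_def by blast
  have "\<bar>\<xi> f + \<eta> f\<bar> \<le> (\<bar>C\<bar> + \<bar>C'\<bar>) * nrm (max m m') f" if f: "f \<in> CP" for f
  proof -
    have "C * nrm m f \<le> \<bar>C\<bar> * nrm (max m m') f" "C' * nrm m' f \<le> \<bar>C'\<bar> * nrm (max m m') f"
      using nrm_nonneg[OF f] by (auto intro!: mult_mono nrm_mono[OF f])
    moreover have "\<bar>\<xi> f\<bar> \<le> C * nrm m f" "\<bar>\<eta> f\<bar> \<le> C' * nrm m' f" using C C' f by blast+
    ultimately show ?thesis unfolding distrib_right by linarith
  qed
  then have "\<exists>m C. \<forall>f\<in>CP. \<bar>\<xi> f + \<eta> f\<bar> \<le> C * nrm m f" by blast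
  then show ?thesis using assms unfolding distribution_on_def by (simp add: algebra_simps)
qed

lemma (in convex_body) distribution_on_sum:
  "(\<And>i. i \<in> I \<Longrightarrow> distribution_on P (\<xi> i)) \<Longrightarrow> distribution_on P (\<lambda>f. \<Sum>i\<in>I. \<xi> i f)"
  by (induction I rule: infinite_finite_induct) (auto intro: distribution_on_zero distribution_on_add)

section \<open>The expansion of the partial density functions\<close>

locale partial_density_setup = toric_inverse_hessian A \<nu> lam P u G Z + rational_polytope P Q H W k0
  for A :: "'a set" and \<nu> :: "'a \<Rightarrow> real^'n" and lam P u G Z Q H W k0
begin

definition "dens k f = (\<Sum>\<alpha>\<in>Q \<inter> scaled_lattice k. expect k \<alpha> f)"

lemma density_pairing_eq:
  assumes fin: "finite (Q \<inter> scaled_lattice k)" and f: "f \<in> CP"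
  shows "density_pairing P u Q k f = dens k f"
proof -
  let ?S = "Q \<inter> scaled_lattice k" and ?c = "(2 * pi) ^ CARD('n)"
  have aP: "\<alpha> \<in> P" if "\<alpha> \<in> ?S" for \<alpha> using that Q_P by blast
  have "sqnorm_e P u k \<alpha> y = E k \<alpha> y / (?c * mass k \<alpha>)" for \<alpha> y
  proof -
    have "integral P (\<lambda>z. exp (- real k * phi u \<alpha> z)) = mass k \<alpha>"
      unfolding mass_def E_def[abs_def] by (rule integral_interior)
    then show ?thesis unfolding sqnorm_e_def E_def by simp
  qed
  then have "density_pairing P u Q k f = ?c * integral (interior P) (\<lambda>y. \<Sum>\<alpha>\<in>?S. (1 / (?c * mass k \<alpha>)) * (E k \<alpha> y * f y))"
    unfolding density_pairing_def liouville_integral_def partial_density_def integral_interior[of "\<lambda>y. _ y * f y"]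
    by (simp add: sum_distrib_right)
  also have "\<dots> = ?c * (\<Sum>\<alpha>\<in>?S. (1 / (?c * mass k \<alpha>)) * integral (interior P) (\<lambda>y. E k \<alpha> y * f y))"
  proof -
    have "integral (interior P) (\<lambda>y. \<Sum>\<alpha>\<in>?S. (1 / (?c * mass k \<alpha>)) * (E k \<alpha> y * f y))
      = (\<Sum>\<alpha>\<in>?S. integral (interior P) (\<lambda>y. (1 / (?c * mass k \<alpha>)) * (E k \<alpha> y * f y)))"
      using fin by (intro integral_sum integrable_on_mult_right E_integrable aP f) auto
    then show ?thesis by (simp only: integral_mult_right)
  qed
  also have "\<dots> = dens k f"
    unfolding dens_def expect_def sum_distrib_left by (intro sum.cong refl) simp
  finally show ?thesis .
qed

lemma dens_distribution:
  shows "distribution_on P (dens k)"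
proof (rule distribution_onI[where m = 0])
  have aP: "\<alpha> \<in> P" if "\<alpha> \<in> Q \<inter> scaled_lattice k" for \<alpha> using that Q_P by blast
  show "dens k (\<lambda>x. f x + g x) = dens k f + dens k g" if "f \<in> CP" "g \<in> CP" for f g
    unfolding dens_def sum.distrib[symmetric] using that aP by (intro sum.cong refl expect_add) auto
  show "dens k (\<lambda>x. c * f x) = c * dens k f" for f c
    unfolding dens_def expect_cmult sum_distrib_left ..
  show "\<bar>dens k f\<bar> \<le> real (card (Q \<inter> scaled_lattice k)) * nrm 0 f" if f: "f \<in> CP" for f
  proof -
    have "\<bar>expect k \<alpha> f\<bar> \<le> nrm 0 f" if "\<alpha> \<in> Q \<inter> scaled_lattice k" for \<alpha>
      using expect_abs_le[OF aP[OF that] f smooth_upto_const nrm_val[OF f], of k 0] expect_const[OF aP[OF that]] by simp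
    then have "\<bar>dens k f\<bar> \<le> (\<Sum>\<alpha>\<in>Q \<inter> scaled_lattice k. nrm 0 f)"
      unfolding dens_def by (intro order_trans[OF sum_abs sum_mono])
    then show ?thesis by simp
  qed
qed

text \<open>The expansion of the expectations is inserted into the sum over the lattice points, and the
  coefficients, being smooth functions on \<open>P\<close>, are summed asymptotically.\<close>

lemma dens_expansion:
  "\<exists>C m. 0 \<le> C \<and> (\<forall>f\<in>CP. expands 1 N (C * nrm m f) (\<lambda>M. dens (k0 * M) f / real M ^ CARD('n)))"
proof -
  obtain T where T: "\<forall>j. bop (T j)" "vanishes N (\<lambda>g k x. expect k x g - (\<Sum>j<N. T j g x / real k ^ j))"
    using expandableD[OF expect_expansion[of N]] by (elim exE conjE)
  obtain C m where C: "0 \<le> C" "\<forall>g\<in>CP. \<forall>x\<in>P. \<forall>k>0. \<bar>expect k x g - (\<Sum>j<N. T j g x / real k ^ j)\<bar> \<le> C * nrm m g / real k ^ N"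
    using vanishesD[OF T(2)] by (elim exE conjE)
  obtain Cn where Cn: "Cn \<ge> 0" "\<forall>m>0. real (card (Q \<inter> scaled_lattice (k0 * m))) \<le> Cn * real m ^ CARD('n)"
    using scaled_count by blast
  have X: "\<forall>j. \<exists>C m. 0 \<le> C \<and> (\<forall>f\<in>CP. expands 1 N (C * nrm m f) (\<lambda>M. lsum M (T j f) / real M ^ CARD('n)))"
  proof
    fix j
    obtain C1 m1 where 1: "0 \<le> C1" "\<forall>g\<in>CP. expands 1 N (C1 * nrm m1 g) (\<lambda>M. lsum M g / real M ^ CARD('n))"
      using lsum_expansion[of N] by blast
    obtain m2 C2 where 2: "0 \<le> C2" "\<forall>f\<in>CP. nrm m1 (T j f) \<le> C2 * nrm m2 f"
      using bop_bound[OF spec[OF T(1)]] by blast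
    have "expands 1 N ((C1 * C2) * nrm m2 f) (\<lambda>M. lsum M (T j f) / real M ^ CARD('n))" if f: "f \<in> CP" for f
    proof (rule expands_mono)
      show "expands 1 N (C1 * nrm m1 (T j f)) (\<lambda>M. lsum M (T j f) / real M ^ CARD('n))"
        using 1(2) bop_CP[OF spec[OF T(1)] f] by blast
      show "C1 * nrm m1 (T j f) \<le> (C1 * C2) * nrm m2 f"
        using mult_left_mono[OF bspec[OF 2(2) f] 1(1)] by (simp add: mult.assoc)
    qed
    then show "\<exists>C m. 0 \<le> C \<and> (\<forall>f\<in>CP. expands 1 N (C * nrm m f) (\<lambda>M. lsum M (T j f) / real M ^ CARD('n)))"
      using 1 2 by (intro exI[of _ "C1 * C2"] exI[of _ m2]) simp
  qed
  from choice[OF X] obtain Cj where "\<forall>j. \<exists>m. 0 \<le> Cj j \<and> (\<forall>f\<in>CP. expands 1 N (Cj j * nrm m f) (\<lambda>M. lsum M (T j f) / real M ^ CARD('n)))"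
    by (elim exE)
  from choice[OF this] obtain mj where Cj: "\<forall>j. 0 \<le> Cj j \<and> (\<forall>f\<in>CP. expands 1 N (Cj j * nrm (mj j) f) (\<lambda>M. lsum M (T j f) / real M ^ CARD('n)))"
    by (elim exE)
  define q where "q = Max (insert m (mj ` {..<N}))"
  have q: "m \<le> q" "\<And>j. j < N \<Longrightarrow> mj j \<le> q" unfolding q_def by (auto intro!: Max_ge)
  define F where "F j = (1 / real k0) ^ j * (real (Suc j) * Cj j)" for j
  have F0: "0 \<le> F j" for j using Cj by (simp add: F_def)
  have "expands 1 N (((\<Sum>j<N. F j) + Cn * C) * nrm q f) (\<lambda>M. dens (k0 * M) f / real M ^ CARD('n))" if f: "f \<in> CP" for f
  proof -
    define main where "main M = (\<Sum>j<N. (1 / real k0) ^ j * (lsum M (T j f) / real M ^ CARD('n) / real M ^ j))" for M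
    have 1: "expands 1 N (\<Sum>j<N. F j * nrm q f) main" unfolding main_def[abs_def]
    proof (rule expands_sum)
      fix j assume j: "j \<in> {..<N}"
      have n0: "0 \<le> Cj j * nrm q f" using Cj nrm_nonneg[OF f] by simp
      have "expands 1 N (Cj j * nrm (mj j) f) (\<lambda>M. lsum M (T j f) / real M ^ CARD('n))" using Cj f by blast
      then have "expands 1 N (Cj j * nrm q f) (\<lambda>M. lsum M (T j f) / real M ^ CARD('n))"
        by (rule expands_mono) (use Cj j q in \<open>auto intro!: mult_left_mono nrm_mono f\<close>)
      from expands_drop[OF expands_divide_power[OF this n0, of j] _ n0]
      have "expands 1 N (real (Suc j) * (Cj j * nrm q f)) (\<lambda>M. lsum M (T j f) / real M ^ CARD('n) / real M ^ j)" by simp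
      from expands_cmult[OF this, of "(1 / real k0) ^ j"]
      show "expands 1 N (F j * nrm q f) (\<lambda>M. (1 / real k0) ^ j * (lsum M (T j f) / real M ^ CARD('n) / real M ^ j))"
        by (simp add: F_def mult.assoc)
    qed
    have 2: "expands 1 N (Cn * C * nrm q f) (\<lambda>M. dens (k0 * M) f / real M ^ CARD('n) - main M)"
    proof (rule expands_bounded)
      fix M :: nat assume M: "1 \<le> M"
      let ?k = "k0 * M" and ?S = "Q \<inter> scaled_lattice (k0 * M)"
      have k: "0 < ?k" using M k0 by simp
      have mm: "main M = (\<Sum>\<alpha>\<in>?S. \<Sum>j<N. T j f \<alpha> / real ?k ^ j) / real M ^ CARD('n)"
        unfolding main_def lsum_def sum.swap[of _ "{..<N}"]
        by (simp add: sum_divide_distrib sum_distrib_left power_mult_distrib power_divide mult_ac)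
      have "\<bar>dens ?k f - (\<Sum>\<alpha>\<in>?S. \<Sum>j<N. T j f \<alpha> / real ?k ^ j)\<bar> \<le> (\<Sum>\<alpha>\<in>?S. C * nrm m f / real ?k ^ N)"
        unfolding dens_def sum_subtractf[symmetric]
        using C(2) f k Q_P by (intro order_trans[OF sum_abs sum_mono]) blast
      also have "\<dots> \<le> (Cn * real M ^ CARD('n)) * (C * nrm m f / real ?k ^ N)"
        unfolding sum_constant using Cn(2) M C(1) nrm_nonneg[OF f] by (intro mult_right_mono) auto
      also have "\<dots> \<le> (Cn * real M ^ CARD('n)) * (C * nrm q f / real M ^ N)"
      proof -
        have "real M \<le> real ?k" using mult_right_mono[of 1 "real k0" "real M"] k0 by simp
        then have "real M ^ N \<le> real ?k ^ N" by (intro power_mono) auto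
        then show ?thesis using Cn(1) C(1) M nrm_mono[OF f q(1)] nrm_nonneg[OF f]
          by (intro mult_left_mono frac_le) auto
      qed
      finally have "\<bar>dens ?k f - (\<Sum>\<alpha>\<in>?S. \<Sum>j<N. T j f \<alpha> / real ?k ^ j)\<bar> / real M ^ CARD('n)
         \<le> (Cn * real M ^ CARD('n)) * (C * nrm q f / real M ^ N) / real M ^ CARD('n)"
        by (intro divide_right_mono) auto
      also have "\<dots> = Cn * C * nrm q f / real M ^ N" using M by simp
      finally show "\<bar>dens (k0 * M) f / real M ^ CARD('n) - main M\<bar> \<le> Cn * C * nrm q f / real M ^ N"
        unfolding mm diff_divide_distrib[symmetric] abs_divide by simp
    qed (use Cn C nrm_nonneg[OF f] in simp)
    have "expands 1 N ((\<Sum>j<N. F j * nrm q f) + Cn * C * nrm q f) (\<lambda>M. dens (k0 * M) f / real M ^ CARD('n))"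
      by (rule expands_cong[OF expands_add[OF 1 2]]) simp
    then show ?thesis by (simp only: distrib_right sum_distrib_right mult.assoc)
  qed
  moreover have "0 \<le> (\<Sum>j<N. F j) + Cn * C" using F0 Cn C by (intro add_nonneg_nonneg sum_nonneg) auto
  ultimately show ?thesis by (intro exI[of _ "(\<Sum>j<N. F j) + Cn * C"] exI[of _ q]) simp
qed

text \<open>The first factor converts an expansion in powers of \<open>1/M\<close> into one in powers of \<open>1/k\<close>, where \<open>k = k\<^sub>0 M\<close>.\<close>

definition "xi j f = real k0 ^ j / real k0 ^ CARD('n) * coeff (\<lambda>M. dens (k0 * M) f / real M ^ CARD('n)) j"

text \<open>Linearity follows from the uniqueness of coefficients, continuity from their bounds.\<close>

lemma xi_distribution: "distribution_on P (xi j)"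
proof -
  let ?s = "\<lambda>f M. dens (k0 * M) f / real M ^ CARD('n)"
  obtain C m where C: "0 \<le> C" "\<forall>f\<in>CP. expands 1 (Suc j) (C * nrm m f) (?s f)" using dens_expansion by blast
  have co: "has_coeffs (Suc j) (?s f) (coeff (?s f))" "\<bar>coeff (?s f) j\<bar> \<le> C * nrm m f" if "f \<in> CP" for f
    using expands_coeff(1,3)[OF bspec[OF C(2) that]] by auto
  have lin: "dens k (\<lambda>x. f x + g x) = dens k f + dens k g" if "f \<in> CP" "g \<in> CP" for k f g
    using dens_distribution[of k] that unfolding distribution_on_def by blast
  have lin': "dens k (\<lambda>x. c * f x) = c * dens k f" if "f \<in> CP" for k f c
    using dens_distribution[of k] that unfolding distribution_on_def by blast
  have "distribution_on P (\<lambda>f. coeff (?s f) j)"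
  proof (rule distribution_onI)
    fix f g assume f: "f \<in> CP" and g: "g \<in> CP"
    have "has_coeffs (Suc j) (\<lambda>M. ?s f M + ?s g M) (\<lambda>j. coeff (?s f) j + coeff (?s g) j)"
      by (rule has_coeffs_add[OF co(1)[OF f] co(1)[OF g]])
    also have "(\<lambda>M. ?s f M + ?s g M) = ?s (\<lambda>x. f x + g x)" by (simp add: lin f g add_divide_distrib fun_eq_iff)
    finally show "coeff (?s (\<lambda>x. f x + g x)) j = coeff (?s f) j + coeff (?s g) j" by (rule coeff_eq) simp
  next
    fix f c assume f: "f \<in> CP"
    have "has_coeffs (Suc j) (\<lambda>M. c * ?s f M) (\<lambda>j. c * coeff (?s f) j)"
      by (rule has_coeffs_cmult[OF co(1)[OF f]])
    also have "(\<lambda>M. c * ?s f M) = ?s (\<lambda>x. c * f x)" by (simp add: lin' f fun_eq_iff)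
    finally show "coeff (?s (\<lambda>x. c * f x)) j = c * coeff (?s f) j" by (rule coeff_eq) simp
  qed (rule co(2))
  then show ?thesis unfolding xi_def[abs_def] by (rule distribution_on_cmult)
qed

definition "remainder N k f = real k ^ (N + 1) * (dens k f / real k ^ CARD('n) - (\<Sum>j=0..N. xi j f / real k ^ j))"

lemma remainder_distribution: "distribution_on P (remainder N k)"
proof -
  have "distribution_on P (\<lambda>f. real k ^ (N + 1) * ((1 / real k ^ CARD('n)) * dens k f + (\<Sum>j=0..N. (- 1 / real k ^ j) * xi j f)))"
    by (intro distribution_on_cmult distribution_on_add distribution_on_sum dens_distribution xi_distribution)
  also have "(\<lambda>f. real k ^ (N + 1) * ((1 / real k ^ CARD('n)) * dens k f + (\<Sum>j=0..N. (- 1 / real k ^ j) * xi j f))) = remainder N k"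
    by (simp add: remainder_def fun_eq_iff sum_negf)
  finally show ?thesis .
qed

lemma remainder_identity:
  assumes "k > 0"
  shows "dens k f = real k ^ CARD('n) * ((\<Sum>j=0..N. xi j f / real k ^ j) + remainder N k f / real k ^ (N + 1))"
  using assms by (simp add: remainder_def)

lemma remainder_bound:
  "\<exists>N' C. \<forall>M>0. \<forall>f\<in>CP. remainder N (k0 * M) f \<le> C * nrm N' f"
proof -
  let ?s = "\<lambda>f M. dens (k0 * M) f / real M ^ CARD('n)"
  obtain C m where C: "0 \<le> C" "\<forall>f\<in>CP. expands 1 (Suc N) (C * nrm m f) (?s f)" using dens_expansion by blast
  let ?c = "real k0 ^ (N + 1) / real k0 ^ CARD('n)"
  have "remainder N (k0 * M) f \<le> (?c * C) * nrm m f" if M: "M > 0" and f: "f \<in> CP" for M f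
  proof -
    have Mp: "real M > 0" and kp: "real k0 > 0" using M k0 by auto
    have e: "xi j f / real (k0 * M) ^ j = coeff (?s f) j / real M ^ j / real k0 ^ CARD('n)" for j
      using kp by (simp add: xi_def power_mult_distrib)
    have "remainder N (k0 * M) f = real (k0 * M) ^ (N + 1) * (?s f M / real k0 ^ CARD('n) - (\<Sum>j=0..N. coeff (?s f) j / real M ^ j / real k0 ^ CARD('n)))"
      unfolding remainder_def e by (simp add: power_mult_distrib mult.commute)
    also have "\<dots> = ?c * real M ^ (N + 1) * (?s f M - (\<Sum>j<Suc N. coeff (?s f) j / real M ^ j))"
      by (simp only: sum_divide_distrib[symmetric] diff_divide_distrib[symmetric] atLeast0AtMost lessThan_Suc_atMost of_nat_mult power_mult_distrib times_divide_eq_left times_divide_eq_right mult.assoc)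
    also have "\<dots> \<le> ?c * real M ^ (N + 1) * (C * nrm m f / real M ^ Suc N)"
      using expands_coeff(2)[OF bspec[OF C(2) f], of M] M by (intro mult_left_mono) auto
    also have "\<dots> = (?c * C) * nrm m f" using Mp by simp
    finally show ?thesis .
  qed
  then show ?thesis by blast
qed

end

section \<open>The polytopes \<open>P\<^sub>t\<close>\<close>

text \<open>A dilate \<open>k Q\<close> is integral if and only if \<open>k w\<close> is a lattice point for each vertex \<open>w\<close> of \<open>Q\<close>. This set of \<open>k\<close> is
  closed under greatest common divisors, so its least element divides all the others.\<close>

lemma integral_multiples:
  fixes Q :: "(real^'n) set"
  assumes K: "K = {k. k > 0 \<and> integral_polytope ((\<lambda>x. real k *\<^sub>R x) ` Q)}" and "K \<noteq> {}" and "Q \<noteq> {}"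
  shows "\<exists>W k0. finite W \<and> W \<noteq> {} \<and> Q = convex hull W \<and> 0 < k0 \<and> (\<forall>w\<in>W. real k0 *\<^sub>R w \<in> int_lattice)
     \<and> (\<forall>k\<in>K. k0 dvd k)"
proof -
  have hullK: "\<exists>V. finite V \<and> Q = convex hull V \<and> (\<forall>v\<in>V. real k *\<^sub>R v \<in> int_lattice)" if "k \<in> K" for k
  proof -
    from that K obtain V where k: "k > 0" and V: "finite V" "V \<subseteq> int_lattice" "(\<lambda>x. real k *\<^sub>R x) ` Q = convex hull V"
      by (auto simp: integral_polytope_def)
    let ?U = "(\<lambda>x. (1 / real k) *\<^sub>R x) ` V"
    have "Q = (\<lambda>x. (1 / real k) *\<^sub>R x) ` ((\<lambda>x. real k *\<^sub>R x) ` Q)"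
      using k by (simp add: image_image)
    also have "\<dots> = convex hull ?U" unfolding V(3) by (rule convex_hull_scaling[symmetric])
    finally have "Q = convex hull ?U" .
    moreover have "\<forall>v\<in>?U. real k *\<^sub>R v \<in> int_lattice" using V(2) k by auto
    ultimately show ?thesis using V(1) by blast
  qed
  define W where "W = {w. w extreme_point_of Q}"
  obtain k1 where k1: "k1 \<in> K" using assms(2) by blast
  obtain V where V: "finite V" "Q = convex hull V" using hullK[OF k1] by blast
  have comp: "compact Q" "convex Q" using V by (simp_all add: finite_imp_compact_convex_hull)
  have QW: "Q = convex hull W" unfolding W_def by (rule Krein_Milman_Minkowski[OF comp])
  have Wlat: "real k *\<^sub>R w \<in> int_lattice" if k: "k \<in> K" and w: "w \<in> W" for k w
  proof -
    obtain V where "Q = convex hull V" "\<forall>v\<in>V. real k *\<^sub>R v \<in> int_lattice" using hullK[OF k] by blast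
    then show ?thesis using w extreme_point_of_convex_hull[of w V] by (auto simp: W_def)
  qed
  have "W \<subseteq> V" using extreme_point_of_convex_hull V(2) by (auto simp: W_def)
  then have finW: "finite W" using V(1) finite_subset by blast
  have Wne: "W \<noteq> {}" using QW assms(3) by auto
  define k0 where "k0 = (LEAST k. k \<in> K)"
  have k0: "k0 \<in> K" unfolding k0_def using k1 by (rule LeastI)
  have k0p: "0 < k0" using k0 K by simp
  have "k0 dvd k" if k: "k \<in> K" for k
  proof -
    let ?g = "gcd k0 k"
    obtain x y where xy: "k0 * x = k * y + ?g" using bezout_nat[of k0 k] k0p by blast
    then have rg: "real ?g = real x * real k0 - real y * real k"
      by (metis add_diff_cancel_left' mult.commute of_nat_add of_nat_mult)
    have "real ?g *\<^sub>R w \<in> int_lattice" if w: "w \<in> W" for w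
    proof -
      have "real x *\<^sub>R (real k0 *\<^sub>R w) \<in> int_lattice" "real y *\<^sub>R (real k *\<^sub>R w) \<in> int_lattice"
        using Wlat[OF k0 w] Wlat[OF k w] by (auto simp: int_lattice_def mult.assoc intro!: Ints_mult)
      from int_lattice_diff[OF this] show ?thesis unfolding rg by (simp add: scaleR_diff_left)
    qed
    then have "(\<lambda>w. real ?g *\<^sub>R w) ` W \<subseteq> int_lattice" by blast
    moreover have "(\<lambda>x. real ?g *\<^sub>R x) ` Q = convex hull ((\<lambda>w. real ?g *\<^sub>R w) ` W)"
      unfolding QW by (rule convex_hull_scaling[symmetric])
    ultimately have "integral_polytope ((\<lambda>x. real ?g *\<^sub>R x) ` Q)"
      unfolding integral_polytope_def using finW by blast
    moreover have "?g > 0" using k0p by simp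
    ultimately have "?g \<in> K" unfolding K by blast
    then have "k0 \<le> ?g" unfolding k0_def by (rule Least_le)
    moreover have "?g dvd k0" by simp
    ultimately have "?g = k0" using k0p by (meson dvd_imp_le le_antisym)
    then show ?thesis by (metis gcd_dvd2)
  qed
  then show ?thesis using finW Wne QW k0p Wlat[OF k0] by blast
qed

theorem theorem4p5:
  fixes A :: "'a set" and \<nu> :: "'a \<Rightarrow> real ^ 'n" and lam :: "'a \<Rightarrow> real"
    and P F Pt :: "(real ^ 'n) set" and u \<Phi> :: "real ^ 'n \<Rightarrow> real"
    and S :: "'a set" and q :: nat and t :: real and K :: "nat set"
  assumes "integral_delzant A \<nu> lam P"
    and "symplectic_potential A \<nu> lam P u"
    and "S \<subseteq> A" and "card S = q"
    and "F = {x\<in>P. \<forall>a\<in>S. ell \<nu> lam a x = 0}"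
    and "F \<noteq> {}" and "aff_dim F = int CARD('n) - int q"
    and "\<Phi> = (\<lambda>x. \<Sum>a\<in>S. ell \<nu> lam a x)"
    and "t > 0" and "t \<in> \<rat>"
    and "Pt = P \<inter> {x. \<Phi> x \<ge> t}"
    and "K = {k. k > 0 \<and> integral_polytope ((\<lambda>x. real k *\<^sub>R x) ` Pt)}"
  shows "\<exists>\<xi> :: nat \<Rightarrow> (real ^ 'n \<Rightarrow> real) \<Rightarrow> real.
    (\<forall>j. distribution_on P (\<xi> j)) \<and>
    (\<forall>N>0. \<exists>R :: nat \<Rightarrow> (real ^ 'n \<Rightarrow> real) \<Rightarrow> real.
       (\<forall>k\<in>K. distribution_on P (R k)) \<and>
       (\<forall>k\<in>K. \<forall>f\<in>smooth_upto P.
          density_pairing P u Pt k f =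
            real k ^ CARD('n) *
              ((\<Sum>j=0..N. \<xi> j f / real k ^ j) + R k f / real k ^ (N + 1))) \<and>
       (\<exists>N' C. \<forall>k\<in>K. \<forall>f\<in>smooth_upto P. R k f \<le> C * Cnorm P N' f))"
proof (cases "K = {} \<or> Pt = {}")
  case True
  have 0: "density_pairing P u Pt k f = 0" if "k \<in> K" for k f
    using True that by (auto simp: density_pairing_def partial_density_def liouville_integral_def)
  show ?thesis
  proof (rule exI[of _ "\<lambda>j f. 0"], intro conjI allI impI)
    show "distribution_on P (\<lambda>f. 0)" by (rule distribution_on_zero)
    fix N :: nat
    show "\<exists>R. (\<forall>k\<in>K. distribution_on P (R k)) \<and>
       (\<forall>k\<in>K. \<forall>f\<in>smooth_upto P. density_pairing P u Pt k f =
            real k ^ CARD('n) * ((\<Sum>j=0..N. 0 / real k ^ j) + R k f / real k ^ (N + 1))) \<and>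
       (\<exists>N' C. \<forall>k\<in>K. \<forall>f\<in>smooth_upto P. R k f \<le> C * Cnorm P N' f)"
      by (rule exI[of _ "\<lambda>k f. 0"], intro conjI ballI distribution_on_zero) (auto simp: 0 intro!: exI[of _ 0])
  qed
next
  case False
  interpret T: toric_potential A \<nu> lam P u
    by unfold_locales (use assms(1,2) in auto)
  obtain G Z where GZ: "(\<forall>j m. G j m \<in> smooth_upto P) \<and> (\<forall>a\<in>A. \<forall>m. Z a m \<in> smooth_upto P) \<and>
    (\<forall>x\<in>P. \<forall>i m. (\<Sum>j\<in>UNIV. pd P j (pd P i T.v) x * G j m x) + (\<Sum>a\<in>A. \<nu> a $ i * Z a m x) = (if i = m then 1 else 0)) \<and>
    (\<forall>x\<in>P. \<forall>a\<in>A. \<forall>m. (\<Sum>j\<in>UNIV. \<nu> a $ j * G j m x) = 2 * ell \<nu> lam a x * Z a m x)"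
    using T.inverse_hessian by (elim exE)
  obtain W k0 where W: "finite W" "W \<noteq> {}" "Pt = convex hull W" "0 < k0" "\<forall>w\<in>W. real k0 *\<^sub>R w \<in> int_lattice"
     "\<forall>k\<in>K. k0 dvd k"
    using integral_multiples[OF assms(12)] False by blast
  \<comment> \<open>the facet inequalities of \<open>P\<close> together with \<open>\<Phi> x \<ge> t\<close>\<close>
  define H where "H = insert (\<Sum>a\<in>S. \<nu> a, - (\<Sum>a\<in>S. lam a) - t) ((\<lambda>a. (\<nu> a, - lam a)) ` A)"
  have PtH: "Pt = {x. \<forall>p\<in>H. 0 \<le> lev p x 1}"
  proof -
    have "\<Phi> x \<ge> t \<longleftrightarrow> 0 \<le> lev (\<Sum>a\<in>S. \<nu> a, - (\<Sum>a\<in>S. lam a) - t) x 1" for x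
      by (simp add: assms(8) lev_def ell_def inner_sum_right sum_subtractf) linarith
    moreover have "x \<in> P \<longleftrightarrow> (\<forall>a\<in>A. 0 \<le> lev (\<nu> a, - lam a) x 1)" for x
      by (subst T.P_def) (simp add: lev_def ell_def)
    ultimately show ?thesis by (auto simp: assms(11) H_def)
  qed
  interpret I: partial_density_setup A \<nu> lam P u G Z Pt H W k0
  proof unfold_locales
    show "finite H" using T.finite_A by (simp add: H_def)
    show "Pt \<subseteq> P" using assms(11) by blast
  qed (use GZ W PtH in blast)+
  have Kk: "\<exists>M>0. k = k0 * M" if "k \<in> K" for k
  proof -
    have "k0 dvd k" using W(6) that by blast
    then obtain M where M: "k = k0 * M" by (rule dvdE)
    moreover have "k > 0" using that assms(12) by simp
    ultimately show ?thesis by (intro exI[of _ M]) simp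
  qed
  show ?thesis
  proof (rule exI[of _ I.xi], intro conjI allI impI)
    show "distribution_on P (I.xi j)" for j by (rule I.xi_distribution)
    fix N :: nat
    show "\<exists>R. (\<forall>k\<in>K. distribution_on P (R k)) \<and>
       (\<forall>k\<in>K. \<forall>f\<in>smooth_upto P. density_pairing P u Pt k f =
            real k ^ CARD('n) * ((\<Sum>j=0..N. I.xi j f / real k ^ j) + R k f / real k ^ (N + 1))) \<and>
       (\<exists>N' C. \<forall>k\<in>K. \<forall>f\<in>smooth_upto P. R k f \<le> C * Cnorm P N' f)"
    proof (rule exI[of _ "I.remainder N"], intro conjI ballI)
      show "distribution_on P (I.remainder N k)" for k by (rule I.remainder_distribution)
      fix k f assume k: "k \<in> K" and f: "f \<in> smooth_upto P"
      obtain M where M: "M > 0" "k = k0 * M" using Kk[OF k] by blast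
      have "density_pairing P u Pt k f = I.dens k f"
        unfolding M(2) by (rule I.density_pairing_eq[OF I.finite_scaled[OF M(1)] f])
      also have "\<dots> = real k ^ CARD('n) * ((\<Sum>j=0..N. I.xi j f / real k ^ j) + I.remainder N k f / real k ^ (N + 1))"
        using M W(4) by (intro I.remainder_identity) simp
      finally show "density_pairing P u Pt k f = real k ^ CARD('n) * ((\<Sum>j=0..N. I.xi j f / real k ^ j) + I.remainder N k f / real k ^ (N + 1))" .
    next
      obtain N' C where "\<forall>M>0. \<forall>f\<in>smooth_upto P. I.remainder N (k0 * M) f \<le> C * Cnorm P N' f"
        using I.remainder_bound by blast
      then have "\<forall>k\<in>K. \<forall>f\<in>smooth_upto P. I.remainder N k f \<le> C * Cnorm P N' f" using Kk by blast
      then show "\<exists>N' C. \<forall>k\<in>K. \<forall>f\<in>smooth_upto P. I.remainder N k f \<le> C * Cnorm P N' f" by blast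
    qed
  qed
qed

end
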